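(* Let $N\ge1$, $k\ge1$ be integers, $1<p<\infty$, $q=p/(p-1)$, $\kappa_0>0$, $\theta_0\in(0,1]$. Let $\Omega_h$ be a conforming simplicial mesh of $\Omega\subset\mathbb{R}^N$ with $|M_K|\,|M_K^{-1}|\le\kappa_0$ for all $K\in\Omega_h$. Let $\beta$ be constant on each element, $\beta|_K\equiv\beta_K\in\mathbb{R}^N\setminus\{0\}$, with continuous normal component across element interfaces, and satisfying the flow conditions (i) and (ii) of the context. Suppose that either $k=1$, or $|\beta_K\cdot n_i|\ge\theta_0|\beta_K|$ for every $K\in\Omega_h$ and every facet $F_i$ of $K$. Let $Y_h$ be a finite-dimensional space with $V_h\subseteq Y_h\subset Y$. Let $f\in L_p(\Omega)$, $\ell(v)=(f,v)_\Omega$, let $u\in W_{p,0}(\partial_\beta,\Omega)$ be the unique solution of $\beta\cdot\nabla u=f$, and put $\mathcal u=(u,D_hu)\in X$. Let $C_\varPi=C_\varPi(N,k,q,\theta_0,\kappa_0)$ (independent of $\theta_0$ when $k=1$) be a constant such that $\|\varPi_hv\|_Y\le C_\varPi\|v\|_Y$ for all $v\in Y$. Then the minimization problem $$\mathcal u_h=\operatorname*{arg\,min}_{\mathcal w_h\in X_h}\big\|\ell-\mathcal b(\mathcal w_h,\cdot)\big\|_{Y_h'}$$ has a solution $\mathcal u_h\in X_h$, the solution is unique, and $$\|\mathcal u-\mathcal u_h\|_{\mathcal E}\le(1+2C_\varPi)\inf_{\mathcal w_h\in X_h}\|\mathcal u-\mathcal w_h\|_{\mathcal E}.$$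
   Context: $\Omega\subset\mathbb{R}^N$ is a Lipschitz polyhedral domain. $\hat K$ is the unit reference $N$-simplex with vertices $\hat a_0,\dots,\hat a_N$. Each $K\in\Omega_h$, with vertices $a_0,\dots,a_N$, is the image of $\hat K$ under an affine homeomorphism $\Phi_K(\hat x)=M_K\hat x+g_K$ mapping $\hat a_i$ to $a_i$; $h_K=\operatorname{diam}K$; $a_K:=h_K/|\beta_K|$. $|\cdot|$ is the Euclidean norm of vectors and the associated matrix norm. $\lambda_i$ are the barycentric coordinates of $K$, $F_i$ the facet of $K$ opposite $a_i$, $n_i$ the outward unit normal on $F_i$; $n$ is the outward unit normal on $\partial\Omega$. Graph spaces: $W_r(\partial_\beta,D)=\{v\in L_r(D):\beta\cdot\nabla v\in L_r(D)\}$ and $W_r(\partial_\beta,\Omega_h)=\prod_KW_r(\partial_\beta,K)$. $\Gamma_{\rm in}=\{x\in\partial\Omega:\beta\cdot n<0\}$, $\Gamma_{\rm out}=\{x\in\partial\Omega:\beta\cdot n>0\}$. Flow conditions: (i) $\overline\Gamma_{\rm in}$ and $\overline\Gamma_{\rm out}$ are disjoint; (ii) there exist $z_\pm\in L_\infty(\Omega)$ with $\beta\cdot\nabla z_\pm\in L_\infty(\Omega)$ and a constant $c_0>0$ such that $-\beta\cdot\nabla z_\pm=c_0$ in $\Omega$, $z_+=0$ on $\Gamma_{\rm out}$, $z_-=0$ on $\Gamma_{\rm in}$. Known facts: under (i), for $1<r<\infty$, functions in $W_r(\partial_\beta,\Omega)$ have traces on $\partial\Omega$ in the $|\beta\cdot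 n|$-weighted $L_r$ sense and $\int_\Omega(\beta\cdot\nabla v)w+\int_\Omega v\,\beta\cdot\nabla w=\int_{\partial\Omega}\beta\cdot n\,vw$ for $v\in W_p(\partial_\beta,\Omega)$, $w\in W_q(\partial_\beta,\Omega)$. $W_{r,0}(\partial_\beta,\Omega)$ is the subspace of functions whose trace vanishes on $\Gamma_{\rm in}$. Under (i),(ii), for every $f\in L_r(\Omega)$ there is a unique $u\in W_{r,0}(\partial_\beta,\Omega)$ with $\beta\cdot\nabla u=f$. $(f,g)_D=\int_Dfg\,dx$. For $w\in W_p(\partial_\beta,K)$, $v\in W_q(\partial_\beta,K)$: $\langle D_Kw,v\rangle=(\beta\cdot\nabla w,v)_K+(w,\beta\cdot\nabla v)_K$. $Y=W_q(\partial_\beta,\Omega_h)$ with norm $$\|v\|_Y^q=\sum_K\big(a_K^{-q}\|v\|_{L_q(K)}^q+\|\beta\cdot\nabla v\|_{L_q(K)}^q\big).$$ For $z\in W_p(\partial_\beta,\Omega)$, $D_hz\in Y'$ is $\langle D_hz,v\rangle=\sum_K\langle D_K(z|_K),v|_K\rangle$. $\hat X_0=D_h(W_{p,0}(\partial_\beta,\Omega))$, $X=L_p(\Omega)\times\hat X_0$, and for $(w,\mu)\in X$, $v\in Y$: $\mathcal b((w,\mu),v)=\langle\mu,v\rangle-\sum_K(w,\beta\cdot\nabla v)_K$. Energy norm: $\|\mathcal w\|_{\mathcal E}=\sup_{0\ne v\in Y}\mathcal b(\mathcal w,v)/\|v\|_Y$. Discrete dual norm: $\|g\|_{Y_h'}=\sup_{0\ne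 v\in Y_h}g(v)/\|v\|_Y$. $P_j(K)$: polynomials of degree at most $j$ on $K$ ($\{0\}$ if $j<0$); $P_j(\Omega_h)=\prod_KP_j(K)$. $S_{h,0}^k=\{z\in P_k(\Omega_h)\cap C(\overline\Omega):z|_{\Gamma_{\rm in}}=0\}$; $X_h=P_{k-1}(\Omega_h)\times D_h(S_{h,0}^k)\subset X$. $\mathring P_j(K)=\{z\in P_j(K):z|_{\partial K}=0\}$ ($=\{0\}$ for $0\le j\le N$); $P_j^\perp(K)$ is its $L_2(K)$-orthogonal complement in $P_j(K)$. $b=\prod_j\lambda_j$, $b_i=\prod_{j\ne i}\lambda_j$, $s_i=\operatorname{sgn}(\beta_K\cdot n_i)$, $b_s=\sum_is_ib_i$, $V(K)=b_sP_k^\perp(K)+bP_{k-2}(K)$, $V_h=\prod_KV(K)$. Under the stated hypotheses each $v\in W_q(\partial_\beta,K)$ has a unique $\varPi_Kv\in V(K)$ with $\langle D_Kw,\varPi_Kv-v\rangle=0$ for all $w\in P_k^\perp(K)$ and $(z,\varPi_Kv-v)_K=0$ for all $z\in P_{k-2}(K)$; $(\varPi_hv)|_K=\varPi_K(v|_K)$. A constant $C_\varPi$ with the stated dependencies exists. *)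

theory Defs
  imports "HOL-Analysis.Analysis"
begin

text \<open>
  The space dimension is \<open>N = CARD('n)\<close>.  Elements of Lebesgue and graph spaces are represented by
  functions \<open>real ^ 'n \<Rightarrow> real\<close>, identified when they agree almost everywhere.  In particular a
  product space over the mesh elements is represented by functions on the whole domain whose
  restriction to each element lies in the factor; the values on the skeleton of the mesh are
  irrelevant.
\<close>

definition L_space :: "real \<Rightarrow> (real ^ 'n) set \<Rightarrow> (real ^ 'n \<Rightarrow> real) set" where
  "L_space r D = {v. v \<in> borel_measurable (lebesgue_on D) \<and>
                     integrable (lebesgue_on D) (\<lambda>x. \<bar>v x\<bar> powr r)}"

definition L_norm :: "real \<Rightarrow> (real ^ 'n) set \<Rightarrow> (real ^ 'n \<Rightarrow> real) \<Rightarrow> real" where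
  "L_norm r D v = (\<integral>x. \<bar>v x\<bar> powr r \<partial>lebesgue_on D) powr (1 / r)"

definition L_inf :: "(real ^ 'n) set \<Rightarrow> (real ^ 'n \<Rightarrow> real) set" where
  "L_inf D = {v. v \<in> borel_measurable (lebesgue_on D) \<and>
                 (\<exists>M. AE x in lebesgue_on D. \<bar>v x\<bar> \<le> M)}"

definition L2_ip :: "(real ^ 'n) set \<Rightarrow> (real ^ 'n \<Rightarrow> real) \<Rightarrow> (real ^ 'n \<Rightarrow> real) \<Rightarrow> real" where
  "L2_ip D f g = (\<integral>x. f x * g x \<partial>lebesgue_on D)"

definition C1_fun :: "(real ^ 'n \<Rightarrow> real) \<Rightarrow> bool" where
  "C1_fun \<phi> \<longleftrightarrow> (\<forall>x. \<phi> differentiable at x) \<and>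
               (\<forall>h. continuous_on UNIV (\<lambda>x. frechet_derivative \<phi> (at x) h))"

definition C1_compact :: "(real ^ 'n) set \<Rightarrow> (real ^ 'n \<Rightarrow> real) \<Rightarrow> bool" where
  "C1_compact U \<phi> \<longleftrightarrow> C1_fun \<phi> \<and> compact (closure {x. \<phi> x \<noteq> 0}) \<and> closure {x. \<phi> x \<noteq> 0} \<subseteq> U"

text \<open>
  \<open>g\<close> is the distributional derivative \<open>\<beta> \<cdot> \<nabla>v\<close> in the interior of \<open>D\<close>.  The field \<open>\<beta>\<close> is always
  piecewise constant with continuous normal components, hence divergence free, so that no term
  with the divergence of \<open>\<beta>\<close> occurs.  Since \<open>g\<close> is locally integrable it is determined by \<open>v\<close>
  up to a null set.
\<close>
definition weak_deriv ::
  "(real ^ 'n \<Rightarrow> real ^ 'n) \<Rightarrow> (real ^ 'n) set \<Rightarrow> (real ^ 'n \<Rightarrow> real) \<Rightarrow> (real ^ 'n \<Rightarrow> real) \<Rightarrow> bool" where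
  "weak_deriv \<beta> D v g \<longleftrightarrow>
     (\<forall>C. compact C \<and> C \<subseteq> interior D \<longrightarrow> set_integrable lebesgue C v \<and> set_integrable lebesgue C g) \<and>
     (\<forall>\<phi>. C1_compact (interior D) \<phi> \<longrightarrow>
        (\<integral>x. v x * frechet_derivative \<phi> (at x) (\<beta> x) \<partial>lebesgue_on D)
          = - (\<integral>x. g x * \<phi> x \<partial>lebesgue_on D))"

definition d_beta ::
  "(real ^ 'n \<Rightarrow> real ^ 'n) \<Rightarrow> (real ^ 'n) set \<Rightarrow> (real ^ 'n \<Rightarrow> real) \<Rightarrow> (real ^ 'n \<Rightarrow> real)" where
  "d_beta \<beta> D v = (SOME g. weak_deriv \<beta> D v g)"

definition W_space ::
  "(real ^ 'n \<Rightarrow> real ^ 'n) \<Rightarrow> real \<Rightarrow> (real ^ 'n) set \<Rightarrow> (real ^ 'n \<Rightarrow> real) set" where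
  "W_space \<beta> r D = {v \<in> L_space r D. \<exists>g \<in> L_space r D. weak_deriv \<beta> D v g}"

definition W_inf ::
  "(real ^ 'n \<Rightarrow> real ^ 'n) \<Rightarrow> (real ^ 'n) set \<Rightarrow> (real ^ 'n \<Rightarrow> real) set" where
  "W_inf \<beta> D = {v \<in> L_inf D. \<exists>g \<in> L_inf D. weak_deriv \<beta> D v g}"

text \<open>
  A numbered simplex is given by its vertices \<open>a\<^sub>0, \<dots>, a\<^sub>N\<close>, indexed by \<^typ>\<open>'n option\<close>:
  \<open>None\<close> plays the role of the index \<open>0\<close>.
\<close>
type_synonym 'n vertices = "'n option \<Rightarrow> real ^ 'n"

definition ref_vertices :: "'n::finite vertices" where
  "ref_vertices i = (case i of None \<Rightarrow> 0 | Some j \<Rightarrow> axis j 1)"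

definition ref_simplex :: "(real ^ 'n::finite) set" where
  "ref_simplex = convex hull (range ref_vertices)"

definition aff_matrix :: "'n::finite vertices \<Rightarrow> real ^ 'n ^ 'n" where
  "aff_matrix s = (\<chi> i j. (s (Some j) - s None) $ i)"

definition elem :: "'n::finite vertices \<Rightarrow> (real ^ 'n) set" where
  "elem s = (\<lambda>x. aff_matrix s *v x + s None) ` ref_simplex"

definition facet :: "'n::finite vertices \<Rightarrow> 'n option \<Rightarrow> (real ^ 'n) set" where
  "facet s i = convex hull (s ` (UNIV - {i}))"

definition normal :: "'n::finite vertices \<Rightarrow> 'n option \<Rightarrow> real ^ 'n" where
  "normal s i = (THE \<nu>. norm \<nu> = 1 \<and> (\<forall>x\<in>facet s i. \<forall>y\<in>facet s i. \<nu> \<bullet> (x - y) = 0)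
                      \<and> (\<forall>x\<in>facet s i. \<nu> \<bullet> (s i - x) < 0))"

definition bary :: "'n::finite vertices \<Rightarrow> 'n option \<Rightarrow> real ^ 'n \<Rightarrow> real" where
  "bary s i x = (THE l. (\<Sum>j\<in>UNIV. l j) = 1 \<and> (\<Sum>j\<in>UNIV. l j *\<^sub>R s j) = x) i"

text \<open>
  Surface measure of a facet \<open>F\<close>: a subset \<open>B\<close> of \<open>F\<close> has the Lebesgue measure of the right prism
  of height \<open>1\<close> over \<open>B\<close>, placed symmetrically to the hyperplane spanned by \<open>F\<close>.  For \<open>N = 1\<close> this
  is the unit mass at the point \<open>F\<close>.
\<close>
definition facet_measure :: "(real ^ 'n) set \<Rightarrow> (real ^ 'n) measure" where
  "facet_measure F =
     (let \<pi> = closest_point (affine hull F)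
      in distr (restrict_space lborel {x. \<pi> x \<in> F \<and> dist x (\<pi> x) \<le> 1 / 2}) borel \<pi>)"

definition lipschitz_domain :: "(real ^ 'n) set \<Rightarrow> bool" where
  "lipschitz_domain \<Omega> \<longleftrightarrow> open \<Omega> \<and> connected \<Omega> \<and> bounded \<Omega> \<and> \<Omega> \<noteq> {} \<and>
     (\<forall>x\<^sub>0\<in>frontier \<Omega>. \<exists>e r L g. norm e = 1 \<and> r > 0 \<and> L-lipschitz_on {y. y \<bullet> e = 0} g \<and>
        \<Omega> \<inter> ball x\<^sub>0 r = {x \<in> ball x\<^sub>0 r. g (x - (x \<bullet> e) *\<^sub>R e) < x \<bullet> e})"

definition polyhedral :: "(real ^ 'n) set \<Rightarrow> bool" where
  "polyhedral \<Omega> \<longleftrightarrow> (\<exists>\<P>. finite \<P> \<and> (\<forall>P\<in>\<P>. polytope P) \<and> closure \<Omega> = \<Union>\<P>)"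

definition conforming_mesh :: "(real ^ 'n) set \<Rightarrow> 'n::finite vertices set \<Rightarrow> bool" where
  "conforming_mesh \<Omega> T \<longleftrightarrow> finite T \<and> (\<forall>s\<in>T. invertible (aff_matrix s)) \<and> inj_on elem T \<and>
     triangulation (elem ` T) \<and> \<Union>(elem ` T) = closure \<Omega>"

definition beta_elem :: "(real ^ 'n \<Rightarrow> real ^ 'n) \<Rightarrow> 'n::finite vertices \<Rightarrow> real ^ 'n" where
  "beta_elem \<beta> s = (THE c. \<forall>x\<in>interior (elem s). \<beta> x = c)"

definition beta_normal :: "(real ^ 'n \<Rightarrow> real ^ 'n) \<Rightarrow> 'n::finite vertices \<Rightarrow> 'n option \<Rightarrow> real" where
  "beta_normal \<beta> s i = beta_elem \<beta> s \<bullet> normal s i"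

definition advection_field ::
  "'n::finite vertices set \<Rightarrow> (real ^ 'n \<Rightarrow> real ^ 'n) \<Rightarrow> bool" where
  "advection_field T \<beta> \<longleftrightarrow>
     (\<forall>s\<in>T. \<exists>c. c \<noteq> 0 \<and> (\<forall>x\<in>interior (elem s). \<beta> x = c)) \<and>
     (\<forall>s\<in>T. \<forall>t\<in>T. \<forall>i j. s \<noteq> t \<and> facet s i = facet t j \<longrightarrow>
        beta_elem \<beta> s \<bullet> normal s i = beta_elem \<beta> t \<bullet> normal s i)"

definition boundary_facets ::
  "(real ^ 'n) set \<Rightarrow> 'n::finite vertices set \<Rightarrow> ('n vertices \<times> 'n option) set" where
  "boundary_facets \<Omega> T = {(s, i). s \<in> T \<and> facet s i \<subseteq> frontier \<Omega>}"

text \<open>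
  The normal component of \<open>\<beta>\<close> on the boundary is constant on the relative interior of each boundary
  facet, and not defined on the (null) set of remaining boundary points.
\<close>
definition Gamma_in ::
  "(real ^ 'n) set \<Rightarrow> 'n::finite vertices set \<Rightarrow> (real ^ 'n \<Rightarrow> real ^ 'n) \<Rightarrow> (real ^ 'n) set" where
  "Gamma_in \<Omega> T \<beta> = (\<Union>(s, i) \<in> {(s, i) \<in> boundary_facets \<Omega> T. beta_normal \<beta> s i < 0}.
                        rel_interior (facet s i))"

definition Gamma_out ::
  "(real ^ 'n) set \<Rightarrow> 'n::finite vertices set \<Rightarrow> (real ^ 'n \<Rightarrow> real ^ 'n) \<Rightarrow> (real ^ 'n) set" where
  "Gamma_out \<Omega> T \<beta> = (\<Union>(s, i) \<in> {(s, i) \<in> boundary_facets \<Omega> T. beta_normal \<beta> s i > 0}.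
                         rel_interior (facet s i))"

text \<open>
  \<open>g\<close> is the trace of \<open>v\<close> on the boundary: \<open>\<bar>g\<bar>\<^sup>r\<close> is integrable with the weight \<open>\<bar>\<beta> \<cdot> n\<bar>\<close>, and
  Green's formula holds against all functions that are \<open>C\<^sup>1\<close> up to the boundary.  This determines
  \<open>g\<close> up to null sets of the weighted surface measure.
\<close>
definition has_trace ::
  "(real ^ 'n) set \<Rightarrow> 'n::finite vertices set \<Rightarrow> (real ^ 'n \<Rightarrow> real ^ 'n) \<Rightarrow> real
     \<Rightarrow> (real ^ 'n \<Rightarrow> real) \<Rightarrow> (real ^ 'n \<Rightarrow> real) \<Rightarrow> bool" where
  "has_trace \<Omega> T \<beta> r v g \<longleftrightarrow> g \<in> borel_measurable borel \<and>
     (\<forall>(s, i) \<in> boundary_facets \<Omega> T.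
        integrable (facet_measure (facet s i)) (\<lambda>x. \<bar>beta_normal \<beta> s i\<bar> * \<bar>g x\<bar> powr r)) \<and>
     (\<forall>\<phi>. C1_fun \<phi> \<longrightarrow>
        (\<integral>x. d_beta \<beta> \<Omega> v x * \<phi> x \<partial>lebesgue_on \<Omega>)
          + (\<integral>x. v x * frechet_derivative \<phi> (at x) (\<beta> x) \<partial>lebesgue_on \<Omega>)
        = (\<Sum>(s, i) \<in> boundary_facets \<Omega> T.
             \<integral>x. beta_normal \<beta> s i * g x * \<phi> x \<partial>facet_measure (facet s i)))"

definition trace_vanishes ::
  "(real ^ 'n) set \<Rightarrow> 'n::finite vertices set \<Rightarrow> (real ^ 'n \<Rightarrow> real ^ 'n) \<Rightarrow> real
     \<Rightarrow> (real ^ 'n \<Rightarrow> real) \<Rightarrow> (real ^ 'n) set \<Rightarrow> bool" where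
  "trace_vanishes \<Omega> T \<beta> r v \<Gamma> \<longleftrightarrow> (\<exists>g. has_trace \<Omega> T \<beta> r v g \<and>
     (\<forall>(s, i) \<in> boundary_facets \<Omega> T. AE x in facet_measure (facet s i). x \<in> \<Gamma> \<longrightarrow> g x = 0))"

definition W_space0 ::
  "(real ^ 'n) set \<Rightarrow> 'n::finite vertices set \<Rightarrow> (real ^ 'n \<Rightarrow> real ^ 'n) \<Rightarrow> real
     \<Rightarrow> (real ^ 'n \<Rightarrow> real) set" where
  "W_space0 \<Omega> T \<beta> r = {v \<in> W_space \<beta> r \<Omega>. trace_vanishes \<Omega> T \<beta> r v (Gamma_in \<Omega> T \<beta>)}"

text \<open>
  The second condition uses traces in the weighted \<open>L\<^sub>1\<close> sense, the weakest one in which Green's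
  formula is meaningful; by uniqueness these are the traces for every larger exponent as well.
\<close>
definition flow_conditions ::
  "(real ^ 'n) set \<Rightarrow> 'n::finite vertices set \<Rightarrow> (real ^ 'n \<Rightarrow> real ^ 'n) \<Rightarrow> bool" where
  "flow_conditions \<Omega> T \<beta> \<longleftrightarrow>
     closure (Gamma_in \<Omega> T \<beta>) \<inter> closure (Gamma_out \<Omega> T \<beta>) = {} \<and>
     (\<exists>zp zm c\<^sub>0. c\<^sub>0 > 0 \<and> zp \<in> W_inf \<beta> \<Omega> \<and> zm \<in> W_inf \<beta> \<Omega> \<and>
        (AE x in lebesgue_on \<Omega>. - d_beta \<beta> \<Omega> zp x = c\<^sub>0) \<and>
        (AE x in lebesgue_on \<Omega>. - d_beta \<beta> \<Omega> zm x = c\<^sub>0) \<and>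
        trace_vanishes \<Omega> T \<beta> 1 zp (Gamma_out \<Omega> T \<beta>) \<and>
        trace_vanishes \<Omega> T \<beta> 1 zm (Gamma_in \<Omega> T \<beta>))"

definition a_elem :: "(real ^ 'n \<Rightarrow> real ^ 'n) \<Rightarrow> 'n::finite vertices \<Rightarrow> real" where
  "a_elem \<beta> s = diameter (elem s) / norm (beta_elem \<beta> s)"

definition Y_space ::
  "'n::finite vertices set \<Rightarrow> (real ^ 'n \<Rightarrow> real ^ 'n) \<Rightarrow> real \<Rightarrow> (real ^ 'n \<Rightarrow> real) set" where
  "Y_space T \<beta> q = {v. \<forall>s\<in>T. v \<in> W_space \<beta> q (elem s)}"

definition Y_norm ::
  "'n::finite vertices set \<Rightarrow> (real ^ 'n \<Rightarrow> real ^ 'n) \<Rightarrow> real \<Rightarrow> (real ^ 'n \<Rightarrow> real) \<Rightarrow> real" where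
  "Y_norm T \<beta> q v = (\<Sum>s\<in>T. a_elem \<beta> s powr (- q) * L_norm q (elem s) v powr q
                           + L_norm q (elem s) (d_beta \<beta> (elem s) v) powr q) powr (1 / q)"

definition D_elem ::
  "(real ^ 'n \<Rightarrow> real ^ 'n) \<Rightarrow> 'n::finite vertices \<Rightarrow> (real ^ 'n \<Rightarrow> real) \<Rightarrow> (real ^ 'n \<Rightarrow> real) \<Rightarrow> real" where
  "D_elem \<beta> s w v = L2_ip (elem s) (d_beta \<beta> (elem s) w) v + L2_ip (elem s) w (d_beta \<beta> (elem s) v)"

text \<open>Functionals on \<open>Y\<close> are restricted to \<open>Y\<close>, so that their equality is equality of functions.\<close>
definition D_h ::
  "'n::finite vertices set \<Rightarrow> (real ^ 'n \<Rightarrow> real ^ 'n) \<Rightarrow> real \<Rightarrow> (real ^ 'n \<Rightarrow> real)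
     \<Rightarrow> (real ^ 'n \<Rightarrow> real) \<Rightarrow> real" where
  "D_h T \<beta> q z = (\<lambda>v\<in>Y_space T \<beta> q. \<Sum>s\<in>T. D_elem \<beta> s z v)"

type_synonym 'n trial = "(real ^ 'n \<Rightarrow> real) \<times> ((real ^ 'n \<Rightarrow> real) \<Rightarrow> real)"

definition trial_diff :: "'n::finite trial \<Rightarrow> 'n trial \<Rightarrow> 'n trial" where
  "trial_diff w w' = (\<lambda>x. fst w x - fst w' x, \<lambda>v. snd w v - snd w' v)"

definition trial_eq :: "(real ^ 'n) set \<Rightarrow> 'n::finite trial \<Rightarrow> 'n trial \<Rightarrow> bool" where
  "trial_eq \<Omega> w w' \<longleftrightarrow> (AE x in lebesgue_on \<Omega>. fst w x = fst w' x) \<and> snd w = snd w'"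

definition b_form ::
  "'n::finite vertices set \<Rightarrow> (real ^ 'n \<Rightarrow> real ^ 'n) \<Rightarrow> 'n trial \<Rightarrow> (real ^ 'n \<Rightarrow> real) \<Rightarrow> real" where
  "b_form T \<beta> w v = snd w v - (\<Sum>s\<in>T. L2_ip (elem s) (fst w) (d_beta \<beta> (elem s) v))"

text \<open>All functionals to which this is applied are bounded, so the supremum is a real number.\<close>
definition dual_norm ::
  "(real ^ 'n) set \<Rightarrow> 'n::finite vertices set \<Rightarrow> (real ^ 'n \<Rightarrow> real ^ 'n) \<Rightarrow> real
     \<Rightarrow> (real ^ 'n \<Rightarrow> real) set \<Rightarrow> ((real ^ 'n \<Rightarrow> real) \<Rightarrow> real) \<Rightarrow> real" where
  "dual_norm \<Omega> T \<beta> q S g =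
     (SUP v \<in> {v \<in> S. \<not> (AE x in lebesgue_on \<Omega>. v x = 0)}. g v / Y_norm T \<beta> q v)"

definition energy_norm ::
  "(real ^ 'n) set \<Rightarrow> 'n::finite vertices set \<Rightarrow> (real ^ 'n \<Rightarrow> real ^ 'n) \<Rightarrow> real
     \<Rightarrow> 'n trial \<Rightarrow> real" where
  "energy_norm \<Omega> T \<beta> q w = dual_norm \<Omega> T \<beta> q (Y_space T \<beta> q) (b_form T \<beta> w)"

definition residual_norm ::
  "(real ^ 'n) set \<Rightarrow> 'n::finite vertices set \<Rightarrow> (real ^ 'n \<Rightarrow> real ^ 'n) \<Rightarrow> real
     \<Rightarrow> (real ^ 'n \<Rightarrow> real) set \<Rightarrow> (real ^ 'n \<Rightarrow> real) \<Rightarrow> 'n trial \<Rightarrow> real" where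
  "residual_norm \<Omega> T \<beta> q S f w = dual_norm \<Omega> T \<beta> q S (\<lambda>v. L2_ip \<Omega> f v - b_form T \<beta> w v)"

definition Poly :: "int \<Rightarrow> (real ^ 'n::finite \<Rightarrow> real) set" where
  "Poly j = {p. \<exists>c :: ('n \<Rightarrow> nat) \<Rightarrow> real.
     \<forall>x. p x = (\<Sum>\<alpha> | int (\<Sum>i\<in>UNIV. \<alpha> i) \<le> j. c \<alpha> * (\<Prod>i\<in>UNIV. (x $ i) ^ \<alpha> i))}"

definition Poly_bubble :: "int \<Rightarrow> 'n::finite vertices \<Rightarrow> (real ^ 'n \<Rightarrow> real) set" where
  "Poly_bubble j s = {z \<in> Poly j. \<forall>x\<in>frontier (elem s). z x = 0}"

definition Poly_perp :: "int \<Rightarrow> 'n::finite vertices \<Rightarrow> (real ^ 'n \<Rightarrow> real) set" where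
  "Poly_perp j s = {z \<in> Poly j. \<forall>y\<in>Poly_bubble j s. L2_ip (elem s) z y = 0}"

definition broken ::
  "'n::finite vertices set \<Rightarrow> ('n vertices \<Rightarrow> (real ^ 'n \<Rightarrow> real) set) \<Rightarrow> (real ^ 'n \<Rightarrow> real) set" where
  "broken T V = {v. \<forall>s\<in>T. \<exists>p\<in>V s. \<forall>x\<in>interior (elem s). v x = p x}"

definition S_h0 ::
  "(real ^ 'n) set \<Rightarrow> 'n::finite vertices set \<Rightarrow> (real ^ 'n \<Rightarrow> real ^ 'n) \<Rightarrow> nat
     \<Rightarrow> (real ^ 'n \<Rightarrow> real) set" where
  "S_h0 \<Omega> T \<beta> k = {z \<in> broken T (\<lambda>s. Poly (int k)).
     continuous_on (closure \<Omega>) z \<and> (\<forall>x\<in>Gamma_in \<Omega> T \<beta>. z x = 0)}"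

definition X_h ::
  "(real ^ 'n) set \<Rightarrow> 'n::finite vertices set \<Rightarrow> (real ^ 'n \<Rightarrow> real ^ 'n) \<Rightarrow> real \<Rightarrow> nat
     \<Rightarrow> 'n trial set" where
  "X_h \<Omega> T \<beta> q k = broken T (\<lambda>s. Poly (int k - 1)) \<times> D_h T \<beta> q ` S_h0 \<Omega> T \<beta> k"

definition bubble :: "'n::finite vertices \<Rightarrow> real ^ 'n \<Rightarrow> real" where
  "bubble s x = (\<Prod>j\<in>UNIV. bary s j x)"

definition signed_bubble ::
  "(real ^ 'n \<Rightarrow> real ^ 'n) \<Rightarrow> 'n::finite vertices \<Rightarrow> real ^ 'n \<Rightarrow> real" where
  "signed_bubble \<beta> s x = (\<Sum>i\<in>UNIV. sgn (beta_normal \<beta> s i) * (\<Prod>j\<in>UNIV - {i}. bary s j x))"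

definition V_elem ::
  "(real ^ 'n \<Rightarrow> real ^ 'n) \<Rightarrow> nat \<Rightarrow> 'n::finite vertices \<Rightarrow> (real ^ 'n \<Rightarrow> real) set" where
  "V_elem \<beta> k s = {\<lambda>x. signed_bubble \<beta> s x * p x + bubble s x * r x | p r.
                     p \<in> Poly_perp (int k) s \<and> r \<in> Poly (int k - 2)}"

definition Pi_elem ::
  "(real ^ 'n \<Rightarrow> real ^ 'n) \<Rightarrow> nat \<Rightarrow> 'n::finite vertices \<Rightarrow> (real ^ 'n \<Rightarrow> real)
     \<Rightarrow> (real ^ 'n \<Rightarrow> real)" where
  "Pi_elem \<beta> k s v = (THE \<pi>. \<pi> \<in> V_elem \<beta> k s \<and>
     (\<forall>w\<in>Poly_perp (int k) s. D_elem \<beta> s w (\<lambda>x. \<pi> x - v x) = 0) \<and>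
     (\<forall>z\<in>Poly (int k - 2). L2_ip (elem s) z (\<lambda>x. \<pi> x - v x) = 0))"

definition Pi_h ::
  "'n::finite vertices set \<Rightarrow> (real ^ 'n \<Rightarrow> real ^ 'n) \<Rightarrow> nat \<Rightarrow> (real ^ 'n \<Rightarrow> real)
     \<Rightarrow> (real ^ 'n \<Rightarrow> real)" where
  "Pi_h T \<beta> k v x = (if \<exists>s\<in>T. x \<in> interior (elem s)
                     then Pi_elem \<beta> k (THE s. s \<in> T \<and> x \<in> interior (elem s)) v x else 0)"

text \<open>
  A linear space of functions which is finite-dimensional after identification of functions that
  agree almost everywhere.
\<close>
definition fin_dim_space :: "(real ^ 'n) set \<Rightarrow> (real ^ 'n \<Rightarrow> real) set \<Rightarrow> bool" where
  "fin_dim_space \<Omega> S \<longleftrightarrow>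
     (\<lambda>x. 0) \<in> S \<and> (\<forall>v\<in>S. \<forall>w\<in>S. (\<lambda>x. v x + w x) \<in> S) \<and> (\<forall>c. \<forall>v\<in>S. (\<lambda>x. c * v x) \<in> S) \<and>
     (\<exists>B\<subseteq>S. finite B \<and> (\<forall>v\<in>S. \<exists>c. AE x in lebesgue_on \<Omega>. v x = (\<Sum>b\<in>B. c b * b x)))"

end

theory Submission
  imports Defs
begin

text \<open>
  Integration by parts and the two defining conditions of \<open>\<Pi>\<^sub>h\<close> give \<open>b(w\<^sub>h, \<Pi>\<^sub>h v) = b(w\<^sub>h, v)\<close> for
  all trial functions \<open>w\<^sub>h\<close>, so that \<open>\<parallel>w\<^sub>h\<parallel>\<^sub>E \<le> C \<parallel>b(w\<^sub>h, \<cdot>)\<parallel>\<close> in the discrete dual norm.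
  If \<open>u\<^sub>h\<close> minimizes the residual, then for every competitor \<open>w\<^sub>h\<close> the triangle inequality bounds
  \<open>\<parallel>b(u\<^sub>h - w\<^sub>h, \<cdot>)\<parallel>\<close> by twice the residual of \<open>w\<^sub>h\<close>, which is at most \<open>2 \<parallel>u - w\<^sub>h\<parallel>\<^sub>E\<close>;
  this is the constant \<open>1 + 2 C\<close>.

  The projection exists because for \<open>p \<in> P\<^sub>k\<close> the number \<open>\<langle>D\<^sub>K p, b\<^sub>s p\<rangle>\<close> is the sum of the facet
  integrals of \<open>\<bar>\<beta> \<cdot> n\<^sub>i\<bar> b\<^sub>i p\<^sup>2\<close>, so it vanishes only if \<open>p\<close> is zero on all non-characteristic facets.
  Facet integrals are avoided throughout: an integral of a divergence over a simplex is the limit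
  of integrals against the gradient of a cutoff function that is a product of smooth steps in
  \<open>m \<lambda>\<^sub>j\<close>, and this gradient is of size \<open>m\<close> on a layer of measure \<open>O(1/m)\<close>.

  Two minimizers give the same functional on \<open>Y\<^sub>h\<close> because the norm of \<open>Y\<close> is uniformly smooth, hence
  its dual norm is strictly convex. The functional determines the trial function: if \<open>b((w, D\<^sub>h z), \<cdot>) = 0\<close>,
  then \<open>w\<close> is constant along \<open>\<beta>\<close> in each element, and for \<open>\<zeta> = z\<^sub>+\<close> the test functions \<open>w \<zeta>\<close> and
  \<open>z \<zeta>\<close> together yield that \<open>-c\<^sub>0\<close> times the integral of \<open>w\<^sup>2\<close> is the boundary integral of
  \<open>\<beta> \<cdot> n \<zeta> z\<^sup>2\<close>; the latter is zero since \<open>\<zeta>\<close> vanishes on the outflow and \<open>z\<close> on the inflow boundary.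
\<close>

section \<open>Continuously differentiable functions\<close>

text \<open>\<open>Pi_elem\<close> is a description and \<open>d_beta\<close> a choice, so existence
  and uniqueness must be proved before either can be computed with. The projection conditions form a
  triangular system: \<open>D_elem\<close> against polynomials does not see the component with the
  factor \<open>bubble\<close>, so the component with \<open>signed_bubble\<close> is found first
  and the other one afterwards. The obstacle is that weak derivatives are tested only with functions
  supported inside an element. Three properties of the limiting cutoff term take over the role of
  facet integrals: it vanishes if the test function is zero on the frontier, it is bounded by the
  sup norm of the test function if the function tested is bounded, and it has a sign if the normal
  flux has one. The second property is what makes the boundary integral accessible although z^2 is
  not C^1 across elements. That w is constant along beta comes from a test function living on one
  element, \<open>bubble\<close> times the derivative of w along beta. In the uniqueness proof the
  step t depends on the smoothness defect only, so the gap between a near-maximizer and the supremum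
  can be removed before dividing by t.\<close>

abbreviation dd :: "real ^ 'n \<Rightarrow> (real ^ 'n \<Rightarrow> real) \<Rightarrow> real ^ 'n \<Rightarrow> real" where
  "dd c \<phi> x \<equiv> frechet_derivative \<phi> (at x) c"

lemma C1_funI:
  assumes "\<And>x. (f has_derivative f' x) (at x)" "\<And>h. continuous_on UNIV (\<lambda>x. f' x h)"
  shows "C1_fun f"
proof -
  have "frechet_derivative f (at x) = f' x" for x
    using frechet_derivative_at[OF assms(1)[of x]] by simp
  then show ?thesis unfolding C1_fun_def using assms by (auto simp: differentiable_def)
qed

lemma C1_fun_deriv: "C1_fun f \<Longrightarrow> (f has_derivative frechet_derivative f (at x)) (at x)"
  by (simp add: C1_fun_def frechet_derivative_works)

lemma dd_eq: "(f has_derivative f') (at x) \<Longrightarrow> dd c f x = f' c"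
  using frechet_derivative_at by metis

lemma C1_fun_cont: "C1_fun f \<Longrightarrow> continuous_on S f"
  by (meson C1_fun_def continuous_at_imp_continuous_on differentiable_imp_continuous_within)

lemma C1_fun_dd_cont: "C1_fun f \<Longrightarrow> continuous_on S (\<lambda>x. dd c f x)"
  unfolding C1_fun_def using continuous_on_subset by blast

lemma C1_fun_const: "C1_fun (\<lambda>x. a)"
  by (rule C1_funI[where f' = "\<lambda>x h. 0"]) auto

lemma C1_fun_bounded_linear: "bounded_linear f \<Longrightarrow> C1_fun f"
  by (rule C1_funI[where f' = "\<lambda>x. f"]) (auto simp: bounded_linear_imp_has_derivative)

lemma has_derivative_add_dd:
  assumes "C1_fun f" "C1_fun g"
  shows "((\<lambda>x. f x + g x) has_derivative (\<lambda>h. dd h f x + dd h g x)) (at x)"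
  by (rule has_derivative_add[OF C1_fun_deriv[OF assms(1)] C1_fun_deriv[OF assms(2)]])

lemma has_derivative_mult_dd:
  assumes "C1_fun f" "C1_fun g"
  shows "((\<lambda>x. f x * g x) has_derivative (\<lambda>h. f x * dd h g x + dd h f x * g x)) (at x)"
  by (rule has_derivative_mult[OF C1_fun_deriv[OF assms(1)] C1_fun_deriv[OF assms(2)]])

lemma dd_const: "dd c (\<lambda>x. a) x = 0"
  by (rule dd_eq) auto

lemma dd_add: "C1_fun f \<Longrightarrow> C1_fun g \<Longrightarrow> dd c (\<lambda>x. f x + g x) x = dd c f x + dd c g x"
  by (rule dd_eq[OF has_derivative_add_dd])

lemma dd_mult: "C1_fun f \<Longrightarrow> C1_fun g \<Longrightarrow> dd c (\<lambda>x. f x * g x) x = f x * dd c g x + dd c f x * g x"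
  by (rule dd_eq[OF has_derivative_mult_dd])

lemma C1_fun_add: "C1_fun f \<Longrightarrow> C1_fun g \<Longrightarrow> C1_fun (\<lambda>x. f x + g x)"
  by (rule C1_funI[OF has_derivative_add_dd]) (assumption | intro continuous_on_add C1_fun_dd_cont)+

lemma C1_fun_mult: "C1_fun f \<Longrightarrow> C1_fun g \<Longrightarrow> C1_fun (\<lambda>x. f x * g x)"
  by (rule C1_funI[OF has_derivative_mult_dd])
     (assumption | intro continuous_on_add continuous_on_mult C1_fun_dd_cont C1_fun_cont)+

lemma C1_fun_cmult: "C1_fun f \<Longrightarrow> C1_fun (\<lambda>x. a * f x)"
  by (intro C1_fun_mult C1_fun_const)

lemma dd_cmult: "C1_fun f \<Longrightarrow> dd c (\<lambda>x. a * f x) x = a * dd c f x"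
  by (simp add: dd_mult C1_fun_const dd_const)

lemma C1_fun_minus: "C1_fun f \<Longrightarrow> C1_fun (\<lambda>x. - f x)"
  using C1_fun_cmult[of f "-1"] by simp

lemma dd_minus: "C1_fun f \<Longrightarrow> dd c (\<lambda>x. - f x) x = - dd c f x"
  using dd_cmult[where a = "-1"] by simp

lemma C1_fun_diff: "C1_fun f \<Longrightarrow> C1_fun g \<Longrightarrow> C1_fun (\<lambda>x. f x - g x)"
  using C1_fun_add[OF _ C1_fun_minus, of f g] by simp

lemma dd_diff: "C1_fun f \<Longrightarrow> C1_fun g \<Longrightarrow> dd c (\<lambda>x. f x - g x) x = dd c f x - dd c g x"
  using dd_add[OF _ C1_fun_minus, where f = f and f1 = g] by (simp add: dd_minus)

lemma C1_fun_sum: "(\<And>i. i \<in> I \<Longrightarrow> C1_fun (f i)) \<Longrightarrow> C1_fun (\<lambda>x. \<Sum>i\<in>I. f i x)"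
  by (induction I rule: infinite_finite_induct) (auto intro: C1_fun_const C1_fun_add)

lemma dd_sum: "(\<And>i. i \<in> I \<Longrightarrow> C1_fun (f i)) \<Longrightarrow> dd c (\<lambda>x. \<Sum>i\<in>I. f i x) x = (\<Sum>i\<in>I. dd c (f i) x)"
  by (induction I rule: infinite_finite_induct) (auto simp: dd_const dd_add C1_fun_sum)

lemma C1_fun_prod: "(\<And>i. i \<in> I \<Longrightarrow> C1_fun (f i)) \<Longrightarrow> C1_fun (\<lambda>x. \<Prod>i\<in>I. f i x)"
  by (induction I rule: infinite_finite_induct) (auto intro: C1_fun_const C1_fun_mult)

lemma dd_prod:
  assumes "\<And>i. i \<in> I \<Longrightarrow> C1_fun (f i)"
  shows "dd c (\<lambda>x. \<Prod>i\<in>I. f i x) x = (\<Sum>i\<in>I. dd c (f i) x * (\<Prod>j\<in>I - {i}. f j x))"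
  by (rule dd_eq[OF has_derivative_prod]) (auto intro: C1_fun_deriv assms)

lemma has_derivative_chain_dd:
  assumes "C1_fun f" "\<And>t. (h has_real_derivative h' t) (at t)"
  shows "((\<lambda>x. h (f x)) has_derivative (\<lambda>v. h' (f x) * dd v f x)) (at x)"
  using has_derivative_compose[OF C1_fun_deriv[OF assms(1), of x], of h "\<lambda>u. h' (f x) * u"]
    assms(2)[of "f x"] by (simp add: has_field_derivative_def)

lemma dd_chain:
  assumes "C1_fun f" "\<And>t. (h has_real_derivative h' t) (at t)"
  shows "dd c (\<lambda>x. h (f x)) x = h' (f x) * dd c f x"
  by (rule dd_eq[OF has_derivative_chain_dd[OF assms]])

lemma C1_fun_chain:
  assumes "C1_fun f" "\<And>t. (h has_real_derivative h' t) (at t)" "continuous_on UNIV h'"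
  shows "C1_fun (\<lambda>x. h (f x))"
  by (rule C1_funI[OF has_derivative_chain_dd[OF assms(1,2)]])
     (intro continuous_on_mult C1_fun_dd_cont assms(1) continuous_on_compose2[OF assms(3)] C1_fun_cont; simp)

lemma dd_scale_dir: "C1_fun f \<Longrightarrow> dd (a *\<^sub>R c) f x = a * dd c f x"
  using linear_scale[OF has_derivative_linear[OF C1_fun_deriv]] by fastforce

lemma dd_sum_dir: "C1_fun f \<Longrightarrow> dd (\<Sum>i\<in>I. d i) f x = (\<Sum>i\<in>I. dd (d i) f x)"
  using linear_sum[OF has_derivative_linear[OF C1_fun_deriv]] by blast

lemma C1_fun_polynomial:
  fixes p :: "real ^ 'n \<Rightarrow> real"
  assumes "real_polynomial_function p"
  shows "C1_fun p"
  using assms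
  by (induction p rule: real_polynomial_function.induct)
     (auto intro: C1_fun_bounded_linear C1_fun_const C1_fun_add C1_fun_mult)

lemma dd_polynomial:
  fixes p :: "real ^ 'n \<Rightarrow> real"
  assumes "real_polynomial_function p"
  shows "real_polynomial_function (\<lambda>x. dd c p x)"
  using assms
proof (induction p rule: real_polynomial_function.induct)
  case (linear f)
  have "dd c f x = f c" for x
    by (rule dd_eq) (use linear in \<open>simp add: bounded_linear_imp_has_derivative\<close>)
  then show ?case by (simp add: real_polynomial_function.intros)
qed (simp_all add: dd_const dd_add dd_mult C1_fun_polynomial real_polynomial_function.intros(2-4))

text \<open>Restriction to a line reduces vanishing in several variables to counting roots in one
  variable.\<close>

lemma polynomial_affine_chain:
  fixes p :: "real ^ 'n \<Rightarrow> real"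
  assumes "real_polynomial_function p"
  shows "real_polynomial_function (\<lambda>t :: real. p (a + t *\<^sub>R b))"
  using assms
proof (induction p rule: real_polynomial_function.induct)
  case (linear f)
  have "(\<lambda>t. f (a + t *\<^sub>R b)) = (\<lambda>t. f a + t * f b)"
    using linear by (auto simp: linear_simps)
  then show ?case
    by (simp add: real_polynomial_function.intros(2-4) real_polynomial_function.intros(1)[OF bounded_linear_ident])
qed (simp_all add: real_polynomial_function.intros(2-4))

text \<open>On the line from a point of U through y the polynomial has infinitely many zeros near
  the starting point, so it vanishes on the whole line and in particular at parameter 1, which is
  y.\<close>

lemma polynomial_zero_on_open:
  fixes p :: "real ^ 'n \<Rightarrow> real"
  assumes p: "real_polynomial_function p" and U: "open U" "U \<noteq> {}" and z: "\<And>x. x \<in> U \<Longrightarrow> p x = 0"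
  shows "p y = 0"
proof -
  obtain a where a: "a \<in> U" using U by auto
  obtain c n where c: "(\<lambda>t :: real. p (a + t *\<^sub>R (y - a))) = (\<lambda>t. \<Sum>i\<le>n. c i * t ^ i)"
    using polynomial_affine_chain[OF p] real_polynomial_function_iff_sum by blast
  have "open ((\<lambda>t::real. a + t *\<^sub>R (y - a)) -` U)"
    by (rule open_vimage[OF U(1)]) (intro continuous_intros)
  moreover have "0 \<in> (\<lambda>t::real. a + t *\<^sub>R (y - a)) -` U" using a by simp
  ultimately obtain e where "e > 0" and "\<And>t. dist t 0 < e \<Longrightarrow> t \<in> (\<lambda>t::real. a + t *\<^sub>R (y - a)) -` U"
    unfolding open_dist by blast
  then have e: "e > 0" "\<And>t::real. \<bar>t\<bar> < e \<Longrightarrow> a + t *\<^sub>R (y - a) \<in> U"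
    by (auto simp: dist_real_def)
  have "{0<..<e} \<subseteq> {t. (\<Sum>i\<le>n. c i * t ^ i) = 0}"
  proof
    fix t assume "t \<in> {0<..<e}"
    then have "p (a + t *\<^sub>R (y - a)) = 0" by (intro z e(2)) simp
    then show "t \<in> {t. (\<Sum>i\<le>n. c i * t ^ i) = 0}" using fun_cong[OF c, of t] by simp
  qed
  then have "infinite {t. (\<Sum>i\<le>n. c i * t ^ i) = 0}"
    using e(1) infinite_Ioo infinite_super by blast
  then have "\<forall>i\<le>n. c i = 0" using polyfun_finite_roots by blast
  then have "p (a + 1 *\<^sub>R (y - a)) = 0" using fun_cong[OF c, of 1] by simp
  then show ?thesis by simp
qed

section \<open>Test functions with compact support\<close>

lemma C1_compactI:
  assumes "C1_fun \<phi>" "compact C" "C \<subseteq> U" "\<And>x. x \<notin> C \<Longrightarrow> \<phi> x = 0"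
  shows "C1_compact U \<phi>"
proof -
  have "closure {x. \<phi> x \<noteq> 0} \<subseteq> C"
    using assms by (intro closure_minimal compact_imp_closed) auto
  moreover have "bounded {x. \<phi> x \<noteq> 0}"
    by (rule bounded_subset[OF compact_imp_bounded[OF assms(2)]]) (use assms(4) in blast)
  ultimately show ?thesis unfolding C1_compact_def using assms by simp
qed

text \<open>The complement of the support is open, so the derivative vanishes there too.\<close>

lemma C1_compact_outside:
  assumes "C1_compact U \<phi>" "x \<notin> U"
  shows "\<phi> x = 0" "dd c \<phi> x = 0"
proof -
  have x: "x \<in> - closure {x. \<phi> x \<noteq> 0}" using assms unfolding C1_compact_def by blast
  then show "\<phi> x = 0" using closure_subset[of "{x. \<phi> x \<noteq> 0}"] by blast
  have "(\<phi> has_derivative (\<lambda>h. 0)) (at x)"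
    by (rule has_derivative_transform_within_open[OF has_derivative_const[of 0] _ x])
       (use closure_subset[of "{x. \<phi> x \<noteq> 0}"] in auto)
  then show "dd c \<phi> x = 0" by (rule dd_eq)
qed

lemma C1_compact_mult:
  assumes "C1_compact U \<phi>" "C1_fun f"
  shows "C1_compact U (\<lambda>x. f x * \<phi> x)"
  by (rule C1_compactI[of _ "closure {x. \<phi> x \<noteq> 0}"])
     (use assms closure_subset[of "{x. \<phi> x \<noteq> 0}"] in \<open>auto simp: C1_compact_def intro: C1_fun_mult\<close>)

section \<open>Integration by parts without boundary\<close>

lemma integral_lborel_translate:
  fixes f :: "real ^ 'n \<Rightarrow> real"
  assumes "f \<in> borel_measurable borel"
  shows "(\<integral>x. f (a + x) \<partial>lborel) = (\<integral>x. f x \<partial>lborel)"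
proof -
  have "(\<integral>x. f x \<partial>lborel) = (\<integral>x. f x \<partial>distr lborel borel ((+) a))"
    by (simp add: lborel_distr_plus)
  also have "\<dots> = (\<integral>x. f (a + x) \<partial>lborel)"
    by (rule integral_distr) (use assms in auto)
  finally show ?thesis by simp
qed

lemma integrable_lborel_compact:
  fixes f :: "real ^ 'n \<Rightarrow> real"
  assumes "continuous_on UNIV f" "compact C" "\<And>x. x \<notin> C \<Longrightarrow> f x = 0"
  shows "integrable lborel f"
proof -
  have "integrable lborel (\<lambda>x. indicator C x *\<^sub>R f x)"
    by (rule borel_integrable_compact[OF assms(2)]) (use assms(1) continuous_on_subset in auto)
  moreover have "(\<lambda>x. indicator C x *\<^sub>R f x) = f" using assms(3) by (fastforce simp: indicator_def)
  ultimately show ?thesis by simp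
qed

text \<open>Difference quotients have integral zero by translation invariance, and they converge to
  the directional derivative under a common integrable bound.\<close>

lemma integral_dd_compact_support:
  fixes \<psi> :: "real ^ 'n \<Rightarrow> real"
  assumes "C1_compact UNIV \<psi>"
  shows "(\<integral>x. dd c \<psi> x \<partial>lborel) = 0"
proof -
  have C1: "C1_fun \<psi>" and cp: "compact (closure {x. \<psi> x \<noteq> 0})"
    using assms unfolding C1_compact_def by auto
  define C where "C = closure {x. \<psi> x \<noteq> 0}"
  have cC: "compact C" unfolding C_def by (fact cp)
  \<comment> \<open>All points from which the support is reached by a shift
    \<open>t *\<^sub>R c\<close> with t in [0,1]: one compact set outside which every difference
    quotient vanishes.\<close>
  define C' where "C' = (\<lambda>(x, t :: real). x - t *\<^sub>R c) ` (C \<times> {0..1})"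
  have cC': "compact C'" unfolding C'_def
    by (intro compact_continuous_image compact_Times)
       (auto intro!: continuous_intros simp: cC split_beta)
  have "\<psi> x = 0" if "x \<notin> C" for x
    using that closure_subset[of "{x. \<psi> x \<noteq> 0}"] unfolding C_def by blast
  then have "C1_compact C \<psi>" by (intro C1_compactI[OF C1 cC]) auto
  then have out: "\<psi> x = 0" "dd h \<psi> x = 0" if "x \<notin> C" for x h
    using C1_compact_outside that by blast+
  have outC': "x + t *\<^sub>R c \<notin> C" if "x \<notin> C'" "t \<in> {0..1}" for x t
    using that unfolding C'_def by (force simp: image_iff split_beta)
  have "compact ((\<lambda>x. dd c \<psi> x) ` C)"
    by (rule compact_continuous_image[OF C1_fun_dd_cont[OF C1]]) (fact cC)
  then obtain M0 where "\<And>x. x \<in> C \<Longrightarrow> \<bar>dd c \<psi> x\<bar> \<le> M0"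
    by (metis (no_types, lifting) bounded_iff compact_imp_bounded image_eqI real_norm_def)
  then have M: "\<bar>dd c \<psi> x\<bar> \<le> max M0 0" for x
    using out(2)[of x c] by (cases "x \<in> C") (force, simp)
  define t where "t n = 1 / (real n + 1)" for n
  have t: "t n > 0" "t n \<le> 1" for n by (auto simp: t_def)
  have t0: "t \<longlonglongrightarrow> 0" unfolding t_def using LIMSEQ_inverse_real_of_nat by (simp add: inverse_eq_divide add.commute)
  have [measurable]: "\<psi> \<in> borel_measurable borel"
    using C1_fun_cont[OF C1] by (simp add: borel_measurable_continuous_onI)
  define d where "d n x = (\<psi> (x + t n *\<^sub>R c) - \<psi> x) / t n" for n x
  have der: "((\<lambda>s. \<psi> (x + s *\<^sub>R c)) has_real_derivative dd c \<psi> (x + s *\<^sub>R c)) (at s)" for x s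
  proof -
    have "((\<lambda>s. x + s *\<^sub>R c) has_derivative (\<lambda>h. h *\<^sub>R c)) (at s)"
      by (auto intro!: derivative_eq_intros)
    from has_derivative_compose[OF this C1_fun_deriv[OF C1]]
    have "((\<lambda>s. \<psi> (x + s *\<^sub>R c)) has_derivative (\<lambda>h. dd (h *\<^sub>R c) \<psi> (x + s *\<^sub>R c))) (at s)" .
    then show ?thesis
      by (simp add: has_field_derivative_def dd_scale_dir[OF C1] mult.commute[of _ "dd c \<psi> _"] cong: if_cong)
  qed
  \<comment> \<open>By the mean value theorem a difference quotient is a derivative at an
    intermediate point, which yields the dominating function.\<close>
  have bd: "\<bar>d n x\<bar> \<le> max M0 0 * indicator C' x" for n x
  proof -
    obtain z where z: "0 < z" "z < t n" "\<psi> (x + t n *\<^sub>R c) - \<psi> (x + 0 *\<^sub>R c) = (t n - 0) * dd c \<psi> (x + z *\<^sub>R c)"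
      using MVT2[of 0 "t n" "\<lambda>s. \<psi> (x + s *\<^sub>R c)" "\<lambda>s. dd c \<psi> (x + s *\<^sub>R c)"] der t by blast
    then have "d n x = dd c \<psi> (x + z *\<^sub>R c)" using t[of n] unfolding d_def by simp
    then show ?thesis using M outC'[of x z] out(2)[of "x + z *\<^sub>R c" c] z t[of n]
      by (cases "x \<in> C'") auto
  qed
  have lim: "(\<lambda>n. d n x) \<longlonglongrightarrow> dd c \<psi> x" for x
  proof -
    have "((\<lambda>h. (\<psi> (x + h *\<^sub>R c) - \<psi> x) / h) \<longlongrightarrow> dd c \<psi> x) (at 0)"
      using der[of x 0] unfolding DERIV_def by simp
    moreover have "t n \<noteq> 0" for n using t(1)[of n] by simp
    then have "filterlim t (at 0) sequentially"
      using t0 by (simp add: filterlim_at)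
    ultimately show ?thesis unfolding d_def by (rule filterlim_compose)
  qed
  have "(\<lambda>n. \<integral>x. d n x \<partial>lborel) \<longlonglongrightarrow> (\<integral>x. dd c \<psi> x \<partial>lborel)"
  proof (rule integral_dominated_convergence)
    show "integrable lborel (\<lambda>x. max M0 0 * indicator C' x)"
      using borel_integrable_compact[OF cC' continuous_on_const[of _ "max M0 0"]] by (simp add: mult.commute)
    show "(\<lambda>x. dd c \<psi> x) \<in> borel_measurable lborel"
      using C1_fun_dd_cont[OF C1] by (simp add: borel_measurable_continuous_onI)
    show "d n \<in> borel_measurable lborel" for n
      unfolding d_def[abs_def] by measurable
  qed (use lim bd in auto)
  moreover have "(\<integral>x. d n x \<partial>lborel) = 0" for n
  proof -
    have i1: "integrable lborel \<psi>" by (rule integrable_lborel_compact[of _ C]) (use out C1_fun_cont[OF C1] cC in auto)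
    have i2: "integrable lborel (\<lambda>x. \<psi> (x + t n *\<^sub>R c))"
      by (rule integrable_lborel_compact[of _ C'])
         (use out(1) outC' t[of n] cC' in \<open>auto intro!: continuous_on_compose2[OF C1_fun_cont[OF C1, of UNIV]] continuous_intros\<close>)
    have "(\<integral>x. d n x \<partial>lborel) = ((\<integral>x. \<psi> (x + t n *\<^sub>R c) \<partial>lborel) - (\<integral>x. \<psi> x \<partial>lborel)) / t n"
      unfolding d_def using i1 i2 by simp
    also have "(\<integral>x. \<psi> (x + t n *\<^sub>R c) \<partial>lborel) = (\<integral>x. \<psi> x \<partial>lborel)"
      using integral_lborel_translate[of \<psi> "t n *\<^sub>R c"] by (simp add: add.commute)
    finally show ?thesis by simp
  qed
  ultimately show ?thesis by (simp add: LIMSEQ_const_iff)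
qed

section \<open>A smooth step\<close>

text \<open>A C^1 function that is zero up to 0 and positive afterwards; it serves both the cutoff
  functions and the bump in \<open>integral_dd_pos\<close>.\<close>

definition pos2 :: "real \<Rightarrow> real" where "pos2 t = (max 0 t)\<^sup>2"

text \<open>The remainder of the tangent is at most h^2 even when t and t + h lie on different sides
  of 0.\<close>

lemma pos2_deriv: "(pos2 has_real_derivative 2 * max 0 t) (at t)"
proof -
  have eq: "\<bar>pos2 (t + h) - pos2 t - 2 * max 0 t * h\<bar> \<le> h\<^sup>2" for h
  proof (cases "0 \<le> t + h"; cases "0 \<le> t")
    assume "0 \<le> t + h" "\<not> 0 \<le> t"
    then have "(t + h)\<^sup>2 \<le> h\<^sup>2" by (intro power_mono) auto
    then show ?thesis using \<open>\<not> 0 \<le> t\<close> \<open>0 \<le> t + h\<close> by (simp add: pos2_def max_def)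
  next
    assume "\<not> 0 \<le> t + h" "0 \<le> t"
    have "- (t\<^sup>2) - 2 * t * h = h\<^sup>2 - (t + h)\<^sup>2" by (simp add: power2_eq_square algebra_simps)
    moreover have "(t + h)\<^sup>2 \<le> h\<^sup>2"
      using \<open>\<not> 0 \<le> t + h\<close> \<open>0 \<le> t\<close> by (simp add: abs_le_square_iff[symmetric])
    ultimately show ?thesis using \<open>\<not> 0 \<le> t + h\<close> \<open>0 \<le> t\<close> by (simp add: pos2_def max_def)
  qed (auto simp: pos2_def max_def power2_eq_square algebra_simps)
  have "((\<lambda>h. (pos2 (t + h) - pos2 t) / h - 2 * max 0 t) \<longlongrightarrow> 0) (at 0)"
  proof (rule Lim_null_comparison[where g = "\<lambda>h. \<bar>h\<bar>"])
    show "\<forall>\<^sub>F h in at 0. norm ((pos2 (t + h) - pos2 t) / h - 2 * max 0 t) \<le> \<bar>h\<bar>"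
      unfolding eventually_at_filter
    proof (intro always_eventually allI impI)
      fix h :: real assume h: "h \<noteq> 0"
      have "(pos2 (t + h) - pos2 t) / h - 2 * max 0 t = (pos2 (t + h) - pos2 t - 2 * max 0 t * h) / h"
        using h by (simp add: field_simps)
      then have "\<bar>(pos2 (t + h) - pos2 t) / h - 2 * max 0 t\<bar> \<le> h\<^sup>2 / \<bar>h\<bar>"
        using eq[of h] h by (simp add: divide_right_mono)
      also have "\<dots> = \<bar>h\<bar>" using h by (cases "h > 0") (simp_all add: power2_eq_square)
      finally show "norm ((pos2 (t + h) - pos2 t) / h - 2 * max 0 t) \<le> \<bar>h\<bar>" by simp
    qed
    show "((\<lambda>h. \<bar>h\<bar>) \<longlongrightarrow> 0) (at (0::real))" by (auto intro!: tendsto_eq_intros)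
  qed
  then show ?thesis unfolding DERIV_def by (subst LIM_zero_iff[symmetric])
qed

text \<open>A quadratic spline with knots 1, 3/2, 2. Its slope is the hat of height 2 over [1,2],
  which has area 1, so the function climbs from 0 to 1.\<close>

definition step :: "real \<Rightarrow> real" where
  "step t = 2 * pos2 (t - 1) - 4 * pos2 (t - 3/2) + 2 * pos2 (t - 2)"

definition step' :: "real \<Rightarrow> real" where
  "step' t = 4 * max 0 (t - 1) - 8 * max 0 (t - 3/2) + 4 * max 0 (t - 2)"

lemma step_deriv: "(step has_real_derivative step' t) (at t)"
proof -
  have s: "((\<lambda>t. pos2 (t - a)) has_real_derivative 2 * max 0 (t - a)) (at t)" for a
  proof -
    have "((\<lambda>t. t - a) has_real_derivative 1) (at t)" by (auto intro!: derivative_eq_intros)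
    from DERIV_chain2[where f = pos2 and g = "\<lambda>t. t - a", OF pos2_deriv this] show ?thesis by simp
  qed
  show ?thesis unfolding step_def[abs_def] step'_def
    by (auto intro!: derivative_eq_intros s)
qed

lemma step'_cont: "continuous_on UNIV step'"
  unfolding step'_def[abs_def] by (intro continuous_intros)

lemma step'_bounds: "0 \<le> step' t" "step' t \<le> 2" "t \<ge> 2 \<Longrightarrow> step' t = 0" "t \<le> 1 \<Longrightarrow> step' t = 0"
  by (auto simp: step'_def max_def)

lemma step_one: "t \<ge> 2 \<Longrightarrow> step t = 1"
  by (simp add: step_def pos2_def max_def power2_eq_square algebra_simps)

lemma step_zero: "t \<le> 1 \<Longrightarrow> step t = 0"
  by (simp add: step_def pos2_def max_def)

lemma step_mono: "s \<le> t \<Longrightarrow> step s \<le> step t"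
  by (rule deriv_nonneg_imp_mono[of _ _ step step']) (auto simp: step_deriv step'_bounds)

lemma step_bounds: "0 \<le> step t" "step t \<le> 1"
proof -
  show "0 \<le> step t"
  proof (cases "t \<le> 1")
    case False
    then show ?thesis using step_mono[of 1 t] by (simp only: step_zero)
  qed (simp add: step_zero)
  show "step t \<le> 1"
  proof (cases "t \<le> 2")
    case True
    then show ?thesis using step_mono[of t 2] by (simp only: step_one)
  qed (simp add: step_one)
qed

section \<open>Barycentric coordinates\<close>

lemma sum_UNIV_option: "(\<Sum>j\<in>UNIV. f j) = f None + (\<Sum>i\<in>(UNIV :: 'n::finite set). f (Some i))"
  by (simp add: UNIV_option_conv sum.insert sum.reindex)

lemma aff_matrix_mult: "aff_matrix s *v y = (\<Sum>j\<in>UNIV. y $ j *\<^sub>R (s (Some j) - s None))"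
  by (simp add: vec_eq_iff aff_matrix_def matrix_vector_mult_def sum_component mult.commute)

text \<open>An explicit form of the barycentric coordinates, which \<open>bary\<close> defines by a description operator.\<close>

definition lam :: "'n::finite vertices \<Rightarrow> 'n option \<Rightarrow> real ^ 'n \<Rightarrow> real" where
  "lam s j x = (let y = matrix_inv (aff_matrix s) *v (x - s None) in
     case j of None \<Rightarrow> 1 - (\<Sum>i\<in>UNIV. y $ i) | Some i \<Rightarrow> y $ i)"

text \<open>
  The derivative of \<open>\<lambda>\<^sub>j\<close> in the direction \<open>h\<close>: a negative multiple of \<open>h \<cdot> n\<^sub>j\<close>.
\<close>

definition bgrad :: "'n::finite vertices \<Rightarrow> 'n option \<Rightarrow> real ^ 'n \<Rightarrow> real" where
  "bgrad s j h = bary s j h - bary s j 0"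

lemma bary_comb_eq:
  fixes s :: "'n::finite vertices"
  assumes "(\<Sum>j\<in>UNIV. l j) = 1"
  shows "(\<Sum>j\<in>UNIV. l j *\<^sub>R s j) = aff_matrix s *v (\<chi> i. l (Some i)) + s None"
proof -
  have "l None = 1 - (\<Sum>i\<in>UNIV. l (Some i))" using assms by (simp add: sum_UNIV_option)
  then show ?thesis
    by (simp add: sum_UNIV_option aff_matrix_mult scaleR_diff_left scaleR_diff_right sum_subtractf scaleR_sum_left)
qed

context
  fixes s :: "'n::finite vertices"
  assumes inv: "invertible (aff_matrix s)"
begin

lemma inv_mult: "aff_matrix s *v (matrix_inv (aff_matrix s) *v x) = x"
  "matrix_inv (aff_matrix s) *v (aff_matrix s *v x) = x"
proof -
  have "aff_matrix s ** matrix_inv (aff_matrix s) = mat 1 \<and> matrix_inv (aff_matrix s) ** aff_matrix s = mat 1"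
    using inv unfolding invertible_def matrix_inv_def by (rule someI_ex)
  then show "aff_matrix s *v (matrix_inv (aff_matrix s) *v x) = x"
    "matrix_inv (aff_matrix s) *v (aff_matrix s *v x) = x"
    by (simp_all add: matrix_vector_mul_assoc)
qed

lemma mult_vec_minus: "A *v (- x) = - (A *v x)" for A :: "real ^ 'n ^ 'n"
  by (rule linear_neg[OF matrix_vector_mul_linear])

lemma lam_sum: "(\<Sum>j\<in>UNIV. lam s j x) = 1"
  by (simp add: sum_UNIV_option lam_def Let_def)

lemma lam_point: "(\<Sum>j\<in>UNIV. lam s j x *\<^sub>R s j) = x"
proof -
  have "(\<chi> i. lam s (Some i) x) = matrix_inv (aff_matrix s) *v (x - s None)"
    by (simp add: vec_eq_iff lam_def Let_def)
  then show ?thesis by (simp add: bary_comb_eq[OF lam_sum] inv_mult)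
qed

lemma lam_unique:
  assumes "(\<Sum>j\<in>UNIV. l j) = 1" "(\<Sum>j\<in>UNIV. l j *\<^sub>R s j) = x"
  shows "l j = lam s j x"
proof -
  have "matrix_inv (aff_matrix s) *v (x - s None) = (\<chi> i. l (Some i))"
    using assms(2) by (simp add: bary_comb_eq[OF assms(1)] inv_mult flip: assms(2))
  then show ?thesis using assms(1) by (cases j) (simp_all add: lam_def Let_def sum_UNIV_option)
qed

lemma bary_eq_lam: "bary s j x = lam s j x"
proof -
  have "(THE l. (\<Sum>j\<in>UNIV. l j) = 1 \<and> (\<Sum>j\<in>UNIV. l j *\<^sub>R s j) = x) = (\<lambda>j. lam s j x)"
  proof (rule the_equality)
    fix l assume "(\<Sum>j\<in>UNIV. l j) = 1 \<and> (\<Sum>j\<in>UNIV. l j *\<^sub>R s j) = x"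
    then show "l = (\<lambda>j. lam s j x)" using lam_unique by (intro ext) blast
  qed (simp add: lam_sum lam_point)
  then show ?thesis by (simp add: bary_def)
qed

lemma bary_sum: "(\<Sum>j\<in>UNIV. bary s j x) = 1"
  and bary_point: "(\<Sum>j\<in>UNIV. bary s j x *\<^sub>R s j) = x"
  by (simp_all add: bary_eq_lam lam_sum lam_point)

lemma bary_comb:
  assumes "(\<Sum>j\<in>UNIV. l j) = 1"
  shows "bary s j (\<Sum>i\<in>UNIV. l i *\<^sub>R s i) = l j"
  unfolding bary_eq_lam by (rule lam_unique[OF assms refl, symmetric])

lemma lam_affine: "lam s j (x + h) = lam s j x + (lam s j h - lam s j 0)"
proof (cases j)
  case None
  then show ?thesis
    by (simp add: lam_def Let_def matrix_vector_mult_diff_distrib matrix_vector_right_distrib sum.distrib sum_subtractf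
        mult_vec_minus sum_negf)
next
  case (Some i)
  then show ?thesis
    by (simp add: lam_def Let_def matrix_vector_mult_diff_distrib matrix_vector_right_distrib mult_vec_minus)
qed

lemma bary_add: "bary s j (x + h) = bary s j x + bgrad s j h"
  by (simp add: bary_eq_lam bgrad_def lam_affine[of j x h])

lemma lam_scale: "lam s j (a *\<^sub>R h) - lam s j 0 = a * (lam s j h - lam s j 0)"
proof (cases j)
  case None
  then show ?thesis
    by (simp add: lam_def Let_def matrix_vector_mult_diff_distrib matrix_vector_mult_scaleR
        sum_subtractf sum_distrib_left right_diff_distrib mult_vec_minus sum_negf)
next
  case (Some i)
  then show ?thesis
    by (simp add: lam_def Let_def matrix_vector_mult_diff_distrib matrix_vector_mult_scaleR mult_vec_minus algebra_simps)
qed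

lemma bgrad_linear: "linear (bgrad s j)"
proof (rule linearI)
  show "bgrad s j (x + y) = bgrad s j x + bgrad s j y" for x y
    using bary_add[of j x y] by (simp add: bgrad_def)
  show "bgrad s j (a *\<^sub>R x) = a *\<^sub>R bgrad s j x" for a x
    using lam_scale[of j a x] by (simp add: bgrad_def bary_eq_lam)
qed

lemma bary_bgrad: "bary s j = (\<lambda>x. bary s j 0 + bgrad s j x)"
  by (simp add: bgrad_def)

lemma bary_polynomial: "real_polynomial_function (bary s j)"
  by (subst bary_bgrad)
     (intro real_polynomial_function.intros(3) real_polynomial_function.intros(2)
        real_polynomial_function.intros(1) linear_conv_bounded_linear[THEN iffD1] bgrad_linear)

lemma bary_C1: "C1_fun (bary s j)"
  by (rule C1_fun_polynomial[OF bary_polynomial])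

lemma bary_cont: "continuous_on S (bary s j)"
  by (rule C1_fun_cont[OF bary_C1])

lemma dd_bary: "dd c (bary s j) x = bgrad s j c"
proof (rule dd_eq)
  show "(bary s j has_derivative bgrad s j) (at x)"
    by (subst bary_bgrad)
       (auto intro!: derivative_eq_intros linear_imp_has_derivative bgrad_linear)
qed

lemma bgrad_sum: "(\<Sum>j\<in>UNIV. bgrad s j h) = 0"
  by (simp add: bgrad_def sum_subtractf bary_sum)

lemma bgrad_point: "(\<Sum>j\<in>UNIV. bgrad s j h *\<^sub>R s j) = h"
  by (simp add: bgrad_def scaleR_diff_left sum_subtractf bary_point)

lemma bary_vertex: "bary s j (s i) = (if i = j then 1 else 0)"
proof -
  have "s i = (\<Sum>k\<in>UNIV. (if k = i then 1 else 0) *\<^sub>R s k)"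
    by (simp add: if_distrib[of "\<lambda>a. a *\<^sub>R _"] cong: if_cong)
  moreover have "bary s j (\<Sum>k\<in>UNIV. (if k = i then 1 else 0) *\<^sub>R s k) = (if j = i then 1 else 0)"
    by (rule bary_comb) simp
  ultimately show ?thesis by (metis (full_types))
qed

lemma bgrad_diff: "bgrad s j (x - y) = bary s j x - bary s j y"
  using linear_diff[OF bgrad_linear, of j x y] by (simp add: bgrad_def)

lemma bgrad_edge: "bgrad s j (s i - s l) = (if i = j then 1 else 0) - (if l = j then 1 else 0)"
  by (simp add: bgrad_diff bary_vertex)

lemma elem_compact: "compact (elem s)"
  unfolding elem_def ref_simplex_def
  by (intro compact_continuous_image finite_imp_compact_convex_hull finite_imageI finite)
     (intro continuous_intros linear_continuous_on matrix_vector_mul_bounded_linear)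

lemma range_ref_vertices: "range (ref_vertices :: 'n vertices) = insert 0 Basis"
  by (auto simp: UNIV_option_conv ref_vertices_def Basis_vec_def image_image)

lemma mem_ref_simplex: "y \<in> ref_simplex \<longleftrightarrow> (\<forall>i. 0 \<le> y $ i) \<and> (\<Sum>i\<in>UNIV. y $ i) \<le> 1" for y :: "real ^ 'n"
proof -
  have b: "Basis = range (\<lambda>i :: 'n. axis i (1::real))" by (auto simp: Basis_vec_def)
  have inj: "inj (\<lambda>i :: 'n. axis i (1::real))" by (auto simp: inj_def axis_eq_axis)
  show ?thesis
    unfolding ref_simplex_def range_ref_vertices std_simplex
    by (simp add: b sum.reindex[OF inj] inner_axis)
qed

lemma mem_elem: "x \<in> elem s \<longleftrightarrow> (\<forall>j. 0 \<le> bary s j x)"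
proof -
  have "x \<in> elem s \<longleftrightarrow> matrix_inv (aff_matrix s) *v (x - s None) \<in> ref_simplex"
  proof
    assume "x \<in> elem s"
    then show "matrix_inv (aff_matrix s) *v (x - s None) \<in> ref_simplex"
      unfolding elem_def by (auto simp: inv_mult)
  next
    assume "matrix_inv (aff_matrix s) *v (x - s None) \<in> ref_simplex"
    then show "x \<in> elem s" unfolding elem_def
      by (intro image_eqI[where x = "matrix_inv (aff_matrix s) *v (x - s None)"]) (simp_all add: inv_mult)
  qed
  also have "\<dots> \<longleftrightarrow> (\<forall>i. 0 \<le> lam s (Some i) x) \<and> 0 \<le> lam s None x"
    by (simp add: mem_ref_simplex lam_def Let_def)
  also have "\<dots> \<longleftrightarrow> (\<forall>j. 0 \<le> lam s j x)" by (metis option.exhaust)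
  finally show ?thesis by (simp add: bary_eq_lam)
qed

lemma exists_other: "\<exists>l :: 'n option. l \<noteq> j"
  by (cases j) auto

lemma interior_elem: "interior (elem s) = {x. \<forall>j. 0 < bary s j x}"
proof
  have "open {x. \<forall>j. 0 < bary s j x}"
    unfolding Collect_all_eq by (intro open_INT ballI open_Collect_less) (auto intro: bary_cont)
  then show "{x. \<forall>j. 0 < bary s j x} \<subseteq> interior (elem s)"
    by (intro interior_maximal) (auto simp: mem_elem less_imp_le)
  show "interior (elem s) \<subseteq> {x. \<forall>j. 0 < bary s j x}"
  proof clarify
    fix x and j :: "'n option" assume x: "x \<in> interior (elem s)"
    \<comment> \<open>Moving in the direction from s j to s l lowers lambda_j at unit rate, and for
      a short time the point remains in the element. Hence lambda_j was positive at the
      start.\<close>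
    obtain l where l: "l \<noteq> j" using exists_other[of j] by blast
    have "((\<lambda>t. x + t *\<^sub>R (s l - s j)) \<longlongrightarrow> x + 0 *\<^sub>R (s l - s j)) (at_right (0::real))"
      by (intro tendsto_intros)
    then have "\<forall>\<^sub>F t in at_right (0::real). x + t *\<^sub>R (s l - s j) \<in> interior (elem s)"
      using x by (intro topological_tendstoD) auto
    moreover have "\<forall>\<^sub>F t in at_right (0::real). t > 0" by (simp add: eventually_at_right_less)
    ultimately obtain t :: real where t: "t > 0" "x + t *\<^sub>R (s l - s j) \<in> interior (elem s)"
      using eventually_happens[OF eventually_conj] trivial_limit_at_right_real by blast
    then have "0 \<le> bary s j (x + t *\<^sub>R (s l - s j))" using interior_subset mem_elem by blast
    then show "0 < bary s j x" using t(1) l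
      by (simp add: bary_add linear_scale[OF bgrad_linear] bgrad_edge)
  qed
qed

lemma frontier_elem: "frontier (elem s) = {x \<in> elem s. \<exists>j. bary s j x = 0}"
  using elem_compact unfolding frontier_def interior_elem
  by (auto simp: compact_imp_closed mem_elem order_less_le)

lemma bary_convex:
  assumes "u + v = 1"
  shows "bary s j (u *\<^sub>R x + v *\<^sub>R y) = u * bary s j x + v * bary s j y"
proof -
  have "bary s j (u *\<^sub>R x + v *\<^sub>R y) = (u + v) * bary s j 0 + u * bgrad s j x + v * bgrad s j y"
    using bary_add[of j 0 "u *\<^sub>R x + v *\<^sub>R y"] assms
    by (simp add: linear_add[OF bgrad_linear] linear_scale[OF bgrad_linear])
  then show ?thesis by (simp add: bgrad_def algebra_simps)
qed

lemma elem_convex: "convex (elem s)"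
  by (rule convexI) (simp add: mem_elem bary_convex)

lemma interior_elem_ne: "interior (elem s) \<noteq> {}"
proof -
  define l :: "'n option \<Rightarrow> real" where "l j = 1 / CARD('n option)" for j
  have "(\<Sum>j\<in>UNIV. l j) = 1" by (simp add: l_def)
  then have "(\<Sum>i\<in>UNIV. l i *\<^sub>R s i) \<in> interior (elem s)"
    unfolding interior_elem by (simp add: bary_comb) (simp add: l_def)
  then show ?thesis by blast
qed

lemma vertex_in_elem: "s i \<in> elem s"
  by (simp add: mem_elem bary_vertex)

lemma facet_eq: "facet s i = {x \<in> elem s. bary s i x = 0}"
proof
  have "convex {x \<in> elem s. bary s i x = 0}"
  proof (rule convexI)
    fix x y and u v :: real
    assume "x \<in> {x \<in> elem s. bary s i x = 0}" "y \<in> {x \<in> elem s. bary s i x = 0}" "0 \<le> u" "0 \<le> v" "u + v = 1"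
    then show "u *\<^sub>R x + v *\<^sub>R y \<in> {x \<in> elem s. bary s i x = 0}"
      by (simp add: mem_elem bary_convex)
  qed
  then show "facet s i \<subseteq> {x \<in> elem s. bary s i x = 0}"
    unfolding facet_def by (intro hull_minimal) (auto simp: vertex_in_elem bary_vertex)
  show "{x \<in> elem s. bary s i x = 0} \<subseteq> facet s i"
  proof clarify
    fix x assume x: "x \<in> elem s" "bary s i x = 0"
    have "(\<Sum>j\<in>UNIV - {i}. bary s j x *\<^sub>R s j) \<in> facet s i"
      unfolding facet_def
    proof (rule convex_sum)
      show "(\<Sum>j\<in>UNIV - {i}. bary s j x) = 1"
        using bary_sum[of x] x(2) by (simp add: sum.remove[of UNIV i])
    qed (use x in \<open>auto simp: mem_elem convex_convex_hull intro: hull_inc\<close>)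
    also have "(\<Sum>j\<in>UNIV - {i}. bary s j x *\<^sub>R s j) = x"
      using bary_point[of x] x(2) by (simp add: sum.remove[of UNIV i])
    finally show "x \<in> facet s i" .
  qed
qed

text \<open>Along the edge direction s j - s l only lambda_j and lambda_l change, by opposite
  amounts. Going back by lambda_j therefore ends on the facet opposite s j without leaving the
  element.\<close>

lemma move_to_facet:
  assumes "x \<in> elem s" "l \<noteq> j"
  defines "y \<equiv> x - bary s j x *\<^sub>R (s j - s l)"
  shows "y \<in> elem s" "bary s j y = 0"
    "\<And>t. 0 \<le> t \<Longrightarrow> t \<le> bary s j x \<Longrightarrow> x - t *\<^sub>R (s j - s l) \<in> elem s"
proof -
  have b: "bary s k (x - t *\<^sub>R (s j - s l))
      = bary s k x - t * ((if j = k then 1 else 0) - (if l = k then 1 else 0))" for k t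
    using bary_add[of k x "- t *\<^sub>R (s j - s l)"] linear_scale[OF bgrad_linear, of k "- t" "s j - s l"]
    by (simp add: bgrad_edge)
  show m: "x - t *\<^sub>R (s j - s l) \<in> elem s" if "0 \<le> t" "t \<le> bary s j x" for t
    unfolding mem_elem b
  proof
    fix k
    have "0 \<le> bary s k x" using assms(1) by (simp add: mem_elem)
    then show "0 \<le> bary s k x - t * ((if j = k then 1 else 0) - (if l = k then 1 else 0))"
      using that assms(2) by auto
  qed
  show "y \<in> elem s" unfolding y_def by (rule m) (use assms(1) in \<open>auto simp: mem_elem\<close>)
  show "bary s j y = 0" unfolding y_def b using assms(2) by simp
qed

text \<open>The minus sign makes the normal outward, since lambda_i grows toward s i. Uniqueness
  holds because the edges ending in a fixed vertex s l of the facet span the space, and all of them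
  except s i - s l are tangential.\<close>

lemma normal_eq:
  obtains g where "\<And>h. bgrad s i h = g \<bullet> h" "g \<noteq> 0" "normal s i = - (1 / norm g) *\<^sub>R g"
proof -
  define g where "g = (\<Sum>b\<in>Basis. bgrad s i b *\<^sub>R b)"
  have g: "bgrad s i h = g \<bullet> h" for h
  proof -
    have "bgrad s i h = bgrad s i (\<Sum>b\<in>Basis. (h \<bullet> b) *\<^sub>R b)" by (simp add: euclidean_representation)
    also have "\<dots> = g \<bullet> h"
      unfolding g_def linear_sum[OF bgrad_linear]
      by (simp add: linear_scale[OF bgrad_linear] inner_sum_left inner_commute[of h] mult.commute)
    finally show ?thesis .
  qed
  obtain l where l: "l \<noteq> i" using exists_other[of i] by blast
  have gl: "g \<bullet> (s i - s l) = 1" using l by (simp add: g[symmetric] bgrad_edge)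
  then have g0: "g \<noteq> 0" by auto
  have "normal s i = - (1 / norm g) *\<^sub>R g"
    unfolding normal_def
  proof (rule the_equality)
    have gd: "g \<bullet> (x - y) = bary s i x - bary s i y" for x y by (simp add: g[symmetric] bgrad_diff)
    show "norm (- (1 / norm g) *\<^sub>R g) = 1 \<and>
      (\<forall>x\<in>facet s i. \<forall>y\<in>facet s i. (- (1 / norm g) *\<^sub>R g) \<bullet> (x - y) = 0) \<and>
      (\<forall>x\<in>facet s i. (- (1 / norm g) *\<^sub>R g) \<bullet> (s i - x) < 0)"
      using g0 by (simp add: facet_eq gd bary_vertex)
  next
    fix \<nu> assume \<nu>: "norm \<nu> = 1 \<and> (\<forall>x\<in>facet s i. \<forall>y\<in>facet s i. \<nu> \<bullet> (x - y) = 0)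
                      \<and> (\<forall>x\<in>facet s i. \<nu> \<bullet> (s i - x) < 0)"
    have v: "s j \<in> facet s i" if "j \<noteq> i" for j
      using that by (simp add: facet_eq vertex_in_elem bary_vertex)
    \<comment> \<open>The value of the candidate on the only non-tangential edge. The gradient g has
      value 1 there, so the candidate must be k times g.\<close>
    define k where "k = \<nu> \<bullet> (s i - s l)"
    have k: "k < 0" using \<nu> v[OF l] by (simp add: k_def)
    have "\<nu> \<bullet> h = (k *\<^sub>R g) \<bullet> h" for h
    proof -
      have "h = (\<Sum>j\<in>UNIV. bgrad s j h *\<^sub>R s j) - (\<Sum>j\<in>UNIV. bgrad s j h) *\<^sub>R s l"
        by (simp add: bgrad_point bgrad_sum)
      then have "h = (\<Sum>j\<in>UNIV. bgrad s j h *\<^sub>R (s j - s l))"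
        by (simp add: scaleR_diff_right sum_subtractf scaleR_sum_left)
      then have "\<nu> \<bullet> h = (\<Sum>j\<in>UNIV. bgrad s j h * (\<nu> \<bullet> (s j - s l)))"
        by (metis (no_types, lifting) inner_scaleR_right inner_sum_right sum.cong)
      also have "\<dots> = (\<Sum>j\<in>UNIV. if j = i then bgrad s i h * k else 0)"
        using \<nu> v l by (intro sum.cong) (auto simp: k_def)
      finally show ?thesis by (simp add: g mult.commute)
    qed
    then have eq: "\<nu> = k *\<^sub>R g" by (metis inner_commute vector_eq_rdot)
    then have "- k * norm g = 1" using \<nu> k by simp
    then have "k = - (1 / norm g)" using g0 by (simp add: field_simps)
    then show "\<nu> = - (1 / norm g) *\<^sub>R g" using eq by simp
  qed
  then show ?thesis using that g g0 by blast
qed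

text \<open>Translates conditions on the normal flux into conditions on \<open>bgrad\<close>, the
  form used from here on.\<close>

lemma sgn_inner_normal: "sgn (c \<bullet> normal s i) = - sgn (bgrad s i c)"
proof -
  obtain g where "\<And>h. bgrad s i h = g \<bullet> h" "g \<noteq> 0" "normal s i = - (1 / norm g) *\<^sub>R g"
    using normal_eq[of i] by blast
  then show ?thesis by (simp add: inner_commute sgn_divide sgn_mult sgn_real_def field_simps)
qed

lemma elem_lmeasurable: "elem s \<in> lmeasurable"
  by (rule lmeasurable_compact[OF elem_compact])

text \<open>The homothety with centre s j and ratio 1 - \<epsilon> maps the element into the part
  where lambda_j is at least \<epsilon>, so the layer has at most the fraction 1 - (1 -
  \<epsilon>)^N of the volume. Bernoulli's inequality bounds this by N \<epsilon>.\<close>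

lemma layer_measure:
  assumes "\<epsilon> > 0"
  shows "measure lebesgue {x \<in> elem s. bary s j x < \<epsilon>} \<le> real CARD('n) * \<epsilon> * measure lebesgue (elem s)"
proof -
  let ?L = "{x \<in> elem s. bary s j x < \<epsilon>}" and ?K = "elem s"
  have Lm: "?L \<in> lmeasurable"
  proof -
    have "?L = ?K - {x \<in> ?K. \<epsilon> \<le> bary s j x}" by auto
    moreover have "closed {x. \<epsilon> \<le> bary s j x}"
      by (intro closed_Collect_le bary_cont continuous_on_const)
    then have "compact {x \<in> ?K. \<epsilon> \<le> bary s j x}"
      using compact_Int_closed[OF elem_compact, of "{x. \<epsilon> \<le> bary s j x}"] by (simp add: Int_def)
    ultimately show ?thesis
      using fmeasurable.Diff[OF elem_lmeasurable lmeasurable_compact] by simp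
  qed
  have N: "1 \<le> real CARD('n)" using zero_less_card_finite[where 'a='n] by linarith
  show ?thesis
  proof (cases "\<epsilon> < 1")
    case False
    have "measure lebesgue ?L \<le> measure lebesgue ?K"
      by (rule measure_mono_fmeasurable) (use elem_lmeasurable Lm in \<open>auto simp: fmeasurableD\<close>)
    also have "\<dots> \<le> (real CARD('n) * \<epsilon>) * measure lebesgue ?K"
      using False N mult_mono[of 1 "real CARD('n)" 1 \<epsilon>] mult_right_mono[of 1 "real CARD('n) * \<epsilon>" "measure lebesgue ?K"]
      by simp
    finally show ?thesis .
  next
    case True
    define t where "t = 1 - \<epsilon>"
    have t: "0 < t" using True by (simp add: t_def)
    let ?S = "(\<lambda>x. t *\<^sub>R x + (1 - t) *\<^sub>R s j) ` ?K"
    have b: "bary s k (t *\<^sub>R x + (1 - t) *\<^sub>R s j) = t * bary s k x + (1 - t) * bary s k (s j)" for k x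
      by (rule bary_convex) simp
    have Sm: "?S \<in> lmeasurable"
      by (intro lmeasurable_compact compact_continuous_image elem_compact continuous_intros)
    have sub: "?S \<subseteq> ?K"
    proof (rule image_subsetI)
      fix x assume "x \<in> ?K"
      then have "0 \<le> t * bary s k x + (1 - t) * bary s k (s j)" for k
        using t True assms by (intro add_nonneg_nonneg mult_nonneg_nonneg) (auto simp: mem_elem bary_vertex t_def)
      then show "t *\<^sub>R x + (1 - t) *\<^sub>R s j \<in> ?K" by (simp add: mem_elem b)
    qed
    have disj: "?S \<inter> ?L = {}"
    proof -
      have "\<epsilon> \<le> bary s j (t *\<^sub>R x + (1 - t) *\<^sub>R s j)" if "x \<in> ?K" for x
      proof -
        have "0 \<le> t * bary s j x" using t that by (simp add: mem_elem)
        then show ?thesis by (simp only: b bary_vertex) (simp add: t_def)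
      qed
      then show ?thesis by fastforce
    qed
    have mS: "measure lebesgue ?S = t ^ CARD('n) * measure lebesgue ?K"
      using measure_lebesgue_affine[of t "(1 - t) *\<^sub>R s j" ?K] t by simp
    have "measure lebesgue ?S + measure lebesgue ?L = measure lebesgue (?S \<union> ?L)"
      using disj Sm Lm by (intro measure_Union[symmetric]) (auto simp: fmeasurable_def less_top)
    also have "\<dots> \<le> measure lebesgue ?K"
      by (rule measure_mono_fmeasurable) (use elem_lmeasurable Lm Sm sub in \<open>auto simp: fmeasurableD\<close>)
    finally have "measure lebesgue ?L \<le> (1 - t ^ CARD('n)) * measure lebesgue ?K"
      unfolding mS left_diff_distrib by linarith
    also have "1 - t ^ CARD('n) \<le> real CARD('n) * \<epsilon>"
      using Bernoulli_inequality[of "- \<epsilon>" "CARD('n)"] True by (simp add: t_def)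
    finally show ?thesis by (simp add: mult_right_mono)
  qed
qed

end

section \<open>Green's formula on a simplex\<close>

lemma bounded_on_compact:
  fixes f :: "real ^ 'n \<Rightarrow> real"
  assumes "compact K" "continuous_on UNIV f"
  obtains B where "B \<ge> 0" "\<And>x. x \<in> K \<Longrightarrow> \<bar>f x\<bar> \<le> B"
proof -
  have "bounded (f ` K)"
    by (intro compact_imp_bounded compact_continuous_image continuous_on_subset[OF assms(2)] assms(1)) simp
  then obtain B where "\<forall>y\<in>f ` K. norm y \<le> B" unfolding bounded_iff by blast
  then have "\<bar>f x\<bar> \<le> max B 0" if "x \<in> K" for x using that by fastforce
  then show ?thesis using that[of "max B 0"] by simp
qed

lemma cont_measurable_on_compact:
  fixes f :: "real ^ 'n \<Rightarrow> real"
  assumes "compact K" "continuous_on UNIV f"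
  shows "f \<in> borel_measurable (lebesgue_on K)"
  using assms by (intro continuous_imp_measurable_on_sets_lebesgue continuous_on_subset[OF assms(2)])
    (auto simp: lmeasurable_compact fmeasurableD)

lemma integrable_mult_cont:
  fixes f v :: "real ^ 'n \<Rightarrow> real"
  assumes K: "compact K" and f: "continuous_on UNIV f" and v: "integrable (lebesgue_on K) v"
  shows "integrable (lebesgue_on K) (\<lambda>x. v x * f x)"
proof -
  obtain B where B: "B \<ge> 0" "\<And>x. x \<in> K \<Longrightarrow> \<bar>f x\<bar> \<le> B" using bounded_on_compact[OF K f] by blast
  show ?thesis
  proof (rule Bochner_Integration.integrable_bound)
    show "integrable (lebesgue_on K) (\<lambda>x. B * v x)" using v by simp
    show "(\<lambda>x. v x * f x) \<in> borel_measurable (lebesgue_on K)"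
      using v cont_measurable_on_compact[OF K f] by measurable
    show "AE x in lebesgue_on K. norm (v x * f x) \<le> norm (B * v x)"
      using B by (intro AE_I2) (simp add: abs_mult mult.commute mult_right_mono)
  qed
qed

lemma integrable_const_on_compact:
  fixes K :: "(real ^ 'n) set"
  assumes "compact K"
  shows "integrable (lebesgue_on K) (\<lambda>x. a :: real)"
  using finite_measure_lebesgue_on[OF lmeasurable_compact[OF assms]]
  by (rule finite_measure.integrable_const)

lemma integrable_cont:
  fixes f :: "real ^ 'n \<Rightarrow> real"
  assumes "compact K" "continuous_on UNIV f"
  shows "integrable (lebesgue_on K) f"
  using integrable_mult_cont[OF assms integrable_const_on_compact[OF assms(1), of 1]] by simp

lemma integral_lebesgue_on_eq_lborel:
  fixes f :: "real ^ 'n \<Rightarrow> real"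
  assumes "compact K" "continuous_on UNIV f" "\<And>x. x \<notin> K \<Longrightarrow> f x = 0"
  shows "(\<integral>x. f x \<partial>lebesgue_on K) = (\<integral>x. f x \<partial>lborel)"
proof -
  have "(\<integral>x. f x \<partial>lebesgue_on K) = (\<integral>x. indicator K x *\<^sub>R f x \<partial>lebesgue)"
    by (rule integral_restrict_space) (use assms(1) in \<open>simp add: lmeasurable_compact fmeasurableD\<close>)
  also have "(\<lambda>x. indicator K x *\<^sub>R f x) = f"
    using assms(3) by (fastforce simp: indicator_def)
  also have "(\<integral>x. f x \<partial>lebesgue) = (\<integral>x. f x \<partial>lborel)"
    by (rule integral_completion) (use assms(2) in \<open>simp add: borel_measurable_continuous_onI\<close>)
  finally show ?thesis .
qed

text \<open>
  The weak derivative in a constant direction \<open>c\<close>. Unlike \<open>weak_deriv\<close> it asks for integrability up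
  to the boundary and puts both sides under one integral.
\<close>

definition weak_pair ::
  "real ^ 'n \<Rightarrow> (real ^ 'n) set \<Rightarrow> (real ^ 'n \<Rightarrow> real) \<Rightarrow> (real ^ 'n \<Rightarrow> real) \<Rightarrow> bool" where
  "weak_pair c K v g \<longleftrightarrow> integrable (lebesgue_on K) v \<and> integrable (lebesgue_on K) g \<and>
     (\<forall>\<phi>. C1_compact (interior K) \<phi> \<longrightarrow> (\<integral>x. v x * dd c \<phi> x + g x * \<phi> x \<partial>lebesgue_on K) = 0)"

text \<open>The product of G with a test function is C^1 with compact support, so its derivative
  integrates to zero.\<close>

lemma weak_pair_C1:
  assumes K: "compact K" and G: "C1_fun G"
  shows "weak_pair c K G (dd c G)"
  unfolding weak_pair_def
proof (intro conjI allI impI)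
  show "integrable (lebesgue_on K) G" "integrable (lebesgue_on K) (dd c G)"
    by (intro integrable_cont K C1_fun_cont C1_fun_dd_cont G)+
  fix \<phi> assume \<phi>: "C1_compact (interior K) \<phi>"
  have C1: "C1_fun \<phi>" using \<phi> by (simp add: C1_compact_def)
  have cm: "C1_compact (interior K) (\<lambda>x. G x * \<phi> x)" by (rule C1_compact_mult[OF \<phi> G])
  have "(\<integral>x. G x * dd c \<phi> x + dd c G x * \<phi> x \<partial>lebesgue_on K) = (\<integral>x. dd c (\<lambda>x. G x * \<phi> x) x \<partial>lebesgue_on K)"
    by (simp add: dd_mult[OF G C1])
  also have "\<dots> = (\<integral>x. dd c (\<lambda>x. G x * \<phi> x) x \<partial>lborel)"
    using C1_compact_outside(2)[OF cm] interior_subset[of K]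
    by (intro integral_lebesgue_on_eq_lborel K C1_fun_dd_cont C1_fun_mult G C1) blast
  also have "\<dots> = 0"
    by (rule integral_dd_compact_support) (use cm in \<open>auto simp: C1_compact_def\<close>)
  finally show "(\<integral>x. G x * dd c \<phi> x + dd c G x * \<phi> x \<partial>lebesgue_on K) = 0" .
qed

lemma weak_pair_add:
  assumes K: "compact K" and "weak_pair c K v g" "weak_pair c K v' g'"
  shows "weak_pair c K (\<lambda>x. v x + v' x) (\<lambda>x. g x + g' x)"
  unfolding weak_pair_def
proof (intro conjI allI impI)
  show "integrable (lebesgue_on K) (\<lambda>x. v x + v' x)" "integrable (lebesgue_on K) (\<lambda>x. g x + g' x)"
    using assms unfolding weak_pair_def by auto
  fix \<phi> assume \<phi>: "C1_compact (interior K) \<phi>"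
  then have C1: "C1_fun \<phi>" by (simp add: C1_compact_def)
  have i: "integrable (lebesgue_on K) (\<lambda>x. v x * dd c \<phi> x + g x * \<phi> x)" if "weak_pair c K v g" for v g
    using that unfolding weak_pair_def
    by (intro Bochner_Integration.integrable_add integrable_mult_cont K C1_fun_dd_cont C1_fun_cont C1) auto
  have "(\<integral>x. (v x + v' x) * dd c \<phi> x + (g x + g' x) * \<phi> x \<partial>lebesgue_on K)
    = (\<integral>x. (v x * dd c \<phi> x + g x * \<phi> x) + (v' x * dd c \<phi> x + g' x * \<phi> x) \<partial>lebesgue_on K)"
    by (rule Bochner_Integration.integral_cong) (auto simp: algebra_simps)
  also have "\<dots> = 0"
    using assms(2,3) \<phi> by (subst Bochner_Integration.integral_add[OF i i]) (auto simp: weak_pair_def)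
  finally show "(\<integral>x. (v x + v' x) * dd c \<phi> x + (g x + g' x) * \<phi> x \<partial>lebesgue_on K) = 0" .
qed

text \<open>The factor P is moved to the test function, which stays admissible.\<close>

lemma weak_pair_mult:
  assumes K: "compact K" and v: "weak_pair c K v g" and P: "C1_fun P"
  shows "weak_pair c K (\<lambda>x. P x * v x) (\<lambda>x. P x * g x + dd c P x * v x)"
  unfolding weak_pair_def
proof (intro conjI allI impI)
  have iv: "integrable (lebesgue_on K) v" "integrable (lebesgue_on K) g"
    using v by (auto simp: weak_pair_def)
  show "integrable (lebesgue_on K) (\<lambda>x. P x * v x)"
    using integrable_mult_cont[OF K C1_fun_cont[OF P] iv(1)] by (simp add: mult.commute)
  show "integrable (lebesgue_on K) (\<lambda>x. P x * g x + dd c P x * v x)"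
    using integrable_mult_cont[OF K C1_fun_cont[OF P] iv(2)] integrable_mult_cont[OF K C1_fun_dd_cont[OF P] iv(1)]
    by (intro Bochner_Integration.integrable_add) (auto simp: mult.commute)
  fix \<phi> assume \<phi>: "C1_compact (interior K) \<phi>"
  then have C1: "C1_fun \<phi>" by (simp add: C1_compact_def)
  have "(\<integral>x. P x * v x * dd c \<phi> x + (P x * g x + dd c P x * v x) * \<phi> x \<partial>lebesgue_on K)
    = (\<integral>x. v x * dd c (\<lambda>x. P x * \<phi> x) x + g x * (P x * \<phi> x) \<partial>lebesgue_on K)"
    by (rule Bochner_Integration.integral_cong) (auto simp: dd_mult[OF P C1] algebra_simps)
  also have "\<dots> = 0" using v C1_compact_mult[OF \<phi> P] by (simp add: weak_pair_def)
  finally show "(\<integral>x. P x * v x * dd c \<phi> x + (P x * g x + dd c P x * v x) * \<phi> x \<partial>lebesgue_on K) = 0" .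
qed

lemma weak_pair_cmult:
  assumes "compact K" "weak_pair c K v g"
  shows "weak_pair c K (\<lambda>x. a * v x) (\<lambda>x. a * g x)"
  using weak_pair_mult[OF assms C1_fun_const[of a]] by (simp add: dd_const)

lemma weak_pair_cong:
  assumes "weak_pair c K v g"
    and "AE x in lebesgue_on K. v x = v' x" "AE x in lebesgue_on K. g x = g' x" and K: "compact K"
    and m: "v' \<in> borel_measurable (lebesgue_on K)" "g' \<in> borel_measurable (lebesgue_on K)"
  shows "weak_pair c K v' g'"
  unfolding weak_pair_def
proof (intro conjI allI impI)
  have m': "v \<in> borel_measurable (lebesgue_on K)" "g \<in> borel_measurable (lebesgue_on K)"
    using assms(1) unfolding weak_pair_def by auto
  show i: "integrable (lebesgue_on K) v'" "integrable (lebesgue_on K) g'"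
    using assms integrable_cong_AE[OF m'(1) m(1)] integrable_cong_AE[OF m'(2) m(2)] unfolding weak_pair_def by auto
  fix \<phi> assume \<phi>: "C1_compact (interior K) \<phi>"
  have eq: "AE x in lebesgue_on K. v' x * dd c \<phi> x + g' x * \<phi> x = v x * dd c \<phi> x + g x * \<phi> x"
    using assms(2,3) by eventually_elim simp
  have C: "C1_fun \<phi>" using \<phi> by (simp add: C1_compact_def)
  have [measurable]: "\<phi> \<in> borel_measurable (lebesgue_on K)" "dd c \<phi> \<in> borel_measurable (lebesgue_on K)"
    by (intro cont_measurable_on_compact K C1_fun_cont[OF C] C1_fun_dd_cont[OF C])+
  have "(\<integral>x. v' x * dd c \<phi> x + g' x * \<phi> x \<partial>lebesgue_on K) = (\<integral>x. v x * dd c \<phi> x + g x * \<phi> x \<partial>lebesgue_on K)"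
    by (rule integral_cong_AE[OF _ _ eq]) (use m m' in measurable)
  then show "(\<integral>x. v' x * dd c \<phi> x + g' x * \<phi> x \<partial>lebesgue_on K) = 0"
    using assms(1) \<phi> by (simp add: weak_pair_def)
qed

section \<open>Cutoff functions on a simplex\<close>

definition cut :: "'n::finite vertices \<Rightarrow> real \<Rightarrow> real ^ 'n \<Rightarrow> real" where
  "cut s m x = (\<Prod>j\<in>UNIV. step (m * bary s j x))"

text \<open>The coefficient of \<open>bgrad s j c\<close> in the derivative of
  \<open>cut s m\<close>. It is nonnegative and lives where m lambda_j is between 1 and 2, so for
  large m it acts as a smeared surface density of the facet opposite s j.\<close>

definition cut_weight :: "'n::finite vertices \<Rightarrow> real \<Rightarrow> 'n option \<Rightarrow> real ^ 'n \<Rightarrow> real" where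
  "cut_weight s m j x = step' (m * bary s j x) * m * (\<Prod>i\<in>UNIV - {j}. step (m * bary s i x))"

lemma cut_weight_bounds:
  assumes "m \<ge> 0"
  shows "0 \<le> cut_weight s m j x" "cut_weight s m j x \<le> 2 * m" "m * bary s j x \<ge> 2 \<Longrightarrow> cut_weight s m j x = 0"
proof -
  have p: "0 \<le> (\<Prod>i\<in>UNIV - {j}. step (m * bary s i x))" "(\<Prod>i\<in>UNIV - {j}. step (m * bary s i x)) \<le> 1"
    by (auto intro!: prod_nonneg prod_le_1 simp: step_bounds)
  show "0 \<le> cut_weight s m j x"
    unfolding cut_weight_def using assms p by (simp add: step'_bounds)
  have "step' (m * bary s j x) * m * (\<Prod>i\<in>UNIV - {j}. step (m * bary s i x)) \<le> (2 * m) * 1"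
    using assms p by (intro mult_mono) (auto simp: step'_bounds)
  then show "cut_weight s m j x \<le> 2 * m" unfolding cut_weight_def by simp
qed (simp add: cut_weight_def step'_bounds)

lemma cut_bounds: "0 \<le> cut s m x" "cut s m x \<le> 1"
  unfolding cut_def by (auto intro!: prod_nonneg prod_le_1 simp: step_bounds)

context
  fixes s :: "'n::finite vertices"
  assumes inv: "invertible (aff_matrix s)"
begin

lemma step_bary_C1: "C1_fun (\<lambda>x. step (m * bary s j x))"
  by (rule C1_fun_chain[OF _ step_deriv step'_cont]) (intro C1_fun_cmult bary_C1 inv)

lemma cut_C1: "C1_fun (cut s m)"
  unfolding cut_def[abs_def] by (intro C1_fun_prod step_bary_C1)

lemma dd_cut: "dd c (cut s m) x = (\<Sum>j\<in>UNIV. bgrad s j c * cut_weight s m j x)"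
proof -
  have "dd c (\<lambda>x. step (m * bary s j x)) x = step' (m * bary s j x) * (m * bgrad s j c)" for j
    by (subst dd_chain[OF C1_fun_cmult[OF bary_C1[OF inv]] step_deriv])
       (simp add: dd_cmult bary_C1 inv dd_bary)
  then show ?thesis
    unfolding cut_def[abs_def]
    by (subst dd_prod) (auto simp: cut_weight_def step_bary_C1 intro!: sum.cong)
qed

lemma cut_weight_cont: "continuous_on UNIV (cut_weight s m j)"
  unfolding cut_weight_def[abs_def]
  by (intro continuous_on_mult continuous_on_const continuous_on_prod C1_fun_cont[OF step_bary_C1]
      continuous_on_compose2[OF step'_cont] bary_cont[OF inv]) simp_all

lemma cut_compact:
  assumes "m > 0"
  shows "C1_compact (interior (elem s)) (cut s m)"
proof (rule C1_compactI[OF cut_C1, where C = "elem s \<inter> {x. \<forall>j. 1 / m \<le> bary s j x}"])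
  have "closed {x. \<forall>j. 1 / m \<le> bary s j x}"
    by (intro closed_Collect_all closed_Collect_le bary_cont[OF inv] continuous_on_const)
  then show "compact (elem s \<inter> {x. \<forall>j. 1 / m \<le> bary s j x})"
    by (rule compact_Int_closed[OF elem_compact[OF inv]])
  show "elem s \<inter> {x. \<forall>j. 1 / m \<le> bary s j x} \<subseteq> interior (elem s)"
  proof
    fix x assume x: "x \<in> elem s \<inter> {x. \<forall>j. 1 / m \<le> bary s j x}"
    have "0 < bary s j x" for j
    proof -
      have "0 < 1 / m" using assms by simp
      also have "1 / m \<le> bary s j x" using x by blast
      finally show ?thesis .
    qed
    then show "x \<in> interior (elem s)" by (simp add: interior_elem[OF inv])
  qed
  fix x assume "x \<notin> elem s \<inter> {x. \<forall>j. 1 / m \<le> bary s j x}"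
  then have "\<exists>j. bary s j x < 1 / m"
  proof (cases "x \<in> elem s")
    case False
    then have "\<exists>j. bary s j x < 0" by (simp add: mem_elem[OF inv] not_le)
    then obtain j where j: "bary s j x < 0" by blast
    have "0 < 1 / m" using assms by simp
    with j have "bary s j x < 1 / m" by linarith
    then show ?thesis by blast
  next
    case True
    then have "\<not> (\<forall>j. 1 / m \<le> bary s j x)" using \<open>x \<notin> _\<close> by blast
    then show ?thesis by (simp only: not_all not_le)
  qed
  then obtain j where "bary s j x < 1 / m" by blast
  then have "m * bary s j x \<le> 1" using assms by (simp add: field_simps)
  then show "cut s m x = 0" unfolding cut_def by (intro prod_zero finite bexI[of _ j] step_zero) auto
qed

lemma eventually_large_bary:
  assumes "x \<in> interior (elem s)"
  shows "\<forall>\<^sub>F n in sequentially. \<forall>j. 2 \<le> real (Suc n) * bary s j x"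
proof (rule eventually_all_finite)
  fix j
  have p: "0 < bary s j x" using assms by (simp add: interior_elem[OF inv])
  have "filterlim (\<lambda>n. real (Suc n) * bary s j x) at_top sequentially"
    by (intro filterlim_at_top_mult_tendsto_pos[OF tendsto_const p]
        filterlim_compose[OF filterlim_real_sequentially filterlim_Suc])
  then show "\<forall>\<^sub>F n in sequentially. 2 \<le> real (Suc n) * bary s j x"
    by (simp add: filterlim_at_top)
qed

lemma AE_interior: "AE x in lebesgue_on (elem s). x \<in> interior (elem s)"
proof -
  have "negligible (frontier (elem s))" by (rule negligible_convex_frontier[OF elem_convex[OF inv]])
  then have "AE x in lebesgue. x \<notin> frontier (elem s)"
    by (auto simp: negligible_iff_null_sets intro: AE_not_in)
  then have "AE x in lebesgue. x \<in> elem s \<longrightarrow> x \<in> interior (elem s)"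
    by eventually_elim (use elem_compact[OF inv] in \<open>auto simp: frontier_def compact_imp_closed\<close>)
  then show ?thesis
    using elem_lmeasurable[OF inv] by (subst AE_restrict_space_iff) auto
qed

lemma cut_lim:
  assumes h: "integrable (lebesgue_on (elem s)) h"
  shows "(\<lambda>n. \<integral>x. h x * cut s (real (Suc n)) x \<partial>lebesgue_on (elem s)) \<longlonglongrightarrow> (\<integral>x. h x \<partial>lebesgue_on (elem s))"
proof (rule integral_dominated_convergence[where w = "\<lambda>x. \<bar>h x\<bar>"])
  show "AE x in lebesgue_on (elem s). (\<lambda>n. h x * cut s (real (Suc n)) x) \<longlonglongrightarrow> h x"
    using AE_interior
  proof eventually_elim
    case (elim x)
    have "\<forall>\<^sub>F n in sequentially. cut s (real (Suc n)) x = 1"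
      using eventually_large_bary[OF elim] by eventually_elim (simp only: cut_def step_one prod.neutral_const)
    then have "\<forall>\<^sub>F n in sequentially. h x * cut s (real (Suc n)) x = h x"
      by eventually_elim simp
    then show ?case by (rule tendsto_eventually)
  qed
  show "AE x in lebesgue_on (elem s). norm (h x * cut s (real (Suc n)) x) \<le> \<bar>h x\<bar>" for n
    using cut_bounds[of s "real (Suc n)"] by (intro AE_I2) (simp add: abs_mult mult_left_le)
  show "(\<lambda>x. h x * cut s (real (Suc n)) x) \<in> borel_measurable (lebesgue_on (elem s))" for n
    using integrable_mult_cont[OF elem_compact[OF inv] C1_fun_cont[OF cut_C1] h] by auto
qed (use h in auto)

text \<open>\<open>\<phi>\<close> times the cutoff is an admissible test function whatever
  \<open>\<phi>\<close> does on the boundary; the derivative of the cutoff is what remains as a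
  boundary term.\<close>

lemma cut_green:
  assumes v: "weak_pair c (elem s) v g" and \<phi>: "C1_fun \<phi>"
  shows "(\<integral>x. (v x * dd c \<phi> x + g x * \<phi> x) * cut s (real (Suc n)) x \<partial>lebesgue_on (elem s))
     = - (\<integral>x. v x * (\<phi> x * dd c (cut s (real (Suc n))) x) \<partial>lebesgue_on (elem s))"
proof -
  let ?K = "lebesgue_on (elem s)" and ?c = "cut s (real (Suc n))"
  note K = elem_compact[OF inv]
  have iv: "integrable ?K v" "integrable ?K g" using v by (auto simp: weak_pair_def)
  have i1: "integrable ?K (\<lambda>x. (v x * dd c \<phi> x + g x * \<phi> x) * ?c x)"
    by (intro integrable_mult_cont Bochner_Integration.integrable_add K C1_fun_cont C1_fun_dd_cont cut_C1 \<phi> iv)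
  have i2: "integrable ?K (\<lambda>x. v x * (\<phi> x * dd c ?c x))"
    by (intro integrable_mult_cont K continuous_on_mult C1_fun_cont C1_fun_dd_cont cut_C1 \<phi> iv)
  have "C1_compact (interior (elem s)) (\<lambda>x. \<phi> x * ?c x)"
    by (intro C1_compact_mult cut_compact \<phi>) simp
  then have "0 = (\<integral>x. v x * dd c (\<lambda>x. \<phi> x * ?c x) x + g x * (\<phi> x * ?c x) \<partial>?K)"
    using v by (simp add: weak_pair_def)
  also have "\<dots> = (\<integral>x. (v x * dd c \<phi> x + g x * \<phi> x) * ?c x + v x * (\<phi> x * dd c ?c x) \<partial>?K)"
    by (rule Bochner_Integration.integral_cong) (auto simp: dd_mult[OF \<phi> cut_C1] algebra_simps)
  also have "\<dots> = (\<integral>x. (v x * dd c \<phi> x + g x * \<phi> x) * ?c x \<partial>?K) + (\<integral>x. v x * (\<phi> x * dd c ?c x) \<partial>?K)"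
    by (rule Bochner_Integration.integral_add[OF i1 i2])
  finally show ?thesis by simp
qed

text \<open>Green's formula on the element, with the facet integrals replaced by a limit of volume
  integrals. All later facts about the boundary term are estimates of the left-hand
  sequence.\<close>

lemma green_lim:
  assumes v: "weak_pair c (elem s) v g" and \<phi>: "C1_fun \<phi>"
  shows "(\<lambda>n. - (\<integral>x. v x * (\<phi> x * dd c (cut s (real (Suc n))) x) \<partial>lebesgue_on (elem s)))
     \<longlonglongrightarrow> (\<integral>x. v x * dd c \<phi> x + g x * \<phi> x \<partial>lebesgue_on (elem s))"
  unfolding cut_green[OF assms, symmetric]
  by (rule cut_lim)
     (use v in \<open>auto simp: weak_pair_def intro!: integrable_mult_cont Bochner_Integration.integrable_add
        elem_compact[OF inv] C1_fun_cont C1_fun_dd_cont \<phi>\<close>)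

text \<open>The facet opposite s j is reached from x by the step lambda_j along an edge direction,
  and \<open>\<phi>\<close> vanishes there. The mean value theorem gives the bound for each j; the
  sum of the constants serves all j.\<close>

lemma bary_bound_of_zero_frontier:
  assumes \<phi>: "C1_fun \<phi>" and z: "\<And>x. x \<in> frontier (elem s) \<Longrightarrow> \<phi> x = 0"
  obtains B where "B \<ge> 0" "\<And>x j. x \<in> elem s \<Longrightarrow> \<bar>\<phi> x\<bar> \<le> B * bary s j x"
proof -
  have "\<exists>B\<ge>0. \<forall>x\<in>elem s. \<bar>\<phi> x\<bar> \<le> B * bary s j x" for j
  proof -
    obtain l where l: "l \<noteq> j" using exists_other[OF inv, of j] by blast
    define e where "e = s j - s l"
    obtain B where B: "B \<ge> 0" "\<And>x. x \<in> elem s \<Longrightarrow> \<bar>dd e \<phi> x\<bar> \<le> B"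
      using bounded_on_compact[OF elem_compact[OF inv] C1_fun_dd_cont[OF \<phi>, of UNIV e]] by blast
    have "\<bar>\<phi> x\<bar> \<le> B * bary s j x" if x: "x \<in> elem s" for x
    proof (cases "bary s j x = 0")
      case True
      then show ?thesis using x z by (auto simp: frontier_elem[OF inv])
    next
      case False
      then have p: "0 < bary s j x" using x by (simp add: mem_elem[OF inv] order_less_le)
      have der: "((\<lambda>t. \<phi> (x - t *\<^sub>R e)) has_real_derivative - dd e \<phi> (x - t *\<^sub>R e)) (at t)" for t
      proof -
        have "((\<lambda>t. x - t *\<^sub>R e) has_derivative (\<lambda>h. (- h) *\<^sub>R e)) (at t)"
          by (auto intro!: derivative_eq_intros)
        from has_derivative_compose[OF this C1_fun_deriv[OF \<phi>]]
        have "((\<lambda>t. \<phi> (x - t *\<^sub>R e)) has_derivative (\<lambda>h. dd ((- h) *\<^sub>R e) \<phi> (x - t *\<^sub>R e))) (at t)" .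
        moreover have "(\<lambda>h. dd ((- h) *\<^sub>R e) \<phi> (x - t *\<^sub>R e)) = (*) (- dd e \<phi> (x - t *\<^sub>R e))"
          unfolding dd_scale_dir[OF \<phi>] by auto
        ultimately show ?thesis by (simp add: has_field_derivative_def)
      qed
      obtain t where t: "0 < t" "t < bary s j x"
        "\<phi> (x - bary s j x *\<^sub>R e) - \<phi> (x - 0 *\<^sub>R e) = (bary s j x - 0) * (- dd e \<phi> (x - t *\<^sub>R e))"
        using MVT2[OF p, of "\<lambda>t. \<phi> (x - t *\<^sub>R e)" "\<lambda>t. - dd e \<phi> (x - t *\<^sub>R e)"] der by blast
      have "\<phi> (x - bary s j x *\<^sub>R e) = 0"
        using move_to_facet[OF inv x l] unfolding e_def by (intro z) (auto simp: frontier_elem[OF inv])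
      then have "\<bar>\<phi> x\<bar> = bary s j x * \<bar>dd e \<phi> (x - t *\<^sub>R e)\<bar>"
        using t(3) p by (simp add: abs_mult)
      also have "\<dots> \<le> bary s j x * B"
        using p move_to_facet(3)[OF inv x l, of t] t(1,2) unfolding e_def[symmetric]
        by (intro mult_left_mono B) auto
      finally show ?thesis by (simp add: mult.commute)
    qed
    then show ?thesis using B(1) by blast
  qed
  then obtain B where B: "\<And>j. B j \<ge> 0" "\<And>j x. x \<in> elem s \<Longrightarrow> \<bar>\<phi> x\<bar> \<le> B j * bary s j x" by metis
  show ?thesis
  proof (rule that[of "\<Sum>j\<in>UNIV. B j"])
    show "(\<Sum>j\<in>UNIV. B j) \<ge> 0" by (simp add: B sum_nonneg)
    fix x j assume x: "x \<in> elem s"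
    have "B j \<le> (\<Sum>j\<in>UNIV. B j)" by (rule member_le_sum) (auto simp: B)
    then have "B j * bary s j x \<le> (\<Sum>j\<in>UNIV. B j) * bary s j x"
      using x by (intro mult_right_mono) (auto simp: mem_elem[OF inv])
    then show "\<bar>\<phi> x\<bar> \<le> (\<Sum>j\<in>UNIV. B j) * bary s j x" using B(2)[OF x, of j] by linarith
  qed
qed

text \<open>The decay of \<open>\<phi>\<close> toward the facets compensates the size m of the
  derivative of the cutoff. So the integrands are dominated by a multiple of \<bar>v\<bar>, and at
  interior points they are eventually zero.\<close>

lemma green_zero_frontier:
  assumes v: "weak_pair c (elem s) v g" and \<phi>: "C1_fun \<phi>" and z: "\<And>x. x \<in> frontier (elem s) \<Longrightarrow> \<phi> x = 0"
  shows "(\<integral>x. v x * dd c \<phi> x + g x * \<phi> x \<partial>lebesgue_on (elem s)) = 0"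
proof -
  let ?K = "lebesgue_on (elem s)"
  obtain B where B: "B \<ge> 0" "\<And>x j. x \<in> elem s \<Longrightarrow> \<bar>\<phi> x\<bar> \<le> B * bary s j x"
    using bary_bound_of_zero_frontier[OF \<phi> z] by blast
  \<comment> \<open>Where the weight does not vanish, lambda_j is at most 2/m, hence
    \<bar>\<phi>\<bar> is at most 2B/m; the weight is at most 2m. The product is 4B for every
    m.\<close>
  define W where "W = (\<Sum>j\<in>UNIV. \<bar>bgrad s j c\<bar> * (4 * B))"
  have iv: "integrable ?K v" using v by (simp add: weak_pair_def)
  have "(\<lambda>n. \<integral>x. v x * (\<phi> x * dd c (cut s (real (Suc n))) x) \<partial>?K) \<longlonglongrightarrow> (\<integral>x. 0 \<partial>?K)"
  proof (rule integral_dominated_convergence[where w = "\<lambda>x. W * \<bar>v x\<bar>"])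
    show "integrable ?K (\<lambda>x. W * \<bar>v x\<bar>)" using iv by simp
    show "(\<lambda>x. v x * (\<phi> x * dd c (cut s (real (Suc n))) x)) \<in> borel_measurable ?K" for n
      by (intro borel_measurable_integrable integrable_mult_cont elem_compact inv continuous_on_mult
          C1_fun_cont C1_fun_dd_cont cut_C1 \<phi> iv)
    show "AE x in ?K. (\<lambda>n. v x * (\<phi> x * dd c (cut s (real (Suc n))) x)) \<longlonglongrightarrow> 0"
      using AE_interior
    proof eventually_elim
      case (elim x)
      have "\<forall>\<^sub>F n in sequentially. v x * (\<phi> x * dd c (cut s (real (Suc n))) x) = 0"
        using eventually_large_bary[OF elim]
      proof eventually_elim
        case (elim n)
        then have "cut_weight s (real (Suc n)) j x = 0" for j
          by (intro cut_weight_bounds(3)) auto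
        then show ?case by (simp only: dd_cut) simp
      qed
      then show ?case by (rule tendsto_eventually)
    qed
    show "AE x in ?K. norm (v x * (\<phi> x * dd c (cut s (real (Suc n))) x)) \<le> W * \<bar>v x\<bar>" for n
    proof (intro AE_I2)
      fix x assume "x \<in> space ?K"
      then have x: "x \<in> elem s" by simp
      let ?m = "real (Suc n)"
      have "\<bar>\<phi> x\<bar> * cut_weight s ?m j x \<le> 4 * B" for j
      proof (cases "?m * bary s j x \<ge> 2")
        case True
        then have "cut_weight s ?m j x = 0" by (intro cut_weight_bounds(3)) auto
        then show ?thesis using B(1) by simp
      next
        case False
        have "\<bar>\<phi> x\<bar> * cut_weight s ?m j x \<le> (B * bary s j x) * (2 * ?m)"
          using cut_weight_bounds[of ?m s j x] B x by (intro mult_mono) (auto simp: mem_elem[OF inv])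
        also have "\<dots> = B * 2 * (?m * bary s j x)" by simp
        also have "\<dots> \<le> B * 2 * 2" using False B(1) by (intro mult_left_mono) auto
        finally show ?thesis by simp
      qed
      then have "\<bar>bgrad s j c\<bar> * (\<bar>\<phi> x\<bar> * cut_weight s ?m j x) \<le> \<bar>bgrad s j c\<bar> * (4 * B)" for j
        by (intro mult_left_mono) auto
      then have "(\<Sum>j\<in>UNIV. \<bar>bgrad s j c\<bar> * (\<bar>\<phi> x\<bar> * cut_weight s ?m j x)) \<le> W"
        unfolding W_def by (intro sum_mono)
      moreover have "\<bar>\<phi> x * dd c (cut s ?m) x\<bar> \<le> (\<Sum>j\<in>UNIV. \<bar>bgrad s j c\<bar> * (\<bar>\<phi> x\<bar> * cut_weight s ?m j x))"
        unfolding dd_cut sum_distrib_left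
        by (rule order_trans[OF sum_abs]) (auto intro!: sum_mono simp: abs_mult cut_weight_bounds)
      ultimately have "\<bar>\<phi> x * dd c (cut s ?m) x\<bar> \<le> W" by linarith
      then show "norm (v x * (\<phi> x * dd c (cut s ?m) x)) \<le> W * \<bar>v x\<bar>"
        unfolding real_norm_def abs_mult[of "v x"] by (subst mult.commute[of W]) (intro mult_left_mono, auto)
    qed
  qed auto
  then have "(\<lambda>n. - (\<integral>x. v x * (\<phi> x * dd c (cut s (real (Suc n))) x) \<partial>?K)) \<longlonglongrightarrow> - 0"
    by (intro tendsto_minus) simp
  from LIMSEQ_unique[OF green_lim[OF v \<phi>] this] show ?thesis by simp
qed

end

section \<open>Continuous functions and null sets\<close>

lemma AE_zero_continuous:
  fixes f :: "real ^ 'n \<Rightarrow> real"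
  assumes K: "compact K" and f: "continuous_on UNIV f" and z: "AE x in lebesgue_on K. f x = 0"
    and x: "x \<in> interior K"
  shows "f x = 0"
proof (rule ccontr)
  assume "f x \<noteq> 0"
  define U where "U = interior K \<inter> {y. f y \<noteq> 0}"
  have "open U" unfolding U_def
    by (intro open_Int open_interior open_Collect_neq f continuous_on_const)
  moreover have "x \<in> U" using x \<open>f x \<noteq> 0\<close> by (simp add: U_def)
  ultimately have "\<not> negligible U" using open_not_negligible by blast
  moreover have "AE y in lebesgue. y \<in> K \<longrightarrow> f y = 0"
    using z by (subst (asm) AE_restrict_space_iff) (use K in \<open>auto simp: lmeasurable_compact fmeasurableD\<close>)
  then obtain N where N: "N \<in> null_sets lebesgue" "{y. \<not> (y \<in> K \<longrightarrow> f y = 0)} \<subseteq> N"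
    by (auto simp: eventually_ae_filter)
  have "U \<subseteq> N" using N(2) interior_subset[of K] unfolding U_def by blast
  then have "negligible U" using N(1) negligible_subset negligible_iff_null_sets by blast
  ultimately show False by simp
qed

lemma integral_pos_continuous:
  fixes f :: "real ^ 'n \<Rightarrow> real"
  assumes K: "compact K" and f: "continuous_on UNIV f" and n: "\<And>x. x \<in> K \<Longrightarrow> 0 \<le> f x"
    and x: "x \<in> interior K" "f x \<noteq> 0"
  shows "0 < (\<integral>x. f x \<partial>lebesgue_on K)"
proof -
  have "0 \<le> (\<integral>x. f x \<partial>lebesgue_on K)" by (intro integral_nonneg_AE AE_I2) (simp add: n)
  moreover have "(\<integral>x. f x \<partial>lebesgue_on K) \<noteq> 0"
  proof
    assume "(\<integral>x. f x \<partial>lebesgue_on K) = 0"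
    then have "AE x in lebesgue_on K. f x = 0"
      by (subst (asm) integral_nonneg_eq_0_iff_AE[OF integrable_cont[OF K f]]) (auto intro!: AE_I2 simp: n)
    then show False using AE_zero_continuous[OF K f _ x(1)] x(2) by blast
  qed
  ultimately show ?thesis by linarith
qed

context
  fixes s :: "'n::finite vertices"
  assumes inv: "invertible (aff_matrix s)"
begin

text \<open>The height 2m of the weight times the measure of the layer of width 2/m, which is at
  most (2N/m) times the volume. The factor m cancels.\<close>

abbreviation (input) layer_const :: real where
  "layer_const \<equiv> 4 * real CARD('n) * measure lebesgue (elem s)"

lemma integral_cut_weight:
  "(\<integral>x. cut_weight s (real (Suc n)) j x \<partial>lebesgue_on (elem s)) \<le> layer_const"
proof -
  let ?m = "real (Suc n)" and ?K = "lebesgue_on (elem s)"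
  let ?L = "{x \<in> elem s. bary s j x < 2 / ?m}"
  have L: "?L \<in> sets lebesgue"
  proof -
    have "open {x. bary s j x < 2 / ?m}"
      by (intro open_Collect_less bary_cont[OF inv] continuous_on_const)
    then have "{x. bary s j x < 2 / ?m} \<in> sets lebesgue" by (simp add: borel_open)
    then have "elem s \<inter> {x. bary s j x < 2 / ?m} \<in> sets lebesgue"
      by (intro sets.Int) (auto simp: fmeasurableD elem_lmeasurable[OF inv])
    then show ?thesis by (simp add: Int_def)
  qed
  have "?L \<in> sets ?K" using L by (auto simp: sets_restrict_space_iff elem_lmeasurable[OF inv] fmeasurableD)
  have Km: "elem s \<inter> space lebesgue \<in> sets lebesgue" using elem_lmeasurable[OF inv] by (simp add: fmeasurableD)
  have mL: "measure ?K ?L = measure lebesgue ?L"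
    by (rule measure_restrict_space) (use Km in auto)
  have "(\<integral>x. cut_weight s ?m j x \<partial>?K) \<le> (\<integral>x. 2 * ?m * indicator ?L x \<partial>?K)"
  proof (rule integral_mono_AE)
    show "integrable ?K (cut_weight s ?m j)"
      by (rule integrable_cont[OF elem_compact[OF inv] cut_weight_cont[OF inv]])
    have "emeasure ?K ?L < \<infinity>"
      using finite_measure.emeasure_finite[OF finite_measure_lebesgue_on[OF elem_lmeasurable[OF inv]], of ?L]
      by (simp add: less_top)
    then show "integrable ?K (\<lambda>x. 2 * ?m * indicator ?L x)"
      using \<open>?L \<in> sets ?K\<close> by (intro integrable_mult_right integrable_real_indicator) auto
    show "AE x in ?K. cut_weight s ?m j x \<le> 2 * ?m * indicator ?L x"
    proof (intro AE_I2)
      fix x assume "x \<in> space ?K"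
      then have x: "x \<in> elem s" by simp
      show "cut_weight s ?m j x \<le> 2 * ?m * indicator ?L x"
      proof (cases "?m * bary s j x \<ge> 2")
        case True
        then have "cut_weight s ?m j x = 0" by (intro cut_weight_bounds(3)) auto
        then show ?thesis by simp
      next
        case False
        then have "bary s j x < 2 / ?m" by (simp add: field_simps)
        then show ?thesis using x cut_weight_bounds(2)[of ?m s j x] by simp
      qed
    qed
  qed
  also have "\<dots> = 2 * ?m * measure lebesgue ?L"
    using \<open>?L \<in> sets ?K\<close> mL by (simp add: Int_absorb2)
  also have "\<dots> \<le> 2 * ?m * (real CARD('n) * (2 / ?m) * measure lebesgue (elem s))"
    by (intro mult_left_mono layer_measure[OF inv]) auto
  also have "\<dots> = layer_const"
  proof -
    have r: "2 * m * (a * (2 / m) * b) = 4 * a * b" if "m > 0" for m a b :: real using that by (simp add: field_simps)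
    show ?thesis by (rule r) simp
  qed
  finally show ?thesis .
qed

text \<open>The weights have integrals bounded independently of m, so only the size of
  \<open>\<phi>\<close> enters although its derivative occurs under the integral. This permits
  uniform approximation of test functions in the boundary term.\<close>

lemma green_bound:
  assumes v: "weak_pair c (elem s) v g" and M: "M \<ge> 0" "AE x in lebesgue_on (elem s). \<bar>v x\<bar> \<le> M"
    and \<phi>: "C1_fun \<phi>" and S: "\<And>x. x \<in> elem s \<Longrightarrow> \<bar>\<phi> x\<bar> \<le> S"
  shows "\<bar>\<integral>x. v x * dd c \<phi> x + g x * \<phi> x \<partial>lebesgue_on (elem s)\<bar>
    \<le> M * (\<Sum>j\<in>UNIV. \<bar>bgrad s j c\<bar> * layer_const) * S"
proof -
  let ?K = "lebesgue_on (elem s)"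
  have iv: "integrable ?K v" using v by (simp add: weak_pair_def)
  have S0: "0 \<le> S" using S[of "s None"] vertex_in_elem[OF inv] by force
  have "\<bar>- (\<integral>x. v x * (\<phi> x * dd c (cut s (real (Suc n))) x) \<partial>?K)\<bar>
      \<le> M * (\<Sum>j\<in>UNIV. \<bar>bgrad s j c\<bar> * layer_const) * S" for n
  proof -
    let ?m = "real (Suc n)"
    let ?w = "cut_weight s ?m"
    have iw: "integrable ?K (?w j)" for j
      by (rule integrable_cont[OF elem_compact[OF inv] cut_weight_cont[OF inv]])
    have "\<bar>\<integral>x. v x * (\<phi> x * dd c (cut s ?m) x) \<partial>?K\<bar> \<le> (\<integral>x. \<bar>v x * (\<phi> x * dd c (cut s ?m) x)\<bar> \<partial>?K)"
      using integral_norm_bound[of ?K "\<lambda>x. v x * (\<phi> x * dd c (cut s ?m) x)"] by simp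
    also have "\<dots> \<le> (\<integral>x. M * S * (\<Sum>j\<in>UNIV. \<bar>bgrad s j c\<bar> * ?w j x) \<partial>?K)"
    proof (rule integral_mono_AE)
      show "integrable ?K (\<lambda>x. \<bar>v x * (\<phi> x * dd c (cut s ?m) x)\<bar>)"
        by (intro Bochner_Integration.integrable_abs integrable_mult_cont elem_compact inv continuous_on_mult
            C1_fun_cont C1_fun_dd_cont cut_C1 \<phi> iv)
      show "integrable ?K (\<lambda>x. M * S * (\<Sum>j\<in>UNIV. \<bar>bgrad s j c\<bar> * ?w j x))"
        by (intro integrable_mult_right Bochner_Integration.integrable_sum iw)
      have "AE x in ?K. x \<in> elem s" by (intro AE_I2) simp
      with M(2) show "AE x in ?K. \<bar>v x * (\<phi> x * dd c (cut s ?m) x)\<bar> \<le> M * S * (\<Sum>j\<in>UNIV. \<bar>bgrad s j c\<bar> * ?w j x)"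
      proof eventually_elim
        case (elim x)
        have "\<bar>dd c (cut s ?m) x\<bar> \<le> (\<Sum>j\<in>UNIV. \<bar>bgrad s j c\<bar> * ?w j x)"
          unfolding dd_cut[OF inv]
          by (rule order_trans[OF sum_abs]) (auto intro!: sum_mono simp: abs_mult cut_weight_bounds)
        then show ?case
          unfolding abs_mult mult.assoc using elim S M(1) S0 by (intro mult_mono) auto
      qed
    qed
    also have "\<dots> = M * S * (\<Sum>j\<in>UNIV. \<bar>bgrad s j c\<bar> * (\<integral>x. ?w j x \<partial>?K))"
      using iw by simp
    also have "\<dots> \<le> M * S * (\<Sum>j\<in>UNIV. \<bar>bgrad s j c\<bar> * layer_const)"
      by (intro mult_left_mono sum_mono integral_cut_weight mult_nonneg_nonneg M(1) S0) auto
    finally show ?thesis by (simp add: mult_ac)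
  qed
  from LIMSEQ_le_const2[OF tendsto_rabs[OF green_lim[OF inv v \<phi>]]] this
  show ?thesis by blast
qed

text \<open>
  Since \<open>bgrad s j c\<close> is a negative multiple of \<open>c \<cdot> n\<^sub>j\<close>, the hypothesis \<open>sg\<close> says that the normal flux
  of \<open>G\<close> is nonnegative on each facet.
\<close>

lemma integral_dd_nonneg:
  assumes G: "C1_fun G" and sg: "\<And>j x. x \<in> facet s j \<Longrightarrow> bgrad s j c * G x \<le> 0"
  shows "0 \<le> (\<integral>x. dd c G x \<partial>lebesgue_on (elem s))"
proof -
  let ?K = "lebesgue_on (elem s)"
  define C where "C = (\<Sum>j\<in>UNIV. \<bar>bgrad s j c\<bar> * layer_const)"
  have C: "C \<ge> 0" unfolding C_def by (intro sum_nonneg) auto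
  have lim: "(\<lambda>n. - (\<integral>x. 1 * (G x * dd c (cut s (real (Suc n))) x) \<partial>?K)) \<longlonglongrightarrow> (\<integral>x. dd c G x \<partial>?K)"
    using green_lim[OF inv weak_pair_C1[OF elem_compact[OF inv] C1_fun_const[of 1]] G, of c]
    by (simp add: dd_const)
  have key: "- (\<eta> * C) \<le> (\<integral>x. dd c G x \<partial>?K)" if \<eta>: "\<eta> > 0" for \<eta>
  proof -
    \<comment> \<open>Uniform continuity of G transfers the sign of the flux from the facet to the
      layer next to it, up to an error \<open>\<eta>\<close>.\<close>
    have ev: "\<forall>\<^sub>F n in sequentially. \<forall>j. \<forall>x\<in>elem s. bary s j x < 2 / real (Suc n) \<longrightarrow>
        bgrad s j c * G x \<le> \<bar>bgrad s j c\<bar> * \<eta>"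
    proof (rule eventually_all_finite)
      fix j :: "'n option"
      obtain l where l: "l \<noteq> j" using exists_other[OF inv, of j] by blast
      have "uniformly_continuous_on (elem s) G"
        by (rule compact_uniformly_continuous[OF C1_fun_cont[OF G] elem_compact[OF inv]])
      then obtain d where d: "d > 0" "\<And>x y. x \<in> elem s \<Longrightarrow> y \<in> elem s \<Longrightarrow> dist y x < d \<Longrightarrow> dist (G y) (G x) < \<eta>"
        using \<eta> unfolding uniformly_continuous_on_def by metis
      have "(\<lambda>n. 2 * norm (s j - s l) * inverse (real (Suc n))) \<longlonglongrightarrow> 2 * norm (s j - s l) * 0"
        by (intro tendsto_intros LIMSEQ_inverse_real_of_nat)
      then have "\<forall>\<^sub>F n in sequentially. 2 * norm (s j - s l) * inverse (real (Suc n)) < d"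
        using d(1) by (intro order_tendstoD(2)[of _ 0]) auto
      then show "\<forall>\<^sub>F n in sequentially. \<forall>x\<in>elem s. bary s j x < 2 / real (Suc n) \<longrightarrow>
        bgrad s j c * G x \<le> \<bar>bgrad s j c\<bar> * \<eta>"
      proof eventually_elim
        case (elim n)
        show ?case
        proof (intro ballI impI)
          fix x assume x: "x \<in> elem s" "bary s j x < 2 / real (Suc n)"
          define y where "y = x - bary s j x *\<^sub>R (s j - s l)"
          have y: "y \<in> elem s" "bary s j y = 0" using move_to_facet[OF inv x(1) l] by (auto simp: y_def)
          have b0: "0 \<le> bary s j x" using x(1) by (simp add: mem_elem[OF inv])
          have "dist y x = bary s j x * norm (s j - s l)"
            using b0 by (simp add: y_def dist_norm)
          also have "\<dots> \<le> 2 / real (Suc n) * norm (s j - s l)"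
            using x(2) by (intro mult_right_mono) auto
          also have "\<dots> = 2 * norm (s j - s l) * inverse (real (Suc n))" by (simp add: field_simps)
          also have "\<dots> < d" by (rule elim)
          finally have "\<bar>G y - G x\<bar> < \<eta>" using d(2)[OF x(1) y(1)] by (simp add: dist_real_def)
          then have "\<bar>bgrad s j c\<bar> * \<bar>G x - G y\<bar> \<le> \<bar>bgrad s j c\<bar> * \<eta>"
            by (intro mult_left_mono) auto
          then have "bgrad s j c * (G x - G y) \<le> \<bar>bgrad s j c\<bar> * \<eta>"
            by (metis abs_ge_self abs_mult order_trans)
          moreover have "bgrad s j c * G y \<le> 0" using y by (intro sg) (simp add: facet_eq[OF inv])
          ultimately show "bgrad s j c * G x \<le> \<bar>bgrad s j c\<bar> * \<eta>" by (simp add: algebra_simps)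
        qed
      qed
    qed
    have "\<forall>\<^sub>F n in sequentially. - (\<eta> * C) \<le> - (\<integral>x. 1 * (G x * dd c (cut s (real (Suc n))) x) \<partial>?K)"
      using ev
    proof eventually_elim
      case (elim n)
      let ?m = "real (Suc n)"
      let ?w = "cut_weight s ?m"
      have iw: "integrable ?K (?w j)" for j
        by (rule integrable_cont[OF elem_compact[OF inv] cut_weight_cont[OF inv]])
      have "(\<integral>x. 1 * (G x * dd c (cut s ?m) x) \<partial>?K) \<le> (\<integral>x. \<eta> * (\<Sum>j\<in>UNIV. \<bar>bgrad s j c\<bar> * ?w j x) \<partial>?K)"
      proof (rule integral_mono_AE)
        show "integrable ?K (\<lambda>x. 1 * (G x * dd c (cut s ?m) x))"
          by (intro integrable_cont elem_compact inv continuous_on_mult continuous_on_const C1_fun_cont C1_fun_dd_cont cut_C1 G)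
        show "integrable ?K (\<lambda>x. \<eta> * (\<Sum>j\<in>UNIV. \<bar>bgrad s j c\<bar> * ?w j x))"
          by (intro integrable_mult_right Bochner_Integration.integrable_sum iw)
        show "AE x in ?K. 1 * (G x * dd c (cut s ?m) x) \<le> \<eta> * (\<Sum>j\<in>UNIV. \<bar>bgrad s j c\<bar> * ?w j x)"
        proof (intro AE_I2)
          fix x assume "x \<in> space ?K"
          then have x: "x \<in> elem s" by simp
          have "G x * (bgrad s j c * ?w j x) \<le> \<eta> * (\<bar>bgrad s j c\<bar> * ?w j x)" for j
          proof (cases "?m * bary s j x \<ge> 2")
            case True
            then have "?w j x = 0" by (intro cut_weight_bounds(3)) auto
            then show ?thesis by simp
          next
            case False
            then have "bary s j x < 2 / ?m" by (simp add: field_simps)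
            then have "bgrad s j c * G x * ?w j x \<le> \<bar>bgrad s j c\<bar> * \<eta> * ?w j x"
              using elim x by (intro mult_right_mono cut_weight_bounds) auto
            then show ?thesis by (simp add: mult_ac)
          qed
          then show "1 * (G x * dd c (cut s ?m) x) \<le> \<eta> * (\<Sum>j\<in>UNIV. \<bar>bgrad s j c\<bar> * ?w j x)"
            unfolding dd_cut[OF inv] sum_distrib_left mult_1 by (intro sum_mono)
        qed
      qed
      also have "\<dots> = \<eta> * (\<Sum>j\<in>UNIV. \<bar>bgrad s j c\<bar> * (\<integral>x. ?w j x \<partial>?K))"
        using iw by simp
      also have "\<dots> \<le> \<eta> * C"
        unfolding C_def using \<eta> by (intro mult_left_mono sum_mono integral_cut_weight) auto
      finally show ?case by simp
    qed
    then show ?thesis by (rule tendsto_lowerbound[OF lim]) simp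
  qed
  show ?thesis
  proof (rule field_le_epsilon)
    fix e :: real assume e: "e > 0"
    have "- (e / (C + 1) * C) \<le> (\<integral>x. dd c G x \<partial>?K)" using e C by (intro key) auto
    moreover have "e / (C + 1) * C \<le> e" using e C by (simp add: field_simps)
    ultimately show "0 \<le> (\<integral>x. dd c G x \<partial>?K) + e" by linarith
  qed
qed

lemma integral_dd_zero:
  assumes G: "C1_fun G" and sg: "\<And>j x. x \<in> facet s j \<Longrightarrow> bgrad s j c * G x = 0"
  shows "(\<integral>x. dd c G x \<partial>lebesgue_on (elem s)) = 0"
proof -
  have "0 \<le> (\<integral>x. dd c G x \<partial>lebesgue_on (elem s))"
    by (rule integral_dd_nonneg[OF G]) (simp add: sg)
  moreover have "0 \<le> (\<integral>x. dd c (\<lambda>x. - G x) x \<partial>lebesgue_on (elem s))"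
    by (rule integral_dd_nonneg[OF C1_fun_minus[OF G]]) (simp add: sg)
  ultimately show ?thesis by (simp add: dd_minus[OF G])
qed

text \<open>The class of test functions grows in three stages: C^1 functions by removing the cutoff,
  continuous functions by the theorem of Stone and Weierstrass, and finally the sign of h as an
  almost everywhere limit. The last one turns the integral into that of \<bar>h\<bar>.\<close>

lemma weak_zero_imp_AE_zero:
  assumes h: "integrable (lebesgue_on (elem s)) h"
    and z: "\<And>\<phi>. C1_compact (interior (elem s)) \<phi> \<Longrightarrow> (\<integral>x. h x * \<phi> x \<partial>lebesgue_on (elem s)) = 0"
  shows "AE x in lebesgue_on (elem s). h x = 0"
proof -
  let ?K = "lebesgue_on (elem s)"
  note K = elem_compact[OF inv]
  have poly: "(\<integral>x. h x * P x \<partial>?K) = 0" if P: "C1_fun P" for P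
  proof -
    have "(\<lambda>n. \<integral>x. h x * P x * cut s (real (Suc n)) x \<partial>?K) \<longlonglongrightarrow> (\<integral>x. h x * P x \<partial>?K)"
      by (rule cut_lim[OF inv integrable_mult_cont[OF K C1_fun_cont[OF P] h]])
    moreover have "(\<integral>x. h x * P x * cut s (real (Suc n)) x \<partial>?K) = 0" for n
      using z[OF C1_compact_mult[OF cut_compact[OF inv] P], of "real (Suc n)"] by (simp add: mult.assoc)
    ultimately show ?thesis by (simp add: LIMSEQ_const_iff)
  qed
  have cont: "(\<integral>x. h x * f x \<partial>?K) = 0" if f: "continuous_on UNIV f" for f
  proof -
    have ih: "integrable ?K (\<lambda>x. \<bar>h x\<bar>)" using h by simp
    define I where "I = (\<integral>x. \<bar>h x\<bar> \<partial>?K)"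
    have I: "I \<ge> 0" unfolding I_def by (rule integral_nonneg_AE) simp
    have "\<bar>\<integral>x. h x * f x \<partial>?K\<bar> \<le> 0 + e" if e: "e > 0" for e
    proof -
      have "e / (I + 1) > 0" using e I by simp
      then obtain P where P: "real_polynomial_function P" "\<And>x. x \<in> elem s \<Longrightarrow> \<bar>f x - P x\<bar> < e / (I + 1)"
        using Stone_Weierstrass_real_polynomial_function[OF K continuous_on_subset[OF f subset_UNIV]] by blast
      have ii: "integrable ?K (\<lambda>x. h x * f x)" "integrable ?K (\<lambda>x. h x * P x)"
        using integrable_mult_cont[OF K _ h] f C1_fun_cont[OF C1_fun_polynomial[OF P(1)]] by auto
      have "(\<integral>x. h x * f x \<partial>?K) = (\<integral>x. h x * f x - h x * P x \<partial>?K)"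
        using poly[OF C1_fun_polynomial[OF P(1)]] by (subst Bochner_Integration.integral_diff[OF ii]) simp
      also have "\<bar>\<dots>\<bar> \<le> (\<integral>x. \<bar>h x * f x - h x * P x\<bar> \<partial>?K)"
        using integral_norm_bound[of ?K "\<lambda>x. h x * f x - h x * P x"] by simp
      also have "\<dots> \<le> (\<integral>x. e / (I + 1) * \<bar>h x\<bar> \<partial>?K)"
      proof (rule integral_mono_AE)
        show "AE x in ?K. \<bar>h x * f x - h x * P x\<bar> \<le> e / (I + 1) * \<bar>h x\<bar>"
        proof (intro AE_I2)
          fix x assume "x \<in> space ?K"
          then have "\<bar>h x\<bar> * \<bar>f x - P x\<bar> \<le> \<bar>h x\<bar> * (e / (I + 1))"
            using P(2)[of x] by (intro mult_left_mono) auto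
          then show "\<bar>h x * f x - h x * P x\<bar> \<le> e / (I + 1) * \<bar>h x\<bar>"
            by (simp add: abs_mult[symmetric] right_diff_distrib mult.commute)
        qed
      qed (use ii ih in auto)
      also have "\<dots> = e / (I + 1) * I" by (simp add: I_def)
      also have "\<dots> \<le> e" using e I by (simp add: field_simps)
      finally show ?thesis by simp
    qed
    then have "\<bar>\<integral>x. h x * f x \<partial>?K\<bar> \<le> 0" by (rule field_le_epsilon)
    then show ?thesis by simp
  qed
  have "(\<lambda>x. sgn (h x)) measurable_on elem s"
    using h by (subst measurable_on_iff_borel_measurable) (auto simp: elem_lmeasurable[OF inv] fmeasurableD)
  then obtain N g where N: "negligible N" and g: "\<And>n. continuous_on UNIV (g n)"
    and lim: "\<And>x. x \<notin> N \<Longrightarrow> (\<lambda>n. g n x) \<longlonglongrightarrow> (if x \<in> elem s then sgn (h x) else 0)"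
    unfolding measurable_on_def by blast
  \<comment> \<open>Truncation to [-1,1] keeps the limit, because a sign lies in this interval, and
    provides \<bar>h\<bar> as dominating function.\<close>
  define G where "G n x = max (-1) (min 1 (g n x))" for n :: nat and x
  have G: "continuous_on UNIV (G n)" for n unfolding G_def[abs_def]
    by (intro continuous_on_max continuous_on_min g continuous_on_const)
  have "AE x in lebesgue. x \<notin> N" using N by (auto simp: negligible_iff_null_sets intro: AE_not_in)
  then have AEN: "AE x in ?K. x \<in> elem s \<and> x \<notin> N"
    by (subst AE_restrict_space_iff) (auto simp: elem_lmeasurable[OF inv] fmeasurableD)
  have "(\<lambda>n. \<integral>x. h x * G n x \<partial>?K) \<longlonglongrightarrow> (\<integral>x. \<bar>h x\<bar> \<partial>?K)"
  proof (rule integral_dominated_convergence[where w = "\<lambda>x. \<bar>h x\<bar>"])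
    show "AE x in ?K. (\<lambda>n. h x * G n x) \<longlonglongrightarrow> \<bar>h x\<bar>"
      using AEN
    proof eventually_elim
      case (elim x)
      have "(\<lambda>n. g n x) \<longlonglongrightarrow> sgn (h x)" using lim[of x] elim by simp
      then have "(\<lambda>n. h x * G n x) \<longlonglongrightarrow> h x * max (-1) (min 1 (sgn (h x)))"
        unfolding G_def by (intro tendsto_intros)
      also have "h x * max (-1) (min 1 (sgn (h x))) = \<bar>h x\<bar>"
        by (simp add: sgn_if abs_if)
      finally show ?case .
    qed
    show "AE x in ?K. norm (h x * G n x) \<le> \<bar>h x\<bar>" for n
    proof (intro AE_I2)
      fix x
      have "\<bar>G n x\<bar> \<le> 1" by (auto simp: G_def)
      then show "norm (h x * G n x) \<le> \<bar>h x\<bar>" by (simp add: abs_mult mult_left_le)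
    qed
    show "(\<lambda>x. h x * G n x) \<in> borel_measurable ?K" for n
      using integrable_mult_cont[OF K G h] by auto
  qed (use h in auto)
  moreover have "(\<integral>x. h x * G n x \<partial>?K) = 0" for n by (rule cont[OF G])
  ultimately have "(\<integral>x. \<bar>h x\<bar> \<partial>?K) = 0" by (simp add: LIMSEQ_const_iff)
  then have "AE x in ?K. \<bar>h x\<bar> = 0"
    by (subst (asm) integral_nonneg_eq_0_iff_AE) (use h in auto)
  then show ?thesis by simp
qed

end

section \<open>Strict positivity of flux integrals\<close>

lemma pos2_props: "0 \<le> pos2 t" "t \<le> 0 \<Longrightarrow> pos2 t = 0" "t \<le> 1 \<Longrightarrow> pos2 t \<le> 1" "0 < t \<Longrightarrow> 0 < pos2 t"
  by (auto simp: pos2_def max_def power_le_one)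

context
  fixes s :: "'n::finite vertices"
  assumes inv: "invertible (aff_matrix s)"
begin

text \<open>The coefficients \<open>bgrad s j c\<close> sum to zero, so c is the combination of the
  edges s j - s l with these coefficients, for any fixed l.\<close>

lemma integral_dd_edges:
  assumes G: "C1_fun G"
  shows "(\<integral>x. dd c G x \<partial>lebesgue_on (elem s))
    = (\<Sum>j\<in>UNIV. bgrad s j c * (\<integral>x. dd (s j - s l) G x \<partial>lebesgue_on (elem s)))"
proof -
  have "c = (\<Sum>j\<in>UNIV. bgrad s j c *\<^sub>R s j) - (\<Sum>j\<in>UNIV. bgrad s j c) *\<^sub>R s l"
    by (simp add: bgrad_point[OF inv] bgrad_sum[OF inv])
  then have c: "c = (\<Sum>j\<in>UNIV. bgrad s j c *\<^sub>R (s j - s l))"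
    by (simp add: scaleR_diff_right sum_subtractf scaleR_sum_left)
  have "dd c G x = (\<Sum>j\<in>UNIV. bgrad s j c * dd (s j - s l) G x)" for x
    by (subst c) (simp add: dd_sum_dir[OF G] dd_scale_dir[OF G])
  then show ?thesis
    using integrable_cont[OF elem_compact[OF inv] C1_fun_dd_cont[OF G]] by simp
qed

text \<open>The strict form of \<open>integral_dd_nonneg\<close>. The flux of G dominates that of a
  small bump concentrated around x0, and the flux integral of the bump can be computed as the volume
  integral of a nonnegative function.\<close>

lemma integral_dd_pos:
  assumes G: "C1_fun G" and sg: "\<And>j x. x \<in> facet s j \<Longrightarrow> bgrad s j c * G x \<le> 0"
    and x0: "x0 \<in> facet s i" "\<And>j. j \<noteq> i \<Longrightarrow> 0 < bary s j x0" and n0: "bgrad s i c * G x0 \<noteq> 0"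
  shows "0 < (\<integral>x. dd c G x \<partial>lebesgue_on (elem s))"
proof -
  let ?K = "lebesgue_on (elem s)"
  define \<kappa> where "\<kappa> = - bgrad s i c"
  have "bgrad s i c * G x0 < 0" using sg[OF x0(1)] n0 by (rule order.not_eq_order_implies_strict[rotated])
  then have pos0: "0 < \<kappa> * G x0" by (simp add: \<kappa>_def)
  \<comment> \<open>Half of the value at x0, so that continuity keeps the flux above m0 in a
    neighbourhood of x0.\<close>
  define m0 where "m0 = \<kappa> * G x0 / 2"
  have m0: "m0 > 0" using pos0 by (simp add: m0_def)
  obtain l where l: "l \<noteq> i" using exists_other[OF inv, of i] by blast
  have "isCont (\<lambda>x. \<kappa> * G x) x0"
    using C1_fun_cont[OF C1_fun_cmult[OF G], of UNIV \<kappa>] by (simp add: continuous_on_eq_continuous_at)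
  then obtain d where d: "d > 0" "\<And>x. dist x x0 < d \<Longrightarrow> dist (\<kappa> * G x) (\<kappa> * G x0) < m0"
    using m0 unfolding continuous_at_eps_delta by metis
  \<comment> \<open>If all barycentric coordinates of two points differ by at most (N + 1)
    \<epsilon>, their distance is at most (D - 1) \<epsilon>. The summand 1 makes D
    positive.\<close>
  define D where "D = real CARD('n option) * (\<Sum>j\<in>UNIV. norm (s j)) + 1"
  have D: "D > 0" unfolding D_def by (intro add_nonneg_pos mult_nonneg_nonneg sum_nonneg) auto
  \<comment> \<open>The bound by d/D/2 keeps the points of facet i where the bump is nonzero within
    distance d of x0. The bounds by the coordinates of x0 make the bump vanish on all other
    facets.\<close>
  define \<epsilon> where "\<epsilon> = Min (insert (min 1 (d / D / 2)) ((\<lambda>j. bary s j x0) ` (UNIV - {i})))"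
  have e0: "\<epsilon> > 0" unfolding \<epsilon>_def using x0(2) d(1) D by (subst Min_gr_iff) auto
  have e1: "\<epsilon> \<le> 1" "\<epsilon> \<le> d / D / 2" and e2: "\<And>j. j \<noteq> i \<Longrightarrow> \<epsilon> \<le> bary s j x0"
  proof -
    have "\<epsilon> \<le> min 1 (d / D / 2)" unfolding \<epsilon>_def by (rule Min_le) auto
    then show "\<epsilon> \<le> 1" "\<epsilon> \<le> d / D / 2" by auto
    show "\<epsilon> \<le> bary s j x0" if "j \<noteq> i" for j unfolding \<epsilon>_def by (rule Min_le) (use that in auto)
  qed
  \<comment> \<open>\<open>B\<close> is a bump that on the boundary lives near \<open>x0\<close> only: \<open>G - (m0 / \<kappa>) * B\<close> still satisfies \<open>sg\<close>,
      and the integral of \<open>dd c B\<close> reduces to a single edge direction.\<close>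
  define \<delta> where "\<delta> j = bary s j x0 - \<epsilon>" for j
  have \<delta>0: "\<delta> j \<ge> 0" if "j \<noteq> i" for j using e2[OF that] by (simp add: \<delta>_def)
  define f where "f j x = pos2 (bary s j x - \<delta> j)" for j x
  define B where "B x = (\<Prod>j\<in>UNIV - {i}. f j x)" for x
  have der: "((\<lambda>t. pos2 (t - a)) has_real_derivative 2 * max 0 (t - a)) (at t)" for a t
  proof -
    have "((\<lambda>t. t - a) has_real_derivative 1) (at t)" by (auto intro!: derivative_eq_intros)
    from DERIV_chain2[where f = pos2 and g = "\<lambda>t. t - a", OF pos2_deriv this] show ?thesis by simp
  qed
  have fC1: "C1_fun (f j)" for j
    unfolding f_def[abs_def] by (rule C1_fun_chain[OF bary_C1[OF inv] der]) (intro continuous_intros)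
  have ddf: "dd e (f j) x = 2 * max 0 (bary s j x - \<delta> j) * bgrad s j e" for e j x
    unfolding f_def[abs_def] by (subst dd_chain[OF bary_C1[OF inv] der]) (simp add: dd_bary[OF inv])
  have f0: "0 \<le> f j x" for j x by (simp add: f_def pos2_props)
  have BC1: "C1_fun B" unfolding B_def[abs_def] by (rule C1_fun_prod[OF fC1])
  have B0: "B x = 0" if "x \<in> facet s j" "j \<noteq> i" for j x
  proof -
    have "f j x = 0" using that \<delta>0 by (simp add: f_def facet_eq[OF inv] pos2_props)
    then show ?thesis unfolding B_def using that by (intro prod_zero finite_Diff finite bexI[of _ j]) auto
  qed
  have bary1: "bary s j x \<le> 1" if "x \<in> elem s" for j x
    using bary_sum[OF inv, of x] member_le_sum[of j UNIV "\<lambda>j. bary s j x"] that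
    by (simp add: mem_elem[OF inv])
  have B1: "0 \<le> B x" "x \<in> elem s \<Longrightarrow> B x \<le> 1" for x
  proof -
    show "0 \<le> B x" unfolding B_def by (intro prod_nonneg f0)
    assume "x \<in> elem s"
    then have "f j x \<le> 1" if "j \<noteq> i" for j
      using bary1[of x j] \<delta>0[OF that] unfolding f_def by (intro pos2_props(3)) linarith
    then show "B x \<le> 1" unfolding B_def by (intro prod_le_1) (auto simp: f0)
  qed
  have near: "\<kappa> * G x \<ge> m0 * B x" if x: "x \<in> facet s i" for x
  proof (cases "B x = 0")
    case True
    then show ?thesis using sg[OF x] by (simp add: \<kappa>_def)
  next
    case False
    have gt: "\<delta> j < bary s j x" if "j \<noteq> i" for j
    proof (rule ccontr)
      assume "\<not> \<delta> j < bary s j x"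
      then have "f j x = 0" by (simp add: f_def pos2_props)
      then show False using False that unfolding B_def by auto
    qed
    have xi: "x \<in> elem s" "bary s i x = 0" "bary s i x0 = 0" using x x0 by (auto simp: facet_eq[OF inv])
    have ge: "- \<epsilon> \<le> bary s j x - bary s j x0" for j
      using gt[of j] xi e0 by (cases "j = i") (auto simp: \<delta>_def)
    \<comment> \<open>The coordinates of both points have sum 1, so the lower bounds for all other
      coordinates give an upper bound for this one.\<close>
    have le: "bary s j x - bary s j x0 \<le> real CARD('n option) * \<epsilon>" for j
    proof -
      have "(\<Sum>k\<in>UNIV - {j}. - \<epsilon>) \<le> (\<Sum>k\<in>UNIV - {j}. bary s k x - bary s k x0)"
        by (rule sum_mono) (rule ge)
      moreover have "(\<Sum>k\<in>UNIV. bary s k x - bary s k x0) = 0"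
        by (simp add: sum_subtractf bary_sum[OF inv])
      moreover have "real (CARD('n option) - 1) * \<epsilon> \<le> real CARD('n option) * \<epsilon>"
        using e0 by (intro mult_right_mono) auto
      ultimately show ?thesis
        by (simp add: sum.remove[of UNIV j "\<lambda>k. bary s k x - bary s k x0"] card_Diff_singleton)
    qed
    have ab: "\<bar>bary s j x - bary s j x0\<bar> \<le> real CARD('n option) * \<epsilon>" for j
    proof -
      have "1 * \<epsilon> \<le> real CARD('n option) * \<epsilon>"
        using e0 zero_less_card_finite[where 'a = "'n option"] by (intro mult_right_mono) linarith+
      then show ?thesis using ge[of j] le[of j] by linarith
    qed
    have "x - x0 = (\<Sum>j\<in>UNIV. (bary s j x - bary s j x0) *\<^sub>R s j)"
      by (simp add: scaleR_diff_left sum_subtractf bary_point[OF inv])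
    then have "dist x x0 \<le> (\<Sum>j\<in>UNIV. \<bar>bary s j x - bary s j x0\<bar> * norm (s j))"
      unfolding dist_norm by (metis (no_types, lifting) norm_scaleR norm_sum sum.cong)
    also have "\<dots> \<le> (\<Sum>j\<in>UNIV. real CARD('n option) * \<epsilon> * norm (s j))"
      by (intro sum_mono mult_right_mono ab) auto
    also have "\<dots> = (D - 1) * \<epsilon>" by (simp add: D_def sum_distrib_left mult_ac)
    also have "\<dots> \<le> D * \<epsilon>" using e0 by (intro mult_right_mono) auto
    also have "\<dots> \<le> D * (d / D / 2)" using e1(2) D by (intro mult_left_mono) auto
    also have "\<dots> < d" using D d(1) by simp
    finally have "dist (\<kappa> * G x) (\<kappa> * G x0) < m0" by (rule d(2))
    then have "m0 \<le> \<kappa> * G x" by (auto simp: dist_real_def m0_def abs_if split: if_splits)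
    moreover have "m0 * B x \<le> m0 * 1" using m0 B1(2)[OF xi(1)] by (intro mult_left_mono) auto
    ultimately show ?thesis by linarith
  qed
  have k0: "\<kappa> \<noteq> 0" using n0 by (auto simp: \<kappa>_def)
  have GB: "C1_fun (\<lambda>x. (m0 / \<kappa>) * B x)" by (rule C1_fun_cmult[OF BC1])
  have "0 \<le> (\<integral>x. dd c (\<lambda>x. G x - (m0 / \<kappa>) * B x) x \<partial>?K)"
  proof (rule integral_dd_nonneg[OF inv C1_fun_diff[OF G GB]])
    fix j x assume x: "x \<in> facet s j"
    show "bgrad s j c * (G x - m0 / \<kappa> * B x) \<le> 0"
    proof (cases "j = i")
      case True
      have "bgrad s j c * (G x - m0 / \<kappa> * B x) = - (\<kappa> * G x - m0 * B x)"
        using k0 True by (simp add: \<kappa>_def field_simps)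
      then show ?thesis using near x True by simp
    next
      case False
      then show ?thesis using sg[OF x] B0[OF x] by simp
    qed
  qed
  also have "\<dots> = (\<integral>x. dd c G x \<partial>?K) - (m0 / \<kappa>) * (\<integral>x. dd c B x \<partial>?K)"
    unfolding dd_diff[OF G GB] dd_cmult[OF BC1]
    by (subst Bochner_Integration.integral_diff)
       (intro integrable_mult_right integrable_cont elem_compact[OF inv] C1_fun_dd_cont G BC1 | simp)+
  finally have 1: "(m0 / \<kappa>) * (\<integral>x. dd c B x \<partial>?K) \<le> (\<integral>x. dd c G x \<partial>?K)" by simp
  \<comment> \<open>For j and l both different from i the direction s j - s l is tangential to facet
    i, and on the other facets the bump is zero.\<close>
  have z: "(\<integral>x. dd (s j - s l) B x \<partial>?K) = 0" if "j \<noteq> i" for j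
  proof (rule integral_dd_zero[OF inv BC1])
    fix k x assume "x \<in> facet s k"
    then show "bgrad s k (s j - s l) * B x = 0"
      using B0[of x k] that l by (cases "k = i") (auto simp: bgrad_edge[OF inv])
  qed
  have "(\<integral>x. dd c B x \<partial>?K) = (\<Sum>j\<in>UNIV. bgrad s j c * (\<integral>x. dd (s j - s l) B x \<partial>?K))"
    by (rule integral_dd_edges[OF BC1])
  also have "\<dots> = (\<Sum>j\<in>UNIV. if j = i then - \<kappa> * (\<integral>x. dd (s i - s l) B x \<partial>?K) else 0)"
    using z by (intro sum.cong) (auto simp: \<kappa>_def)
  also have "\<dots> = - \<kappa> * (\<integral>x. dd (s i - s l) B x \<partial>?K)" by simp
  finally have 2: "(m0 / \<kappa>) * (\<integral>x. dd c B x \<partial>?K) = m0 * (- (\<integral>x. dd (s i - s l) B x \<partial>?K))"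
    using k0 by simp
  \<comment> \<open>In the direction s i - s l only the factor belonging to l varies, and it
    decreases at the rate of its own derivative.\<close>
  define R where "R x = 2 * max 0 (bary s l x - \<delta> l) * (\<Prod>k\<in>UNIV - {i} - {l}. f k x)" for x
  have "dd (s i - s l) B x = - R x" for x
  proof -
    have "dd (s i - s l) B x = (\<Sum>j\<in>UNIV - {i}. dd (s i - s l) (f j) x * (\<Prod>k\<in>UNIV - {i} - {j}. f k x))"
      unfolding B_def[abs_def] by (rule dd_prod[OF fC1])
    also have "\<dots> = (\<Sum>j\<in>UNIV - {i}. if j = l then - R x else 0)"
      by (intro sum.cong) (auto simp: ddf bgrad_edge[OF inv] R_def)
    also have "\<dots> = - R x" using l by simp
    finally show ?thesis .
  qed
  then have 3: "- (\<integral>x. dd (s i - s l) B x \<partial>?K) = (\<integral>x. R x \<partial>?K)" by simp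
  \<comment> \<open>A small step from x0 toward the opposite vertex enters the interior and keeps
    all coordinates except lambda_i above their thresholds, so R is positive there.\<close>
  define x1 where "x1 = x0 + (\<epsilon> / 2) *\<^sub>R (s i - x0)"
  have b1: "bary s j x1 = (1 - \<epsilon> / 2) * bary s j x0 + (\<epsilon> / 2) * (if i = j then 1 else 0)" for j
    unfolding x1_def bary_add[OF inv] linear_scale[OF bgrad_linear[OF inv]] bgrad_diff[OF inv] bary_vertex[OF inv]
    by (simp add: algebra_simps)
  have x0e: "x0 \<in> elem s" "bary s i x0 = 0" using x0(1) by (auto simp: facet_eq[OF inv])
  have b2: "\<delta> j < bary s j x1" if "j \<noteq> i" for j
  proof -
    have "\<epsilon> / 2 * bary s j x0 \<le> \<epsilon> / 2 * 1" using e0 bary1[OF x0e(1)] by (intro mult_left_mono) auto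
    then show ?thesis using e0 that by (simp add: b1 \<delta>_def algebra_simps)
  qed
  have "x1 \<in> interior (elem s)"
    unfolding interior_elem[OF inv]
  proof (intro CollectI allI)
    fix j show "0 < bary s j x1"
    proof (cases "j = i")
      case True
      then show ?thesis using e0 x0e by (simp add: b1)
    next
      case False
      then show ?thesis using b2[OF False] \<delta>0[OF False] by linarith
    qed
  qed
  moreover have "R x1 \<noteq> 0"
  proof -
    have "f k x1 > 0" if "k \<noteq> i" for k using b2[OF that] by (simp add: f_def pos2_props)
    then have "(\<Prod>k\<in>UNIV - {i} - {l}. f k x1) > 0" by (intro prod_pos) auto
    moreover have "0 < 2 * max 0 (bary s l x1 - \<delta> l)" using b2[OF l] by simp
    ultimately have "0 < R x1" unfolding R_def by (rule mult_pos_pos[rotated])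
    then show ?thesis by simp
  qed
  moreover have "continuous_on UNIV R" unfolding R_def[abs_def]
    by (intro continuous_intros continuous_on_prod C1_fun_cont[OF fC1] bary_cont[OF inv])
  moreover have "0 \<le> R x" for x unfolding R_def by (intro mult_nonneg_nonneg prod_nonneg f0) auto
  ultimately have "0 < (\<integral>x. R x \<partial>?K)"
    by (intro integral_pos_continuous[where x = x1, OF elem_compact[OF inv]]) blast+
  then have "0 < m0 * (- (\<integral>x. dd (s i - s l) B x \<partial>?K))" unfolding 3 using m0 by simp
  then show ?thesis using 1 2 by linarith
qed

end

section \<open>Finite-dimensional linear algebra for function spaces\<close>

text \<open>A linear space as a set of functions on an arbitrary type: the same notion covers spaces
  of functions on R^N and spaces of functionals, whose arguments are functions themselves.\<close>

definition lin_space :: "('x \<Rightarrow> real) set \<Rightarrow> bool" where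
  "lin_space S \<longleftrightarrow> (\<lambda>x. 0) \<in> S \<and> (\<forall>v\<in>S. \<forall>w\<in>S. (\<lambda>x. v x + w x) \<in> S) \<and> (\<forall>a. \<forall>v\<in>S. (\<lambda>x. a * v x) \<in> S)"

definition lin_on :: "('x \<Rightarrow> real) set \<Rightarrow> (('x \<Rightarrow> real) \<Rightarrow> real) \<Rightarrow> bool" where
  "lin_on S L \<longleftrightarrow> (\<forall>v\<in>S. \<forall>w\<in>S. L (\<lambda>x. v x + w x) = L v + L w) \<and> (\<forall>a. \<forall>v\<in>S. L (\<lambda>x. a * v x) = a * L v)"

lemma lin_spaceD:
  assumes "lin_space S"
  shows "(\<lambda>x. 0) \<in> S" "v \<in> S \<Longrightarrow> w \<in> S \<Longrightarrow> (\<lambda>x. v x + w x) \<in> S" "v \<in> S \<Longrightarrow> (\<lambda>x. a * v x) \<in> S"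
  using assms by (auto simp: lin_space_def)

lemma lin_onD:
  assumes "lin_on S L"
  shows "v \<in> S \<Longrightarrow> w \<in> S \<Longrightarrow> L (\<lambda>x. v x + w x) = L v + L w" "v \<in> S \<Longrightarrow> L (\<lambda>x. a * v x) = a * L v"
  using assms by (auto simp: lin_on_def)

lemma lin_space_diff: "lin_space S \<Longrightarrow> v \<in> S \<Longrightarrow> w \<in> S \<Longrightarrow> (\<lambda>x. v x - a * w x) \<in> S"
proof -
  assume S: "lin_space S" "v \<in> S" "w \<in> S"
  then have "(\<lambda>x. v x + (- a) * w x) \<in> S" by (intro lin_spaceD(2,3))
  then show ?thesis by simp
qed

lemma lin_on_diff:
  assumes "lin_space S" "lin_on S L" "v \<in> S" "w \<in> S"
  shows "L (\<lambda>x. v x - a * w x) = L v - a * L w"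
proof -
  have "L (\<lambda>x. v x + (- a) * w x) = L v + L (\<lambda>x. (- a) * w x)"
    by (rule lin_onD(1)[OF assms(2,3) lin_spaceD(3)[OF assms(1,4)]])
  also have "L (\<lambda>x. (- a) * w x) = (- a) * L w" by (rule lin_onD(2)[OF assms(2,4)])
  finally show ?thesis by simp
qed

lemma lin_space_sum:
  assumes "lin_space S" "\<And>b. b \<in> B \<Longrightarrow> f b \<in> S"
  shows "(\<lambda>x. \<Sum>b\<in>B. c b * f b x) \<in> S"
  using assms(2)
proof (induction B rule: infinite_finite_induct)
  case (insert b B)
  have "(\<lambda>x. (\<Sum>b\<in>B. c b * f b x) - (- c b) * f b x) \<in> S"
    by (rule lin_space_diff[OF assms(1)]) (use insert in auto)
  then show ?case using insert by (simp add: add.commute)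
qed (use assms(1) in \<open>auto simp: lin_space_def\<close>)

lemma lin_on_sum:
  assumes "lin_space S" "lin_on S L" "\<And>b. b \<in> B \<Longrightarrow> f b \<in> S"
  shows "L (\<lambda>x. \<Sum>b\<in>B. c b * f b x) = (\<Sum>b\<in>B. c b * L (f b))"
  using assms(3)
proof (induction B rule: infinite_finite_induct)
  have "L (\<lambda>x. 0 * 0) = 0 * L (\<lambda>x. 0)"
    by (rule lin_onD(2)[OF assms(2) lin_spaceD(1)[OF assms(1)]])
  then have z: "L (\<lambda>x. 0) = 0" by simp
  {
    case (infinite B)
    then show ?case using z by simp
  next
    case empty
    then show ?case using z by simp
  next
    case (insert b B)
    have m: "(\<lambda>x. \<Sum>b\<in>B. c b * f b x) \<in> S" by (rule lin_space_sum[OF assms(1)]) (use insert in auto)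
    have "L (\<lambda>x. (\<Sum>b\<in>B. c b * f b x) - (- c b) * f b x) = (\<Sum>b\<in>B. c b * L (f b)) - (- c b) * L (f b)"
      using insert by (subst lin_on_diff[OF assms(1,2) m]) auto
    then show ?case using insert by (simp add: add.commute)
  }
qed

text \<open>A vector e in the common kernel of the earlier functionals with \<open>F b e\<close>
  nonzero forces the coefficient of \<open>F b\<close> to be \<open>L e / F b e\<close>. If there is
  no such vector, \<open>F b\<close> vanishes on that kernel too and can be given the coefficient
  0.\<close>

lemma functional_combination:
  fixes F :: "'b \<Rightarrow> ('x \<Rightarrow> real) \<Rightarrow> real"
  assumes S: "lin_space S" and "finite B" and "\<And>b. b \<in> B \<Longrightarrow> lin_on S (F b)" and "lin_on S L"
    and "\<And>v. v \<in> S \<Longrightarrow> (\<And>b. b \<in> B \<Longrightarrow> F b v = 0) \<Longrightarrow> L v = 0"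
  shows "\<exists>c. \<forall>v\<in>S. L v = (\<Sum>b\<in>B. c b * F b v)"
  using assms(2-)
proof (induction B arbitrary: L rule: finite_induct)
  case (insert b B)
  show ?case
  proof (cases "\<exists>e\<in>S. (\<forall>a\<in>B. F a e = 0) \<and> F b e \<noteq> 0")
    case True
    then obtain e where e: "e \<in> S" "\<And>a. a \<in> B \<Longrightarrow> F a e = 0" "F b e \<noteq> 0" by blast
    define k where "k = L e / F b e"
    have linFb: "lin_on S (F b)" using insert by blast
    have "\<exists>c. \<forall>v\<in>S. L v - k * F b v = (\<Sum>b\<in>B. c b * F b v)"
    proof (rule insert.IH)
      show "lin_on S (\<lambda>v. L v - k * F b v)"
        using linFb insert.prems(2) unfolding lin_on_def by (auto simp: algebra_simps)
      fix v assume v: "v \<in> S" "\<And>a. a \<in> B \<Longrightarrow> F a v = 0"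
      define t where "t = F b v / F b e"
      have "L (\<lambda>x. v x - t * e x) = 0"
      proof (rule insert.prems(3))
        show "(\<lambda>x. v x - t * e x) \<in> S" by (rule lin_space_diff[OF S v(1) e(1)])
        fix a assume a: "a \<in> insert b B"
        have "F a (\<lambda>x. v x - t * e x) = F a v - t * F a e"
          by (rule lin_on_diff[OF S _ v(1) e(1)]) (use insert.prems(1) a in blast)
        then show "F a (\<lambda>x. v x - t * e x) = 0" using a v(2) e(2,3) by (auto simp: t_def)
      qed
      then have "L v - t * L e = 0" using lin_on_diff[OF S insert.prems(2) v(1) e(1)] by simp
      then show "L v - k * F b v = 0" using e(3) by (simp add: t_def k_def field_simps)
    qed (use insert.prems in auto)
    then obtain c where c: "\<And>v. v \<in> S \<Longrightarrow> L v - k * F b v = (\<Sum>b\<in>B. c b * F b v)" by blast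
    have "L v = (\<Sum>a\<in>insert b B. (c(b := k)) a * F a v)" if "v \<in> S" for v
    proof -
      have "(\<Sum>a\<in>B. (c(b := k)) a * F a v) = (\<Sum>a\<in>B. c a * F a v)"
        using insert.hyps(2) by (intro sum.cong) auto
      then show ?thesis using c[OF that] insert.hyps by simp
    qed
    then show ?thesis by blast
  next
    case False
    have "\<exists>c. \<forall>v\<in>S. L v = (\<Sum>b\<in>B. c b * F b v)"
    proof (rule insert.IH)
      fix v assume v: "v \<in> S" "\<And>b. b \<in> B \<Longrightarrow> F b v = 0"
      then have "F b v = 0" using False by blast
      then show "L v = 0" using v by (intro insert.prems(3)) auto
    qed (use insert.prems in auto)
    then obtain c where c: "\<And>v. v \<in> S \<Longrightarrow> L v = (\<Sum>b\<in>B. c b * F b v)" by blast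
    have "L v = (\<Sum>a\<in>insert b B. (c(b := 0)) a * F a v)" if "v \<in> S" for v
    proof -
      have "(\<Sum>a\<in>B. (c(b := 0)) a * F a v) = (\<Sum>a\<in>B. c a * F a v)"
        using insert.hyps(2) by (intro sum.cong) auto
      then show ?thesis using c[OF that] insert.hyps by simp
    qed
    then show ?thesis by blast
  qed
qed auto

definition spanned_by :: "('x \<Rightarrow> real) set \<Rightarrow> ('x \<Rightarrow> real) set \<Rightarrow> bool" where
  "spanned_by S B \<longleftrightarrow> finite B \<and> (\<forall>v\<in>S. \<exists>c. v = (\<lambda>x. \<Sum>b\<in>B. c b * b x))"

text \<open>The generators in B may lie outside S. One of them is removed at a time: the part
  \<open>S0\<close> of S that does without b has codimension at most one, and any element of S
  outside \<open>S0\<close> supplies the missing generator.\<close>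

lemma subspace_spanned:
  assumes "finite B" "lin_space S" "\<forall>v\<in>S. \<exists>c. v = (\<lambda>x. \<Sum>b\<in>B. c b * b x)"
  shows "\<exists>E. E \<subseteq> S \<and> spanned_by S E"
  using assms
proof (induction B arbitrary: S rule: finite_induct)
  case empty
  then show ?case by (intro exI[of _ "{}"]) (auto simp: spanned_by_def)
next
  case (insert b B)
  define S0 where "S0 = {v\<in>S. \<exists>c. v = (\<lambda>x. \<Sum>b\<in>B. c b * b x)}"
  have S0: "lin_space S0"
    unfolding lin_space_def
  proof (intro conjI ballI allI)
    show "(\<lambda>x. 0) \<in> S0" using insert.prems(1)
      by (auto simp: S0_def lin_space_def intro!: exI[of _ "\<lambda>_. 0"])
    fix v assume "v \<in> S0"
    then obtain c where v: "v \<in> S" "v = (\<lambda>x. \<Sum>b\<in>B. c b * b x)" by (auto simp: S0_def)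
    show "(\<lambda>x. a * v x) \<in> S0" for a
    proof -
      have "(\<lambda>x. a * v x) = (\<lambda>x. \<Sum>b\<in>B. (a * c b) * b x)"
        by (simp add: v(2) sum_distrib_left mult.assoc)
      then show ?thesis using lin_spaceD(3)[OF insert.prems(1) v(1), of a]
        unfolding S0_def by (intro CollectI conjI exI[of _ "\<lambda>b. a * c b"])
    qed
    fix w assume "w \<in> S0"
    then obtain d where w: "w \<in> S" "w = (\<lambda>x. \<Sum>b\<in>B. d b * b x)" by (auto simp: S0_def)
    have "(\<lambda>x. v x + w x) = (\<lambda>x. \<Sum>b\<in>B. (c b + d b) * b x)"
      by (simp add: v(2) w(2) sum.distrib distrib_right)
    then show "(\<lambda>x. v x + w x) \<in> S0" using lin_spaceD(2)[OF insert.prems(1) v(1) w(1)]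
      unfolding S0_def by (intro CollectI conjI exI[of _ "\<lambda>b. c b + d b"])
  qed
  have "\<exists>E. E \<subseteq> S0 \<and> spanned_by S0 E" by (rule insert.IH[OF S0]) (auto simp: S0_def)
  then obtain E where E: "E \<subseteq> S0" "spanned_by S0 E" by blast
  show ?case
  proof (cases "S = S0")
    case True
    then show ?thesis using E by blast
  next
    case False
    then obtain e where e: "e \<in> S" "e \<notin> S0" by (auto simp: S0_def)
    obtain c where c: "e = (\<lambda>x. \<Sum>b\<in>insert b B. c b * b x)" using insert.prems(2) e(1) by blast
    have cb: "c b \<noteq> 0"
    proof
      assume "c b = 0"
      then have "e = (\<lambda>x. \<Sum>b\<in>B. c b * b x)" using c insert.hyps by simp
      then show False using e by (auto simp: S0_def)
    qed
    have eE: "e \<notin> E" using e E by blast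
    have "\<exists>d. v = (\<lambda>x. \<Sum>b\<in>insert e E. d b * b x)" if v: "v \<in> S" for v
    proof -
      obtain d where d: "v = (\<lambda>x. \<Sum>b\<in>insert b B. d b * b x)" using insert.prems(2) v by blast
      define t where "t = d b / c b"
      have "(\<lambda>x. v x - t * e x) = (\<lambda>x. \<Sum>b\<in>B. (d b - t * c b) * b x)"
      proof
        fix x
        have "v x - t * e x = (d b - t * c b) * b x + (\<Sum>b\<in>B. (d b - t * c b) * b x)"
          using insert.hyps unfolding d c
          by (simp add: algebra_simps sum_subtractf sum_distrib_left)
        also have "d b - t * c b = 0" using cb by (simp add: t_def)
        finally show "v x - t * e x = (\<Sum>b\<in>B. (d b - t * c b) * b x)" by simp
      qed
      moreover have "(\<lambda>x. v x - t * e x) \<in> S" by (rule lin_space_diff[OF insert.prems(1) v e(1)])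
      ultimately have "(\<lambda>x. v x - t * e x) \<in> S0"
        unfolding S0_def by (intro CollectI conjI exI[of _ "\<lambda>b. d b - t * c b"])
      then obtain k where k: "(\<lambda>x. v x - t * e x) = (\<lambda>x. \<Sum>b\<in>E. k b * b x)"
        using E(2) by (auto simp: spanned_by_def)
      have "v x = (\<Sum>b\<in>insert e E. (k(e := t)) b * b x)" for x
      proof -
        have "(\<Sum>b\<in>E. (k(e := t)) b * b x) = (\<Sum>b\<in>E. k b * b x)"
          using eE by (intro sum.cong) auto
        then show ?thesis using fun_cong[OF k, of x] eE E(2) by (simp add: spanned_by_def)
      qed
      then show ?thesis by blast
    qed
    moreover have "finite (insert e E)" using E(2) by (simp add: spanned_by_def)
    moreover have "insert e E \<subseteq> S" using E(1) e(1) by (auto simp: S0_def)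
    ultimately show ?thesis unfolding spanned_by_def by blast
  qed
qed

text \<open>If all \<open>A v e\<close> with e in E vanish, then so does \<open>A v v\<close>, hence
  v is zero. So the functionals given by the generators have trivial common kernel, and
  \<open>functional_combination\<close> represents L by them.\<close>

lemma riesz_finite_dim:
  fixes A :: "('x \<Rightarrow> real) \<Rightarrow> ('x \<Rightarrow> real) \<Rightarrow> real"
  assumes S: "lin_space S" and E: "E \<subseteq> S" "spanned_by S E"
    and A1: "\<And>v. v \<in> S \<Longrightarrow> lin_on S (\<lambda>w. A w v)" and A2: "\<And>w. w \<in> S \<Longrightarrow> lin_on S (A w)"
    and def: "\<And>v. v \<in> S \<Longrightarrow> A v v = 0 \<Longrightarrow> v = (\<lambda>x. 0)" and L: "lin_on S L"
  shows "\<exists>v\<in>S. \<forall>w\<in>S. L w = A w v"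
proof -
  have fin: "finite E" using E by (simp add: spanned_by_def)
  have "\<exists>c. \<forall>v\<in>S. L v = (\<Sum>e\<in>E. c e * A v e)"
  proof (rule functional_combination[OF S fin _ L])
    show "lin_on S (\<lambda>v. A v e)" if "e \<in> E" for e using A1 E(1) that by blast
    fix v assume v: "v \<in> S" and z: "\<And>e. e \<in> E \<Longrightarrow> A v e = 0"
    obtain c where c: "v = (\<lambda>x. \<Sum>e\<in>E. c e * e x)" using E(2) v by (auto simp: spanned_by_def)
    have "A v (\<lambda>x. \<Sum>e\<in>E. c e * e x) = (\<Sum>e\<in>E. c e * A v e)"
      by (rule lin_on_sum[OF S A2[OF v]]) (use E(1) in blast)
    then have "A v v = 0" using c z by simp
    then have "v = (\<lambda>x. 0)" by (rule def[OF v])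
    moreover have "L (\<lambda>x. 0 * v x) = 0 * L v" by (rule lin_onD(2)[OF L v])
    ultimately show "L v = 0" by simp
  qed
  then obtain c where c: "\<And>v. v \<in> S \<Longrightarrow> L v = (\<Sum>e\<in>E. c e * A v e)" by blast
  have m: "(\<lambda>x. \<Sum>e\<in>E. c e * e x) \<in> S" by (rule lin_space_sum[OF S]) (use E(1) in blast)
  have "L w = A w (\<lambda>x. \<Sum>e\<in>E. c e * e x)" if w: "w \<in> S" for w
  proof -
    have "A w (\<lambda>x. \<Sum>e\<in>E. c e * e x) = (\<Sum>e\<in>E. c e * A w e)"
      by (rule lin_on_sum[OF S A2[OF w]]) (use E(1) in blast)
    then show ?thesis using c[OF w] by simp
  qed
  then show ?thesis using m by blast
qed

text \<open>The image of S under finitely many linear functionals is a subspace of a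
  finite-dimensional space and therefore closed. S itself carries no topology and may have infinite
  dimension.\<close>

lemma finite_dim_closed:
  fixes F :: "'b \<Rightarrow> ('x \<Rightarrow> real) \<Rightarrow> real"
  assumes S: "lin_space S" and "finite B" and "\<And>b. b \<in> B \<Longrightarrow> lin_on S (F b)"
    and "\<And>n. f n \<in> S" and "\<And>b. b \<in> B \<Longrightarrow> (\<lambda>n. F b (f n)) \<longlonglongrightarrow> l b"
  shows "\<exists>v\<in>S. \<forall>b\<in>B. F b v = l b"
  using assms(2-)
proof (induction B rule: finite_induct)
  case empty
  then show ?case using S by (auto simp: lin_space_def)
next
  case (insert a B)
  have "\<exists>v\<in>S. \<forall>b\<in>B. F b v = l b" by (rule insert.IH) (use insert.prems in auto)
  then obtain v where v: "v \<in> S" "\<And>b. b \<in> B \<Longrightarrow> F b v = l b" by blast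
  have La: "lin_on S (F a)" using insert.prems by blast
  show ?case
  proof (cases "\<exists>e\<in>S. (\<forall>b\<in>B. F b e = 0) \<and> F a e \<noteq> 0")
    case True
    then obtain e where e: "e \<in> S" "\<And>a. a \<in> B \<Longrightarrow> F a e = 0" "F a e \<noteq> 0" by blast
    define t where "t = (F a v - l a) / F a e"
    have "F b (\<lambda>x. v x - t * e x) = l b" if b: "b \<in> insert a B" for b
    proof -
      have "F b (\<lambda>x. v x - t * e x) = F b v - t * F b e"
        by (rule lin_on_diff[OF S _ v(1) e(1)]) (use insert.prems(1) b in blast)
      then show ?thesis using b v(2) e by (auto simp: t_def)
    qed
    then show ?thesis using lin_space_diff[OF S v(1) e(1)] by blast
  next
    case False
    have "\<exists>c. \<forall>v\<in>S. F a v = (\<Sum>b\<in>B. c b * F b v)"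
      by (rule functional_combination[OF S insert.hyps(1) _ La]) (use insert.prems False in auto)
    then obtain c where c: "\<And>v. v \<in> S \<Longrightarrow> F a v = (\<Sum>b\<in>B. c b * F b v)" by blast
    have "(\<lambda>n. \<Sum>b\<in>B. c b * F b (f n)) \<longlonglongrightarrow> (\<Sum>b\<in>B. c b * l b)"
      by (intro tendsto_intros insert.prems(3)) auto
    then have "(\<lambda>n. F a (f n)) \<longlonglongrightarrow> (\<Sum>b\<in>B. c b * l b)" using c insert.prems(2) by simp
    then have "l a = (\<Sum>b\<in>B. c b * l b)" using insert.prems(3)[of a] LIMSEQ_unique by blast
    then have "F a v = l a" using c[OF v(1)] v(2) by simp
    then show ?thesis using v by blast
  qed
qed

lemma bounded_family_subsequence:
  fixes f :: "nat \<Rightarrow> 'b \<Rightarrow> real"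
  assumes "finite B" "\<And>b. b \<in> B \<Longrightarrow> bounded (range (\<lambda>n. f n b))"
  shows "\<exists>r l. strict_mono r \<and> (\<forall>b\<in>B. (\<lambda>n. f (r n) b) \<longlonglongrightarrow> l b)"
  using assms
proof (induction B rule: finite_induct)
  case empty
  show ?case by (intro exI[of _ id]) (auto simp: strict_mono_def)
next
  case (insert a B)
  obtain r l where r: "strict_mono r" "\<And>b. b \<in> B \<Longrightarrow> (\<lambda>n. f (r n) b) \<longlonglongrightarrow> l b"
    using insert by auto
  have "bounded (range (\<lambda>n. f (r n) a))"
    by (rule bounded_subset[of "range (\<lambda>n. f n a)"]) (use insert.prems in auto)
  then obtain m r' where r': "strict_mono r'" "((\<lambda>n. f (r n) a) \<circ> r') \<longlonglongrightarrow> m"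
    using bounded_imp_convergent_subsequence by blast
  have "(\<lambda>n. f ((r \<circ> r') n) b) \<longlonglongrightarrow> (l(a := m)) b" if "b \<in> insert a B" for b
  proof (cases "b = a")
    case True
    then show ?thesis using r'(2) by (simp add: o_def)
  next
    case False
    then show ?thesis
      using LIMSEQ_subseq_LIMSEQ[OF r(2) r'(1), of b] that by (simp add: o_def)
  qed
  then show ?case using strict_mono_o[OF r(1) r'(1)] by blast
qed

section \<open>Weak derivatives on an element\<close>

text \<open>Rests on the completeness of Lebesgue measure. It supplies the measurability of
  \<open>d_beta\<close>, a chosen function known only up to null sets.\<close>

lemma borel_measurable_lebesgue_on_AE:
  fixes f g :: "real ^ 'n \<Rightarrow> real"
  assumes D: "D \<in> sets lebesgue" and f: "f \<in> borel_measurable (lebesgue_on D)"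
    and ae: "AE x in lebesgue_on D. f x = g x"
  shows "g \<in> borel_measurable (lebesgue_on D)"
proof -
  have "AE x in lebesgue. x \<in> D \<longrightarrow> f x = g x"
    using ae by (subst (asm) AE_restrict_space_iff) (use D in auto)
  then have "AE x in lebesgue. indicator D x *\<^sub>R f x = indicator D x *\<^sub>R g x"
    by eventually_elim (auto simp: indicator_def)
  moreover have "(\<lambda>x. indicator D x *\<^sub>R f x) \<in> borel_measurable lebesgue"
    using f by (subst (asm) borel_measurable_restrict_space_iff) (use D in auto)
  ultimately have "(\<lambda>x. indicator D x *\<^sub>R g x) \<in> borel_measurable lebesgue"
    by (rule borel_measurable_AE[rotated])
  then show ?thesis by (subst borel_measurable_restrict_space_iff) (use D in auto)
qed

text \<open>By completeness f and g are both measurable or both not; in the second case both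
  integrals are 0 by default.\<close>

lemma integral_lebesgue_on_cong_AE:
  fixes f g :: "real ^ 'n \<Rightarrow> real"
  assumes D: "D \<in> sets lebesgue" and ae: "AE x in lebesgue_on D. f x = g x"
  shows "(\<integral>x. f x \<partial>lebesgue_on D) = (\<integral>x. g x \<partial>lebesgue_on D)"
    and "integrable (lebesgue_on D) f \<longleftrightarrow> integrable (lebesgue_on D) g"
proof -
  have ae': "AE x in lebesgue_on D. g x = f x" using ae by eventually_elim simp
  have "(\<integral>x. f x \<partial>lebesgue_on D) = (\<integral>x. g x \<partial>lebesgue_on D) \<and>
    (integrable (lebesgue_on D) f \<longleftrightarrow> integrable (lebesgue_on D) g)"
  proof (cases "f \<in> borel_measurable (lebesgue_on D)")
    case True
    then have "g \<in> borel_measurable (lebesgue_on D)"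
      using borel_measurable_lebesgue_on_AE[OF D _ ae] by blast
    then show ?thesis using integral_cong_AE[OF True _ ae] integrable_cong_AE[OF True _ ae] by blast
  next
    case False
    then have "g \<notin> borel_measurable (lebesgue_on D)"
      using borel_measurable_lebesgue_on_AE[OF D _ ae'] by blast
    then have "\<not> integrable (lebesgue_on D) f" "\<not> integrable (lebesgue_on D) g" using False by auto
    then show ?thesis by (simp add: not_integrable_integral_eq)
  qed
  then show "(\<integral>x. f x \<partial>lebesgue_on D) = (\<integral>x. g x \<partial>lebesgue_on D)"
    "integrable (lebesgue_on D) f \<longleftrightarrow> integrable (lebesgue_on D) g" by auto
qed

lemma set_integrable_of_integrable_on:
  fixes f :: "real ^ 'n \<Rightarrow> real"
  assumes "integrable (lebesgue_on D) f" "D \<in> sets lebesgue" "C \<subseteq> D" "C \<in> sets lebesgue"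
  shows "set_integrable lebesgue C f"
proof -
  have "set_integrable lebesgue D f"
    using assms(1,2) by (simp add: set_integrable_def integrable_restrict_space)
  then show ?thesis by (rule set_integrable_subset) (use assms in auto)
qed

context
  fixes s :: "'n::finite vertices"
  assumes inv: "invertible (aff_matrix s)"
begin

lemma elem_sets: "elem s \<in> sets lebesgue"
  using elem_lmeasurable[OF inv] by (simp add: fmeasurableD)

text \<open>Weak derivatives are only locally integrable. Multiplication by a cutoff makes h
  integrable, and at an interior point some cutoff equals 1.\<close>

lemma weak_zero_local:
  assumes loc: "\<And>C. compact C \<Longrightarrow> C \<subseteq> interior (elem s) \<Longrightarrow> set_integrable lebesgue C h"
    and z: "\<And>\<phi>. C1_compact (interior (elem s)) \<phi> \<Longrightarrow> (\<integral>x. h x * \<phi> x \<partial>lebesgue_on (elem s)) = 0"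
  shows "AE x in lebesgue_on (elem s). h x = 0"
proof -
  let ?K = "lebesgue_on (elem s)"
  have "AE x in ?K. h x * cut s (real (Suc n)) x = 0" for n
  proof (rule weak_zero_imp_AE_zero[OF inv])
    let ?c = "cut s (real (Suc n))"
    define C where "C = closure {x. ?c x \<noteq> 0}"
    have C: "compact C" "C \<subseteq> interior (elem s)"
      using cut_compact[OF inv, of "real (Suc n)"] by (auto simp: C1_compact_def C_def)
    have out: "?c x = 0" if "x \<notin> C" for x using that closure_subset[of "{x. ?c x \<noteq> 0}"] by (auto simp: C_def)
    have "integrable lebesgue (\<lambda>x. indicator C x *\<^sub>R h x)" using loc[OF C] by (simp add: set_integrable_def)
    then have "integrable ?K (\<lambda>x. indicator C x *\<^sub>R h x)"
      by (rule integrable_restrict_space[THEN iffD2, rotated, OF integrable_mult_indicator[rotated]])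
         (use elem_sets in auto)
    then have "integrable ?K (\<lambda>x. (indicator C x *\<^sub>R h x) * ?c x)"
      by (rule integrable_mult_cont[OF elem_compact[OF inv] C1_fun_cont[OF cut_C1[OF inv]]])
    moreover have "(\<lambda>x. (indicator C x *\<^sub>R h x) * ?c x) = (\<lambda>x. h x * ?c x)"
      using out by (fastforce simp: indicator_def)
    ultimately show "integrable ?K (\<lambda>x. h x * ?c x)" by simp
    fix \<phi> assume \<phi>: "C1_compact (interior (elem s)) \<phi>"
    show "(\<integral>x. h x * ?c x * \<phi> x \<partial>?K) = 0"
      using z[OF C1_compact_mult[OF \<phi> cut_C1[OF inv]], of "real (Suc n)"] by (simp add: mult.assoc)
  qed
  then have "AE x in ?K. \<forall>n. h x * cut s (real (Suc n)) x = 0"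
    by (intro AE_all_countable[THEN iffD2] allI)
  with AE_interior[OF inv] show ?thesis
  proof eventually_elim
    case (elim x)
    have "\<forall>\<^sub>F n in sequentially. cut s (real (Suc n)) x = 1"
      using eventually_large_bary[OF inv elim(1)] by eventually_elim (simp only: cut_def step_one prod.neutral_const)
    then obtain n where "cut s (real (Suc n)) x = 1" using eventually_happens' sequentially_bot by blast
    then show ?case using elim(2) by (metis mult.right_neutral)
  qed
qed

context
  fixes \<beta> :: "real ^ 'n \<Rightarrow> real ^ 'n" and c :: "real ^ 'n"
  assumes bc: "\<forall>x\<in>interior (elem s). \<beta> x = c"
begin

lemma beta_elem_eq: "beta_elem \<beta> s = c"
  unfolding beta_elem_def using interior_elem_ne[OF inv] bc by (intro the_equality) auto

lemma weak_pair_imp_weak_deriv: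
  assumes w: "weak_pair c (elem s) v g"
  shows "weak_deriv \<beta> (elem s) v g"
  unfolding weak_deriv_def
proof (intro conjI allI impI)
  have i: "integrable (lebesgue_on (elem s)) v" "integrable (lebesgue_on (elem s)) g"
    using w by (auto simp: weak_pair_def)
  fix C assume "compact C \<and> C \<subseteq> interior (elem s)"
  then have C: "C \<in> sets lebesgue" "C \<subseteq> elem s" using interior_subset[of "elem s"]
    by (auto simp: lmeasurable_compact fmeasurableD)
  show "set_integrable lebesgue C v" "set_integrable lebesgue C g"
    using i C elem_sets by (auto intro: set_integrable_of_integrable_on)
next
  have i: "integrable (lebesgue_on (elem s)) v" "integrable (lebesgue_on (elem s)) g"
    using w by (auto simp: weak_pair_def)
  fix \<phi> assume \<phi>: "C1_compact (interior (elem s)) \<phi>"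
  then have C1: "C1_fun \<phi>" by (simp add: C1_compact_def)
  have eq: "dd (\<beta> x) \<phi> x = dd c \<phi> x" for x
    using bc C1_compact_outside(2)[OF \<phi>] by (cases "x \<in> interior (elem s)") auto
  have i2: "integrable (lebesgue_on (elem s)) (\<lambda>x. v x * dd c \<phi> x)" "integrable (lebesgue_on (elem s)) (\<lambda>x. g x * \<phi> x)"
    by (intro integrable_mult_cont elem_compact[OF inv] C1_fun_dd_cont C1_fun_cont C1 i)+
  have "(\<integral>x. v x * dd c \<phi> x + g x * \<phi> x \<partial>lebesgue_on (elem s)) = 0" using w \<phi> by (simp add: weak_pair_def)
  then show "(\<integral>x. v x * dd (\<beta> x) \<phi> x \<partial>lebesgue_on (elem s)) = - (\<integral>x. g x * \<phi> x \<partial>lebesgue_on (elem s))"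
    unfolding eq Bochner_Integration.integral_add[OF i2] by linarith
qed

lemma weak_deriv_imp_weak_pair:
  assumes w: "weak_deriv \<beta> (elem s) v g"
    and i: "integrable (lebesgue_on (elem s)) v" "integrable (lebesgue_on (elem s)) g"
  shows "weak_pair c (elem s) v g"
  unfolding weak_pair_def
proof (intro conjI allI impI i)
  fix \<phi> assume \<phi>: "C1_compact (interior (elem s)) \<phi>"
  then have C1: "C1_fun \<phi>" by (simp add: C1_compact_def)
  have eq: "dd (\<beta> x) \<phi> x = dd c \<phi> x" for x
    using bc C1_compact_outside(2)[OF \<phi>] by (cases "x \<in> interior (elem s)") auto
  have i2: "integrable (lebesgue_on (elem s)) (\<lambda>x. v x * dd c \<phi> x)" "integrable (lebesgue_on (elem s)) (\<lambda>x. g x * \<phi> x)"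
    by (intro integrable_mult_cont elem_compact[OF inv] C1_fun_dd_cont C1_fun_cont C1 i)+
  have "(\<integral>x. v x * dd (\<beta> x) \<phi> x \<partial>lebesgue_on (elem s)) = - (\<integral>x. g x * \<phi> x \<partial>lebesgue_on (elem s))"
    using w \<phi> by (simp add: weak_deriv_def)
  then show "(\<integral>x. v x * dd c \<phi> x + g x * \<phi> x \<partial>lebesgue_on (elem s)) = 0"
    unfolding eq Bochner_Integration.integral_add[OF i2] by linarith
qed

text \<open>Two weak derivatives of v differ by a locally integrable function that annihilates all
  test functions. So the choice in \<open>d_beta\<close> may be replaced by any convenient weak
  derivative.\<close>

lemma d_beta_AE:
  assumes w: "weak_pair c (elem s) v g"
  shows "AE x in lebesgue_on (elem s). d_beta \<beta> (elem s) v x = g x"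
proof -
  let ?K = "lebesgue_on (elem s)"
  have wd: "weak_deriv \<beta> (elem s) v g" by (rule weak_pair_imp_weak_deriv[OF w])
  have ws: "weak_deriv \<beta> (elem s) v (d_beta \<beta> (elem s) v)"
    unfolding d_beta_def by (rule someI[of "weak_deriv \<beta> (elem s) v", OF wd])
  have loc: "set_integrable lebesgue C g'" if "weak_deriv \<beta> (elem s) v g'" "compact C" "C \<subseteq> interior (elem s)" for C g'
    using that by (simp add: weak_deriv_def)
  have "AE x in ?K. d_beta \<beta> (elem s) v x - g x = 0"
  proof (rule weak_zero_local)
    show "set_integrable lebesgue C (\<lambda>x. d_beta \<beta> (elem s) v x - g x)" if "compact C" "C \<subseteq> interior (elem s)" for C
      by (rule set_integral_diff(1)[OF loc[OF ws that] loc[OF wd that]])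
    fix \<phi> assume \<phi>: "C1_compact (interior (elem s)) \<phi>"
    have C1: "C1_fun \<phi>" using \<phi> by (simp add: C1_compact_def)
    define C where "C = closure {x. \<phi> x \<noteq> 0}"
    have C: "compact C" "C \<subseteq> interior (elem s)" using \<phi> by (auto simp: C1_compact_def C_def)
    have out: "\<phi> x = 0" if "x \<notin> C" for x using that closure_subset[of "{x. \<phi> x \<noteq> 0}"] by (auto simp: C_def)
    have I: "integrable ?K (\<lambda>x. g' x * \<phi> x)" if "weak_deriv \<beta> (elem s) v g'" for g'
    proof -
      have "integrable lebesgue (\<lambda>x. indicator C x *\<^sub>R g' x)"
        using loc[OF that C] by (simp add: set_integrable_def)
      then have "integrable ?K (\<lambda>x. indicator C x *\<^sub>R g' x)"
        by (rule integrable_restrict_space[THEN iffD2, rotated, OF integrable_mult_indicator[rotated]])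
           (use elem_sets in auto)
      then have "integrable ?K (\<lambda>x. (indicator C x *\<^sub>R g' x) * \<phi> x)"
        by (rule integrable_mult_cont[OF elem_compact[OF inv] C1_fun_cont[OF C1]])
      moreover have "(\<lambda>x. (indicator C x *\<^sub>R g' x) * \<phi> x) = (\<lambda>x. g' x * \<phi> x)"
        using out by (fastforce simp: indicator_def)
      ultimately show ?thesis by simp
    qed
    have "(\<integral>x. d_beta \<beta> (elem s) v x * \<phi> x \<partial>?K) = (\<integral>x. g x * \<phi> x \<partial>?K)"
      using ws wd \<phi> by (simp add: weak_deriv_def)
    then show "(\<integral>x. (d_beta \<beta> (elem s) v x - g x) * \<phi> x \<partial>?K) = 0"
      unfolding left_diff_distrib using Bochner_Integration.integral_diff[OF I[OF ws] I[OF wd]] by simp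
  qed
  then show ?thesis by simp
qed

lemma d_beta_pair:
  assumes w: "weak_pair c (elem s) v g"
  shows "weak_pair c (elem s) v (d_beta \<beta> (elem s) v)"
proof (rule weak_pair_cong[OF w _ _ elem_compact[OF inv]])
  show ae: "AE x in lebesgue_on (elem s). g x = d_beta \<beta> (elem s) v x"
    using d_beta_AE[OF w] by eventually_elim simp
  show "v \<in> borel_measurable (lebesgue_on (elem s))" using w by (auto simp: weak_pair_def)
  show "d_beta \<beta> (elem s) v \<in> borel_measurable (lebesgue_on (elem s))"
    using w by (intro borel_measurable_lebesgue_on_AE[OF elem_sets _ ae]) (auto simp: weak_pair_def)
qed auto

lemma L2_ip_dbeta:
  assumes "weak_pair c (elem s) v g"
  shows "L2_ip (elem s) w (d_beta \<beta> (elem s) v) = L2_ip (elem s) w g"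
    "L2_ip (elem s) (d_beta \<beta> (elem s) v) w = L2_ip (elem s) g w"
  unfolding L2_ip_def
  by (rule integral_lebesgue_on_cong_AE(1)[OF elem_sets], use d_beta_AE[OF assms] in eventually_elim, simp)+

lemma D_elem_pair:
  assumes "weak_pair c (elem s) w gw" "weak_pair c (elem s) v gv"
  shows "D_elem \<beta> s w v = L2_ip (elem s) gw v + L2_ip (elem s) w gv"
  unfolding D_elem_def using L2_ip_dbeta[OF assms(1)] L2_ip_dbeta[OF assms(2)] by simp

lemma D_elem_C1:
  assumes w: "C1_fun w" and v: "weak_pair c (elem s) v g"
  shows "D_elem \<beta> s w v = (\<integral>x. v x * dd c w x + g x * w x \<partial>lebesgue_on (elem s))"
proof -
  have i: "integrable (lebesgue_on (elem s)) v" "integrable (lebesgue_on (elem s)) g"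
    using v by (auto simp: weak_pair_def)
  have i2: "integrable (lebesgue_on (elem s)) (\<lambda>x. v x * dd c w x)" "integrable (lebesgue_on (elem s)) (\<lambda>x. g x * w x)"
    by (intro integrable_mult_cont elem_compact[OF inv] C1_fun_dd_cont C1_fun_cont w i)+
  show ?thesis
    unfolding D_elem_pair[OF weak_pair_C1[OF elem_compact[OF inv] w] v] L2_ip_def
      Bochner_Integration.integral_add[OF i2] by (simp add: mult.commute)
qed

lemma D_elem_C1_C1:
  assumes w: "C1_fun w" and v: "C1_fun v"
  shows "D_elem \<beta> s w v = (\<integral>x. dd c (\<lambda>x. w x * v x) x \<partial>lebesgue_on (elem s))"
  unfolding D_elem_C1[OF w weak_pair_C1[OF elem_compact[OF inv] v]] dd_mult[OF w v] by (simp add: algebra_simps)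

text \<open>The reason why projection conditions against the orthogonal complement of the bubbles
  already control all of P_k.\<close>

lemma D_elem_zero_frontier:
  assumes w: "C1_fun w" "\<And>x. x \<in> frontier (elem s) \<Longrightarrow> w x = 0" and v: "weak_pair c (elem s) v g"
  shows "D_elem \<beta> s w v = 0"
  unfolding D_elem_C1[OF w(1) v] by (rule green_zero_frontier[OF inv v w])

end

end

section \<open>Polynomials of bounded degree\<close>

definition mono_fun :: "('n::finite \<Rightarrow> nat) \<Rightarrow> real ^ 'n \<Rightarrow> real" where
  "mono_fun \<alpha> x = (\<Prod>i\<in>UNIV. (x $ i) ^ \<alpha> i)"

definition mono_idx :: "int \<Rightarrow> ('n::finite \<Rightarrow> nat) set" where
  "mono_idx j = {\<alpha>. int (\<Sum>i\<in>UNIV. \<alpha> i) \<le> j}"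

lemma finite_mono_idx: "finite (mono_idx j :: ('n::finite \<Rightarrow> nat) set)"
proof (rule finite_subset)
  show "(mono_idx j :: ('n \<Rightarrow> nat) set) \<subseteq> PiE UNIV (\<lambda>_. {..nat j})"
  proof
    fix \<alpha> :: "'n \<Rightarrow> nat" assume a: "\<alpha> \<in> mono_idx j"
    have "\<alpha> i \<le> nat j" for i
    proof -
      have 1: "\<alpha> i \<le> (\<Sum>i\<in>UNIV. \<alpha> i)" by (rule member_le_sum) auto
      have "int (\<Sum>i\<in>UNIV. \<alpha> i) \<le> j" using a unfolding mono_idx_def by (rule CollectD)
      with 1 show ?thesis by linarith
    qed
    then show "\<alpha> \<in> PiE UNIV (\<lambda>_. {..nat j})" by auto
  qed
  show "finite (PiE UNIV (\<lambda>_ :: 'n. {..nat j}))" by (intro finite_PiE) auto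
qed

lemma Poly_iff: "p \<in> Poly j \<longleftrightarrow> (\<exists>c. p = (\<lambda>x. \<Sum>\<alpha>\<in>mono_idx j. c \<alpha> * mono_fun \<alpha> x))"
  unfolding Poly_def mono_idx_def mono_fun_def by (simp add: fun_eq_iff)

lemma Poly_lin: "lin_space (Poly j)"
  unfolding lin_space_def
proof (intro conjI ballI allI)
  show "(\<lambda>x. 0) \<in> Poly j" unfolding Poly_iff by (rule exI[of _ "\<lambda>_. 0"]) simp
  fix v :: "real ^ 'a \<Rightarrow> real" assume "v \<in> Poly j"
  then obtain c where c: "v = (\<lambda>x. \<Sum>\<alpha>\<in>mono_idx j. c \<alpha> * mono_fun \<alpha> x)" unfolding Poly_iff by blast
  show "(\<lambda>x. a * v x) \<in> Poly j" for a unfolding Poly_iff c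
    by (rule exI[of _ "\<lambda>\<alpha>. a * c \<alpha>"]) (simp add: sum_distrib_left mult.assoc)
  fix w :: "real ^ 'a \<Rightarrow> real" assume "w \<in> Poly j"
  then obtain d where d: "w = (\<lambda>x. \<Sum>\<alpha>\<in>mono_idx j. d \<alpha> * mono_fun \<alpha> x)" unfolding Poly_iff by blast
  show "(\<lambda>x. v x + w x) \<in> Poly j" unfolding Poly_iff c d
    by (rule exI[of _ "\<lambda>\<alpha>. c \<alpha> + d \<alpha>"]) (simp add: sum.distrib distrib_right)
qed

lemma mono_in_Poly: "\<alpha> \<in> mono_idx j \<Longrightarrow> mono_fun \<alpha> \<in> Poly j"
  unfolding Poly_iff
  by (intro exI[of _ "\<lambda>\<gamma>. if \<gamma> = \<alpha> then 1 else 0"] ext)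
     (simp add: if_distrib[of "\<lambda>a. a * _"] finite_mono_idx cong: if_cong)

lemma Poly_mono: "p \<in> Poly i \<Longrightarrow> i \<le> j \<Longrightarrow> p \<in> Poly j"
proof -
  assume "p \<in> Poly i" and ij: "i \<le> j"
  then obtain c where c: "p = (\<lambda>x. \<Sum>\<alpha>\<in>mono_idx i. c \<alpha> * mono_fun \<alpha> x)" unfolding Poly_iff by blast
  show "p \<in> Poly j" unfolding c
    by (rule lin_space_sum[OF Poly_lin]) (use ij in \<open>auto intro!: mono_in_Poly simp: mono_idx_def\<close>)
qed

lemma Poly_const: "0 \<le> j \<Longrightarrow> (\<lambda>x. a) \<in> Poly j"
  using lin_spaceD(3)[OF Poly_lin mono_in_Poly[of "\<lambda>_. 0" j], of a]
  by (simp add: mono_fun_def mono_idx_def)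

lemma Poly_spanned:
  assumes "lin_space S" "S \<subseteq> Poly j"
  shows "\<exists>E. E \<subseteq> S \<and> spanned_by S E"
proof (rule subspace_spanned[of "mono_fun ` mono_idx j"])
  show "\<forall>v\<in>S. \<exists>c. v = (\<lambda>x. \<Sum>b\<in>mono_fun ` mono_idx j. c b * b x)"
  proof
    fix v assume "v \<in> S"
    then obtain c where c: "v = (\<lambda>x. \<Sum>\<alpha>\<in>mono_idx j. c \<alpha> * mono_fun \<alpha> x)"
      using assms(2) unfolding Poly_iff[symmetric] by (metis Poly_iff subsetD)
    \<comment> \<open>\<open>spanned_by\<close> indexes coefficients by functions, so the
      coefficients of all multi-indices with the same monomial are collected; injectivity of
      \<open>mono_fun\<close> is thereby avoided.\<close>
    define d where "d b = (\<Sum>\<alpha>\<in>{\<alpha>\<in>mono_idx j. mono_fun \<alpha> = b}. c \<alpha>)" for b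
    have "v x = (\<Sum>b\<in>mono_fun ` mono_idx j. d b * b x)" for x
    proof -
      have "v x = (\<Sum>b\<in>mono_fun ` mono_idx j. \<Sum>\<alpha>\<in>{\<alpha>\<in>mono_idx j. mono_fun \<alpha> = b}. c \<alpha> * mono_fun \<alpha> x)"
        unfolding c by (rule sum.image_gen[OF finite_mono_idx])
      also have "\<dots> = (\<Sum>b\<in>mono_fun ` mono_idx j. d b * b x)"
        unfolding d_def sum_distrib_right by (intro sum.cong refl) auto
      finally show ?thesis .
    qed
    then show "\<exists>c. v = (\<lambda>x. \<Sum>b\<in>mono_fun ` mono_idx j. c b * b x)" by blast
  qed
qed (use assms finite_mono_idx in auto)

lemma component_polynomial: "real_polynomial_function (\<lambda>x :: real ^ 'n. x $ i)"
  by (rule real_polynomial_function.intros(1)) (rule bounded_linear_vec_nth)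

lemma mono_polynomial: "real_polynomial_function (mono_fun \<alpha>)"
  unfolding mono_fun_def[abs_def]
  by (intro real_polynomial_function_prod real_polynomial_function_power component_polynomial) simp

lemma Poly_polynomial: "p \<in> Poly j \<Longrightarrow> real_polynomial_function p"
  unfolding Poly_iff
  by (auto intro!: real_polynomial_function_sum real_polynomial_function.intros(4)[OF real_polynomial_function.intros(2)]
      mono_polynomial finite_mono_idx)

lemma Poly_C1: "p \<in> Poly j \<Longrightarrow> C1_fun p"
  by (rule C1_fun_polynomial[OF Poly_polynomial])

lemma dd_mono:
  fixes \<alpha> :: "'n::finite \<Rightarrow> nat"
  assumes "\<alpha> \<in> mono_idx j"
  shows "(\<lambda>x. dd c (mono_fun \<alpha>) x) \<in> Poly (j - 1)"
proof -
  have comp: "C1_fun (\<lambda>x :: real ^ 'n. x $ i)" for i by (rule C1_fun_polynomial[OF component_polynomial])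
  have ddc: "dd c (\<lambda>x :: real ^ 'n. x $ i) x = c $ i" for i x
    by (rule dd_eq) (rule bounded_linear_imp_has_derivative[OF bounded_linear_vec_nth])
  have der: "((\<lambda>t :: real. t ^ m) has_real_derivative real m * t ^ (m - 1)) (at t)" for m t
    by (auto intro!: derivative_eq_intros)
  have pC1: "C1_fun (\<lambda>x :: real ^ 'n. (x $ i) ^ \<alpha> i)" for i
    by (rule C1_fun_polynomial[OF real_polynomial_function_power[OF component_polynomial]])
  have ddp: "dd c (\<lambda>x :: real ^ 'n. (x $ i) ^ \<alpha> i) x = real (\<alpha> i) * (x $ i) ^ (\<alpha> i - 1) * c $ i" for i x
    by (subst dd_chain[OF comp der]) (simp add: ddc)
  have eq: "dd c (mono_fun \<alpha>) x = (\<Sum>i\<in>UNIV. (real (\<alpha> i) * c $ i) * mono_fun (\<alpha>(i := \<alpha> i - 1)) x)" for x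
  proof -
    have e: "mono_fun (\<alpha>(i := \<alpha> i - 1)) x = (x $ i) ^ (\<alpha> i - 1) * (\<Prod>k\<in>UNIV - {i}. (x $ k) ^ \<alpha> k)" for i
    proof -
      have "(\<Prod>k\<in>UNIV - {i}. (x $ k) ^ (\<alpha>(i := \<alpha> i - 1)) k) = (\<Prod>k\<in>UNIV - {i}. (x $ k) ^ \<alpha> k)"
        by (rule prod.cong) auto
      then show ?thesis unfolding mono_fun_def by (subst prod.remove[of UNIV i]) auto
    qed
    have "dd c (mono_fun \<alpha>) x = (\<Sum>i\<in>UNIV. dd c (\<lambda>x. (x $ i) ^ \<alpha> i) x * (\<Prod>k\<in>UNIV - {i}. (x $ k) ^ \<alpha> k))"
      unfolding mono_fun_def[abs_def] by (rule dd_prod[OF pC1])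
    also have "\<dots> = (\<Sum>i\<in>UNIV. (real (\<alpha> i) * c $ i) * mono_fun (\<alpha>(i := \<alpha> i - 1)) x)"
      unfolding ddp e by (intro sum.cong refl) (simp only: mult_ac)
    finally show ?thesis .
  qed
  have "(\<lambda>x. \<Sum>i\<in>UNIV. 1 * ((real (\<alpha> i) * c $ i) * mono_fun (\<alpha>(i := \<alpha> i - 1)) x)) \<in> Poly (j - 1)"
  proof (rule lin_space_sum[OF Poly_lin])
    fix i
    show "(\<lambda>x. (real (\<alpha> i) * c $ i) * mono_fun (\<alpha>(i := \<alpha> i - 1)) x) \<in> Poly (j - 1)"
    proof (cases "\<alpha> i = 0")
      \<comment> \<open>The exponent \<open>\<alpha> i - 1\<close> is truncated to 0 here, but its
        coefficient is 0 as well.\<close>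
      case True
      then show ?thesis using lin_spaceD(1)[OF Poly_lin] by simp
    next
      case False
      have "(\<Sum>k\<in>UNIV. (\<alpha>(i := \<alpha> i - 1)) k) + 1 = (\<Sum>k\<in>UNIV. \<alpha> k)"
        using False by (simp add: sum.remove[of UNIV i])
      moreover have "int (\<Sum>k\<in>UNIV. \<alpha> k) \<le> j" using assms unfolding mono_idx_def by (rule CollectD)
      ultimately have "int (\<Sum>k\<in>UNIV. (\<alpha>(i := \<alpha> i - 1)) k) \<le> j - 1" by linarith
      then have "\<alpha>(i := \<alpha> i - 1) \<in> mono_idx (j - 1)" by (simp only: mono_idx_def mem_Collect_eq)
      then show ?thesis by (intro lin_spaceD(3)[OF Poly_lin] mono_in_Poly)
    qed
  qed
  then show ?thesis by (simp add: eq)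
qed

lemma dd_Poly: "p \<in> Poly j \<Longrightarrow> (\<lambda>x. dd c p x) \<in> Poly (j - 1)"
proof -
  assume "p \<in> Poly j"
  then obtain k where k: "p = (\<lambda>x. \<Sum>\<alpha>\<in>mono_idx j. k \<alpha> * mono_fun \<alpha> x)" unfolding Poly_iff by blast
  have C: "C1_fun (mono_fun \<alpha>)" for \<alpha> :: "'a \<Rightarrow> nat" by (rule C1_fun_polynomial[OF mono_polynomial])
  have "dd c p x = (\<Sum>\<alpha>\<in>mono_idx j. k \<alpha> * dd c (mono_fun \<alpha>) x)" for x
    unfolding k by (simp add: dd_sum C1_fun_cmult C dd_cmult)
  then show ?thesis using lin_space_sum[OF Poly_lin dd_mono] by simp
qed

text \<open>For the lowest order case: an affine function with zero values at all vertices is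
  zero.\<close>

lemma Poly_affine:
  fixes l :: "'b::finite \<Rightarrow> real" and y :: "'b \<Rightarrow> real ^ 'n"
  assumes p: "p \<in> Poly 1" and l: "(\<Sum>j\<in>UNIV. l j) = 1"
  shows "p (\<Sum>j\<in>UNIV. l j *\<^sub>R y j) = (\<Sum>j\<in>UNIV. l j * p (y j))"
proof -
  obtain k where k: "p = (\<lambda>x. \<Sum>\<alpha>\<in>mono_idx 1. k \<alpha> * mono_fun \<alpha> x)" using p unfolding Poly_iff by blast
  have m: "mono_fun \<alpha> (\<Sum>j\<in>UNIV. l j *\<^sub>R y j) = (\<Sum>j\<in>UNIV. l j * mono_fun \<alpha> (y j))" if a: "\<alpha> \<in> mono_idx 1" for \<alpha>
  proof (cases "\<exists>i. \<alpha> i \<noteq> 0")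
    case False
    then show ?thesis using l by (simp add: mono_fun_def)
  next
    case True
    then obtain i where i: "\<alpha> i \<noteq> 0" by blast
    have "(\<Sum>k\<in>UNIV. \<alpha> k) = \<alpha> i + (\<Sum>k\<in>UNIV - {i}. \<alpha> k)" by (simp add: sum.remove[of UNIV i])
    moreover have "int (\<Sum>k\<in>UNIV. \<alpha> k) \<le> 1" using a unfolding mono_idx_def by (rule CollectD)
    ultimately have ai: "\<alpha> i = 1" and "(\<Sum>k\<in>UNIV - {i}. \<alpha> k) = 0" using i by linarith+
    then have ak: "\<alpha> k = 0" if "k \<noteq> i" for k using that by simp
    have "mono_fun \<alpha> x = x $ i" for x
      unfolding mono_fun_def by (subst prod.remove[of UNIV i]) (auto simp: ai ak)
    then show ?thesis by (simp add: sum_component)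
  qed
  have "p (\<Sum>j\<in>UNIV. l j *\<^sub>R y j) = (\<Sum>\<alpha>\<in>mono_idx 1. \<Sum>j\<in>UNIV. l j * (k \<alpha> * mono_fun \<alpha> (y j)))"
    unfolding k by (intro sum.cong refl) (simp add: m sum_distrib_left mult_ac)
  also have "\<dots> = (\<Sum>j\<in>UNIV. l j * p (y j))"
    unfolding k by (subst sum.swap) (simp add: sum_distrib_left)
  finally show ?thesis .
qed

section \<open>The local projection\<close>

lemma lin_on_integral:
  assumes "\<And>v. v \<in> S \<Longrightarrow> integrable M (F v)"
    and "\<And>v w x. v \<in> S \<Longrightarrow> w \<in> S \<Longrightarrow> F (\<lambda>x. v x + w x) x = F v x + F w x"
    and "\<And>v a x. v \<in> S \<Longrightarrow> F (\<lambda>x. a * v x) x = a * F v x"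
  shows "lin_on S (\<lambda>v. \<integral>x. F v x \<partial>M)"
  unfolding lin_on_def
proof (intro conjI ballI allI)
  fix v assume v: "v \<in> S"
  show "(\<integral>x. F (\<lambda>x. a * v x) x \<partial>M) = a * (\<integral>x. F v x \<partial>M)" for a
    unfolding assms(3)[OF v] by simp
  fix w assume w: "w \<in> S"
  show "(\<integral>x. F (\<lambda>x. v x + w x) x \<partial>M) = (\<integral>x. F v x \<partial>M) + (\<integral>x. F w x \<partial>M)"
    unfolding assms(2)[OF v w] by (rule Bochner_Integration.integral_add[OF assms(1)[OF v] assms(1)[OF w]])
qed

context
  fixes s :: "'n::finite vertices"
  assumes inv: "invertible (aff_matrix s)"
begin

lemma frontier_facets: "frontier (elem s) = (\<Union>i. facet s i)"
  by (auto simp: frontier_elem[OF inv] facet_eq[OF inv])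

lemma bubble_polynomial: "real_polynomial_function (bubble s)"
  unfolding bubble_def[abs_def] by (intro real_polynomial_function_prod bary_polynomial[OF inv]) simp

lemma bubble_frontier: "x \<in> frontier (elem s) \<Longrightarrow> bubble s x = 0"
  unfolding bubble_def frontier_elem[OF inv] by (auto intro!: prod_zero)

lemma bubble_pos: "x \<in> interior (elem s) \<Longrightarrow> 0 < bubble s x"
  unfolding bubble_def interior_elem[OF inv] by (auto intro!: prod_pos)

lemma bubble_nonneg: "x \<in> elem s \<Longrightarrow> 0 \<le> bubble s x"
  unfolding bubble_def mem_elem[OF inv] by (auto intro!: prod_nonneg)

text \<open>A nonnegative continuous integrand with integral zero vanishes in the interior, and a
  polynomial that is zero there is zero. The weight is 1 or \<open>bubble s\<close>.\<close>

lemma polynomial_zero_if_weighted_zero: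
  assumes r: "real_polynomial_function r" and b: "real_polynomial_function b"
    and n: "\<And>x. x \<in> elem s \<Longrightarrow> 0 \<le> b x" and p: "\<And>x. x \<in> interior (elem s) \<Longrightarrow> 0 < b x"
    and z: "(\<integral>x. r x * (b x * r x) \<partial>lebesgue_on (elem s)) = 0"
  shows "r = (\<lambda>x. 0)"
proof
  fix y
  show "r y = 0"
  proof (rule polynomial_zero_on_open[OF r open_interior interior_elem_ne[OF inv]], rule ccontr)
    fix x assume x: "x \<in> interior (elem s)" "r x \<noteq> 0"
    have "0 < (\<integral>x. r x * (b x * r x) \<partial>lebesgue_on (elem s))"
    proof (rule integral_pos_continuous[OF elem_compact[OF inv] _ _ x(1)])
      show "continuous_on UNIV (\<lambda>x. r x * (b x * r x))"
        by (intro continuous_on_mult C1_fun_cont C1_fun_polynomial r b)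
      show "0 \<le> r x * (b x * r x)" if "x \<in> elem s" for x
        using mult_nonneg_nonneg[OF n[OF that] zero_le_square[of "r x"]] by (simp add: mult_ac)
      show "r x * (b x * r x) \<noteq> 0" using x p[OF x(1)] by simp
    qed
    then show False using z by simp
  qed
qed

lemma polynomial_zero_if_norm_zero:
  assumes "real_polynomial_function r" "L2_ip (elem s) r r = 0"
  shows "r = (\<lambda>x. 0)"
  by (rule polynomial_zero_if_weighted_zero[OF assms(1) real_polynomial_function.intros(2)[of 1]])
     (use assms(2) in \<open>auto simp: L2_ip_def\<close>)

lemma bubble_space_lin: "lin_space (Poly_bubble j s)"
  unfolding lin_space_def Poly_bubble_def using lin_spaceD[OF Poly_lin] by auto

lemma L2_integrable:
  assumes "C1_fun f" "C1_fun g"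
  shows "integrable (lebesgue_on (elem s)) (\<lambda>x. f x * g x)"
  by (intro integrable_cont elem_compact[OF inv] continuous_on_mult C1_fun_cont assms)

lemma L2_lin_left:
  assumes "\<And>v. v \<in> S \<Longrightarrow> C1_fun v" "integrable (lebesgue_on (elem s)) g"
  shows "lin_on S (\<lambda>w. L2_ip (elem s) w g)"
  unfolding L2_ip_def
  by (rule lin_on_integral)
     (use integrable_mult_cont[OF elem_compact[OF inv] C1_fun_cont[OF assms(1)] assms(2)] in \<open>auto simp: algebra_simps\<close>)

lemma L2_commute: "L2_ip K f g = L2_ip K g f"
  by (simp add: L2_ip_def mult.commute)

lemma perp_space_lin: "lin_space (Poly_perp j s)"
  unfolding lin_space_def
proof (intro conjI ballI allI)
  have L: "lin_on (Poly j) (\<lambda>w. L2_ip (elem s) w y)" if "y \<in> Poly_bubble j s" for y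
    using that by (intro L2_lin_left integrable_cont elem_compact[OF inv] C1_fun_cont) (auto simp: Poly_bubble_def intro: Poly_C1)
  show "(\<lambda>x. 0) \<in> Poly_perp j s" using lin_spaceD(1)[OF Poly_lin] by (simp add: Poly_perp_def L2_ip_def)
  fix v assume v: "v \<in> Poly_perp j s"
  then have v': "v \<in> Poly j" by (simp add: Poly_perp_def)
  show "(\<lambda>x. a * v x) \<in> Poly_perp j s" for a
    using v lin_spaceD(3)[OF Poly_lin v'] lin_onD(2)[OF L v'] by (simp add: Poly_perp_def)
  fix w assume w: "w \<in> Poly_perp j s"
  then have w': "w \<in> Poly j" by (simp add: Poly_perp_def)
  show "(\<lambda>x. v x + w x) \<in> Poly_perp j s"
    using v w lin_spaceD(2)[OF Poly_lin v' w'] lin_onD(1)[OF L v' w'] by (simp add: Poly_perp_def)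
qed

text \<open>The first summand is the L_2 projection onto the bubble polynomials. The splitting
  extends identities from \<open>Poly_perp\<close> to the whole polynomial space.\<close>

lemma Poly_decomposition:
  assumes z: "z \<in> Poly j"
  obtains y y' where "y \<in> Poly_bubble j s" "y' \<in> Poly_perp j s" "z = (\<lambda>x. y x + y' x)"
proof -
  let ?B = "Poly_bubble j s"
  have sub: "?B \<subseteq> Poly j" by (auto simp: Poly_bubble_def)
  obtain E where E: "E \<subseteq> ?B" "spanned_by ?B E" using Poly_spanned[OF bubble_space_lin sub] by blast
  have C: "C1_fun v" if "v \<in> ?B" for v using that sub by (auto intro: Poly_C1)
  have i: "integrable (lebesgue_on (elem s)) v" if "C1_fun v" for v
    by (intro integrable_cont elem_compact[OF inv] C1_fun_cont that)
  have "\<exists>y\<in>?B. \<forall>w\<in>?B. L2_ip (elem s) w z = L2_ip (elem s) w y"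
  proof (rule riesz_finite_dim[OF bubble_space_lin E])
    show "lin_on ?B (\<lambda>w. L2_ip (elem s) w v)" if "v \<in> ?B" for v by (intro L2_lin_left C i that)
    show "lin_on ?B (L2_ip (elem s) w)" if "w \<in> ?B" for w
      unfolding L2_commute[of _ w] by (intro L2_lin_left C i that)
    show "v = (\<lambda>x. 0)" if "v \<in> ?B" "L2_ip (elem s) v v = 0" for v
      using that sub by (intro polynomial_zero_if_norm_zero) (auto intro: Poly_polynomial)
    show "lin_on ?B (\<lambda>w. L2_ip (elem s) w z)" by (intro L2_lin_left C i Poly_C1[OF z])
  qed
  then obtain y where y: "y \<in> ?B" "\<And>w. w \<in> ?B \<Longrightarrow> L2_ip (elem s) w z = L2_ip (elem s) w y" by blast
  have y': "y \<in> Poly j" using y(1) sub by blast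
  have "(\<lambda>x. z x - 1 * y x) \<in> Poly_perp j s"
    unfolding Poly_perp_def
  proof (intro CollectI conjI ballI)
    show "(\<lambda>x. z x - 1 * y x) \<in> Poly j" by (rule lin_space_diff[OF Poly_lin z y'])
    fix w assume w: "w \<in> ?B"
    have "lin_on (Poly j) (\<lambda>v. L2_ip (elem s) v w)" by (intro L2_lin_left C i w Poly_C1)
    then have "L2_ip (elem s) (\<lambda>x. z x - 1 * y x) w = L2_ip (elem s) z w - 1 * L2_ip (elem s) y w"
      by (rule lin_on_diff[OF Poly_lin _ z y'])
    then show "L2_ip (elem s) (\<lambda>x. z x - 1 * y x) w = 0" using y(2)[OF w] by (simp add: L2_commute)
  qed
  then show ?thesis using that[of y "\<lambda>x. z x - 1 * y x"] y(1) by simp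
qed

text \<open>Each point of the facet is a limit of points on the segment toward the barycentre y of
  the facet, and all of these have positive coordinates except lambda_i.\<close>

lemma facet_closure_zero:
  fixes p :: "real ^ 'n \<Rightarrow> real"
  assumes p: "continuous_on UNIV p" and z: "\<And>x. x \<in> facet s i \<Longrightarrow> (\<And>j. j \<noteq> i \<Longrightarrow> 0 < bary s j x) \<Longrightarrow> p x = 0"
    and x: "x \<in> facet s i"
  shows "p x = 0"
proof -
  define l where "l j = (if j = i then 0 else 1 / real (CARD('n option) - 1))" for j
  define y where "y = (\<Sum>j\<in>UNIV. l j *\<^sub>R s j)"
  have cN: "CARD('n option) - 1 > 0" by simp
  have "(\<Sum>j\<in>UNIV. l j) = l i + (\<Sum>j\<in>UNIV - {i}. l j)" by (rule sum.remove) auto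
  also have "(\<Sum>j\<in>UNIV - {i}. l j) = (\<Sum>j\<in>UNIV - {i}. 1 / real (CARD('n option) - 1))"
    by (rule sum.cong) (auto simp: l_def)
  also have "\<dots> = 1" using cN by (simp add: card_Diff_singleton)
  finally have "(\<Sum>j\<in>UNIV. l j) = 1" by (simp add: l_def)
  then have bry: "bary s j y = l j" for j unfolding y_def by (rule bary_comb[OF inv])
  have lp: "l j > 0" if "j \<noteq> i" for j using that cN by (simp add: l_def)
  have ln: "l j \<ge> 0" for j by (simp add: l_def)
  have xb: "0 \<le> bary s j x" "bary s i x = 0" for j using x by (auto simp: facet_eq[OF inv] mem_elem[OF inv])
  define w where "w n = inverse (real (Suc n)) *\<^sub>R y + (1 - inverse (real (Suc n))) *\<^sub>R x" for n
  have bw: "bary s j (w n) = inverse (real (Suc n)) * l j + (1 - inverse (real (Suc n))) * bary s j x" for j n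
    unfolding w_def by (subst bary_convex[OF inv]) (auto simp: bry)
  have in1: "0 \<le> 1 - inverse (real (Suc n))" for n by (simp add: field_simps)
  have "p (w n) = 0" for n
  proof (rule z)
    have "0 \<le> bary s j (w n)" for j unfolding bw by (intro add_nonneg_nonneg mult_nonneg_nonneg ln xb in1) simp
    then show "w n \<in> facet s i" by (simp add: facet_eq[OF inv] mem_elem[OF inv] bw xb(2)) (simp add: l_def)
    show "0 < bary s j (w n)" if "j \<noteq> i" for j
      unfolding bw by (intro add_pos_nonneg mult_pos_pos mult_nonneg_nonneg lp that xb in1) simp
  qed
  moreover have "(\<lambda>n. p (w n)) \<longlonglongrightarrow> p x"
  proof (rule isCont_tendsto_compose[of x p])
    show "isCont p x" using p by (simp add: continuous_on_eq_continuous_at)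
    have "w \<longlonglongrightarrow> 0 *\<^sub>R y + (1 - 0) *\<^sub>R x" unfolding w_def
      by (intro tendsto_intros LIMSEQ_inverse_real_of_nat)
    then show "w \<longlonglongrightarrow> x" by simp
  qed
  ultimately show ?thesis by (simp add: LIMSEQ_const_iff)
qed

context
  fixes \<beta> :: "real ^ 'n \<Rightarrow> real ^ 'n" and c :: "real ^ 'n" and k :: nat
  assumes bc: "\<forall>x\<in>interior (elem s). \<beta> x = c" and c0: "c \<noteq> 0"
    and cond: "k = 1 \<or> (\<forall>i. bgrad s i c \<noteq> 0)"
begin

lemma sgn_beta_normal: "sgn (beta_normal \<beta> s i) = - sgn (bgrad s i c)"
  unfolding beta_normal_def beta_elem_eq[OF inv bc] by (rule sgn_inner_normal[OF inv])

lemma signed_bubble_polynomial: "real_polynomial_function (signed_bubble \<beta> s)"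
  unfolding signed_bubble_def[abs_def]
  by (intro real_polynomial_function_sum real_polynomial_function.intros(4)[OF real_polynomial_function.intros(2)]
      real_polynomial_function_prod bary_polynomial[OF inv]) simp_all

text \<open>On the facet where lambda_i = 0 every product that contains lambda_i drops out. The sign
  that is left turns \<open>bgrad s i c\<close> into minus its absolute value, so all facets
  contribute to the flux with the same sign.\<close>

lemma signed_bubble_facet:
  assumes "x \<in> facet s i"
  shows "signed_bubble \<beta> s x = - sgn (bgrad s i c) * (\<Prod>j\<in>UNIV - {i}. bary s j x)"
proof -
  have "(\<Prod>j\<in>UNIV - {l}. bary s j x) = 0" if "l \<noteq> i" for l
    by (rule prod_zero) (use that assms in \<open>auto simp: facet_eq[OF inv]\<close>)
  then have "signed_bubble \<beta> s x = (\<Sum>l\<in>UNIV. if l = i then - sgn (bgrad s i c) * (\<Prod>j\<in>UNIV - {i}. bary s j x) else 0)"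
    unfolding signed_bubble_def sgn_beta_normal by (intro sum.cong) auto
  then show ?thesis by simp
qed

text \<open>By strict positivity p is zero on every non-characteristic facet. If no facet is
  characteristic, p is a bubble and orthogonal to itself. For k = 1 there are at least two
  non-characteristic facets, and together they contain all vertices.\<close>

lemma perp_definite:
  assumes p: "p \<in> Poly_perp (int k) s"
    and z: "(\<integral>x. dd c (\<lambda>x. p x * (signed_bubble \<beta> s x * p x)) x \<partial>lebesgue_on (elem s)) = 0"
  shows "p = (\<lambda>x. 0)"
proof -
  have pP: "p \<in> Poly (int k)" using p by (simp add: Poly_perp_def)
  have pp: "real_polynomial_function p" by (rule Poly_polynomial[OF pP])
  define G where "G x = p x * (signed_bubble \<beta> s x * p x)" for x
  have G: "C1_fun G" unfolding G_def[abs_def]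
    by (intro C1_fun_mult C1_fun_polynomial pp signed_bubble_polynomial)
  have Gf: "bgrad s i c * G x = - \<bar>bgrad s i c\<bar> * ((\<Prod>j\<in>UNIV - {i}. bary s j x) * (p x * p x))"
    if "x \<in> facet s i" for i x
    unfolding G_def signed_bubble_facet[OF that] by (simp add: sgn_if abs_if)
  have sg: "bgrad s i c * G x \<le> 0" if x: "x \<in> facet s i" for i x
  proof -
    have "0 \<le> (\<Prod>j\<in>UNIV - {i}. bary s j x)"
      using x by (intro prod_nonneg) (auto simp: facet_eq[OF inv] mem_elem[OF inv])
    then have "0 \<le> \<bar>bgrad s i c\<bar> * ((\<Prod>j\<in>UNIV - {i}. bary s j x) * (p x * p x))"
      by (intro mult_nonneg_nonneg[OF abs_ge_zero mult_nonneg_nonneg[OF _ zero_le_square]])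
    then show ?thesis unfolding Gf[OF x] by linarith
  qed
  have zero: "p x = 0" if i: "bgrad s i c \<noteq> 0" and x: "x \<in> facet s i" for i x
  proof (rule facet_closure_zero[OF C1_fun_cont[OF C1_fun_polynomial[OF pp]] _ x], rule ccontr)
    fix y assume y: "y \<in> facet s i" "\<And>j. j \<noteq> i \<Longrightarrow> 0 < bary s j y" "p y \<noteq> 0"
    have "0 < (\<Prod>j\<in>UNIV - {i}. bary s j y)" using y(2) by (intro prod_pos) auto
    then have "(\<Prod>j\<in>UNIV - {i}. bary s j y) \<noteq> 0" by linarith
    then have "bgrad s i c * G y \<noteq> 0" unfolding Gf[OF y(1)] using i y(3)
      by (simp only: mult_eq_0_iff neg_equal_0_iff_equal abs_eq_0 not_False_eq_True simp_thms)
    then have "0 < (\<integral>x. dd c G x \<partial>lebesgue_on (elem s))"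
      by (intro integral_dd_pos[OF inv G sg y(1,2)])
    then show False using z by (simp add: G_def[abs_def])
  qed
  show ?thesis
  proof (cases "\<forall>i. bgrad s i c \<noteq> 0")
    case True
    then have "p \<in> Poly_bubble (int k) s"
      using zero pP by (auto simp: Poly_bubble_def frontier_facets)
    then have "L2_ip (elem s) p p = 0" using p by (simp add: Poly_perp_def)
    then show ?thesis by (rule polynomial_zero_if_norm_zero[OF pp])
  next
    case False
    then have k: "k = 1" using cond by blast
    have "\<exists>i. bgrad s i c \<noteq> 0"
    proof (rule ccontr)
      assume "\<not> (\<exists>i. bgrad s i c \<noteq> 0)"
      then have "c = 0" using bgrad_point[OF inv, of c] by simp
      then show False using c0 by simp
    qed
    then obtain i where i: "bgrad s i c \<noteq> 0" by blast
    \<comment> \<open>The values \<open>bgrad s j c\<close> sum to zero, so a single one cannot be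
      nonzero.\<close>
    have "\<exists>l. l \<noteq> i \<and> bgrad s l c \<noteq> 0"
    proof (rule ccontr)
      assume "\<not> (\<exists>l. l \<noteq> i \<and> bgrad s l c \<noteq> 0)"
      then have "(\<Sum>l\<in>UNIV - {i}. bgrad s l c) = 0" by (intro sum.neutral) blast
      then show False using bgrad_sum[OF inv, of c] i by (simp add: sum.remove[of UNIV i])
    qed
    then obtain l where l: "l \<noteq> i" "bgrad s l c \<noteq> 0" by blast
    have v: "p (s j) = 0" for j
    proof (cases "j = i")
      case True
      then show ?thesis using l by (intro zero[of l]) (auto simp: facet_eq[OF inv] vertex_in_elem[OF inv] bary_vertex[OF inv])
    next
      case False
      then show ?thesis using i by (intro zero[of i]) (auto simp: facet_eq[OF inv] vertex_in_elem[OF inv] bary_vertex[OF inv])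
    qed
    have p1: "p \<in> Poly 1" using pP k by simp
    show ?thesis
    proof
      fix x
      show "p x = 0"
        using Poly_affine[OF p1 bary_sum[OF inv, of x], of s] by (simp add: bary_point[OF inv] v)
    qed
  qed
qed

lemma D_elem_lin_left:
  assumes S: "\<And>v. v \<in> S \<Longrightarrow> C1_fun v" and v: "weak_pair c (elem s) v g" and SL: "lin_space S"
  shows "lin_on S (\<lambda>w. D_elem \<beta> s w v)"
proof -
  have i: "integrable (lebesgue_on (elem s)) v" "integrable (lebesgue_on (elem s)) g"
    using v by (auto simp: weak_pair_def)
  define F where "F w x = v x * dd c w x + g x * w x" for w x
  have F: "lin_on S (\<lambda>w. \<integral>x. F w x \<partial>lebesgue_on (elem s))"
  proof (rule lin_on_integral)
    show "integrable (lebesgue_on (elem s)) (F w)" if "w \<in> S" for w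
      unfolding F_def by (intro Bochner_Integration.integrable_add integrable_mult_cont elem_compact[OF inv]
          C1_fun_cont C1_fun_dd_cont S[OF that] i)
  qed (auto simp: F_def dd_add dd_cmult S algebra_simps)
  have eq: "D_elem \<beta> s w v = (\<integral>x. F w x \<partial>lebesgue_on (elem s))" if "w \<in> S" for w
    unfolding F_def by (rule D_elem_C1[OF inv bc S[OF that] v])
  show ?thesis using F lin_spaceD[OF SL] unfolding lin_on_def by (simp add: eq)
qed

lemma D_elem_diff:
  assumes w: "C1_fun w" and v: "weak_pair c (elem s) v g" and v': "weak_pair c (elem s) v' g'"
  shows "D_elem \<beta> s w (\<lambda>x. v x - v' x) = D_elem \<beta> s w v - D_elem \<beta> s w v'"
proof -
  have d: "weak_pair c (elem s) (\<lambda>x. v x - v' x) (\<lambda>x. g x - g' x)"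
    using weak_pair_add[OF elem_compact[OF inv] v weak_pair_cmult[OF elem_compact[OF inv] v', of "-1"]] by simp
  have i: "integrable (lebesgue_on (elem s)) (\<lambda>x. v x * dd c w x + g x * w x)" if "weak_pair c (elem s) v g" for v g
    using that unfolding weak_pair_def
    by (intro Bochner_Integration.integrable_add integrable_mult_cont elem_compact[OF inv] C1_fun_cont C1_fun_dd_cont w) auto
  show ?thesis
    unfolding D_elem_C1[OF inv bc w d] D_elem_C1[OF inv bc w v] D_elem_C1[OF inv bc w v']
    by (subst Bochner_Integration.integral_diff[symmetric, OF i[OF v] i[OF v']])
       (rule Bochner_Integration.integral_cong, auto simp: algebra_simps)
qed

lemma V_elem_C1: "\<pi> \<in> V_elem \<beta> k s \<Longrightarrow> C1_fun \<pi>"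
  unfolding V_elem_def Poly_perp_def
  by (auto intro!: C1_fun_add C1_fun_mult C1_fun_polynomial[OF signed_bubble_polynomial]
      C1_fun_polynomial[OF bubble_polynomial] intro: Poly_C1)

lemma V_elem_intro: "p \<in> Poly_perp (int k) s \<Longrightarrow> r \<in> Poly (int k - 2) \<Longrightarrow>
   (\<lambda>x. signed_bubble \<beta> s x * p x + bubble s x * r x) \<in> V_elem \<beta> k s"
  unfolding V_elem_def by blast

text \<open>The product under the derivative vanishes on all facets.\<close>

lemma D_elem_bubble:
  assumes "C1_fun w" "C1_fun r"
  shows "D_elem \<beta> s w (\<lambda>x. bubble s x * r x) = 0"
proof -
  note b = C1_fun_polynomial[OF bubble_polynomial]
  have "D_elem \<beta> s w (\<lambda>x. bubble s x * r x) = (\<integral>x. dd c (\<lambda>x. w x * (bubble s x * r x)) x \<partial>lebesgue_on (elem s))"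
    by (rule D_elem_C1_C1[OF inv bc assms(1) C1_fun_mult[OF b assms(2)]])
  also have "\<dots> = 0"
  proof (intro integral_dd_zero[OF inv] C1_fun_mult b assms)
    fix j x assume "x \<in> facet s j"
    then have "bubble s x = 0" using bubble_frontier frontier_facets by blast
    then show "bgrad s j c * (w x * (bubble s x * r x)) = 0" by simp
  qed
  finally show ?thesis .
qed

lemma D_elem_V:
  assumes w: "C1_fun w" and p: "C1_fun p" and r: "C1_fun r"
  shows "D_elem \<beta> s w (\<lambda>x. signed_bubble \<beta> s x * p x + bubble s x * r x)
    = D_elem \<beta> s w (\<lambda>x. signed_bubble \<beta> s x * p x)"
proof -
  note b = C1_fun_polynomial[OF bubble_polynomial] and sb = C1_fun_polynomial[OF signed_bubble_polynomial]
  have C: "C1_fun (\<lambda>x. signed_bubble \<beta> s x * p x + bubble s x * r x)" "C1_fun (\<lambda>x. bubble s x * r x)"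
    by (intro C1_fun_add C1_fun_mult b sb p r)+
  show ?thesis
    using D_elem_diff[OF w weak_pair_C1[OF elem_compact[OF inv] C(1)] weak_pair_C1[OF elem_compact[OF inv] C(2)]]
      D_elem_bubble[OF w r] by simp
qed

text \<open>The first condition does not see the summand with \<open>bubble\<close>, hence it is an
  equation for p alone, solvable by \<open>perp_definite\<close>. With p known, the second condition
  is an equation for r with the definite form weighted by \<open>bubble\<close>.\<close>

lemma Pi_elem_exists:
  assumes v: "weak_pair c (elem s) v g"
  shows "\<exists>\<pi>. \<pi> \<in> V_elem \<beta> k s \<and> (\<forall>w\<in>Poly_perp (int k) s. D_elem \<beta> s w (\<lambda>x. \<pi> x - v x) = 0) \<and>
     (\<forall>z\<in>Poly (int k - 2). L2_ip (elem s) z (\<lambda>x. \<pi> x - v x) = 0)"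
proof -
  let ?S = "Poly_perp (int k) s" and ?b = "signed_bubble \<beta> s" and ?R = "Poly (int k - 2) :: (real ^ 'n \<Rightarrow> real) set"
  have iv: "integrable (lebesgue_on (elem s)) v" using v by (simp add: weak_pair_def)
  have C: "C1_fun w" if "w \<in> ?S" for w using that by (auto simp: Poly_perp_def intro: Poly_C1)
  note b = C1_fun_polynomial[OF bubble_polynomial] and sb = C1_fun_polynomial[OF signed_bubble_polynomial]
  note wp = weak_pair_C1[OF elem_compact[OF inv]]
  obtain E where E: "E \<subseteq> ?S" "spanned_by ?S E"
    using Poly_spanned[OF perp_space_lin, of "int k" "int k"] by (auto simp: Poly_perp_def)
  have "\<exists>p\<in>?S. \<forall>w\<in>?S. D_elem \<beta> s w v = D_elem \<beta> s w (\<lambda>x. ?b x * p x)"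
  proof (rule riesz_finite_dim[OF perp_space_lin E, where A = "\<lambda>w p. D_elem \<beta> s w (\<lambda>x. ?b x * p x)"])
    show "lin_on ?S (\<lambda>w. D_elem \<beta> s w (\<lambda>x. ?b x * p x))" if "p \<in> ?S" for p
      by (rule D_elem_lin_left[OF C wp[OF C1_fun_mult[OF sb C[OF that]]] perp_space_lin])
    show "lin_on ?S (\<lambda>p. D_elem \<beta> s w (\<lambda>x. ?b x * p x))" if w: "w \<in> ?S" for w
    proof -
      define F where "F p x = dd c (\<lambda>x. w x * (?b x * p x)) x" for p x
      have cc: "C1_fun (\<lambda>x. w x * (?b x * p x))" if "p \<in> ?S" for p by (intro C1_fun_mult C[OF w] sb C[OF that])
      have F: "lin_on ?S (\<lambda>p. \<integral>x. F p x \<partial>lebesgue_on (elem s))"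
      proof (rule lin_on_integral)
        show "integrable (lebesgue_on (elem s)) (F p)" if "p \<in> ?S" for p
          unfolding F_def by (intro integrable_cont elem_compact[OF inv] C1_fun_dd_cont cc that)
        show "F (\<lambda>x. p x + p' x) x = F p x + F p' x" if "p \<in> ?S" "p' \<in> ?S" for p p' x
          unfolding F_def dd_add[OF cc[OF that(1)] cc[OF that(2)], symmetric] by (simp add: distrib_left)
        show "F (\<lambda>x. a * p x) x = a * F p x" if "p \<in> ?S" for a p x
          unfolding F_def dd_cmult[OF cc[OF that], symmetric] by (simp add: mult_ac)
      qed
      have eq: "D_elem \<beta> s w (\<lambda>x. ?b x * p x) = (\<integral>x. F p x \<partial>lebesgue_on (elem s))" if "p \<in> ?S" for p
        unfolding F_def by (rule D_elem_C1_C1[OF inv bc C[OF w] C1_fun_mult[OF sb C[OF that]]])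
      show ?thesis using F lin_spaceD[OF perp_space_lin] unfolding lin_on_def by (simp add: eq)
    qed
    show "p = (\<lambda>x. 0)" if p: "p \<in> ?S" and z: "D_elem \<beta> s p (\<lambda>x. ?b x * p x) = 0" for p
      by (rule perp_definite[OF p]) (use z D_elem_C1_C1[OF inv bc C[OF p] C1_fun_mult[OF sb C[OF p]]] in simp)
    show "lin_on ?S (\<lambda>w. D_elem \<beta> s w v)" by (rule D_elem_lin_left[OF C v perp_space_lin])
  qed
  then obtain p where p: "p \<in> ?S" "\<And>w. w \<in> ?S \<Longrightarrow> D_elem \<beta> s w v = D_elem \<beta> s w (\<lambda>x. ?b x * p x)" by blast
  have isb: "integrable (lebesgue_on (elem s)) (\<lambda>x. ?b x * p x)" by (rule L2_integrable[OF sb C[OF p(1)]])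
  obtain E' where E': "E' \<subseteq> ?R" "spanned_by ?R E'" using Poly_spanned[OF Poly_lin subset_refl] by blast
  have ib: "integrable (lebesgue_on (elem s)) (\<lambda>x. bubble s x * r x)" if "r \<in> ?R" for r
    by (rule L2_integrable[OF b Poly_C1[OF that]])
  have "\<exists>r\<in>?R. \<forall>z\<in>?R. L2_ip (elem s) z (\<lambda>x. v x - ?b x * p x) = L2_ip (elem s) z (\<lambda>x. bubble s x * r x)"
  proof (rule riesz_finite_dim[OF Poly_lin E', where A = "\<lambda>z r. L2_ip (elem s) z (\<lambda>x. bubble s x * r x)"])
    show "lin_on ?R (\<lambda>z. L2_ip (elem s) z (\<lambda>x. bubble s x * r x))" if "r \<in> ?R" for r
      by (intro L2_lin_left Poly_C1 ib that)
    show "lin_on ?R (\<lambda>r. L2_ip (elem s) z (\<lambda>x. bubble s x * r x))" if "z \<in> ?R" for z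
      unfolding L2_ip_def
    proof (rule lin_on_integral)
      show "integrable (lebesgue_on (elem s)) (\<lambda>x. z x * (bubble s x * r x))" if "r \<in> ?R" for r
        by (intro L2_integrable C1_fun_mult b Poly_C1[OF that] Poly_C1[OF \<open>z \<in> ?R\<close>])
    qed (auto simp: algebra_simps)
    show "r = (\<lambda>x. 0)" if "r \<in> ?R" "L2_ip (elem s) r (\<lambda>x. bubble s x * r x) = 0" for r
      using that by (intro polynomial_zero_if_weighted_zero[OF Poly_polynomial bubble_polynomial bubble_nonneg bubble_pos])
        (auto simp: L2_ip_def)
    show "lin_on ?R (\<lambda>z. L2_ip (elem s) z (\<lambda>x. v x - ?b x * p x))"
      by (intro L2_lin_left Poly_C1 Bochner_Integration.integrable_diff iv isb)
  qed
  then obtain r where r: "r \<in> ?R" "\<And>z. z \<in> ?R \<Longrightarrow>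
      L2_ip (elem s) z (\<lambda>x. v x - ?b x * p x) = L2_ip (elem s) z (\<lambda>x. bubble s x * r x)" by blast
  define \<pi> where "\<pi> x = ?b x * p x + bubble s x * r x" for x
  have \<pi>V: "\<pi> \<in> V_elem \<beta> k s" unfolding \<pi>_def[abs_def] by (rule V_elem_intro[OF p(1) r(1)])
  have "D_elem \<beta> s w (\<lambda>x. \<pi> x - v x) = 0" if w: "w \<in> ?S" for w
    using D_elem_diff[OF C[OF w] wp[OF V_elem_C1[OF \<pi>V]] v] D_elem_V[OF C[OF w] C[OF p(1)] Poly_C1[OF r(1)]] p(2)[OF w]
    by (simp add: \<pi>_def[abs_def])
  moreover have "L2_ip (elem s) z (\<lambda>x. \<pi> x - v x) = 0" if z: "z \<in> ?R" for z
  proof -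
    note zc = C1_fun_cont[OF Poly_C1[OF z], of UNIV]
    have i1: "integrable (lebesgue_on (elem s)) (\<lambda>x. z x * (bubble s x * r x))"
      using integrable_mult_cont[OF elem_compact[OF inv] zc ib[OF r(1)]] by (simp add: mult.commute)
    have i2: "integrable (lebesgue_on (elem s)) (\<lambda>x. z x * (v x - ?b x * p x))"
      using integrable_mult_cont[OF elem_compact[OF inv] zc Bochner_Integration.integrable_diff[OF iv isb]]
      by (simp add: mult.commute)
    have "L2_ip (elem s) z (\<lambda>x. \<pi> x - v x) = (\<integral>x. z x * (bubble s x * r x) - z x * (v x - ?b x * p x) \<partial>lebesgue_on (elem s))"
      unfolding L2_ip_def \<pi>_def by (rule Bochner_Integration.integral_cong) (auto simp: algebra_simps)
    then show ?thesis using r(2)[OF z] unfolding Bochner_Integration.integral_diff[OF i1 i2] L2_ip_def by simp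
  qed
  ultimately show ?thesis using \<pi>V by blast
qed

text \<open>The difference of two solutions solves the homogeneous triangular system: tested with
  its own p it gives p = 0, and then with its own r it gives r = 0.\<close>

lemma Pi_elem_unique:
  assumes v: "weak_pair c (elem s) v g"
    and 1: "\<pi>1 \<in> V_elem \<beta> k s" "\<forall>w\<in>Poly_perp (int k) s. D_elem \<beta> s w (\<lambda>x. \<pi>1 x - v x) = 0"
      "\<forall>z\<in>Poly (int k - 2). L2_ip (elem s) z (\<lambda>x. \<pi>1 x - v x) = 0"
    and 2: "\<pi>2 \<in> V_elem \<beta> k s" "\<forall>w\<in>Poly_perp (int k) s. D_elem \<beta> s w (\<lambda>x. \<pi>2 x - v x) = 0"
      "\<forall>z\<in>Poly (int k - 2). L2_ip (elem s) z (\<lambda>x. \<pi>2 x - v x) = 0"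
  shows "\<pi>1 = \<pi>2"
proof -
  let ?S = "Poly_perp (int k) s" and ?b = "signed_bubble \<beta> s" and ?R = "Poly (int k - 2) :: (real ^ 'n \<Rightarrow> real) set"
  have iv: "integrable (lebesgue_on (elem s)) v" using v by (simp add: weak_pair_def)
  have C: "C1_fun w" if "w \<in> ?S" for w using that by (auto simp: Poly_perp_def intro: Poly_C1)
  note wp = weak_pair_C1[OF elem_compact[OF inv]]
  note b = C1_fun_polynomial[OF bubble_polynomial] and sb = C1_fun_polynomial[OF signed_bubble_polynomial]
  obtain p1 r1 where pr1: "\<pi>1 = (\<lambda>x. ?b x * p1 x + bubble s x * r1 x)" "p1 \<in> ?S" "r1 \<in> ?R"
    using 1(1) unfolding V_elem_def by blast
  obtain p2 r2 where pr2: "\<pi>2 = (\<lambda>x. ?b x * p2 x + bubble s x * r2 x)" "p2 \<in> ?S" "r2 \<in> ?R"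
    using 2(1) unfolding V_elem_def by blast
  define p where "p x = p1 x - 1 * p2 x" for x
  define r where "r x = r1 x - 1 * r2 x" for x
  have p: "p \<in> ?S" unfolding p_def[abs_def] by (rule lin_space_diff[OF perp_space_lin pr1(2) pr2(2)])
  have r: "r \<in> ?R" unfolding r_def[abs_def] by (rule lin_space_diff[OF Poly_lin pr1(3) pr2(3)])
  have diff: "(\<lambda>x. \<pi>1 x - \<pi>2 x) = (\<lambda>x. ?b x * p x + bubble s x * r x)"
    unfolding pr1 pr2 p_def r_def by (simp add: algebra_simps)
  have "D_elem \<beta> s p (\<lambda>x. \<pi>1 x - \<pi>2 x) = D_elem \<beta> s p \<pi>1 - D_elem \<beta> s p \<pi>2"
    by (rule D_elem_diff[OF C[OF p] wp[OF V_elem_C1[OF 1(1)]] wp[OF V_elem_C1[OF 2(1)]]])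
  also have "\<dots> = D_elem \<beta> s p (\<lambda>x. \<pi>1 x - v x) - D_elem \<beta> s p (\<lambda>x. \<pi>2 x - v x)"
    unfolding D_elem_diff[OF C[OF p] wp[OF V_elem_C1[OF 1(1)]] v] D_elem_diff[OF C[OF p] wp[OF V_elem_C1[OF 2(1)]] v] by simp
  also have "\<dots> = 0" using 1(2) 2(2) p by simp
  finally have "D_elem \<beta> s p (\<lambda>x. ?b x * p x) = 0"
    unfolding diff D_elem_V[OF C[OF p] C[OF p] Poly_C1[OF r]] .
  then have p0: "p = (\<lambda>x. 0)"
    unfolding D_elem_C1_C1[OF inv bc C[OF p] C1_fun_mult[OF sb C[OF p]]] by (rule perp_definite[OF p])
  have L: "L2_ip (elem s) r \<pi> = L2_ip (elem s) r v" if "\<pi> \<in> V_elem \<beta> k s" "L2_ip (elem s) r (\<lambda>x. \<pi> x - v x) = 0" for \<pi>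
  proof -
    have i1: "integrable (lebesgue_on (elem s)) (\<lambda>x. r x * \<pi> x)"
      by (rule L2_integrable[OF Poly_C1[OF r] V_elem_C1[OF that(1)]])
    have i2: "integrable (lebesgue_on (elem s)) (\<lambda>x. r x * v x)"
      using integrable_mult_cont[OF elem_compact[OF inv] C1_fun_cont[OF Poly_C1[OF r]] iv] by (simp add: mult.commute)
    show ?thesis using that(2) unfolding L2_ip_def right_diff_distrib Bochner_Integration.integral_diff[OF i1 i2] by simp
  qed
  have "L2_ip (elem s) r (\<lambda>x. \<pi>1 x - \<pi>2 x) = L2_ip (elem s) r \<pi>1 - L2_ip (elem s) r \<pi>2"
    unfolding L2_ip_def right_diff_distrib
    by (rule Bochner_Integration.integral_diff) (intro L2_integrable Poly_C1[OF r] V_elem_C1 1(1) 2(1))+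
  then have "L2_ip (elem s) r (\<lambda>x. bubble s x * r x) = 0"
    using L[OF 1(1)] L[OF 2(1)] 1(3) 2(3) r unfolding diff p0 by simp
  then have "r = (\<lambda>x. 0)"
    by (intro polynomial_zero_if_weighted_zero[OF Poly_polynomial[OF r] bubble_polynomial bubble_nonneg bubble_pos])
       (auto simp: L2_ip_def)
  then show ?thesis using fun_cong[OF diff] p0 by (auto simp: fun_eq_iff)
qed

text \<open>For the third claim, integration by parts writes the volume term as
  \<open>D_elem\<close> minus the integral of the derivative of w against the projection. This
  derivative has degree at most k - 2, which the second projection condition covers.\<close>

lemma Pi_elem_props:
  assumes v: "weak_pair c (elem s) v g"
  shows "Pi_elem \<beta> k s v \<in> V_elem \<beta> k s"
    "\<And>w. w \<in> Poly (int k) \<Longrightarrow> D_elem \<beta> s w (Pi_elem \<beta> k s v) = D_elem \<beta> s w v"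
    "\<And>w. w \<in> Poly (int k - 1) \<Longrightarrow>
       L2_ip (elem s) w (d_beta \<beta> (elem s) (Pi_elem \<beta> k s v)) = L2_ip (elem s) w (d_beta \<beta> (elem s) v)"
proof -
  let ?\<pi> = "Pi_elem \<beta> k s v"
  let ?P = "\<lambda>\<pi>. \<pi> \<in> V_elem \<beta> k s \<and> (\<forall>w\<in>Poly_perp (int k) s. D_elem \<beta> s w (\<lambda>x. \<pi> x - v x) = 0) \<and>
     (\<forall>z\<in>Poly (int k - 2). L2_ip (elem s) z (\<lambda>x. \<pi> x - v x) = 0)"
  have "\<exists>!\<pi>. ?P \<pi>" using Pi_elem_exists[OF v] Pi_elem_unique[OF v] by blast
  then have P: "?P ?\<pi>" unfolding Pi_elem_def by (rule theI')
  then show V: "?\<pi> \<in> V_elem \<beta> k s" by blast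
  note wp = weak_pair_C1[OF elem_compact[OF inv]]
  have iv: "integrable (lebesgue_on (elem s)) v" using v by (simp add: weak_pair_def)
  show D: "D_elem \<beta> s w ?\<pi> = D_elem \<beta> s w v" if w: "w \<in> Poly (int k)" for w
  proof -
    obtain y y' where y: "y \<in> Poly_bubble (int k) s" "y' \<in> Poly_perp (int k) s" "w = (\<lambda>x. y x + y' x)"
      using Poly_decomposition[OF w] by blast
    have yP: "y \<in> Poly (int k)" "y' \<in> Poly (int k)" using y by (auto simp: Poly_bubble_def Poly_perp_def)
    have add: "D_elem \<beta> s w u = D_elem \<beta> s y u + D_elem \<beta> s y' u" if "weak_pair c (elem s) u h" for u h
      unfolding y(3) by (rule lin_onD(1)[OF D_elem_lin_left[OF Poly_C1 that Poly_lin] yP])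
    have z: "D_elem \<beta> s y u = 0" if "weak_pair c (elem s) u h" for u h
      using y(1) by (intro D_elem_zero_frontier[OF inv bc Poly_C1[OF yP(1)] _ that]) (auto simp: Poly_bubble_def)
    have "D_elem \<beta> s y' ?\<pi> = D_elem \<beta> s y' v"
      using P y(2) D_elem_diff[OF Poly_C1[OF yP(2)] wp[OF V_elem_C1[OF V]] v] by simp
    then show ?thesis using add[OF wp[OF V_elem_C1[OF V]]] add[OF v] z[OF wp[OF V_elem_C1[OF V]]] z[OF v] by simp
  qed
  show "L2_ip (elem s) w (d_beta \<beta> (elem s) ?\<pi>) = L2_ip (elem s) w (d_beta \<beta> (elem s) v)"
    if w: "w \<in> Poly (int k - 1)" for w
  proof -
    have wk: "w \<in> Poly (int k)" by (rule Poly_mono[OF w]) simp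
    have dw: "(\<lambda>x. dd c w x) \<in> Poly (int k - 2)" using dd_Poly[OF w, of c] by simp
    have "L2_ip (elem s) (\<lambda>x. dd c w x) (\<lambda>x. ?\<pi> x - v x) = 0" using P dw by blast
    moreover have i1: "integrable (lebesgue_on (elem s)) (\<lambda>x. dd c w x * ?\<pi> x)"
      by (rule L2_integrable[OF Poly_C1[OF dw] V_elem_C1[OF V]])
    have i2: "integrable (lebesgue_on (elem s)) (\<lambda>x. dd c w x * v x)"
      using integrable_mult_cont[OF elem_compact[OF inv] C1_fun_cont[OF Poly_C1[OF dw]] iv] by (simp add: mult.commute)
    ultimately have "L2_ip (elem s) (dd c w) ?\<pi> = L2_ip (elem s) (dd c w) v"
      unfolding L2_ip_def right_diff_distrib Bochner_Integration.integral_diff[OF i1 i2] by simp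
    moreover have "D_elem \<beta> s w u = L2_ip (elem s) (dd c w) u + L2_ip (elem s) w (d_beta \<beta> (elem s) u)" for u
      unfolding D_elem_def L2_ip_dbeta(2)[OF inv bc wp[OF Poly_C1[OF w]]] by simp
    ultimately show ?thesis using D[OF wk] by simp
  qed
qed

end

end

section \<open>Lebesgue spaces\<close>

lemma powr_le_one_plus: "r \<ge> 1 \<Longrightarrow> \<bar>a\<bar> \<le> 1 + \<bar>a\<bar> powr r" for a r :: real
proof (cases "\<bar>a\<bar> \<le> 1")
  case False
  assume "r \<ge> 1"
  then have "\<bar>a\<bar> powr 1 \<le> \<bar>a\<bar> powr r" using False by (intro powr_mono) auto
  then show ?thesis using False by simp
qed (simp add: add_increasing2)

lemma L_space_integrable:
  assumes D: "D \<in> lmeasurable" and r: "r \<ge> 1" and v: "v \<in> L_space r D"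
  shows "integrable (lebesgue_on D) v"
proof (rule Bochner_Integration.integrable_bound)
  show "integrable (lebesgue_on D) (\<lambda>x. 1 + \<bar>v x\<bar> powr r)"
    using v finite_measure.integrable_const[OF finite_measure_lebesgue_on[OF D], of "1::real"]
    by (auto simp: L_space_def)
  show "AE x in lebesgue_on D. norm (v x) \<le> norm (1 + \<bar>v x\<bar> powr r)"
    using powr_le_one_plus[OF r] by (intro AE_I2) (simp add: abs_of_nonneg)
qed (use v in \<open>auto simp: L_space_def\<close>)

lemma powr_add_le: "r \<ge> 0 \<Longrightarrow> \<bar>a + b\<bar> powr r \<le> 2 powr r * (\<bar>a\<bar> powr r + \<bar>b\<bar> powr r)" for a b r :: real
proof -
  assume r: "r \<ge> 0"
  have "\<bar>a + b\<bar> powr r \<le> (2 * max \<bar>a\<bar> \<bar>b\<bar>) powr r" using r by (intro powr_mono2) auto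
  also have "\<dots> = 2 powr r * max \<bar>a\<bar> \<bar>b\<bar> powr r" by (simp add: powr_mult)
  also have "\<dots> \<le> 2 powr r * (\<bar>a\<bar> powr r + \<bar>b\<bar> powr r)"
    by (intro mult_left_mono) (auto simp: max_def)
  finally show ?thesis .
qed

lemma L_space_add:
  assumes "r \<ge> 0" "v \<in> L_space r D" "w \<in> L_space r D"
  shows "(\<lambda>x. v x + w x) \<in> L_space r D"
proof -
  have m[measurable]: "v \<in> borel_measurable (lebesgue_on D)" "w \<in> borel_measurable (lebesgue_on D)"
    using assms by (auto simp: L_space_def)
  have "integrable (lebesgue_on D) (\<lambda>x. \<bar>v x + w x\<bar> powr r)"
  proof (rule Bochner_Integration.integrable_bound)
    show "integrable (lebesgue_on D) (\<lambda>x. 2 powr r * (\<bar>v x\<bar> powr r + \<bar>w x\<bar> powr r))"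
      using assms by (auto simp: L_space_def)
    show "AE x in lebesgue_on D. norm (\<bar>v x + w x\<bar> powr r) \<le> norm (2 powr r * (\<bar>v x\<bar> powr r + \<bar>w x\<bar> powr r))"
      using powr_add_le[OF assms(1)] by (intro AE_I2) (simp add: abs_of_nonneg)
  qed measurable
  then show ?thesis using m by (auto simp: L_space_def)
qed

lemma L_space_cmult:
  assumes "v \<in> L_space r D"
  shows "(\<lambda>x. a * v x) \<in> L_space r D"
  using assms by (auto simp: L_space_def abs_mult powr_mult)

lemma L_space_cong:
  assumes D: "D \<in> sets lebesgue" and v: "v \<in> L_space r D" and ae: "AE x in lebesgue_on D. v x = w x"
  shows "w \<in> L_space r D"
proof -
  have "w \<in> borel_measurable (lebesgue_on D)"
    using v by (intro borel_measurable_lebesgue_on_AE[OF D _ ae]) (auto simp: L_space_def)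
  moreover have "AE x in lebesgue_on D. \<bar>v x\<bar> powr r = \<bar>w x\<bar> powr r" using ae by eventually_elim simp
  ultimately show ?thesis using v integral_lebesgue_on_cong_AE(2)[OF D] by (auto simp: L_space_def)
qed

lemma L_space_bounded:
  assumes D: "D \<in> lmeasurable" and r: "r \<ge> 0" and m: "v \<in> borel_measurable (lebesgue_on D)"
    and b: "AE x in lebesgue_on D. \<bar>v x\<bar> \<le> M"
  shows "v \<in> L_space r D"
proof -
  note [measurable] = m
  have "integrable (lebesgue_on D) (\<lambda>x. \<bar>v x\<bar> powr r)"
  proof (rule finite_measure.integrable_const_bound[OF finite_measure_lebesgue_on[OF D]])
    show "AE x in lebesgue_on D. norm (\<bar>v x\<bar> powr r) \<le> \<bar>M\<bar> powr r"
      using b by eventually_elim (use r in \<open>auto intro!: powr_mono2\<close>)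
  qed measurable
  then show ?thesis using m by (simp add: L_space_def)
qed

text \<open>The r-th power of \<open>L_norm\<close>; the norm of Y adds such powers, so no roots
  have to be handled.\<close>

definition L_int :: "real \<Rightarrow> (real ^ 'n) set \<Rightarrow> (real ^ 'n \<Rightarrow> real) \<Rightarrow> real" where
  "L_int r D v = (\<integral>x. \<bar>v x\<bar> powr r \<partial>lebesgue_on D)"

lemma L_int_nonneg: "0 \<le> L_int r D v"
  unfolding L_int_def by (rule integral_nonneg_AE) simp

lemma L_norm_powr: "r > 0 \<Longrightarrow> L_norm r D v powr r = L_int r D v"
  using L_int_nonneg[of r D v] by (simp add: L_norm_def L_int_def powr_powr)

lemma L_int_cong: "D \<in> sets lebesgue \<Longrightarrow> AE x in lebesgue_on D. v x = w x \<Longrightarrow> L_int r D v = L_int r D w"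
  unfolding L_int_def by (rule integral_lebesgue_on_cong_AE(1)) (auto elim: eventually_mono)

lemma L_int_cmult: "L_int r D (\<lambda>x. a * v x) = \<bar>a\<bar> powr r * L_int r D v"
  unfolding L_int_def by (simp add: abs_mult powr_mult)

lemma L_int_eq_0:
  assumes "v \<in> L_space r D" "L_int r D v = 0"
  shows "AE x in lebesgue_on D. v x = 0"
proof -
  have "AE x in lebesgue_on D. \<bar>v x\<bar> powr r = 0"
    using assms unfolding L_int_def
    by (subst (asm) integral_nonneg_eq_0_iff_AE) (auto simp: L_space_def)
  then show ?thesis by eventually_elim simp
qed

lemma conjugate_exponent:
  fixes p q :: real
  assumes "p > 1" "q = p / (p - 1)"
  shows "q > 1" "1 / p + 1 / q = 1"
proof -
  show "q > 1" using assms by (simp add: less_divide_eq)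
  have "1 / q = (p - 1) / p" using assms by simp
  then show "1 / p + 1 / q = 1" using assms(1) by (simp add: diff_divide_distrib)
qed

text \<open>Young's inequality without the weights 1/p and 1/q. Only boundedness of functionals is
  derived from it, and \<open>bfun_intro\<close> recovers a bound by the norm through
  scaling.\<close>

lemma young_le:
  fixes a b p q :: real
  assumes "p > 1" "q = p / (p - 1)"
  shows "\<bar>a * b\<bar> \<le> \<bar>a\<bar> powr p + \<bar>b\<bar> powr q"
proof -
  note q = conjugate_exponent[OF assms]
  have "\<bar>a\<bar> * \<bar>b\<bar> \<le> \<bar>a\<bar> powr p / p + \<bar>b\<bar> powr q / q"
    using Youngs_inequality[of p q "\<bar>a\<bar>" "\<bar>b\<bar>"] assms(1) q by simp
  also have "\<dots> \<le> \<bar>a\<bar> powr p + \<bar>b\<bar> powr q"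
    using assms(1) q(1) mult_left_mono[of 1 p "\<bar>a\<bar> powr p"] mult_left_mono[of 1 q "\<bar>b\<bar> powr q"]
    by (intro add_mono) (auto simp: divide_le_eq)
  finally show ?thesis by (simp add: abs_mult)
qed

lemma L2_young:
  assumes pq: "p > 1" "q = p / (p - 1)" and f: "f \<in> L_space p D" and v: "v \<in> L_space q D"
  shows "integrable (lebesgue_on D) (\<lambda>x. f x * v x)" "\<bar>L2_ip D f v\<bar> \<le> L_int p D f + L_int q D v"
proof -
  have i: "integrable (lebesgue_on D) (\<lambda>x. \<bar>f x\<bar> powr p)" "integrable (lebesgue_on D) (\<lambda>x. \<bar>v x\<bar> powr q)"
    using f v by (auto simp: L_space_def)
  have [measurable]: "f \<in> borel_measurable (lebesgue_on D)" "v \<in> borel_measurable (lebesgue_on D)"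
    using f v by (auto simp: L_space_def)
  show I: "integrable (lebesgue_on D) (\<lambda>x. f x * v x)"
  proof (rule Bochner_Integration.integrable_bound)
    show "integrable (lebesgue_on D) (\<lambda>x. \<bar>f x\<bar> powr p + \<bar>v x\<bar> powr q)" using i by simp
    show "AE x in lebesgue_on D. norm (f x * v x) \<le> norm (\<bar>f x\<bar> powr p + \<bar>v x\<bar> powr q)"
      using young_le[OF pq] by (intro AE_I2) (simp add: abs_of_nonneg)
  qed measurable
  have "\<bar>L2_ip D f v\<bar> \<le> (\<integral>x. \<bar>f x * v x\<bar> \<partial>lebesgue_on D)"
    unfolding L2_ip_def using integral_norm_bound[of "lebesgue_on D" "\<lambda>x. f x * v x"] by simp
  also have "\<dots> \<le> (\<integral>x. \<bar>f x\<bar> powr p + \<bar>v x\<bar> powr q \<partial>lebesgue_on D)"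
    by (rule integral_mono) (use I i young_le[OF pq] in auto)
  also have "\<dots> = L_int p D f + L_int q D v" using i by (simp add: L_int_def)
  finally show "\<bar>L2_ip D f v\<bar> \<le> L_int p D f + L_int q D v" .
qed

section \<open>Uniform smoothness of the power function\<close>

text \<open>\<open>h'\<close> is q sgn(x) \<bar>x\<bar>^(q-1), written with maxima so that its
  continuity at 0 is evident. At 0 the difference quotient is bounded by \<bar>h\<bar>^(q-1), which
  tends to 0 because q > 1.\<close>

lemma abs_powr_deriv:
  fixes q x :: real
  assumes q: "q > 1"
  defines "h' \<equiv> (\<lambda>x. q * (max 0 x powr (q - 1) - max 0 (- x) powr (q - 1)))"
  shows "((\<lambda>x. \<bar>x\<bar> powr q) has_real_derivative h' x) (at x)"
proof -
  consider "x > 0" | "x < 0" | "x = 0" by linarith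
  then show ?thesis
  proof cases
    case 1
    have "((\<lambda>x. x powr q) has_real_derivative q * x powr (q - 1)) (at x)"
      by (rule has_real_derivative_powr[OF 1])
    then have "((\<lambda>x. \<bar>x\<bar> powr q) has_real_derivative q * x powr (q - 1)) (at x)"
      by (rule has_field_derivative_transform_within_open[where S = "{0<..}"]) (use 1 in auto)
    then show ?thesis using 1 q by (simp add: h'_def)
  next
    case 2
    have "((\<lambda>x. (- x) powr q) has_real_derivative (q * (- x) powr (q - 1)) * (- 1)) (at x)"
      using 2 by (intro DERIV_chain2[where f = "\<lambda>x. x powr q" and g = uminus, OF has_real_derivative_powr])
        (auto intro!: derivative_eq_intros)
    then have "((\<lambda>x. \<bar>x\<bar> powr q) has_real_derivative (q * (- x) powr (q - 1)) * (- 1)) (at x)"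
      by (rule has_field_derivative_transform_within_open[where S = "{..<0}"]) (use 2 in auto)
    then show ?thesis using 2 q by (simp add: h'_def)
  next
    case 3
    have "((\<lambda>h. (\<bar>0 + h\<bar> powr q - \<bar>0\<bar> powr q) / h) \<longlongrightarrow> 0) (at 0)"
    proof (rule Lim_null_comparison[where g = "\<lambda>h. \<bar>h\<bar> powr (q - 1)"])
      show "\<forall>\<^sub>F h in at 0. norm ((\<bar>0 + h\<bar> powr q - \<bar>0\<bar> powr q) / h) \<le> \<bar>h\<bar> powr (q - 1)"
        unfolding eventually_at_filter
      proof (intro always_eventually allI impI)
        fix h :: real assume h: "h \<noteq> 0"
        have "\<bar>h\<bar> powr q = \<bar>h\<bar> powr (q - 1) * \<bar>h\<bar>"
          using h powr_add[of "\<bar>h\<bar>" "q - 1" 1] by simp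
        then show "norm ((\<bar>0 + h\<bar> powr q - \<bar>0\<bar> powr q) / h) \<le> \<bar>h\<bar> powr (q - 1)"
          using h q by simp
      qed
      have "continuous_on UNIV (\<lambda>h :: real. \<bar>h\<bar> powr (q - 1))"
        using q by (intro continuous_on_powr' continuous_intros) auto
      then have "((\<lambda>h :: real. \<bar>h\<bar> powr (q - 1)) \<longlongrightarrow> \<bar>0\<bar> powr (q - 1)) (at 0)"
        unfolding continuous_on_def by blast
      then show "((\<lambda>h :: real. \<bar>h\<bar> powr (q - 1)) \<longlongrightarrow> 0) (at 0)" using q by simp
    qed
    then show ?thesis using 3 q by (simp add: DERIV_def h'_def)
  qed
qed

text \<open>The point is that t depends on \<open>\<epsilon>\<close> only, so that the inequality
  can be integrated. For a and b in [-1,1] the derivative in t is a difference of two values of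
  \<open>h'\<close> times b, small by uniform continuity; the general case follows by
  homogeneity.\<close>

lemma powr_uniformly_smooth:
  fixes q \<epsilon> :: real
  assumes q: "q > 1" and \<epsilon>: "\<epsilon> > 0"
  obtains t where "0 < t" "\<And>a b :: real. \<bar>a + t * b\<bar> powr q + \<bar>a - t * b\<bar> powr q
    \<le> 2 * \<bar>a\<bar> powr q + \<epsilon> * t * (\<bar>a\<bar> powr q + \<bar>b\<bar> powr q)"
proof -
  define h' where "h' x = q * (max 0 x powr (q - 1) - max 0 (- x) powr (q - 1))" for x :: real
  have der: "((\<lambda>x. \<bar>x\<bar> powr q) has_real_derivative h' x) (at x)" for x
    unfolding h'_def by (rule abs_powr_deriv[OF q])
  have "continuous_on {-2..2} h'" unfolding h'_def[abs_def]
    using q by (intro continuous_on_powr' continuous_intros) auto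
  then have "uniformly_continuous_on {-2..2} h'" by (rule compact_uniformly_continuous) simp
  then obtain d where d: "d > 0" "\<And>x y. x \<in> {-2..2} \<Longrightarrow> y \<in> {-2..2} \<Longrightarrow> dist y x < d \<Longrightarrow> dist (h' y) (h' x) < \<epsilon>"
    using \<epsilon> unfolding uniformly_continuous_on_def by metis
  \<comment> \<open>The arguments a + z b and a - z b are at most 2t apart, which is at most d/2,
    and they stay in [-2,2] since t is at most 1.\<close>
  define t where "t = min 1 (d / 4)"
  have t: "0 < t" "t \<le> 1" "t \<le> d / 4" using d(1) by (auto simp: t_def)
  have unit: "\<bar>a + t * b\<bar> powr q + \<bar>a - t * b\<bar> powr q \<le> 2 * \<bar>a\<bar> powr q + \<epsilon> * t" if ab: "\<bar>a\<bar> \<le> 1" "\<bar>b\<bar> \<le> 1" for a b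
  proof -
    define f where "f u = \<bar>a + u * b\<bar> powr q + \<bar>a - u * b\<bar> powr q" for u
    have df: "(f has_real_derivative h' (a + u * b) * b + h' (a - u * b) * (- b)) (at u)" for u
      unfolding f_def[abs_def]
      by (intro DERIV_add DERIV_chain2[where f = "\<lambda>x. \<bar>x\<bar> powr q", OF der])
         (auto intro!: derivative_eq_intros)
    obtain z where z: "0 < z" "z < t" "f t - f 0 = (t - 0) * (h' (a + z * b) * b + h' (a - z * b) * (- b))"
      using MVT2[OF t(1), of f "\<lambda>u. h' (a + u * b) * b + h' (a - u * b) * (- b)"] df by blast
    have zb: "\<bar>z * b\<bar> \<le> t"
    proof -
      have "\<bar>z\<bar> * \<bar>b\<bar> \<le> t * 1" using z ab(2) by (intro mult_mono) auto
      then show ?thesis by (simp add: abs_mult)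
    qed
    have "dist (h' (a + z * b)) (h' (a - z * b)) < \<epsilon>"
    proof (rule d(2))
      show "a - z * b \<in> {-2..2}" "a + z * b \<in> {-2..2}" using zb ab t(2) by auto
      have "dist (a + z * b) (a - z * b) = 2 * \<bar>z * b\<bar>" by (simp add: dist_real_def abs_mult)
      also have "\<dots> \<le> 2 * t" using zb by simp
      also have "\<dots> < d" using t(3) d(1) by simp
      finally show "dist (a + z * b) (a - z * b) < d" .
    qed
    then have dd: "\<bar>h' (a + z * b) - h' (a - z * b)\<bar> \<le> \<epsilon>" by (simp add: dist_real_def)
    have "h' (a + z * b) * b + h' (a - z * b) * (- b) = (h' (a + z * b) - h' (a - z * b)) * b"
      by (simp add: algebra_simps)
    also have "\<dots> \<le> \<bar>h' (a + z * b) - h' (a - z * b)\<bar> * \<bar>b\<bar>" by (metis abs_ge_self abs_mult)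
    also have "\<dots> \<le> \<epsilon> * 1" using dd ab(2) \<epsilon> by (intro mult_mono) auto
    finally have "t * (h' (a + z * b) * b + h' (a - z * b) * (- b)) \<le> t * \<epsilon>"
      using t(1) by (intro mult_left_mono) auto
    then show ?thesis using z(3) by (simp add: f_def mult.commute)
  qed
  have "\<bar>a + t * b\<bar> powr q + \<bar>a - t * b\<bar> powr q \<le> 2 * \<bar>a\<bar> powr q + \<epsilon> * t * (\<bar>a\<bar> powr q + \<bar>b\<bar> powr q)" for a b
  proof (cases "max \<bar>a\<bar> \<bar>b\<bar> = 0")
    case True
    then have "a = 0" "b = 0" by (auto simp: max_def split: if_splits)
    then show ?thesis by simp
  next
    case False
    define m where "m = max \<bar>a\<bar> \<bar>b\<bar>"
    have m: "m > 0" using False by (auto simp: m_def max_def split: if_splits)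
    have sc: "\<bar>x\<bar> powr q = m powr q * \<bar>x / m\<bar> powr q" for x
      using m by (simp add: powr_mult[symmetric] abs_divide)
    have "\<bar>a / m + t * (b / m)\<bar> powr q + \<bar>a / m - t * (b / m)\<bar> powr q \<le> 2 * \<bar>a / m\<bar> powr q + \<epsilon> * t"
      by (rule unit) (use m in \<open>auto simp: m_def abs_divide\<close>)
    also have "\<dots> \<le> 2 * \<bar>a / m\<bar> powr q + \<epsilon> * t * (\<bar>a / m\<bar> powr q + \<bar>b / m\<bar> powr q)"
    proof -
      \<comment> \<open>After division by the larger modulus one of the two numbers has modulus 1,
        so the additive constant of the normalized case is absorbed.\<close>
      have "\<bar>a / m\<bar> = 1 \<or> \<bar>b / m\<bar> = 1" using m by (auto simp: m_def abs_divide max_def)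
      then have "1 \<le> \<bar>a / m\<bar> powr q + \<bar>b / m\<bar> powr q" by (auto simp del: abs_divide)
      then have "\<epsilon> * t * 1 \<le> \<epsilon> * t * (\<bar>a / m\<bar> powr q + \<bar>b / m\<bar> powr q)"
        using \<epsilon> t(1) by (intro mult_left_mono) auto
      then show ?thesis by simp
    qed
    finally have "m powr q * (\<bar>a / m + t * (b / m)\<bar> powr q + \<bar>a / m - t * (b / m)\<bar> powr q)
      \<le> m powr q * (2 * \<bar>a / m\<bar> powr q + \<epsilon> * t * (\<bar>a / m\<bar> powr q + \<bar>b / m\<bar> powr q))"
      by (rule mult_left_mono) simp
    moreover have "a / m + t * (b / m) = (a + t * b) / m" "a / m - t * (b / m) = (a - t * b) / m"
      by (simp_all add: add_divide_distrib diff_divide_distrib)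
    ultimately show ?thesis
      unfolding sc[of "a + t * b"] sc[of "a - t * b"] sc[of a] sc[of b] by (simp only: distrib_left mult_ac)
  qed
  then show ?thesis using that t(1) by blast
qed

lemma L_int_uniformly_smooth:
  assumes q: "q > 1" and \<epsilon>: "\<epsilon> > 0"
    and t: "\<And>a b :: real. \<bar>a + t * b\<bar> powr q + \<bar>a - t * b\<bar> powr q \<le> 2 * \<bar>a\<bar> powr q + \<epsilon> * t * (\<bar>a\<bar> powr q + \<bar>b\<bar> powr q)"
    and v: "v \<in> L_space q D" and y: "y \<in> L_space q D"
  shows "L_int q D (\<lambda>x. v x + t * y x) + L_int q D (\<lambda>x. v x + (- t) * y x)
    \<le> 2 * L_int q D v + \<epsilon> * t * (L_int q D v + L_int q D y)"
proof -
  have i: "integrable (lebesgue_on D) (\<lambda>x. \<bar>v x\<bar> powr q)" "integrable (lebesgue_on D) (\<lambda>x. \<bar>y x\<bar> powr q)"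
    using v y by (auto simp: L_space_def)
  have i2: "integrable (lebesgue_on D) (\<lambda>x. \<bar>v x + a * y x\<bar> powr q)" for a
    using L_space_add[OF _ v L_space_cmult[OF y, of a]] q by (simp add: L_space_def)
  have "L_int q D (\<lambda>x. v x + t * y x) + L_int q D (\<lambda>x. v x + (- t) * y x)
    = (\<integral>x. \<bar>v x + t * y x\<bar> powr q + \<bar>v x + (- t) * y x\<bar> powr q \<partial>lebesgue_on D)"
    unfolding L_int_def by (rule Bochner_Integration.integral_add[OF i2 i2, symmetric])
  also have "\<dots> \<le> (\<integral>x. 2 * \<bar>v x\<bar> powr q + \<epsilon> * t * (\<bar>v x\<bar> powr q + \<bar>y x\<bar> powr q) \<partial>lebesgue_on D)"
    by (intro integral_mono Bochner_Integration.integrable_add i2 integrable_mult_right i) (use t in simp)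
  also have "\<dots> = 2 * L_int q D v + \<epsilon> * t * (L_int q D v + L_int q D y)"
    using i by (simp add: L_int_def)
  finally show ?thesis .
qed

section \<open>Broken spaces over a mesh\<close>

text \<open>The geometry reduced to its measure-theoretic content: the interiors of the elements lie
  in the domain, are disjoint and cover it up to a null set, and beta is constant and nonzero on
  each of them.\<close>

locale advection_mesh =
  fixes \<Omega> :: "(real ^ 'n::finite) set" and T :: "'n vertices set"
    and \<beta> :: "real ^ 'n \<Rightarrow> real ^ 'n" and q :: real
  assumes finT: "finite T" and inv: "\<And>s. s \<in> T \<Longrightarrow> invertible (aff_matrix s)"
    and bc: "\<And>s. s \<in> T \<Longrightarrow> \<forall>x\<in>interior (elem s). \<beta> x = beta_elem \<beta> s"
    and bne: "\<And>s. s \<in> T \<Longrightarrow> beta_elem \<beta> s \<noteq> 0"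
    and Om: "\<Omega> \<in> lmeasurable"
    and int_sub: "\<And>s. s \<in> T \<Longrightarrow> interior (elem s) \<subseteq> \<Omega>"
    and disj: "\<And>s t. s \<in> T \<Longrightarrow> t \<in> T \<Longrightarrow> s \<noteq> t \<Longrightarrow> interior (elem s) \<inter> interior (elem t) = {}"
    and cover: "AE x in lebesgue. x \<in> \<Omega> \<longrightarrow> (\<exists>s\<in>T. x \<in> interior (elem s))"
    and q1: "q > 1"
begin

abbreviation "Y \<equiv> Y_space T \<beta> q"
abbreviation "db s \<equiv> d_beta \<beta> (elem s)"

lemma Om_sets: "\<Omega> \<in> sets lebesgue"
  using Om by (simp add: fmeasurableD)

lemma AE_elem_iff:
  assumes "s \<in> T"
  shows "(AE x in lebesgue_on (elem s). P x) \<longleftrightarrow> (AE x in lebesgue. x \<in> interior (elem s) \<longrightarrow> P x)"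
proof -
  have K: "elem s \<in> sets lebesgue" by (rule elem_sets[OF inv[OF assms]])
  have i: "AE x in lebesgue. x \<in> elem s \<longrightarrow> x \<in> interior (elem s)"
    using AE_interior[OF inv[OF assms]] by (subst (asm) AE_restrict_space_iff) (use K in auto)
  have "(AE x in lebesgue_on (elem s). P x) \<longleftrightarrow> (AE x in lebesgue. x \<in> elem s \<longrightarrow> P x)"
    by (subst AE_restrict_space_iff) (use K in auto)
  also have "\<dots> \<longleftrightarrow> (AE x in lebesgue. x \<in> interior (elem s) \<longrightarrow> P x)"
  proof
    show "AE x in lebesgue. x \<in> interior (elem s) \<longrightarrow> P x" if "AE x in lebesgue. x \<in> elem s \<longrightarrow> P x"
      using that by eventually_elim (use interior_subset in blast)
    show "AE x in lebesgue. x \<in> elem s \<longrightarrow> P x" if "AE x in lebesgue. x \<in> interior (elem s) \<longrightarrow> P x"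
      using that i by eventually_elim blast
  qed
  finally show ?thesis .
qed

lemma AE_Omega_restrict: "(AE x in lebesgue_on \<Omega>. P x) \<longleftrightarrow> (AE x in lebesgue. x \<in> \<Omega> \<longrightarrow> P x)"
  by (subst AE_restrict_space_iff) (use Om_sets in auto)

lemma AE_Omega_iff: "(AE x in lebesgue_on \<Omega>. P x) \<longleftrightarrow> (\<forall>s\<in>T. AE x in lebesgue_on (elem s). P x)"
proof
  assume a: "AE x in lebesgue_on \<Omega>. P x"
  show "\<forall>s\<in>T. AE x in lebesgue_on (elem s). P x"
  proof
    fix s assume s: "s \<in> T"
    show "AE x in lebesgue_on (elem s). P x"
      unfolding AE_elem_iff[OF s] using a[unfolded AE_Omega_restrict]
      by eventually_elim (use int_sub[OF s] in blast)
  qed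
next
  assume "\<forall>s\<in>T. AE x in lebesgue_on (elem s). P x"
  then have "\<forall>s\<in>T. AE x in lebesgue. x \<in> interior (elem s) \<longrightarrow> P x" by (simp add: AE_elem_iff)
  then have "AE x in lebesgue. \<forall>s\<in>T. x \<in> interior (elem s) \<longrightarrow> P x"
    by (intro AE_finite_allI finT) blast
  with cover show "AE x in lebesgue_on \<Omega>. P x" unfolding AE_Omega_restrict
    by eventually_elim blast
qed

lemma indicator_split:
  "AE x in lebesgue. indicator \<Omega> x *\<^sub>R h x = (\<Sum>s\<in>T. indicator (elem s) x *\<^sub>R (h x :: real))"
proof -
  have "AE x in lebesgue. \<forall>s\<in>T. x \<in> elem s \<longrightarrow> x \<in> interior (elem s)"
  proof (intro AE_finite_allI finT)
    fix s assume s: "s \<in> T"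
    show "AE x in lebesgue. x \<in> elem s \<longrightarrow> x \<in> interior (elem s)"
      using AE_interior[OF inv[OF s]] by (subst (asm) AE_restrict_space_iff) (use elem_sets[OF inv[OF s]] in auto)
  qed
  with cover show ?thesis
  proof eventually_elim
    case (elim x)
    show ?case
    proof (cases "x \<in> \<Omega>")
      case True
      then obtain s where s: "s \<in> T" "x \<in> interior (elem s)" using elim by blast
      have "(\<Sum>t\<in>T. indicator (elem t) x *\<^sub>R h x) = (\<Sum>t\<in>T. if t = s then h x else 0)"
      proof (rule sum.cong[OF refl])
        fix t assume t: "t \<in> T"
        show "indicator (elem t) x *\<^sub>R h x = (if t = s then h x else 0)"
          using s t elim(2) disj[OF t s(1)] interior_subset[of "elem s"] by (cases "t = s") auto
      qed
      also have "\<dots> = h x" using s(1) finT by simp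
      finally show ?thesis using True by simp
    next
      case False
      then have "x \<notin> elem s" if "s \<in> T" for s using elim(2) int_sub[OF that] that by blast
      then show ?thesis using False by simp
    qed
  qed
qed

lemma integral_Omega:
  fixes h :: "real ^ 'n \<Rightarrow> real"
  assumes "\<And>s. s \<in> T \<Longrightarrow> integrable (lebesgue_on (elem s)) h"
  shows "integrable (lebesgue_on \<Omega>) h"
    "(\<integral>x. h x \<partial>lebesgue_on \<Omega>) = (\<Sum>s\<in>T. \<integral>x. h x \<partial>lebesgue_on (elem s))"
proof -
  have i: "integrable lebesgue (\<lambda>x. indicator (elem s) x *\<^sub>R h x)" if "s \<in> T" for s
    using assms[OF that] by (subst (asm) integrable_restrict_space) (use elem_sets[OF inv[OF that]] in auto)
  have i2: "integrable lebesgue (\<lambda>x. \<Sum>s\<in>T. indicator (elem s) x *\<^sub>R h x)"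
    by (rule Bochner_Integration.integrable_sum[OF i])
  have ae: "AE x in lebesgue_on UNIV. indicator \<Omega> x *\<^sub>R h x = (\<Sum>s\<in>T. indicator (elem s) x *\<^sub>R h x)"
    using indicator_split by (simp only: lebesgue_on_UNIV_eq)
  note e = integral_lebesgue_on_cong_AE[OF _ ae, unfolded lebesgue_on_UNIV_eq]
  show "integrable (lebesgue_on \<Omega>) h"
    using i2 e(2) by (subst integrable_restrict_space) (use Om_sets in auto)
  have "(\<integral>x. h x \<partial>lebesgue_on \<Omega>) = (\<integral>x. indicator \<Omega> x *\<^sub>R h x \<partial>lebesgue)"
    by (rule integral_restrict_space) (use Om_sets in auto)
  also have "\<dots> = (\<integral>x. (\<Sum>s\<in>T. indicator (elem s) x *\<^sub>R h x) \<partial>lebesgue)" by (rule e(1)) simp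
  also have "\<dots> = (\<Sum>s\<in>T. \<integral>x. indicator (elem s) x *\<^sub>R h x \<partial>lebesgue)"
    by (rule Bochner_Integration.integral_sum[OF i])
  also have "\<dots> = (\<Sum>s\<in>T. \<integral>x. h x \<partial>lebesgue_on (elem s))"
    by (intro sum.cong refl integral_restrict_space[symmetric]) (use elem_sets inv in auto)
  finally show "(\<integral>x. h x \<partial>lebesgue_on \<Omega>) = (\<Sum>s\<in>T. \<integral>x. h x \<partial>lebesgue_on (elem s))" .
qed

lemma restrict_measurable:
  assumes s: "s \<in> T" and h: "h \<in> borel_measurable (lebesgue_on \<Omega>)"
  shows "(h :: _ \<Rightarrow> real) \<in> borel_measurable (lebesgue_on (elem s))"
proof -
  have "(\<lambda>x. indicator \<Omega> x *\<^sub>R h x) \<in> borel_measurable lebesgue"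
    using h by (subst (asm) borel_measurable_restrict_space_iff) (use Om_sets in auto)
  then have "(\<lambda>x. indicator \<Omega> x *\<^sub>R h x) \<in> borel_measurable (lebesgue_on (elem s))"
    by (rule measurable_restrict_space1)
  moreover have "AE x in lebesgue_on (elem s). indicator \<Omega> x *\<^sub>R h x = h x"
    using AE_interior[OF inv[OF s]] by eventually_elim (use int_sub[OF s] in \<open>auto simp: indicator_def\<close>)
  ultimately show ?thesis by (rule borel_measurable_lebesgue_on_AE[OF elem_sets[OF inv[OF s]]])
qed

lemma restrict_integrable:
  assumes s: "s \<in> T" and h: "integrable (lebesgue_on \<Omega>) h"
  shows "integrable (lebesgue_on (elem s)) (h :: _ \<Rightarrow> real)"
proof -
  have "integrable lebesgue (\<lambda>x. indicator \<Omega> x *\<^sub>R h x)"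
    using h by (subst (asm) integrable_restrict_space) (use Om_sets in auto)
  then have I: "integrable (lebesgue_on (elem s)) (\<lambda>x. indicator \<Omega> x *\<^sub>R h x)"
    by (rule integrable_restrict_space[THEN iffD2, rotated, OF integrable_mult_indicator[rotated]])
       (use elem_sets[OF inv[OF s]] in auto)
  have ae: "AE x in lebesgue_on (elem s). indicator \<Omega> x *\<^sub>R h x = h x"
    using AE_interior[OF inv[OF s]] by eventually_elim (use int_sub[OF s] in \<open>auto simp: indicator_def\<close>)
  show ?thesis
    by (rule integral_lebesgue_on_cong_AE(2)[OF elem_sets[OF inv[OF s]] ae, THEN iffD1, OF I])
qed

lemma L_space_restrict: "s \<in> T \<Longrightarrow> v \<in> L_space r \<Omega> \<Longrightarrow> v \<in> L_space r (elem s)"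
  unfolding L_space_def using restrict_measurable restrict_integrable by blast

lemma W_pair:
  assumes s: "s \<in> T" and r: "r \<ge> 1" and v: "v \<in> W_space \<beta> r (elem s)"
  shows "weak_pair (beta_elem \<beta> s) (elem s) v (db s v)" "v \<in> L_space r (elem s)" "db s v \<in> L_space r (elem s)"
proof -
  obtain g where g: "v \<in> L_space r (elem s)" "g \<in> L_space r (elem s)" "weak_deriv \<beta> (elem s) v g"
    using v by (auto simp: W_space_def)
  have w: "weak_pair (beta_elem \<beta> s) (elem s) v g"
    by (rule weak_deriv_imp_weak_pair[OF inv[OF s] bc[OF s] g(3)])
       (intro L_space_integrable[OF elem_lmeasurable[OF inv[OF s]] r] g)+
  show "weak_pair (beta_elem \<beta> s) (elem s) v (db s v)" by (rule d_beta_pair[OF inv[OF s] bc[OF s] w])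
  show "v \<in> L_space r (elem s)" by fact
  show "db s v \<in> L_space r (elem s)"
    by (rule L_space_cong[OF elem_sets[OF inv[OF s]] g(2)])
       (use d_beta_AE[OF inv[OF s] bc[OF s] w] in \<open>auto elim: eventually_mono\<close>)
qed

lemma W_intro:
  assumes s: "s \<in> T" and "weak_pair (beta_elem \<beta> s) (elem s) v g" "v \<in> L_space r (elem s)" "g \<in> L_space r (elem s)"
  shows "v \<in> W_space \<beta> r (elem s)"
  using assms weak_pair_imp_weak_deriv[OF inv[OF s] bc[OF s]] by (auto simp: W_space_def)

lemma Y_pair:
  assumes "s \<in> T" "v \<in> Y"
  shows "weak_pair (beta_elem \<beta> s) (elem s) v (db s v)" "v \<in> L_space q (elem s)" "db s v \<in> L_space q (elem s)"
  using W_pair[OF assms(1), of q v] assms q1 by (auto simp: Y_space_def)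

lemma Y_intro:
  assumes "\<And>s. s \<in> T \<Longrightarrow> \<exists>g. weak_pair (beta_elem \<beta> s) (elem s) v g \<and> v \<in> L_space q (elem s) \<and> g \<in> L_space q (elem s)"
  shows "v \<in> Y"
  unfolding Y_space_def using assms W_intro by blast

lemma db_add:
  assumes "s \<in> T" "v \<in> Y" "w \<in> Y"
  shows "AE x in lebesgue_on (elem s). db s (\<lambda>x. v x + w x) x = db s v x + db s w x"
  by (rule d_beta_AE[OF inv[OF assms(1)] bc[OF assms(1)] weak_pair_add[OF elem_compact[OF inv[OF assms(1)]]]])
     (use Y_pair assms in auto)

lemma db_cmult:
  assumes "s \<in> T" "v \<in> Y"
  shows "AE x in lebesgue_on (elem s). db s (\<lambda>x. a * v x) x = a * db s v x"
  by (rule d_beta_AE[OF inv[OF assms(1)] bc[OF assms(1)] weak_pair_cmult[OF elem_compact[OF inv[OF assms(1)]]]])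
     (use Y_pair assms in auto)

lemma Y_lin: "lin_space Y"
  unfolding lin_space_def
proof (intro conjI ballI allI)
  show "(\<lambda>x. 0) \<in> Y"
  proof (rule Y_intro)
    fix s assume s: "s \<in> T"
    have "(\<lambda>x. 0) \<in> L_space q (elem s)" by (simp add: L_space_def)
    then show "\<exists>g. weak_pair (beta_elem \<beta> s) (elem s) (\<lambda>x. 0) g \<and> (\<lambda>x. 0) \<in> L_space q (elem s) \<and> g \<in> L_space q (elem s)"
      by (intro exI[of _ "\<lambda>x. 0"]) (simp add: weak_pair_def)
  qed
  fix v assume v: "v \<in> Y"
  show "(\<lambda>x. a * v x) \<in> Y" for a
    by (rule Y_intro) (use v weak_pair_cmult[OF elem_compact[OF inv]] Y_pair L_space_cmult in blast)
  fix w assume w: "w \<in> Y"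
  show "(\<lambda>x. v x + w x) \<in> Y"
  proof (rule Y_intro)
    fix s assume s: "s \<in> T"
    show "\<exists>g. weak_pair (beta_elem \<beta> s) (elem s) (\<lambda>x. v x + w x) g \<and> (\<lambda>x. v x + w x) \<in> L_space q (elem s) \<and> g \<in> L_space q (elem s)"
      using q1 by (intro exI[of _ "\<lambda>x. db s v x + db s w x"] conjI L_space_add weak_pair_add elem_compact[OF inv[OF s]] Y_pair[OF s] v w) auto
  qed
qed

lemma Y_cong:
  assumes v: "v \<in> Y" and ae: "\<And>s. s \<in> T \<Longrightarrow> AE x in lebesgue_on (elem s). v x = w x"
  shows "w \<in> Y" "\<And>s. s \<in> T \<Longrightarrow> AE x in lebesgue_on (elem s). db s v x = db s w x"
proof -
  have wp: "weak_pair (beta_elem \<beta> s) (elem s) w (db s v)" and wL: "w \<in> L_space q (elem s)" if s: "s \<in> T" for s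
  proof -
    show L: "w \<in> L_space q (elem s)"
      by (rule L_space_cong[OF elem_sets[OF inv[OF s]] Y_pair(2)[OF s v] ae[OF s]])
    show "weak_pair (beta_elem \<beta> s) (elem s) w (db s v)"
      by (rule weak_pair_cong[OF Y_pair(1)[OF s v] ae[OF s] _ elem_compact[OF inv[OF s]]])
         (use L Y_pair(3)[OF s v] in \<open>auto simp: L_space_def\<close>)
  qed
  show "w \<in> Y" by (rule Y_intro) (use wp wL Y_pair(3) v in blast)
  show "AE x in lebesgue_on (elem s). db s v x = db s w x" if "s \<in> T" for s
    using d_beta_AE[OF inv[OF that] bc[OF that] wp[OF that]] by eventually_elim simp
qed

definition Y_pow :: "(real ^ 'n \<Rightarrow> real) \<Rightarrow> real" where
  "Y_pow v = (\<Sum>s\<in>T. a_elem \<beta> s powr (- q) * L_int q (elem s) v + L_int q (elem s) (db s v))"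

lemma Y_norm_pow: "Y_norm T \<beta> q v = Y_pow v powr (1 / q)"
  unfolding Y_norm_def Y_pow_def using q1 by (simp add: L_norm_powr)

lemma Y_pow_nonneg: "0 \<le> Y_pow v"
  unfolding Y_pow_def by (intro sum_nonneg add_nonneg_nonneg mult_nonneg_nonneg L_int_nonneg) simp

lemma Y_norm_nonneg: "0 \<le> Y_norm T \<beta> q v"
  by (simp add: Y_norm_pow)

lemma Y_pow_norm: "Y_pow v = Y_norm T \<beta> q v powr q"
  using q1 Y_pow_nonneg[of v] by (simp add: Y_norm_pow powr_powr)

lemma Y_pow_cmult: "v \<in> Y \<Longrightarrow> Y_pow (\<lambda>x. a * v x) = \<bar>a\<bar> powr q * Y_pow v"
  unfolding Y_pow_def sum_distrib_left
proof (rule sum.cong[OF refl])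
  fix s assume v: "v \<in> Y" and s: "s \<in> T"
  have "L_int q (elem s) (db s (\<lambda>x. a * v x)) = L_int q (elem s) (\<lambda>x. a * db s v x)"
    by (rule L_int_cong[OF elem_sets[OF inv[OF s]] db_cmult[OF s v]])
  then show "a_elem \<beta> s powr - q * L_int q (elem s) (\<lambda>x. a * v x) + L_int q (elem s) (db s (\<lambda>x. a * v x))
    = \<bar>a\<bar> powr q * (a_elem \<beta> s powr - q * L_int q (elem s) v + L_int q (elem s) (db s v))"
    by (simp add: L_int_cmult algebra_simps)
qed

lemma Y_norm_cmult: "v \<in> Y \<Longrightarrow> Y_norm T \<beta> q (\<lambda>x. a * v x) = \<bar>a\<bar> * Y_norm T \<beta> q v"
  using q1 by (simp add: Y_norm_pow Y_pow_cmult powr_mult powr_powr)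

lemma a_elem_pos:
  assumes "s \<in> T"
  shows "a_elem \<beta> s > 0"
proof -
  note i = inv[OF assms]
  obtain l :: "'n option" where l: "l \<noteq> None" using exists_other[OF i, of None] by blast
  have "s l \<noteq> s None" using bary_vertex[OF i, of l l] bary_vertex[OF i, of l None] l by auto
  then have "0 < dist (s l) (s None)" by simp
  also have "\<dots> \<le> diameter (elem s)"
    by (rule diameter_bounded_bound[OF compact_imp_bounded[OF elem_compact[OF i]]]) (intro vertex_in_elem[OF i])+
  finally show ?thesis using bne[OF assms] by (simp add: a_elem_def)
qed

lemma L_int_le_Y_pow:
  assumes s: "s \<in> T"
  shows "L_int q (elem s) v \<le> a_elem \<beta> s powr q * Y_pow v" "L_int q (elem s) (db s v) \<le> Y_pow v"
proof -
  have t: "a_elem \<beta> s powr (- q) * L_int q (elem s) v + L_int q (elem s) (db s v) \<le> Y_pow v"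
    unfolding Y_pow_def
    by (rule member_le_sum[OF s _ finT]) (intro add_nonneg_nonneg mult_nonneg_nonneg L_int_nonneg, simp)
  have n: "0 \<le> a_elem \<beta> s powr (- q) * L_int q (elem s) v" by (intro mult_nonneg_nonneg L_int_nonneg) simp
  show "L_int q (elem s) (db s v) \<le> Y_pow v" using t n by linarith
  have "a_elem \<beta> s powr (- q) * L_int q (elem s) v \<le> Y_pow v" using t L_int_nonneg[of q "elem s" "db s v"] by linarith
  then have "a_elem \<beta> s powr q * (a_elem \<beta> s powr (- q) * L_int q (elem s) v) \<le> a_elem \<beta> s powr q * Y_pow v"
    by (intro mult_left_mono) auto
  moreover have "a_elem \<beta> s powr q * a_elem \<beta> s powr (- q) = 1"
    using a_elem_pos[OF s] by (simp add: powr_add[symmetric])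
  ultimately show "L_int q (elem s) v \<le> a_elem \<beta> s powr q * Y_pow v" by (simp add: mult.assoc[symmetric])
qed

lemma Y_norm_zero_iff:
  assumes v: "v \<in> Y"
  shows "Y_norm T \<beta> q v = 0 \<longleftrightarrow> (AE x in lebesgue_on \<Omega>. v x = 0)"
proof
  assume "Y_norm T \<beta> q v = 0"
  then have z: "Y_pow v = 0" using Y_pow_norm by simp
  show "AE x in lebesgue_on \<Omega>. v x = 0"
    unfolding AE_Omega_iff
  proof
    fix s assume s: "s \<in> T"
    have "L_int q (elem s) v = 0"
      using L_int_le_Y_pow(1)[OF s, of v] L_int_nonneg[of q "elem s" v] by (simp add: z)
    then show "AE x in lebesgue_on (elem s). v x = 0" by (rule L_int_eq_0[OF Y_pair(2)[OF s v]])
  qed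
next
  assume "AE x in lebesgue_on \<Omega>. v x = 0"
  then have ae: "AE x in lebesgue_on (elem s). v x = 0 * v x" if "s \<in> T" for s
    using that unfolding AE_Omega_iff by simp
  have "Y_pow v = Y_pow (\<lambda>x. 0 * v x)"
    unfolding Y_pow_def
    by (intro sum.cong refl arg_cong2[of _ _ _ _ "(+)"] arg_cong2[of _ _ _ _ "(*)"] L_int_cong
        elem_sets inv ae Y_cong(2)[OF v, of "\<lambda>x. 0 * v x"])
  also have "\<dots> = 0" using Y_pow_cmult[OF v, of 0] by simp
  finally show "Y_norm T \<beta> q v = 0" by (simp add: Y_norm_pow)
qed

lemma Y_pow_uniformly_smooth:
  assumes e: "\<epsilon> > 0"
  obtains t where "t > 0" "\<And>v y. v \<in> Y \<Longrightarrow> y \<in> Y \<Longrightarrow>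
    Y_pow (\<lambda>x. v x + t * y x) + Y_pow (\<lambda>x. v x + (- t) * y x) \<le> 2 * Y_pow v + \<epsilon> * t * (Y_pow v + Y_pow y)"
proof -
  obtain t where t: "0 < t" "\<And>a b :: real. \<bar>a + t * b\<bar> powr q + \<bar>a - t * b\<bar> powr q
    \<le> 2 * \<bar>a\<bar> powr q + \<epsilon> * t * (\<bar>a\<bar> powr q + \<bar>b\<bar> powr q)" using powr_uniformly_smooth[OF q1 e] by blast
  have "Y_pow (\<lambda>x. v x + t * y x) + Y_pow (\<lambda>x. v x + (- t) * y x) \<le> 2 * Y_pow v + \<epsilon> * t * (Y_pow v + Y_pow y)"
    if v: "v \<in> Y" and y: "y \<in> Y" for v y
  proof -
    let ?a = "\<lambda>s. a_elem \<beta> s powr (- q)"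
    have db: "L_int q (elem s) (db s (\<lambda>x. v x + a * y x)) = L_int q (elem s) (\<lambda>x. db s v x + a * db s y x)"
      if s: "s \<in> T" for s a
    proof (rule L_int_cong[OF elem_sets[OF inv[OF s]]])
      show "AE x in lebesgue_on (elem s). db s (\<lambda>x. v x + a * y x) x = db s v x + a * db s y x"
        using db_add[OF s v lin_spaceD(3)[OF Y_lin y, of a]] db_cmult[OF s y, of a] by eventually_elim simp
    qed
    have "(?a s * L_int q (elem s) (\<lambda>x. v x + t * y x) + L_int q (elem s) (db s (\<lambda>x. v x + t * y x)))
       + (?a s * L_int q (elem s) (\<lambda>x. v x + (- t) * y x) + L_int q (elem s) (db s (\<lambda>x. v x + (- t) * y x)))
      \<le> 2 * (?a s * L_int q (elem s) v + L_int q (elem s) (db s v))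
       + \<epsilon> * t * ((?a s * L_int q (elem s) v + L_int q (elem s) (db s v)) + (?a s * L_int q (elem s) y + L_int q (elem s) (db s y)))"
      (is "?l1 + ?l2 \<le> ?r") if s: "s \<in> T" for s
    proof -
      have 1: "?a s * (L_int q (elem s) (\<lambda>x. v x + t * y x) + L_int q (elem s) (\<lambda>x. v x + (- t) * y x))
        \<le> ?a s * (2 * L_int q (elem s) v + \<epsilon> * t * (L_int q (elem s) v + L_int q (elem s) y))"
        by (intro mult_left_mono L_int_uniformly_smooth[OF q1 e t(2)] Y_pair[OF s] v y) simp
      have 2: "L_int q (elem s) (\<lambda>x. db s v x + t * db s y x) + L_int q (elem s) (\<lambda>x. db s v x + (- t) * db s y x)
        \<le> 2 * L_int q (elem s) (db s v) + \<epsilon> * t * (L_int q (elem s) (db s v) + L_int q (elem s) (db s y))"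
        by (intro L_int_uniformly_smooth[OF q1 e t(2)] Y_pair[OF s] v y)
      show ?thesis using add_mono[OF 1 2] unfolding db[OF s] by (simp only: algebra_simps)
    qed
    then have "(\<Sum>s\<in>T. (?a s * L_int q (elem s) (\<lambda>x. v x + t * y x) + L_int q (elem s) (db s (\<lambda>x. v x + t * y x)))
       + (?a s * L_int q (elem s) (\<lambda>x. v x + (- t) * y x) + L_int q (elem s) (db s (\<lambda>x. v x + (- t) * y x))))
      \<le> (\<Sum>s\<in>T. 2 * (?a s * L_int q (elem s) v + L_int q (elem s) (db s v))
       + \<epsilon> * t * ((?a s * L_int q (elem s) v + L_int q (elem s) (db s v)) + (?a s * L_int q (elem s) y + L_int q (elem s) (db s y))))"
      by (rule sum_mono)
    then show ?thesis by (simp only: Y_pow_def sum.distrib sum_distrib_left[symmetric])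
  qed
  then show ?thesis using that t(1) by blast
qed

section \<open>Bounded functionals and dual norms\<close>

text \<open>Linearity and boundedness concern arguments in Y alone: off Y the functional
  \<open>D_h\<close> has an unspecified value.\<close>

definition bfun :: "((real ^ 'n \<Rightarrow> real) \<Rightarrow> real) \<Rightarrow> bool" where
  "bfun g \<longleftrightarrow> lin_on Y g \<and> (\<exists>C. \<forall>v\<in>Y. \<bar>g v\<bar> \<le> C * Y_norm T \<beta> q v)"

text \<open>Scaling v to norm 1 turns the estimate with the q-th power into the constant A + B. If v
  has norm 0, all its multiples obey the bound A, which forces \<open>g v\<close> to be 0.\<close>

lemma bfun_intro:
  assumes g: "lin_on Y g" and b: "\<And>v. v \<in> Y \<Longrightarrow> \<bar>g v\<bar> \<le> A + B * Y_pow v"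
  shows "bfun g"
proof -
  have "\<bar>g v\<bar> \<le> (A + B) * Y_norm T \<beta> q v" if v: "v \<in> Y" for v
  proof (cases "Y_norm T \<beta> q v = 0")
    case True
    then have z: "Y_pow (\<lambda>x. a * v x) = 0" for a using Y_pow_cmult[OF v, of a] Y_pow_norm[of v] by simp
    have "\<bar>a\<bar> * \<bar>g v\<bar> \<le> A" for a
      using b[OF lin_spaceD(3)[OF Y_lin v, of a]] lin_onD(2)[OF g v, of a] by (simp add: z abs_mult)
    then have A: "\<bar>0\<bar> * \<bar>g v\<bar> \<le> A" "\<bar>(A + 1) / g v\<bar> * \<bar>g v\<bar> \<le> A" by blast+
    have "g v = 0"
    proof (rule ccontr)
      assume "g v \<noteq> 0"
      then have "\<bar>A + 1\<bar> \<le> A" using A(2) by (simp add: abs_divide)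
      then show False by linarith
    qed
    then show ?thesis using True by simp
  next
    case False
    then have n: "Y_norm T \<beta> q v > 0" using Y_norm_nonneg[of v] by linarith
    define a where "a = 1 / Y_norm T \<beta> q v"
    have "\<bar>a\<bar> * Y_norm T \<beta> q v = 1" using n by (simp add: a_def)
    then have "Y_norm T \<beta> q (\<lambda>x. a * v x) = 1" by (simp only: Y_norm_cmult[OF v])
    then have "Y_pow (\<lambda>x. a * v x) = 1" by (simp add: Y_pow_norm)
    then have "\<bar>a * g v\<bar> \<le> A + B"
      using b[OF lin_spaceD(3)[OF Y_lin v, of a]] lin_onD(2)[OF g v, of a] by simp
    then show ?thesis using n by (simp add: a_def abs_mult field_simps)
  qed
  then show ?thesis using g unfolding bfun_def by blast
qed

lemma bfun_comb:
  assumes "bfun g" "bfun h"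
  shows "bfun (\<lambda>v. a * g v + b * h v)"
proof -
  obtain C where C: "\<And>v. v \<in> Y \<Longrightarrow> \<bar>g v\<bar> \<le> C * Y_norm T \<beta> q v" using assms(1) unfolding bfun_def by blast
  obtain D where D: "\<And>v. v \<in> Y \<Longrightarrow> \<bar>h v\<bar> \<le> D * Y_norm T \<beta> q v" using assms(2) unfolding bfun_def by blast
  have "\<bar>a * g v + b * h v\<bar> \<le> (\<bar>a\<bar> * C + \<bar>b\<bar> * D) * Y_norm T \<beta> q v" if v: "v \<in> Y" for v
  proof -
    have "\<bar>a * g v + b * h v\<bar> \<le> \<bar>a\<bar> * \<bar>g v\<bar> + \<bar>b\<bar> * \<bar>h v\<bar>"
      using abs_triangle_ineq[of "a * g v" "b * h v"] by (simp add: abs_mult)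
    also have "\<dots> \<le> \<bar>a\<bar> * (C * Y_norm T \<beta> q v) + \<bar>b\<bar> * (D * Y_norm T \<beta> q v)"
      by (intro add_mono mult_left_mono C D v) auto
    finally show ?thesis by (simp add: algebra_simps)
  qed
  moreover have "lin_on Y (\<lambda>v. a * g v + b * h v)"
    using assms unfolding bfun_def lin_on_def by (auto simp: algebra_simps)
  ultimately show ?thesis unfolding bfun_def by blast
qed

lemma bfun_cong: "bfun g \<Longrightarrow> (\<And>v. v \<in> Y \<Longrightarrow> h v = g v) \<Longrightarrow> bfun h"
proof -
  assume g: "bfun g" and e: "\<And>v. v \<in> Y \<Longrightarrow> h v = g v"
  have "lin_on Y g" using g by (simp add: bfun_def)
  then have "lin_on Y h" unfolding lin_on_def by (simp add: e lin_spaceD[OF Y_lin])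
  then show "bfun h" using g unfolding bfun_def by (simp add: e)
qed

lemma bfun_diff: "bfun g \<Longrightarrow> bfun h \<Longrightarrow> bfun (\<lambda>v. g v - h v)"
  using bfun_comb[of g h 1 "-1"] by simp

lemma bfun_add: "bfun g \<Longrightarrow> bfun h \<Longrightarrow> bfun (\<lambda>v. g v + h v)"
  using bfun_comb[of g h 1 1] by simp

lemma bfun_zero: "bfun (\<lambda>v. 0)"
  unfolding bfun_def lin_on_def by (auto intro!: exI[of _ 0])

lemma bfun_sum: "(\<And>i. i \<in> I \<Longrightarrow> bfun (g i)) \<Longrightarrow> bfun (\<lambda>v. \<Sum>i\<in>I. g i v)"
  by (induction I rule: infinite_finite_induct) (auto intro: bfun_zero bfun_add)

lemma bfun_AE_zero:
  assumes "bfun g" "v \<in> Y" "AE x in lebesgue_on \<Omega>. v x = 0"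
  shows "g v = 0"
proof -
  obtain C where "\<bar>g v\<bar> \<le> C * Y_norm T \<beta> q v" using assms(1,2) unfolding bfun_def by blast
  moreover have "Y_norm T \<beta> q v = 0" using Y_norm_zero_iff[OF assms(2)] assms(3) by blast
  ultimately show ?thesis by simp
qed

lemma Y_norm_pos: "v \<in> Y \<Longrightarrow> \<not> (AE x in lebesgue_on \<Omega>. v x = 0) \<Longrightarrow> Y_norm T \<beta> q v > 0"
  using Y_norm_zero_iff[of v] Y_norm_nonneg[of v] by (simp add: order_less_le)

abbreviation "dn S g \<equiv> dual_norm \<Omega> T \<beta> q S g"

text \<open>Ensures that the supremum in \<open>dual_norm\<close> runs over a nonempty set.\<close>

definition nontrivial :: "(real ^ 'n \<Rightarrow> real) set \<Rightarrow> bool" where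
  "nontrivial S \<longleftrightarrow> (\<exists>v\<in>S. \<not> (AE x in lebesgue_on \<Omega>. v x = 0))"

lemma dn_upper:
  assumes g: "bfun g" and S: "S \<subseteq> Y" and v: "v \<in> S"
  shows "g v \<le> dn S g * Y_norm T \<beta> q v"
proof (cases "AE x in lebesgue_on \<Omega>. v x = 0")
  case True
  have vY: "v \<in> Y" using v S by blast
  have "g v = 0" by (rule bfun_AE_zero[OF g vY True])
  moreover have "Y_norm T \<beta> q v = 0" using Y_norm_zero_iff[OF vY] True by blast
  ultimately show ?thesis by simp
next
  case False
  obtain C where C: "\<And>v. v \<in> Y \<Longrightarrow> \<bar>g v\<bar> \<le> C * Y_norm T \<beta> q v" using g unfolding bfun_def by blast
  have pos: "Y_norm T \<beta> q w > 0" if "w \<in> S" "\<not> (AE x in lebesgue_on \<Omega>. w x = 0)" for w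
    using that S by (intro Y_norm_pos) auto
  have "g v / Y_norm T \<beta> q v \<le> dn S g"
    unfolding dual_norm_def
  proof (rule cSUP_upper)
    show "bdd_above ((\<lambda>v. g v / Y_norm T \<beta> q v) ` {v \<in> S. \<not> (AE x in lebesgue_on \<Omega>. v x = 0)})"
    proof (rule bdd_aboveI2)
      fix w assume w: "w \<in> {v \<in> S. \<not> (AE x in lebesgue_on \<Omega>. v x = 0)}"
      then have "g w \<le> C * Y_norm T \<beta> q w" using C[of w] S by auto
      then show "g w / Y_norm T \<beta> q w \<le> C" using pos[of w] w by (simp add: divide_le_eq)
    qed
  qed (use v False in auto)
  then show ?thesis using pos[OF v False] by (simp add: divide_le_eq)
qed

lemma dn_least:
  assumes S: "S \<subseteq> Y" "nontrivial S" and M: "\<And>v. v \<in> S \<Longrightarrow> g v \<le> M * Y_norm T \<beta> q v"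
  shows "dn S g \<le> M"
  unfolding dual_norm_def
proof (rule cSUP_least)
  show "{v \<in> S. \<not> (AE x in lebesgue_on \<Omega>. v x = 0)} \<noteq> {}" using S(2) by (auto simp: nontrivial_def)
  fix w assume w: "w \<in> {v \<in> S. \<not> (AE x in lebesgue_on \<Omega>. v x = 0)}"
  then have "Y_norm T \<beta> q w > 0"
    using S by (intro Y_norm_pos) auto
  then show "g w / Y_norm T \<beta> q w \<le> M" using M[of w] w by (simp add: divide_le_eq)
qed

lemma dn_abs:
  assumes g: "bfun g" and S: "S \<subseteq> Y" "lin_space S" and v: "v \<in> S"
  shows "\<bar>g v\<bar> \<le> dn S g * Y_norm T \<beta> q v"
proof -
  have m: "(\<lambda>x. (- 1) * v x) \<in> S" by (rule lin_spaceD(3)[OF S(2) v])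
  have vY: "v \<in> Y" using v S by blast
  have "g (\<lambda>x. (- 1) * v x) = - g v" using g lin_onD(2)[of Y g v "-1"] vY unfolding bfun_def by simp
  moreover have "Y_norm T \<beta> q (\<lambda>x. (- 1) * v x) = Y_norm T \<beta> q v" using Y_norm_cmult[OF vY, of "-1"] by simp
  ultimately have "- g v \<le> dn S g * Y_norm T \<beta> q v" using dn_upper[OF g S(1) m] by simp
  then show ?thesis using dn_upper[OF g S(1) v] by linarith
qed

lemma dn_nonneg:
  assumes g: "bfun g" and S: "S \<subseteq> Y" "lin_space S" "nontrivial S"
  shows "0 \<le> dn S g"
proof -
  obtain v where v: "v \<in> S" "\<not> (AE x in lebesgue_on \<Omega>. v x = 0)" using S(3) by (auto simp: nontrivial_def)
  then have "Y_norm T \<beta> q v > 0"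
    using S(1) by (intro Y_norm_pos) auto
  moreover have "0 \<le> dn S g * Y_norm T \<beta> q v" using dn_abs[OF g S(1,2) v(1)] by linarith
  ultimately show ?thesis by (simp add: zero_le_mult_iff)
qed

end

context advection_mesh
begin

section \<open>Residual minimization in a finite-dimensional dual norm\<close>

lemma fin_dim_lin: "fin_dim_space \<Omega> S \<Longrightarrow> lin_space S"
  unfolding fin_dim_space_def lin_space_def by blast

text \<open>Finite-dimensional test spaces are spanned only up to null sets, which bounded
  functionals do not see; so finitely many values determine such a functional on the whole test
  space.\<close>

lemma bfun_combination:
  assumes h: "bfun h" and B: "B \<subseteq> Y" and v: "v \<in> Y"
    and ae: "AE x in lebesgue_on \<Omega>. v x = (\<Sum>b\<in>B. c b * b x)"
  shows "h v = (\<Sum>b\<in>B. c b * h b)"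
proof -
  have hl: "lin_on Y h" using h by (simp add: bfun_def)
  have w: "(\<lambda>x. \<Sum>b\<in>B. c b * b x) \<in> Y" by (rule lin_space_sum[OF Y_lin]) (use B in blast)
  have "h (\<lambda>x. v x - 1 * (\<Sum>b\<in>B. c b * b x)) = 0"
    by (rule bfun_AE_zero[OF h lin_space_diff[OF Y_lin v w]]) (use ae in \<open>auto elim: eventually_mono\<close>)
  then have "h v = h (\<lambda>x. \<Sum>b\<in>B. c b * b x)" using lin_on_diff[OF Y_lin hl v w, of 1] by simp
  also have "\<dots> = (\<Sum>b\<in>B. c b * h b)" by (rule lin_on_sum[OF Y_lin hl]) (use B in blast)
  finally show ?thesis .
qed

context
  fixes Yh :: "(real ^ 'n \<Rightarrow> real) set" and G :: "((real ^ 'n \<Rightarrow> real) \<Rightarrow> real) set"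
    and lf :: "(real ^ 'n \<Rightarrow> real) \<Rightarrow> real"
  assumes Yh: "fin_dim_space \<Omega> Yh" "Yh \<subseteq> Y" "nontrivial Yh"
    and G: "lin_space G" "\<And>g. g \<in> G \<Longrightarrow> bfun g" and ell: "bfun lf"
begin

text \<open>Along a minimizing sequence the values on a finite generating set of the test space are
  bounded, so a subsequence of them converges. The limits are again the values of some element of G
  by \<open>finite_dim_closed\<close>, and this element attains the infimum.\<close>

lemma residual_minimizer_exists:
  "\<exists>g\<in>G. \<forall>g'\<in>G. dn Yh (\<lambda>v. lf v - g v) \<le> dn Yh (\<lambda>v. lf v - g' v)"
proof -
  note lin = fin_dim_lin[OF Yh(1)]
  define R where "R g = dn Yh (\<lambda>v. lf v - g v)" for g
  have res: "bfun (\<lambda>v. lf v - g v)" if "g \<in> G" for g by (rule bfun_diff[OF ell G(2)[OF that]])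
  have R0: "0 \<le> R g" if "g \<in> G" for g unfolding R_def by (rule dn_nonneg[OF res[OF that] Yh(2) lin Yh(3)])
  have Gne: "G \<noteq> {}" using lin_spaceD(1)[OF G(1)] by blast
  have bdd: "bdd_below (R ` G)" by (rule bdd_belowI2[of _ 0]) (rule R0)
  define m where "m = (INF g\<in>G. R g)"
  have "\<exists>g\<in>G. R g < m + 1 / real (Suc n)" for n
    using cINF_less_iff[OF Gne bdd, of "m + 1 / real (Suc n)"] by (simp add: m_def)
  then obtain g where g: "\<And>n. g n \<in> G" "\<And>n. R (g n) < m + 1 / real (Suc n)" by metis
  obtain B where B: "B \<subseteq> Yh" "finite B" "\<And>v. v \<in> Yh \<Longrightarrow> \<exists>c. AE x in lebesgue_on \<Omega>. v x = (\<Sum>b\<in>B. c b * b x)"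
    using Yh(1) unfolding fin_dim_space_def by blast
  have BY: "B \<subseteq> Y" using B(1) Yh(2) by blast
  have "bounded (range (\<lambda>n. g n b))" if b: "b \<in> B" for b
    unfolding bounded_iff
  proof (intro exI ballI)
    fix y assume "y \<in> range (\<lambda>n. g n b)"
    then obtain n where y: "y = g n b" by blast
    have bY: "b \<in> Yh" using b B(1) by blast
    have "\<bar>lf b - g n b\<bar> \<le> R (g n) * Y_norm T \<beta> q b"
      unfolding R_def by (rule dn_abs[OF res[OF g(1)] Yh(2) lin bY])
    also have "\<dots> \<le> (m + 1) * Y_norm T \<beta> q b"
    proof (rule mult_right_mono[OF _ Y_norm_nonneg])
      have "1 / real (Suc n) \<le> 1" by simp
      then show "R (g n) \<le> m + 1" using g(2)[of n] by linarith
    qed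
    finally show "norm y \<le> \<bar>lf b\<bar> + (m + 1) * Y_norm T \<beta> q b" unfolding y real_norm_def by linarith
  qed
  then obtain r l where r: "strict_mono r" "\<And>b. b \<in> B \<Longrightarrow> (\<lambda>n. g (r n) b) \<longlonglongrightarrow> l b"
    using bounded_family_subsequence[OF B(2), of g] by blast
  have "\<exists>h\<in>G. \<forall>b\<in>B. h b = l b"
    by (rule finite_dim_closed[OF G(1) B(2), where F = "\<lambda>b g. g b" and f = "\<lambda>n. g (r n)"])
       (use g(1) r(2) in \<open>auto simp: lin_on_def\<close>)
  then obtain h where h: "h \<in> G" "\<And>b. b \<in> B \<Longrightarrow> h b = l b" by blast
  have "R h \<le> m"
    unfolding R_def
  proof (rule dn_least[OF Yh(2,3)])
    fix v assume v: "v \<in> Yh"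
    have vY: "v \<in> Y" using v Yh(2) by blast
    obtain c where c: "AE x in lebesgue_on \<Omega>. v x = (\<Sum>b\<in>B. c b * b x)" using B(3)[OF v] by blast
    have e: "g' v = (\<Sum>b\<in>B. c b * g' b)" if "g' \<in> G" for g' by (rule bfun_combination[OF G(2)[OF that] BY vY c])
    have "(\<lambda>n. \<Sum>b\<in>B. c b * g (r n) b) \<longlonglongrightarrow> (\<Sum>b\<in>B. c b * l b)" by (intro tendsto_intros r(2))
    then have lim: "(\<lambda>n. g (r n) v) \<longlonglongrightarrow> h v" unfolding e[OF g(1)] e[OF h(1)] using h(2) by simp
    have "(\<lambda>n. (m + inverse (real (Suc (r n)))) * Y_norm T \<beta> q v) \<longlonglongrightarrow> (m + 0) * Y_norm T \<beta> q v"
      using LIMSEQ_subseq_LIMSEQ[OF LIMSEQ_inverse_real_of_nat r(1)]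
      by (intro tendsto_intros) (simp add: o_def)
    moreover have "lf v - g (r n) v \<le> (m + inverse (real (Suc (r n)))) * Y_norm T \<beta> q v" for n
    proof -
      have "lf v - g (r n) v \<le> R (g (r n)) * Y_norm T \<beta> q v"
        unfolding R_def by (rule dn_upper[OF res[OF g(1)] Yh(2) v])
      also have "\<dots> \<le> (m + inverse (real (Suc (r n)))) * Y_norm T \<beta> q v"
        using g(2)[of "r n"] by (intro mult_right_mono[OF _ Y_norm_nonneg]) (simp add: inverse_eq_divide)
      finally show ?thesis .
    qed
    ultimately show "lf v - h v \<le> m * Y_norm T \<beta> q v"
      using LIMSEQ_le[OF tendsto_diff[OF tendsto_const lim, of "lf v"]] by fastforce
  qed
  moreover have "m \<le> R g'" if "g' \<in> G" for g' unfolding m_def by (rule cINF_lower[OF bdd that])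
  ultimately show ?thesis using h(1) unfolding R_def by (meson order_trans)
qed

text \<open>
  The midpoint of two minimizers is again one, so both residuals nearly attain their norm at a common unit
  vector \<open>v\<close>. Moving \<open>v\<close> by \<open>t * y\<close> and \<open>- t * y\<close> changes the sum of the norms by \<open>o(t)\<close>
  only, which forces the residuals to agree on \<open>y\<close>.
\<close>

lemma residual_minimizer_unique_le:
  assumes g: "g \<in> G" "\<And>k. k \<in> G \<Longrightarrow> dn Yh (\<lambda>v. lf v - g v) \<le> dn Yh (\<lambda>v. lf v - k v)"
    and h: "h \<in> G" "\<And>k. k \<in> G \<Longrightarrow> dn Yh (\<lambda>v. lf v - h v) \<le> dn Yh (\<lambda>v. lf v - k v)"
    and y: "y \<in> Yh"
  shows "h y \<le> g y"
proof -
  note lin = fin_dim_lin[OF Yh(1)]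
  define r where "r = (\<lambda>v. lf v - g v)"
  define r' where "r' = (\<lambda>v. lf v - h v)"
  define \<mu> where "\<mu> = dn Yh r"
  have rb: "bfun r" "bfun r'" unfolding r_def r'_def by (intro bfun_diff ell G(2) g(1) h(1))+
  have \<mu>': "dn Yh r' = \<mu>" unfolding \<mu>_def r_def r'_def using g(2)[OF h(1)] h(2)[OF g(1)] by linarith
  have \<mu>0: "0 \<le> \<mu>" unfolding \<mu>_def by (rule dn_nonneg[OF rb(1) Yh(2) lin Yh(3)])
  define mid where "mid = (\<lambda>v. (1 / 2) * g v + (1 / 2) * h v)"
  have midG: "mid \<in> G" unfolding mid_def by (intro lin_spaceD[OF G(1)] g(1) h(1))
  have mide: "(\<lambda>v. lf v - mid v) = (\<lambda>v. (r v + r' v) / 2)"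
    unfolding mid_def r_def r'_def by (auto simp: field_simps)
  have mdn: "\<mu> \<le> dn Yh (\<lambda>v. (r v + r' v) / 2)"
    using g(2)[OF midG] unfolding mide \<mu>_def r_def[symmetric] .
  have yY: "y \<in> Y" using y Yh(2) by blast
  have key: "r y - r' y \<le> \<mu> * \<epsilon> * (1 + Y_pow y)" if \<epsilon>: "\<epsilon> > 0" for \<epsilon>
  proof -
    obtain t where t: "t > 0" and sm: "\<And>v y. v \<in> Y \<Longrightarrow> y \<in> Y \<Longrightarrow>
      Y_pow (\<lambda>x. v x + t * y x) + Y_pow (\<lambda>x. v x + (- t) * y x) \<le> 2 * Y_pow v + \<epsilon> * t * (Y_pow v + Y_pow y)"
      using Y_pow_uniformly_smooth[OF \<epsilon>] by blast
    \<comment> \<open>The supremum defining the norm is approached up to \<open>\<delta>\<close>. As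
      t is fixed already, \<open>\<delta>\<close> can tend to 0 before the inequality is divided by
      t.\<close>
    have d: "t * (r y - r' y) \<le> \<mu> * (\<epsilon> * t * (1 + Y_pow y)) + 2 * \<delta>" if \<delta>: "\<delta> > 0" for \<delta>
    proof -
      have "\<exists>v\<in>Yh. (\<mu> - \<delta>) * Y_norm T \<beta> q v < (r v + r' v) / 2"
      proof (rule ccontr)
        assume "\<not> ?thesis"
        then have "dn Yh (\<lambda>v. (r v + r' v) / 2) \<le> \<mu> - \<delta>"
          by (intro dn_least[OF Yh(2,3)]) (auto simp: not_less)
        then show False using mdn \<delta> by linarith
      qed
      then obtain v0 where v0: "v0 \<in> Yh" "(\<mu> - \<delta>) * Y_norm T \<beta> q v0 < (r v0 + r' v0) / 2" by blast
      have v0Y: "v0 \<in> Y" using v0(1) Yh(2) by blast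
      have n0: "Y_norm T \<beta> q v0 > 0"
      proof (rule Y_norm_pos[OF v0Y], rule notI)
        assume ae: "AE x in lebesgue_on \<Omega>. v0 x = 0"
        have "r v0 = 0" "r' v0 = 0" by (intro bfun_AE_zero[OF _ v0Y ae] rb)+
        moreover have "Y_norm T \<beta> q v0 = 0" using Y_norm_zero_iff[OF v0Y] ae by blast
        ultimately show False using v0(2) by simp
      qed
      \<comment> \<open>Normalization gives \<open>Y_pow v\<close> the value 1, where the linear
        bound \<open>bern\<close> for the root is sharp.\<close>
      define a where "a = 1 / Y_norm T \<beta> q v0"
      have a: "a > 0" using n0 by (simp add: a_def)
      define v where "v = (\<lambda>x. a * v0 x)"
      have v: "v \<in> Yh" unfolding v_def by (rule lin_spaceD(3)[OF lin v0(1)])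
      have vY: "v \<in> Y" using v Yh(2) by blast
      have "\<bar>a\<bar> * Y_norm T \<beta> q v0 = 1" using n0 by (simp add: a_def)
      then have "Y_norm T \<beta> q v = 1" unfolding v_def by (simp only: Y_norm_cmult[OF v0Y])
      then have Yv: "Y_pow v = 1" by (simp add: Y_pow_norm)
      have rl: "lin_on Y r" "lin_on Y r'" using rb by (auto simp: bfun_def)
      have rv: "r v = a * r v0" "r' v = a * r' v0" unfolding v_def
        by (rule lin_onD(2)[OF rl(1) v0Y], rule lin_onD(2)[OF rl(2) v0Y])
      have "a * ((\<mu> - \<delta>) * Y_norm T \<beta> q v0) < a * ((r v0 + r' v0) / 2)" by (rule mult_strict_left_mono[OF v0(2) a])
      moreover have "a * ((\<mu> - \<delta>) * Y_norm T \<beta> q v0) = \<mu> - \<delta>" using n0 by (simp add: a_def)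
      moreover have "a * ((r v0 + r' v0) / 2) = (r v + r' v) / 2" unfolding rv by (simp add: distrib_left)
      ultimately have "\<mu> - \<delta> < (r v + r' v) / 2" by (simp only:)
      then have low: "2 * (\<mu> - \<delta>) < r v + r' v" by simp
      have ty: "(\<lambda>x. b * y x) \<in> Yh" for b by (rule lin_spaceD(3)[OF lin y])
      have vt: "(\<lambda>x. v x + b * y x) \<in> Yh" for b by (rule lin_spaceD(2)[OF lin v ty])
      have rsum: "r'' (\<lambda>x. v x + b * y x) = r'' v + b * r'' y" if "lin_on Y r''" for r'' b
        using lin_onD(1)[OF that vY lin_spaceD(3)[OF Y_lin yY, of b]] lin_onD(2)[OF that yY] by simp
      have up1: "r v + t * r y \<le> \<mu> * Y_norm T \<beta> q (\<lambda>x. v x + t * y x)"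
        using dn_upper[OF rb(1) Yh(2) vt[of t]] unfolding rsum[OF rl(1)] \<mu>_def .
      have up2: "r' v + (- t) * r' y \<le> \<mu> * Y_norm T \<beta> q (\<lambda>x. v x + (- t) * y x)"
        using dn_upper[OF rb(2) Yh(2) vt[of "- t"]] unfolding rsum[OF rl(2)] \<mu>' .
      \<comment> \<open>The concave function A^(1/q) lies below its tangent at 1. This converts the
        smoothness estimate for q-th powers into one for norms.\<close>
      have bern: "A powr (1 / q) \<le> 1 + (A - 1) / q" if "A \<ge> 0" for A
      proof (cases "A = 0")
        case True
        then show ?thesis using q1 by simp
      next
        case False
        then have "A powr (1 / q) * 1 powr (1 - 1 / q) \<le> 1 / q * A + (1 - 1 / q) * 1"
          using q1 that by (intro Youngs_inequality_0) auto
        then show ?thesis by (simp add: diff_divide_distrib)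
      qed
      have "Y_norm T \<beta> q (\<lambda>x. v x + t * y x) + Y_norm T \<beta> q (\<lambda>x. v x + (- t) * y x)
        \<le> 2 + (Y_pow (\<lambda>x. v x + t * y x) + Y_pow (\<lambda>x. v x + (- t) * y x) - 2) / q"
        using bern[OF Y_pow_nonneg, of "\<lambda>x. v x + t * y x"] bern[OF Y_pow_nonneg, of "\<lambda>x. v x + (- t) * y x"]
        unfolding Y_norm_pow by (simp add: diff_divide_distrib add_divide_distrib)
      also have "\<dots> \<le> 2 + (\<epsilon> * t * (1 + Y_pow y)) / q"
        using sm[OF vY yY] q1 Yv by (intro add_left_mono divide_right_mono) auto
      also have "\<dots> \<le> 2 + \<epsilon> * t * (1 + Y_pow y)"
      proof -
        have "0 \<le> \<epsilon> * t * (1 + Y_pow y)" using \<epsilon> t Y_pow_nonneg[of y] by simp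
        then have "\<epsilon> * t * (1 + Y_pow y) / q \<le> \<epsilon> * t * (1 + Y_pow y) / 1"
          using q1 by (intro divide_left_mono) auto
        then show ?thesis by simp
      qed
      finally have "\<mu> * (Y_norm T \<beta> q (\<lambda>x. v x + t * y x) + Y_norm T \<beta> q (\<lambda>x. v x + (- t) * y x))
        \<le> \<mu> * (2 + \<epsilon> * t * (1 + Y_pow y))" by (rule mult_left_mono[OF _ \<mu>0])
      then have "r v + r' v + t * (r y - r' y) \<le> 2 * \<mu> + \<mu> * (\<epsilon> * t * (1 + Y_pow y))"
        using up1 up2 by (simp add: algebra_simps)
      moreover have "B \<le> C + 2 * \<delta>" if "A + B \<le> 2 * \<mu> + C" "2 * (\<mu> - \<delta>) < A" for A B C :: real
        using that by argo
      ultimately show ?thesis using low by blast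
    qed
    \<comment> \<open>The term with \<open>\<delta>\<close> is removed here; the remaining factor t
      cancels, and \<open>\<epsilon>\<close> tends to 0 only at the end.\<close>
    have "t * (r y - r' y) \<le> \<mu> * (\<epsilon> * t * (1 + Y_pow y))"
    proof (rule field_le_epsilon)
      fix e :: real assume "e > 0"
      then show "t * (r y - r' y) \<le> \<mu> * (\<epsilon> * t * (1 + Y_pow y)) + e" using d[of "e / 2"] by simp
    qed
    then have "t * (r y - r' y) \<le> t * (\<mu> * \<epsilon> * (1 + Y_pow y))" by (simp add: mult_ac)
    then show ?thesis using t by (simp add: mult_le_cancel_left_pos)
  qed
  define C where "C = \<mu> * (1 + Y_pow y)"
  have C: "C \<ge> 0" unfolding C_def using \<mu>0 Y_pow_nonneg[of y] by simp
  have "r y - r' y \<le> 0"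
  proof (rule field_le_epsilon)
    fix e :: real assume e: "e > 0"
    have "r y - r' y \<le> e / (C + 1) * C" using key[of "e / (C + 1)"] e C by (simp add: C_def mult_ac)
    also have "\<dots> \<le> e" using e C by (simp add: field_simps)
    finally show "r y - r' y \<le> 0 + e" by simp
  qed
  then show ?thesis by (simp add: r_def r'_def)
qed

lemma residual_minimizer_unique:
  assumes "g \<in> G" "\<And>k. k \<in> G \<Longrightarrow> dn Yh (\<lambda>v. lf v - g v) \<le> dn Yh (\<lambda>v. lf v - k v)"
    and "h \<in> G" "\<And>k. k \<in> G \<Longrightarrow> dn Yh (\<lambda>v. lf v - h v) \<le> dn Yh (\<lambda>v. lf v - k v)"
    and "y \<in> Yh"
  shows "h y = g y"
  by (rule order_antisym[OF residual_minimizer_unique_le[OF assms] residual_minimizer_unique_le[OF assms(3,4,1,2,5)]])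

end

section \<open>The functionals of the mixed formulation\<close>

context
  fixes p :: real
  assumes p1: "p > 1" and qp: "q = p / (p - 1)"
begin

lemma bfun_L2_db:
  assumes s: "s \<in> T" and w: "w \<in> L_space p (elem s)"
  shows "bfun (\<lambda>v. L2_ip (elem s) w (db s v))"
proof (rule bfun_intro[where A = "L_int p (elem s) w" and B = 1])
  have i: "integrable (lebesgue_on (elem s)) (\<lambda>x. w x * db s v x)" if "v \<in> Y" for v
    by (rule L2_young(1)[OF p1 qp w Y_pair(3)[OF s that]])
  show "lin_on Y (\<lambda>v. L2_ip (elem s) w (db s v))"
    unfolding lin_on_def L2_ip_def
  proof (intro conjI ballI allI)
    fix v assume v: "v \<in> Y"
    have "(\<integral>x. w x * db s (\<lambda>x. a * v x) x \<partial>lebesgue_on (elem s)) = (\<integral>x. a * (w x * db s v x) \<partial>lebesgue_on (elem s))" for a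
      by (rule integral_lebesgue_on_cong_AE(1)[OF elem_sets[OF inv[OF s]]])
         (use db_cmult[OF s v, of a] in eventually_elim, simp)
    then show "(\<integral>x. w x * db s (\<lambda>x. a * v x) x \<partial>lebesgue_on (elem s)) = a * (\<integral>x. w x * db s v x \<partial>lebesgue_on (elem s))" for a
      by simp
    fix u assume u: "u \<in> Y"
    have "(\<integral>x. w x * db s (\<lambda>x. v x + u x) x \<partial>lebesgue_on (elem s)) = (\<integral>x. w x * db s v x + w x * db s u x \<partial>lebesgue_on (elem s))"
      by (rule integral_lebesgue_on_cong_AE(1)[OF elem_sets[OF inv[OF s]]])
         (use db_add[OF s v u] in eventually_elim, simp add: distrib_left)
    then show "(\<integral>x. w x * db s (\<lambda>x. v x + u x) x \<partial>lebesgue_on (elem s))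
      = (\<integral>x. w x * db s v x \<partial>lebesgue_on (elem s)) + (\<integral>x. w x * db s u x \<partial>lebesgue_on (elem s))"
      using Bochner_Integration.integral_add[OF i[OF v] i[OF u]] by simp
  qed
  fix v assume v: "v \<in> Y"
  show "\<bar>L2_ip (elem s) w (db s v)\<bar> \<le> L_int p (elem s) w + 1 * Y_pow v"
    using L2_young(2)[OF p1 qp w Y_pair(3)[OF s v]] L_int_le_Y_pow(2)[OF s, of v] by simp
qed

lemma bfun_L2:
  assumes s: "s \<in> T" and w: "w \<in> L_space p (elem s)"
  shows "bfun (\<lambda>v. L2_ip (elem s) w v)"
proof (rule bfun_intro[where A = "L_int p (elem s) w" and B = "a_elem \<beta> s powr q"])
  have i: "integrable (lebesgue_on (elem s)) (\<lambda>x. w x * v x)" if "v \<in> Y" for v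
    by (rule L2_young(1)[OF p1 qp w Y_pair(2)[OF s that]])
  show "lin_on Y (\<lambda>v. L2_ip (elem s) w v)"
    unfolding L2_ip_def by (rule lin_on_integral[OF i]) (auto simp: algebra_simps)
  fix v assume v: "v \<in> Y"
  show "\<bar>L2_ip (elem s) w v\<bar> \<le> L_int p (elem s) w + a_elem \<beta> s powr q * Y_pow v"
    using L2_young(2)[OF p1 qp w Y_pair(2)[OF s v]] L_int_le_Y_pow(1)[OF s, of v] by simp
qed

lemma bfun_D_h:
  assumes "\<And>s. s \<in> T \<Longrightarrow> z \<in> W_space \<beta> p (elem s)"
  shows "bfun (D_h T \<beta> q z)"
proof (rule bfun_cong[where g = "\<lambda>v. \<Sum>s\<in>T. D_elem \<beta> s z v"])
  show "bfun (\<lambda>v. \<Sum>s\<in>T. D_elem \<beta> s z v)"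
    unfolding D_elem_def
  proof (rule bfun_sum, rule bfun_add)
    fix s assume s: "s \<in> T"
    note w = W_pair[OF s less_imp_le[OF p1] assms[OF s]]
    show "bfun (\<lambda>v. L2_ip (elem s) (db s z) v)" by (rule bfun_L2[OF s w(3)])
    show "bfun (\<lambda>v. L2_ip (elem s) z (db s v))" by (rule bfun_L2_db[OF s w(2)])
  qed
qed (simp add: D_h_def)

lemma bfun_b_form:
  assumes "\<And>s. s \<in> T \<Longrightarrow> fst w \<in> L_space p (elem s)" "bfun (snd w)"
  shows "bfun (b_form T \<beta> w)"
  unfolding b_form_def[abs_def]
  by (intro bfun_diff bfun_sum bfun_L2_db assms)

lemma L2_Omega:
  assumes f: "\<And>s. s \<in> T \<Longrightarrow> f \<in> L_space p (elem s)" and v: "v \<in> Y"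
  shows "L2_ip \<Omega> f v = (\<Sum>s\<in>T. L2_ip (elem s) f v)"
  unfolding L2_ip_def
  by (rule integral_Omega(2)) (intro L2_young(1)[OF p1 qp f Y_pair(2)[OF _ v]])

lemma bfun_L2_Omega:
  assumes "\<And>s. s \<in> T \<Longrightarrow> f \<in> L_space p (elem s)"
  shows "bfun (L2_ip \<Omega> f)"
proof (rule bfun_cong[where g = "\<lambda>v. \<Sum>s\<in>T. L2_ip (elem s) f v"])
  show "bfun (\<lambda>v. \<Sum>s\<in>T. L2_ip (elem s) f v)" by (rule bfun_sum, rule bfun_L2) (use assms in auto)
qed (rule L2_Omega[OF assms])

end

section \<open>Passing from the domain to single elements\<close>

lemma integral_Omega_supported:
  fixes h :: "real ^ 'n \<Rightarrow> real"
  assumes s: "s \<in> T" and h: "integrable (lebesgue_on (elem s)) h" and z: "\<And>x. x \<notin> interior (elem s) \<Longrightarrow> h x = 0"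
  shows "(\<integral>x. h x \<partial>lebesgue_on \<Omega>) = (\<integral>x. h x \<partial>lebesgue_on (elem s))"
proof -
  have ae: "AE x in lebesgue_on (elem t). h x = 0" if t: "t \<in> T" "t \<noteq> s" for t
    using AE_interior[OF inv[OF t(1)]] by eventually_elim (use disj[OF t(1) s t(2)] z in blast)
  have i: "integrable (lebesgue_on (elem t)) h" if t: "t \<in> T" for t
  proof (cases "t = s")
    case False
    show ?thesis
      using integral_lebesgue_on_cong_AE(2)[OF elem_sets[OF inv[OF t]] ae[OF t False]] by simp
  qed (use h in simp)
  have "(\<integral>x. h x \<partial>lebesgue_on \<Omega>) = (\<Sum>t\<in>T. \<integral>x. h x \<partial>lebesgue_on (elem t))" by (rule integral_Omega(2)[OF i])
  also have "\<dots> = (\<Sum>t\<in>T. if t = s then (\<integral>x. h x \<partial>lebesgue_on (elem s)) else 0)"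
  proof (rule sum.cong[OF refl])
    fix t assume t: "t \<in> T"
    show "(\<integral>x. h x \<partial>lebesgue_on (elem t)) = (if t = s then (\<integral>x. h x \<partial>lebesgue_on (elem s)) else 0)"
      using integral_lebesgue_on_cong_AE(1)[OF elem_sets[OF inv[OF t]] ae[OF t]] by (cases "t = s") auto
  qed
  also have "\<dots> = (\<integral>x. h x \<partial>lebesgue_on (elem s))" using s finT by simp
  finally show ?thesis .
qed

text \<open>A test function supported inside one element is a test function on the domain, and beta
  is constant on its support. The derivative may be exchanged for an almost everywhere equal one on
  the way.\<close>

lemma weak_deriv_restrict:
  assumes s: "s \<in> T" and w: "weak_deriv \<beta> \<Omega> v g" and ae: "AE x in lebesgue_on \<Omega>. g x = g' x"
    and i: "integrable (lebesgue_on (elem s)) v" "integrable (lebesgue_on (elem s)) g'"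
  shows "weak_pair (beta_elem \<beta> s) (elem s) v g'"
  unfolding weak_pair_def
proof (intro conjI allI impI i)
  fix \<phi> assume \<phi>: "C1_compact (interior (elem s)) \<phi>"
  let ?c = "beta_elem \<beta> s" and ?K = "lebesgue_on (elem s)"
  have C1: "C1_fun \<phi>" using \<phi> by (simp add: C1_compact_def)
  have "interior (elem s) \<subseteq> interior \<Omega>" by (rule interior_maximal[OF int_sub[OF s] open_interior])
  then have \<phi>': "C1_compact (interior \<Omega>) \<phi>" using \<phi> by (auto simp: C1_compact_def)
  note out = C1_compact_outside[OF \<phi>]
  have eq: "dd (\<beta> x) \<phi> x = dd ?c \<phi> x" for x
    using bc[OF s] out(2) by (cases "x \<in> interior (elem s)") auto
  have i2: "integrable ?K (\<lambda>x. v x * dd ?c \<phi> x)" "integrable ?K (\<lambda>x. g' x * \<phi> x)"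
    by (intro integrable_mult_cont elem_compact[OF inv[OF s]] C1_fun_dd_cont C1_fun_cont C1 i)+
  have "(\<integral>x. v x * dd ?c \<phi> x \<partial>?K) = (\<integral>x. v x * dd (\<beta> x) \<phi> x \<partial>lebesgue_on \<Omega>)"
    unfolding eq by (rule integral_Omega_supported[OF s i2(1), symmetric]) (simp add: out)
  also have "\<dots> = - (\<integral>x. g x * \<phi> x \<partial>lebesgue_on \<Omega>)"
    using w \<phi>' by (simp add: weak_deriv_def)
  also have "(\<integral>x. g x * \<phi> x \<partial>lebesgue_on \<Omega>) = (\<integral>x. g' x * \<phi> x \<partial>lebesgue_on \<Omega>)"
    by (rule integral_lebesgue_on_cong_AE(1)[OF Om_sets]) (use ae in eventually_elim, simp)
  also have "\<dots> = (\<integral>x. g' x * \<phi> x \<partial>?K)"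
    by (rule integral_Omega_supported[OF s i2(2)]) (simp add: out)
  finally show "(\<integral>x. v x * dd ?c \<phi> x + g' x * \<phi> x \<partial>?K) = 0"
    using Bochner_Integration.integral_add[OF i2] by simp
qed

lemma C1_L_space:
  assumes "s \<in> T" "C1_fun f" "r \<ge> 0"
  shows "f \<in> L_space r (elem s)"
proof -
  note K = elem_compact[OF inv[OF assms(1)]] and c = C1_fun_cont[OF assms(2), of UNIV]
  obtain B where "\<And>x. x \<in> elem s \<Longrightarrow> \<bar>f x\<bar> \<le> B" using bounded_on_compact[OF K c] by blast
  then show ?thesis
    by (intro L_space_bounded[OF elem_lmeasurable[OF inv[OF assms(1)]] assms(3) cont_measurable_on_compact[OF K c]])
       (auto intro!: AE_I2)
qed

text \<open>Broken functions are prescribed only in the interiors of the elements; the frontier is a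
  null set, so they inherit weak derivative and integrability from the C^1 function.\<close>

lemma piecewise_C1:
  assumes s: "s \<in> T" and f: "C1_fun f" and e: "\<forall>x\<in>interior (elem s). v x = f x"
  shows "AE x in lebesgue_on (elem s). v x = f x"
    "weak_pair (beta_elem \<beta> s) (elem s) v (dd (beta_elem \<beta> s) f)"
    "AE x in lebesgue_on (elem s). db s v x = dd (beta_elem \<beta> s) f x"
    "r \<ge> 0 \<Longrightarrow> v \<in> L_space r (elem s)"
    "(\<And>c. C1_fun (dd c f)) \<Longrightarrow> r \<ge> 0 \<Longrightarrow> v \<in> W_space \<beta> r (elem s)"
proof -
  show ae: "AE x in lebesgue_on (elem s). v x = f x"
    using AE_interior[OF inv[OF s]] by eventually_elim (use e in blast)
  have ae': "AE x in lebesgue_on (elem s). f x = v x" using ae by eventually_elim simp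
  note K = elem_compact[OF inv[OF s]]
  have fm: "f \<in> borel_measurable (lebesgue_on (elem s))" by (rule cont_measurable_on_compact[OF K C1_fun_cont[OF f]])
  show wp: "weak_pair (beta_elem \<beta> s) (elem s) v (dd (beta_elem \<beta> s) f)"
    by (rule weak_pair_cong[OF weak_pair_C1[OF K f] ae' _ K])
       (auto intro: borel_measurable_lebesgue_on_AE[OF elem_sets[OF inv[OF s]] fm ae'] cont_measurable_on_compact[OF K C1_fun_dd_cont[OF f]])
  show "AE x in lebesgue_on (elem s). db s v x = dd (beta_elem \<beta> s) f x"
    by (rule d_beta_AE[OF inv[OF s] bc[OF s] wp])
  show L: "v \<in> L_space r (elem s)" if "r \<ge> 0"
    by (rule L_space_cong[OF elem_sets[OF inv[OF s]] C1_L_space[OF s f that] ae'])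
  show "v \<in> W_space \<beta> r (elem s)" if "\<And>c. C1_fun (dd c f)" "r \<ge> 0"
    by (rule W_intro[OF s wp L[OF that(2)] C1_L_space[OF s that]])
qed

end

lemma dual_norm_cong:
  assumes "\<And>v. v \<in> S \<Longrightarrow> g v = h v"
  shows "dual_norm \<Omega> T \<beta> q S g = dual_norm \<Omega> T \<beta> q S h"
  unfolding dual_norm_def using assms by (intro SUP_cong) auto

context advection_mesh
begin

section \<open>Discrete trial functions\<close>

lemma elem_cong_AE:
  assumes s: "s \<in> T"
    and z: "AE x in lebesgue_on (elem s). z x = z' x" "AE x in lebesgue_on (elem s). db s z x = dz x"
    and v: "AE x in lebesgue_on (elem s). v x = v' x" "AE x in lebesgue_on (elem s). db s v x = dv x"
  shows "D_elem \<beta> s z v = L2_ip (elem s) dz v' + L2_ip (elem s) z' dv"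
    "L2_ip (elem s) z (db s v) = L2_ip (elem s) z' dv"
proof -
  note c = integral_lebesgue_on_cong_AE(1)[OF elem_sets[OF inv[OF s]]]
  have 1: "L2_ip (elem s) (db s z) v = L2_ip (elem s) dz v'"
    unfolding L2_ip_def by (rule c) (use z(2) v(1) in eventually_elim, simp)
  show 2: "L2_ip (elem s) z (db s v) = L2_ip (elem s) z' dv"
    unfolding L2_ip_def by (rule c) (use z(1) v(2) in eventually_elim, simp)
  show "D_elem \<beta> s z v = L2_ip (elem s) dz v' + L2_ip (elem s) z' dv"
    unfolding D_elem_def 1 2 ..
qed

lemma poly_rep:
  assumes "v \<in> broken T (\<lambda>s. Poly j)"
  obtains P where "\<And>s. s \<in> T \<Longrightarrow> P s \<in> Poly j" "\<And>s. s \<in> T \<Longrightarrow> \<forall>x\<in>interior (elem s). v x = P s x"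
proof -
  have "\<forall>s\<in>T. \<exists>p\<in>Poly j. \<forall>x\<in>interior (elem s). v x = p x" using assms by (simp add: broken_def)
  then obtain P where "\<forall>s\<in>T. P s \<in> Poly j \<and> (\<forall>x\<in>interior (elem s). v x = P s x)" by metis
  then show ?thesis using that by blast
qed

lemma broken_lin: "lin_space (broken T (\<lambda>s. Poly j))"
  unfolding lin_space_def
proof (intro conjI ballI allI)
  show "(\<lambda>x. 0) \<in> broken T (\<lambda>s. Poly j)" unfolding broken_def by (intro CollectI ballI bexI[OF _ lin_spaceD(1)[OF Poly_lin]]) simp
  fix v assume v: "v \<in> broken T (\<lambda>s. Poly j)"
  then obtain P where P: "\<And>s. s \<in> T \<Longrightarrow> P s \<in> Poly j" "\<And>s. s \<in> T \<Longrightarrow> \<forall>x\<in>interior (elem s). v x = P s x"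
    using poly_rep by blast
  show "(\<lambda>x. a * v x) \<in> broken T (\<lambda>s. Poly j)" for a unfolding broken_def
  proof (intro CollectI ballI)
    fix s assume s: "s \<in> T"
    show "\<exists>p\<in>Poly j. \<forall>x\<in>interior (elem s). a * v x = p x"
      by (rule bexI[OF _ lin_spaceD(3)[OF Poly_lin P(1)[OF s], of a]]) (simp add: P(2)[OF s])
  qed
  fix w assume w: "w \<in> broken T (\<lambda>s. Poly j)"
  then obtain Q where Q: "\<And>s. s \<in> T \<Longrightarrow> Q s \<in> Poly j" "\<And>s. s \<in> T \<Longrightarrow> \<forall>x\<in>interior (elem s). w x = Q s x"
    using poly_rep by blast
  show "(\<lambda>x. v x + w x) \<in> broken T (\<lambda>s. Poly j)" unfolding broken_def
  proof (intro CollectI ballI)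
    fix s assume s: "s \<in> T"
    show "\<exists>p\<in>Poly j. \<forall>x\<in>interior (elem s). v x + w x = p x"
      by (rule bexI[OF _ lin_spaceD(2)[OF Poly_lin P(1)[OF s] Q(1)[OF s]]]) (simp add: P(2)[OF s] Q(2)[OF s])
  qed
qed

lemma poly_rep_facts:
  assumes s: "s \<in> T" and P: "P \<in> Poly j" "\<forall>x\<in>interior (elem s). v x = P x"
  shows "AE x in lebesgue_on (elem s). v x = P x"
    "AE x in lebesgue_on (elem s). db s v x = dd (beta_elem \<beta> s) P x"
    "r \<ge> 0 \<Longrightarrow> v \<in> L_space r (elem s)" "r \<ge> 0 \<Longrightarrow> v \<in> W_space \<beta> r (elem s)"
proof -
  note f = piecewise_C1[OF s Poly_C1[OF P(1)] P(2)]
  show "AE x in lebesgue_on (elem s). v x = P x"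
    "AE x in lebesgue_on (elem s). db s v x = dd (beta_elem \<beta> s) P x"
    "r \<ge> 0 \<Longrightarrow> v \<in> L_space r (elem s)" using f(1,3,4) by auto
  show "r \<ge> 0 \<Longrightarrow> v \<in> W_space \<beta> r (elem s)" using f(5)[of r] Poly_C1[OF dd_Poly[OF P(1)]] by blast
qed

lemma D_elem_poly:
  assumes s: "s \<in> T" and P: "P \<in> Poly j" "\<forall>x\<in>interior (elem s). z x = P x"
  shows "D_elem \<beta> s z v = D_elem \<beta> s P v" "L2_ip (elem s) z (db s v) = L2_ip (elem s) P (db s v)"
proof -
  note f = poly_rep_facts[OF s P] and g = poly_rep_facts[OF s P(1) ballI[OF refl]]
  have t: "AE x in lebesgue_on (elem s). v x = v x" "AE x in lebesgue_on (elem s). db s v x = db s v x" by auto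
  show "D_elem \<beta> s z v = D_elem \<beta> s P v"
    using elem_cong_AE(1)[OF s f(1,2) t] elem_cong_AE(1)[OF s g(1,2) t] by simp
  show "L2_ip (elem s) z (db s v) = L2_ip (elem s) P (db s v)" by (rule elem_cong_AE(2)[OF s f(1,2) t])
qed

context
  fixes p :: real and k :: nat
  assumes p1: "p > 1" and qp: "q = p / (p - 1)"
    and cond: "\<forall>s\<in>T. k = 1 \<or> (\<forall>i. bgrad s i (beta_elem \<beta> s) \<noteq> 0)"
    and VY: "broken T (V_elem \<beta> k) \<subseteq> Y"
begin

abbreviation "Wh \<equiv> broken T (\<lambda>s. Poly (int k - 1))"
abbreviation "Zh \<equiv> broken T (\<lambda>s. Poly (int k))"

lemma Zh_W:
  assumes "z \<in> Zh" "s \<in> T"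
  shows "z \<in> W_space \<beta> p (elem s)"
proof -
  obtain P where "\<And>s. s \<in> T \<Longrightarrow> P s \<in> Poly (int k)" "\<And>s. s \<in> T \<Longrightarrow> \<forall>x\<in>interior (elem s). z x = P s x"
    using poly_rep[OF assms(1)] by blast
  then show ?thesis using p1 assms(2) by (intro poly_rep_facts(4)[of s "P s" "int k"]) auto
qed

lemma Wh_L:
  assumes "w \<in> Wh" "s \<in> T"
  shows "w \<in> L_space p (elem s)"
proof -
  obtain P where "\<And>s. s \<in> T \<Longrightarrow> P s \<in> Poly (int k - 1)" "\<And>s. s \<in> T \<Longrightarrow> \<forall>x\<in>interior (elem s). w x = P s x"
    using poly_rep[OF assms(1)] by blast
  then show ?thesis using p1 assms(2) by (intro poly_rep_facts(3)[of s "P s" "int k - 1"]) auto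
qed

lemma bfun_b: "w \<in> Wh \<Longrightarrow> z \<in> Zh \<Longrightarrow> bfun (b_form T \<beta> (w, D_h T \<beta> q z))"
  by (rule bfun_b_form[OF p1 qp]) (auto intro: Wh_L bfun_D_h[OF p1 qp] Zh_W)

lemma b_form_eq:
  assumes "v \<in> Y"
  shows "b_form T \<beta> (w, D_h T \<beta> q z) v = (\<Sum>s\<in>T. D_elem \<beta> s z v - L2_ip (elem s) w (db s v))"
  using assms by (simp add: b_form_def D_h_def sum_subtractf)

lemma b_form_lin:
  assumes w: "w \<in> Wh" "w' \<in> Wh" and z: "z \<in> Zh" "z' \<in> Zh" and v: "v \<in> Y"
  shows "b_form T \<beta> (\<lambda>x. w x + w' x, D_h T \<beta> q (\<lambda>x. z x + z' x)) v
      = b_form T \<beta> (w, D_h T \<beta> q z) v + b_form T \<beta> (w', D_h T \<beta> q z') v"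
    "b_form T \<beta> (\<lambda>x. a * w x, D_h T \<beta> q (\<lambda>x. a * z x)) v = a * b_form T \<beta> (w, D_h T \<beta> q z) v"
proof -
  obtain P where P: "\<And>s. s \<in> T \<Longrightarrow> P s \<in> Poly (int k)" "\<And>s. s \<in> T \<Longrightarrow> \<forall>x\<in>interior (elem s). z x = P s x"
    using poly_rep[OF z(1)] by blast
  obtain P' where P': "\<And>s. s \<in> T \<Longrightarrow> P' s \<in> Poly (int k)" "\<And>s. s \<in> T \<Longrightarrow> \<forall>x\<in>interior (elem s). z' x = P' s x"
    using poly_rep[OF z(2)] by blast
  have i: "integrable (lebesgue_on (elem s)) (\<lambda>x. w x * db s v x)" if "w \<in> Wh" "s \<in> T" for w s
    by (rule L2_young(1)[OF p1 qp Wh_L[OF that] Y_pair(3)[OF that(2) v]])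
  have lin: "lin_on (Poly (int k)) (\<lambda>w. D_elem \<beta> s w v)" if s: "s \<in> T" for s
    by (rule D_elem_lin_left[OF inv[OF s] bc[OF s] bne[OF s] bspec[OF cond s] Poly_C1 Y_pair(1)[OF s v] Poly_lin])
  show "b_form T \<beta> (\<lambda>x. w x + w' x, D_h T \<beta> q (\<lambda>x. z x + z' x)) v
      = b_form T \<beta> (w, D_h T \<beta> q z) v + b_form T \<beta> (w', D_h T \<beta> q z') v"
    unfolding b_form_eq[OF v] sum.distrib[symmetric]
  proof (rule sum.cong[OF refl])
    fix s assume s: "s \<in> T"
    have "D_elem \<beta> s (\<lambda>x. z x + z' x) v = D_elem \<beta> s (\<lambda>x. P s x + P' s x) v"
      by (rule D_elem_poly(1)[OF s lin_spaceD(2)[OF Poly_lin P(1)[OF s] P'(1)[OF s]]]) (simp add: P(2)[OF s] P'(2)[OF s])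
    also have "\<dots> = D_elem \<beta> s (P s) v + D_elem \<beta> s (P' s) v" by (rule lin_onD(1)[OF lin[OF s] P(1)[OF s] P'(1)[OF s]])
    finally have D: "D_elem \<beta> s (\<lambda>x. z x + z' x) v = D_elem \<beta> s z v + D_elem \<beta> s z' v"
      using D_elem_poly(1)[OF s P(1)[OF s] P(2)[OF s]] D_elem_poly(1)[OF s P'(1)[OF s] P'(2)[OF s]] by simp
    have "L2_ip (elem s) (\<lambda>x. w x + w' x) (db s v) = L2_ip (elem s) w (db s v) + L2_ip (elem s) w' (db s v)"
      unfolding L2_ip_def distrib_right by (rule Bochner_Integration.integral_add[OF i[OF w(1) s] i[OF w(2) s]])
    then show "D_elem \<beta> s (\<lambda>x. z x + z' x) v - L2_ip (elem s) (\<lambda>x. w x + w' x) (db s v)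
      = (D_elem \<beta> s z v - L2_ip (elem s) w (db s v)) + (D_elem \<beta> s z' v - L2_ip (elem s) w' (db s v))"
      by (simp add: D)
  qed
  show "b_form T \<beta> (\<lambda>x. a * w x, D_h T \<beta> q (\<lambda>x. a * z x)) v = a * b_form T \<beta> (w, D_h T \<beta> q z) v"
    unfolding b_form_eq[OF v] sum_distrib_left
  proof (rule sum.cong[OF refl])
    fix s assume s: "s \<in> T"
    have "D_elem \<beta> s (\<lambda>x. a * z x) v = D_elem \<beta> s (\<lambda>x. a * P s x) v"
      by (rule D_elem_poly(1)[OF s lin_spaceD(3)[OF Poly_lin P(1)[OF s]]]) (simp add: P(2)[OF s])
    also have "\<dots> = a * D_elem \<beta> s (P s) v" by (rule lin_onD(2)[OF lin[OF s] P(1)[OF s]])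
    finally have D: "D_elem \<beta> s (\<lambda>x. a * z x) v = a * D_elem \<beta> s z v"
      using D_elem_poly(1)[OF s P(1)[OF s] P(2)[OF s]] by simp
    have "L2_ip (elem s) (\<lambda>x. a * w x) (db s v) = a * L2_ip (elem s) w (db s v)"
      unfolding L2_ip_def mult.assoc by simp
    then show "D_elem \<beta> s (\<lambda>x. a * z x) v - L2_ip (elem s) (\<lambda>x. a * w x) (db s v)
      = a * (D_elem \<beta> s z v - L2_ip (elem s) w (db s v))" by (simp add: D right_diff_distrib)
  qed
qed

lemma Pi_h_elem:
  assumes "s \<in> T" "x \<in> interior (elem s)"
  shows "Pi_h T \<beta> k v x = Pi_elem \<beta> k s v x"
proof -
  have "(THE s. s \<in> T \<and> x \<in> interior (elem s)) = s"
    using assms disj by (intro the_equality) blast+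
  then show ?thesis using assms unfolding Pi_h_def by auto
qed

lemma Pi_h_broken:
  assumes "v \<in> Y"
  shows "Pi_h T \<beta> k v \<in> broken T (V_elem \<beta> k)"
  unfolding broken_def
proof (intro CollectI ballI)
  fix s assume s: "s \<in> T"
  show "\<exists>p\<in>V_elem \<beta> k s. \<forall>x\<in>interior (elem s). Pi_h T \<beta> k v x = p x"
    by (rule bexI[OF _ Pi_elem_props(1)[OF inv[OF s] bc[OF s] bne[OF s] bspec[OF cond s] Y_pair(1)[OF s assms]]])
       (simp add: Pi_h_elem[OF s])
qed

text \<open>\<open>Pi_h\<close> coincides with \<open>Pi_elem\<close> on each interior, so the terms
  are compared element by element: those with \<open>D_elem\<close> through degree k, the volume
  terms through degree k - 1.\<close>

lemma b_form_Pi: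
  assumes w: "w \<in> Wh" and z: "z \<in> Zh" and v: "v \<in> Y"
  shows "b_form T \<beta> (w, D_h T \<beta> q z) (Pi_h T \<beta> k v) = b_form T \<beta> (w, D_h T \<beta> q z) v"
proof -
  have PY: "Pi_h T \<beta> k v \<in> Y" using Pi_h_broken[OF v] VY by blast
  obtain P where P: "\<And>s. s \<in> T \<Longrightarrow> P s \<in> Poly (int k)" "\<And>s. s \<in> T \<Longrightarrow> \<forall>x\<in>interior (elem s). z x = P s x"
    using poly_rep[OF z] by blast
  obtain R where R: "\<And>s. s \<in> T \<Longrightarrow> R s \<in> Poly (int k - 1)" "\<And>s. s \<in> T \<Longrightarrow> \<forall>x\<in>interior (elem s). w x = R s x"
    using poly_rep[OF w] by blast
  show ?thesis
    unfolding b_form_eq[OF v] b_form_eq[OF PY]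
  proof (rule sum.cong[OF refl])
    fix s assume s: "s \<in> T"
    let ?\<pi> = "Pi_elem \<beta> k s v"
    note ctx = inv[OF s] bc[OF s] bne[OF s] bspec[OF cond s]
    note pr = Pi_elem_props[OF ctx Y_pair(1)[OF s v]]
    have \<pi>C: "C1_fun ?\<pi>" by (rule V_elem_C1[OF ctx pr(1)])
    have Pe: "\<forall>x\<in>interior (elem s). Pi_h T \<beta> k v x = ?\<pi> x" by (simp add: Pi_h_elem[OF s])
    note f = piecewise_C1[OF s \<pi>C Pe] and g = piecewise_C1[OF s \<pi>C ballI[OF refl]]
    have t: "AE x in lebesgue_on (elem s). u x = u x" "AE x in lebesgue_on (elem s). db s u x = db s u x" for u by auto
    have 1: "D_elem \<beta> s z' (Pi_h T \<beta> k v) = D_elem \<beta> s z' ?\<pi>" for z'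
      unfolding elem_cong_AE(1)[OF s t f(1,3)] elem_cong_AE(1)[OF s t g(1,3)] ..
    have 2: "L2_ip (elem s) z' (db s (Pi_h T \<beta> k v)) = L2_ip (elem s) z' (db s ?\<pi>)" for z'
      unfolding elem_cong_AE(2)[OF s t f(1,3)] elem_cong_AE(2)[OF s t g(1,3)] ..
    show "D_elem \<beta> s z (Pi_h T \<beta> k v) - L2_ip (elem s) w (db s (Pi_h T \<beta> k v)) = D_elem \<beta> s z v - L2_ip (elem s) w (db s v)"
      unfolding 1 2 D_elem_poly(1)[OF s P(1)[OF s] P(2)[OF s]] D_elem_poly(2)[OF s R(1)[OF s] R(2)[OF s]]
        pr(2)[OF P(1)[OF s]] pr(3)[OF R(1)[OF s]] ..
  qed
qed

text \<open>The test function is \<open>bubble\<close> times the derivative of R along beta on one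
  element and zero on the others. It vanishes on the frontier, so both terms with
  \<open>D_elem\<close> disappear, and the weighted integral of the squared derivative is
  zero.\<close>

lemma streamline_constant:
  assumes w: "w \<in> Wh" and z: "z \<in> Zh" and b: "\<And>v. v \<in> Y \<Longrightarrow> b_form T \<beta> (w, D_h T \<beta> q z) v = 0"
    and s: "s \<in> T" and R: "R \<in> Poly (int k - 1)" "\<forall>x\<in>interior (elem s). w x = R x"
  shows "dd (beta_elem \<beta> s) R = (\<lambda>x. 0)"
proof -
  let ?c = "beta_elem \<beta> s"
  note ctx = inv[OF s] bc[OF s] bne[OF s] bspec[OF cond s]
  obtain P where P: "\<And>s. s \<in> T \<Longrightarrow> P s \<in> Poly (int k)" "\<And>s. s \<in> T \<Longrightarrow> \<forall>x\<in>interior (elem s). z x = P s x"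
    using poly_rep[OF z] by blast
  have RC: "C1_fun R" by (rule Poly_C1[OF R(1)])
  have dR: "real_polynomial_function (dd ?c R)" by (rule dd_polynomial[OF Poly_polynomial[OF R(1)]])
  note dRC = C1_fun_polynomial[OF dR]
  note bC = C1_fun_polynomial[OF bubble_polynomial[OF inv[OF s]]]
  define f where "f = (\<lambda>x. bubble s x * dd ?c R x)"
  have fp: "real_polynomial_function f" unfolding f_def
    by (intro real_polynomial_function.intros(4) bubble_polynomial[OF inv[OF s]] dR)
  have fC: "C1_fun f" by (rule C1_fun_polynomial[OF fp])
  have dfC: "C1_fun (dd ?c f)" by (rule C1_fun_polynomial[OF dd_polynomial[OF fp]])
  \<comment> \<open>Jumps across the skeleton are allowed in Y, so extension by zero needs no
    compatibility condition.\<close>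
  define v where "v = (\<lambda>x. if x \<in> interior (elem s) then f x else 0)"
  have vs: "\<forall>x\<in>interior (elem s). v x = f x" by (simp add: v_def)
  have vt: "\<forall>x\<in>interior (elem t). v x = 0" if "t \<in> T" "t \<noteq> s" for t
    using that disj[OF that(1) s that(2)] by (auto simp: v_def)
  have q0: "q \<ge> 0" using q1 by simp
  note fs = piecewise_C1[OF s fC vs]
  have vY: "v \<in> Y"
  proof (rule Y_intro)
    fix t assume t: "t \<in> T"
    show "\<exists>g. weak_pair (beta_elem \<beta> t) (elem t) v g \<and> v \<in> L_space q (elem t) \<and> g \<in> L_space q (elem t)"
    proof (cases "t = s")
      case True
      show ?thesis unfolding True
        by (rule exI[of _ "dd ?c f"]) (intro conjI fs(2) fs(4)[OF q0] C1_L_space[OF s dfC q0])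
    next
      case False
      note ft = piecewise_C1[OF t C1_fun_const[of 0] vt[OF t False]]
      show ?thesis
        by (rule exI[of _ "dd (beta_elem \<beta> t) (\<lambda>x. 0)"])
           (intro conjI ft(2) ft(4)[OF q0] C1_L_space[OF t _ q0], simp add: dd_const C1_fun_const)
    qed
  qed
  have tr: "AE x in lebesgue_on (elem t). u x = u x" "AE x in lebesgue_on (elem t). db t u x = db t u x" for t u by auto
  have zt: "D_elem \<beta> t z v - L2_ip (elem t) w (db t v) = 0" if t: "t \<in> T" "t \<noteq> s" for t
  proof -
    note ft = piecewise_C1[OF t(1) C1_fun_const[of 0] vt[OF t]]
    show ?thesis unfolding elem_cong_AE[OF t(1) tr ft(1,3)] by (simp add: L2_ip_def dd_const)
  qed
  have "0 = (\<Sum>t\<in>T. D_elem \<beta> t z v - L2_ip (elem t) w (db t v))" using b[OF vY] b_form_eq[OF vY] by simp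
  also have "\<dots> = (\<Sum>t\<in>T. if t = s then D_elem \<beta> s z v - L2_ip (elem s) w (db s v) else 0)"
    using zt by (intro sum.cong) auto
  also have "\<dots> = D_elem \<beta> s z v - L2_ip (elem s) w (db s v)" using s finT by simp
  finally have e: "D_elem \<beta> s z v = L2_ip (elem s) w (db s v)" by simp
  note g = piecewise_C1[OF s fC ballI[OF refl]]
  have "D_elem \<beta> s z v = D_elem \<beta> s (P s) v" by (rule D_elem_poly(1)[OF s P(1)[OF s] P(2)[OF s]])
  also have "\<dots> = D_elem \<beta> s (P s) f"
    unfolding elem_cong_AE(1)[OF s tr fs(1,3)] elem_cong_AE(1)[OF s tr g(1,3)] ..
  also have "\<dots> = 0" unfolding f_def by (rule D_elem_bubble[OF ctx Poly_C1[OF P(1)[OF s]] dRC])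
  finally have z1: "L2_ip (elem s) w (db s v) = 0" using e by simp
  have "L2_ip (elem s) w (db s v) = L2_ip (elem s) R (db s v)" by (rule D_elem_poly(2)[OF s R])
  also have "\<dots> = L2_ip (elem s) R (db s f)"
    unfolding elem_cong_AE(2)[OF s tr fs(1,3)] elem_cong_AE(2)[OF s tr g(1,3)] ..
  finally have "L2_ip (elem s) w (db s v) = L2_ip (elem s) R (db s f)" .
  moreover have "D_elem \<beta> s R f = 0" unfolding f_def by (rule D_elem_bubble[OF ctx RC dRC])
  ultimately have "L2_ip (elem s) (db s R) f = 0" using z1 by (simp add: D_elem_def)
  moreover have "L2_ip (elem s) (db s R) f = L2_ip (elem s) (dd ?c R) f"
    by (rule L2_ip_dbeta(2)[OF ctx(1,2) weak_pair_C1[OF elem_compact[OF inv[OF s]] RC]])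
  ultimately show ?thesis
    by (intro polynomial_zero_if_weighted_zero[OF inv[OF s] dR bubble_polynomial[OF inv[OF s]]
          bubble_nonneg[OF inv[OF s]] bubble_pos[OF inv[OF s]]]) (auto simp: L2_ip_def f_def)
qed

text \<open>
  Testing with \<open>w * \<zeta>\<close> and with \<open>z * \<zeta>\<close> produces the same terms \<open>A s\<close>; the hypothesis \<open>gz\<close> says that the
  boundary integral of \<open>\<beta> \<cdot> n \<zeta> z\<^sup>2\<close> vanishes.
\<close>

lemma kernel_trivial:
  fixes \<zeta> :: "real ^ 'n \<Rightarrow> real"
  assumes w: "w \<in> Wh" and z: "z \<in> Zh" and b: "\<And>v. v \<in> Y \<Longrightarrow> b_form T \<beta> (w, D_h T \<beta> q z) v = 0"
    and c0: "c0 > 0" and \<zeta>: "\<And>s. s \<in> T \<Longrightarrow> weak_pair (beta_elem \<beta> s) (elem s) \<zeta> (\<lambda>x. - c0)"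
      "\<And>s. s \<in> T \<Longrightarrow> AE x in lebesgue_on (elem s). \<bar>\<zeta> x\<bar> \<le> M"
    and P: "\<And>s. s \<in> T \<Longrightarrow> P s \<in> Poly (int k)" "\<And>s. s \<in> T \<Longrightarrow> \<forall>x\<in>interior (elem s). z x = P s x"
    and gz: "(\<Sum>s\<in>T. \<integral>x. \<zeta> x * dd (beta_elem \<beta> s) (\<lambda>x. P s x * P s x) x + (- c0) * (P s x * P s x) \<partial>lebesgue_on (elem s)) = 0"
  shows "AE x in lebesgue_on \<Omega>. w x = 0"
proof -
  obtain R where R: "\<And>s. s \<in> T \<Longrightarrow> R s \<in> Poly (int k - 1)" "\<And>s. s \<in> T \<Longrightarrow> \<forall>x\<in>interior (elem s). w x = R s x"
    using poly_rep[OF w] by blast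
  have q0: "q \<ge> 0" using q1 by simp
  have dR: "dd (beta_elem \<beta> s) (R s) x = 0" if s: "s \<in> T" for s x
    by (rule fun_cong[OF streamline_constant[OF w z b s R(1)[OF s] R(2)[OF s]]])
  \<comment> \<open>Serves both test functions, with y = w and with y = z. Boundedness of
    \<open>\<zeta>\<close> puts the product and its weak derivative into L_q on each
    element.\<close>
  have prod: "weak_pair (beta_elem \<beta> s) (elem s) (\<lambda>x. y x * \<zeta> x) (\<lambda>x. Q x * (- c0) + dd (beta_elem \<beta> s) Q x * \<zeta> x)"
      "(\<lambda>x. y x * \<zeta> x) \<in> L_space q (elem s)"
      "(\<lambda>x. Q x * (- c0) + dd (beta_elem \<beta> s) Q x * \<zeta> x) \<in> L_space q (elem s)"
      "AE x in lebesgue_on (elem s). y x * \<zeta> x = Q x * \<zeta> x"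
      "AE x in lebesgue_on (elem s). db s (\<lambda>x. y x * \<zeta> x) x = Q x * (- c0) + dd (beta_elem \<beta> s) Q x * \<zeta> x"
    if s: "s \<in> T" and Q: "Q \<in> Poly j" "\<forall>x\<in>interior (elem s). y x = Q x" for s Q j y
  proof -
    let ?K = "lebesgue_on (elem s)"
    note K = elem_compact[OF inv[OF s]] and Ks = elem_sets[OF inv[OF s]]
    note QC = Poly_C1[OF Q(1)] and dQC = Poly_C1[OF dd_Poly[OF Q(1)]]
    have m\<zeta>: "\<zeta> \<in> borel_measurable ?K" using \<zeta>(1)[OF s] by (auto simp: weak_pair_def)
    show ae: "AE x in ?K. y x * \<zeta> x = Q x * \<zeta> x" using poly_rep_facts(1)[OF s Q] by eventually_elim simp
    have ae': "AE x in ?K. Q x * \<zeta> x = y x * \<zeta> x" using ae by eventually_elim (rule sym)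
    have bd: "(\<lambda>x. F x * \<zeta> x) \<in> L_space q (elem s)" if F: "C1_fun F" for F
    proof -
      obtain B where B: "B \<ge> 0" "\<And>x. x \<in> elem s \<Longrightarrow> \<bar>F x\<bar> \<le> B" using bounded_on_compact[OF K C1_fun_cont[OF F]] by blast
      have mF: "F \<in> borel_measurable ?K" by (rule cont_measurable_on_compact[OF K C1_fun_cont[OF F]])
      have "AE x in ?K. x \<in> elem s" by (intro AE_I2) simp
      with \<zeta>(2)[OF s] have "AE x in ?K. \<bar>F x * \<zeta> x\<bar> \<le> B * M"
      proof eventually_elim
        case (elim x)
        then show ?case unfolding abs_mult using B by (intro mult_mono) auto
      qed
      then show ?thesis using m\<zeta> mF by (intro L_space_bounded[OF elem_lmeasurable[OF inv[OF s]] q0]) auto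
    qed
    show L: "(\<lambda>x. y x * \<zeta> x) \<in> L_space q (elem s)" by (rule L_space_cong[OF Ks bd[OF QC] ae'])
    have "(\<lambda>x. (- c0) * Q x) \<in> L_space q (elem s)" by (rule C1_L_space[OF s C1_fun_cmult[OF QC] q0])
    from L_space_add[OF q0 this bd[OF dQC]]
    show Lg: "(\<lambda>x. Q x * (- c0) + dd (beta_elem \<beta> s) Q x * \<zeta> x) \<in> L_space q (elem s)" by (simp add: mult.commute)
    show wp: "weak_pair (beta_elem \<beta> s) (elem s) (\<lambda>x. y x * \<zeta> x) (\<lambda>x. Q x * (- c0) + dd (beta_elem \<beta> s) Q x * \<zeta> x)"
      by (rule weak_pair_cong[OF weak_pair_mult[OF K \<zeta>(1)[OF s] QC] ae' _ K])
         (use L Lg in \<open>auto simp: L_space_def\<close>)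
    show "AE x in ?K. db s (\<lambda>x. y x * \<zeta> x) x = Q x * (- c0) + dd (beta_elem \<beta> s) Q x * \<zeta> x"
      by (rule d_beta_AE[OF inv[OF s] bc[OF s] wp])
  qed
  note p1' = prod[OF _ R(1) R(2)] and p2' = prod[OF _ P(1) P(2)]
  have v1: "(\<lambda>x. w x * \<zeta> x) \<in> Y" by (rule Y_intro) (use p1' in blast)
  have v2: "(\<lambda>x. z x * \<zeta> x) \<in> Y" by (rule Y_intro) (use p2' in blast)
  \<comment> \<open>This number occurs twice, as the flux term of z against
    \<open>w * \<zeta>\<close> and as the volume term of w against \<open>z * \<zeta>\<close>,
    because the derivative of w along beta vanishes.\<close>
  define A where "A s = (\<integral>x. dd (beta_elem \<beta> s) (P s) x * (R s x * \<zeta> x) \<partial>lebesgue_on (elem s)) + (\<integral>x. P s x * (R s x * (- c0)) \<partial>lebesgue_on (elem s))" for s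
  have D1: "D_elem \<beta> s z (\<lambda>x. w x * \<zeta> x) = A s"
    and L1: "L2_ip (elem s) w (db s (\<lambda>x. w x * \<zeta> x)) = - c0 * L2_ip (elem s) (R s) (R s)"
    and D2: "D_elem \<beta> s z (\<lambda>x. z x * \<zeta> x) = (\<integral>x. \<zeta> x * dd (beta_elem \<beta> s) (\<lambda>x. P s x * P s x) x + (- c0) * (P s x * P s x) \<partial>lebesgue_on (elem s))"
    and L2: "L2_ip (elem s) w (db s (\<lambda>x. z x * \<zeta> x)) = A s"
    if s: "s \<in> T" for s
  proof -
    let ?c = "beta_elem \<beta> s" and ?K = "lebesgue_on (elem s)"
    note K = elem_compact[OF inv[OF s]]
    note fz = poly_rep_facts[OF s P(1)[OF s] P(2)[OF s]] and fw = poly_rep_facts[OF s R(1)[OF s] R(2)[OF s]]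
    note PC = Poly_C1[OF P(1)[OF s]] and dPC = Poly_C1[OF dd_Poly[OF P(1)[OF s]]] and RC = Poly_C1[OF R(1)[OF s]]
    have i\<zeta>: "integrable ?K \<zeta>" using \<zeta>(1)[OF s] by (simp add: weak_pair_def)
    have i1: "integrable ?K (\<lambda>x. F x * \<zeta> x)" if "C1_fun F" for F
      using integrable_mult_cont[OF K C1_fun_cont[OF that] i\<zeta>] by (simp add: mult.commute)
    have i2: "integrable ?K F" if "C1_fun F" for F by (rule integrable_cont[OF K C1_fun_cont[OF that]])
    show "D_elem \<beta> s z (\<lambda>x. w x * \<zeta> x) = A s"
      unfolding elem_cong_AE(1)[OF s fz(1,2) p1'(4,5)[OF s s s]] unfolding A_def L2_ip_def dR[OF s] by simp
    show "L2_ip (elem s) w (db s (\<lambda>x. w x * \<zeta> x)) = - c0 * L2_ip (elem s) (R s) (R s)"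
    proof -
      have "L2_ip (elem s) w (db s (\<lambda>x. w x * \<zeta> x)) = L2_ip (elem s) (R s) (\<lambda>x. R s x * (- c0) + dd ?c (R s) x * \<zeta> x)"
        by (rule elem_cong_AE(2)[OF s fw(1,2) p1'(4,5)[OF s s s]])
      also have "\<dots> = (\<integral>x. - c0 * (R s x * R s x) \<partial>?K)"
        unfolding L2_ip_def dR[OF s] by (rule Bochner_Integration.integral_cong) auto
      also have "\<dots> = - c0 * L2_ip (elem s) (R s) (R s)" unfolding L2_ip_def by simp
      finally show ?thesis .
    qed
    have "L2_ip (elem s) w (db s (\<lambda>x. z x * \<zeta> x)) = (\<integral>x. R s x * (P s x * (- c0) + dd ?c (P s) x * \<zeta> x) \<partial>?K)"
      unfolding elem_cong_AE(2)[OF s fw(1,2) p2'(4,5)[OF s s s]] unfolding L2_ip_def ..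
    also have "\<dots> = (\<integral>x. (dd ?c (P s) x * R s x) * \<zeta> x + P s x * (R s x * (- c0)) \<partial>?K)"
      by (rule Bochner_Integration.integral_cong) (auto simp: algebra_simps)
    also have "\<dots> = (\<integral>x. (dd ?c (P s) x * R s x) * \<zeta> x \<partial>?K) + (\<integral>x. P s x * (R s x * (- c0)) \<partial>?K)"
      by (intro Bochner_Integration.integral_add i1 i2 C1_fun_mult dPC RC PC C1_fun_const)
    finally show "L2_ip (elem s) w (db s (\<lambda>x. z x * \<zeta> x)) = A s" by (simp add: A_def mult.assoc)
    have "D_elem \<beta> s z (\<lambda>x. z x * \<zeta> x)
      = (\<integral>x. dd ?c (P s) x * (P s x * \<zeta> x) \<partial>?K) + (\<integral>x. P s x * (P s x * (- c0) + dd ?c (P s) x * \<zeta> x) \<partial>?K)"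
      unfolding elem_cong_AE(1)[OF s fz(1,2) p2'(4,5)[OF s s s]] unfolding L2_ip_def ..
    also have "\<dots> = (\<integral>x. dd ?c (P s) x * (P s x * \<zeta> x) + P s x * (P s x * (- c0) + dd ?c (P s) x * \<zeta> x) \<partial>?K)"
    proof (rule Bochner_Integration.integral_add[symmetric])
      show "integrable ?K (\<lambda>x. dd ?c (P s) x * (P s x * \<zeta> x))"
        using i1[OF C1_fun_mult[OF dPC PC]] by (simp add: mult.assoc)
      have "integrable ?K (\<lambda>x. P s x * P s x * (- c0) + (P s x * dd ?c (P s) x) * \<zeta> x)"
        by (intro Bochner_Integration.integrable_add i1 i2 C1_fun_mult dPC PC C1_fun_const)
      then show "integrable ?K (\<lambda>x. P s x * (P s x * (- c0) + dd ?c (P s) x * \<zeta> x))"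
        by (simp only: distrib_left mult.assoc)
    qed
    also have "\<dots> = (\<integral>x. \<zeta> x * dd ?c (\<lambda>x. P s x * P s x) x + (- c0) * (P s x * P s x) \<partial>?K)"
      by (rule Bochner_Integration.integral_cong) (auto simp: dd_mult[OF PC PC] algebra_simps)
    finally show "D_elem \<beta> s z (\<lambda>x. z x * \<zeta> x) = (\<integral>x. \<zeta> x * dd ?c (\<lambda>x. P s x * P s x) x + (- c0) * (P s x * P s x) \<partial>?K)" .
  qed
  have "(\<Sum>s\<in>T. D_elem \<beta> s z (\<lambda>x. z x * \<zeta> x)) = 0" using gz D2 by simp
  moreover have "(\<Sum>s\<in>T. D_elem \<beta> s z (\<lambda>x. z x * \<zeta> x)) = (\<Sum>s\<in>T. A s)"
    using b[OF v2] L2 unfolding b_form_eq[OF v2] sum_subtractf by simp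
  moreover have "(\<Sum>s\<in>T. A s) = (\<Sum>s\<in>T. - c0 * L2_ip (elem s) (R s) (R s))"
    using b[OF v1] D1 L1 unfolding b_form_eq[OF v1] sum_subtractf by simp
  ultimately have "c0 * (\<Sum>s\<in>T. L2_ip (elem s) (R s) (R s)) = 0"
    by (simp add: sum_distrib_left sum_negf)
  then have s0: "(\<Sum>s\<in>T. L2_ip (elem s) (R s) (R s)) = 0" using c0 by simp
  have nn: "0 \<le> L2_ip (elem s) (R s) (R s)" for s unfolding L2_ip_def by (rule integral_nonneg_AE) simp
  have "R s = (\<lambda>x. 0)" if s: "s \<in> T" for s
    using s0 sum_nonneg_eq_0_iff[OF finT, of "\<lambda>s. L2_ip (elem s) (R s) (R s)"] nn s
    by (intro polynomial_zero_if_norm_zero[OF inv[OF s] Poly_polynomial[OF R(1)[OF s]]]) simp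
  then have "AE x in lebesgue_on (elem s). w x = 0" if s: "s \<in> T" for s
    using poly_rep_facts(1)[OF s R(1)[OF s] R(2)[OF s]] s by simp
  then show ?thesis by (simp add: AE_Omega_iff)
qed

end

end

section \<open>Quasi-optimality\<close>

context advection_mesh
begin

context
  fixes p :: real and k :: nat and Yh :: "(real ^ 'n \<Rightarrow> real) set" and Zh0 :: "(real ^ 'n \<Rightarrow> real) set"
    and f u :: "real ^ 'n \<Rightarrow> real" and C :: real
  assumes p1: "p > 1" and qp: "q = p / (p - 1)" and k1: "k \<ge> 1" and Tne: "T \<noteq> {}"
    and cond: "\<forall>s\<in>T. k = 1 \<or> (\<forall>i. bgrad s i (beta_elem \<beta> s) \<noteq> 0)"
    and Yh: "fin_dim_space \<Omega> Yh" "broken T (V_elem \<beta> k) \<subseteq> Yh" "Yh \<subseteq> Y"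
    and Z0: "lin_space Zh0" "Zh0 \<subseteq> broken T (\<lambda>s. Poly (int k))"
    and ker: "\<And>w z. w \<in> broken T (\<lambda>s. Poly (int k - 1)) \<Longrightarrow> z \<in> Zh0 \<Longrightarrow>
       (\<And>v. v \<in> Y \<Longrightarrow> b_form T \<beta> (w, D_h T \<beta> q z) v = 0) \<Longrightarrow> AE x in lebesgue_on \<Omega>. w x = 0"
    and u: "\<And>s. s \<in> T \<Longrightarrow> weak_pair (beta_elem \<beta> s) (elem s) u f" "\<And>s. s \<in> T \<Longrightarrow> u \<in> L_space p (elem s)"
      "\<And>s. s \<in> T \<Longrightarrow> f \<in> L_space p (elem s)"
    and C: "\<And>v. v \<in> Y \<Longrightarrow> Y_norm T \<beta> q (Pi_h T \<beta> k v) \<le> C * Y_norm T \<beta> q v"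
begin

abbreviation (input) "Wk \<equiv> broken T (\<lambda>s. Poly (int k - 1))"
abbreviation (input) "Xk \<equiv> Wk \<times> D_h T \<beta> q ` Zh0"
abbreviation (input) "b w \<equiv> b_form T \<beta> w"

lemma VY: "broken T (V_elem \<beta> k) \<subseteq> Y"
  using Yh by blast

lemma Xh_bfun: "w \<in> Xk \<Longrightarrow> bfun (b w)"
  using bfun_b[OF p1 qp cond VY] Z0(2) by blast

lemma Xh_Pi:
  assumes "w \<in> Xk" "v \<in> Y"
  shows "b w (Pi_h T \<beta> k v) = b w v"
  using b_form_Pi[OF p1 qp cond VY _ _ assms(2)] assms(1) Z0(2) by blast

lemma Pi_Yh: "v \<in> Y \<Longrightarrow> Pi_h T \<beta> k v \<in> Yh"
  using Pi_h_broken[OF p1 qp cond VY] Yh(2) by blast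

lemma ell_bfun: "bfun (L2_ip \<Omega> f)"
  by (rule bfun_L2_Omega[OF p1 qp u(3)])

lemma exact_solution: "v \<in> Y \<Longrightarrow> b (u, D_h T \<beta> q u) v = L2_ip \<Omega> f v"
proof -
  assume v: "v \<in> Y"
  have "D_elem \<beta> s u v - L2_ip (elem s) u (db s v) = L2_ip (elem s) f v" if s: "s \<in> T" for s
    using L2_ip_dbeta(2)[OF inv[OF s] bc[OF s] u(1)[OF s], of v] by (simp add: D_elem_def)
  then have "b (u, D_h T \<beta> q u) v = (\<Sum>s\<in>T. L2_ip (elem s) f v)"
    unfolding b_form_eq[OF p1 qp cond VY v] by (intro sum.cong refl)
  also have "\<dots> = L2_ip \<Omega> f v" by (rule L2_Omega[OF p1 qp u(3) v, symmetric])
  finally show ?thesis .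
qed

text \<open>By consistency the energy error is the residual measured over all of Y, so it can be
  compared with the residual over the discrete test space.\<close>

lemma energy_eq:
  assumes w: "w \<in> Xk"
  shows "energy_norm \<Omega> T \<beta> q (trial_diff (u, D_h T \<beta> q u) w) = dn Y (\<lambda>v. L2_ip \<Omega> f v - b w v)"
  unfolding energy_norm_def
proof (rule dual_norm_cong)
  fix v assume v: "v \<in> Y"
  have i: "integrable (lebesgue_on (elem s)) (\<lambda>x. u x * db s v x)"
    "integrable (lebesgue_on (elem s)) (\<lambda>x. fst w x * db s v x)" if s: "s \<in> T" for s
    using L2_young(1)[OF p1 qp u(2)[OF s] Y_pair(3)[OF s v]]
      L2_young(1)[OF p1 qp Wh_L[OF p1 qp cond VY _ s] Y_pair(3)[OF s v]] w by auto
  have "L2_ip (elem s) (\<lambda>x. u x - fst w x) (db s v) = L2_ip (elem s) u (db s v) - L2_ip (elem s) (fst w) (db s v)" if s: "s \<in> T" for s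
    unfolding L2_ip_def left_diff_distrib by (rule Bochner_Integration.integral_diff[OF i[OF s]])
  then have "b (trial_diff (u, D_h T \<beta> q u) w) v = b (u, D_h T \<beta> q u) v - b w v"
    by (simp add: b_form_def trial_diff_def sum_subtractf)
  then show "b (trial_diff (u, D_h T \<beta> q u) w) v = L2_ip \<Omega> f v - b w v"
    using exact_solution[OF v] by simp
qed

text \<open>
  The values off \<open>Y\<close> are left free because \<open>D_h\<close> takes the value \<open>undefined\<close> there, so that the
  functionals \<open>b w\<close> alone are not closed under addition.
\<close>

definition Fh :: "((real ^ 'n \<Rightarrow> real) \<Rightarrow> real) set" where
  "Fh = {g. \<exists>w\<in>Wk. \<exists>z\<in>Zh0. \<forall>v\<in>Y. g v = b (w, D_h T \<beta> q z) v}"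

lemma Fh_lin: "lin_space Fh"
  unfolding lin_space_def
proof (intro conjI ballI allI)
  note bl = b_form_lin[OF p1 qp cond VY]
  have Zs: "z \<in> Zh0 \<Longrightarrow> z \<in> broken T (\<lambda>s. Poly (int k))" for z using Z0(2) by blast
  have zero: "(\<lambda>v. 0) \<in> Fh"
  proof -
    have m: "(\<lambda>x. 0) \<in> Wk" "(\<lambda>x. 0) \<in> Zh0" using lin_spaceD(1)[OF broken_lin] lin_spaceD(1)[OF Z0(1)] by auto
    have "b (\<lambda>x. 0, D_h T \<beta> q (\<lambda>x. 0)) v = 0" if "v \<in> Y" for v
      using bl(2)[OF m(1,1) Zs[OF m(2)] Zs[OF m(2)] that, of 0] by simp
    then show ?thesis unfolding Fh_def using m by (intro CollectI bexI[of _ "\<lambda>x. 0"] ballI) auto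
  qed
  then show "(\<lambda>v. 0) \<in> Fh" .
  fix g assume "g \<in> Fh"
  then obtain w z where g: "w \<in> Wk" "z \<in> Zh0" "\<forall>v\<in>Y. g v = b (w, D_h T \<beta> q z) v" unfolding Fh_def by blast
  show "(\<lambda>v. a * g v) \<in> Fh" for a
    unfolding Fh_def
    by (intro CollectI bexI[OF _ lin_spaceD(3)[OF broken_lin g(1), of a]] bexI[OF _ lin_spaceD(3)[OF Z0(1) g(2), of a]] ballI)
       (simp add: g(3) bl(2)[OF g(1) g(1) Zs[OF g(2)] Zs[OF g(2)]])
  fix h assume "h \<in> Fh"
  then obtain w' z' where h: "w' \<in> Wk" "z' \<in> Zh0" "\<forall>v\<in>Y. h v = b (w', D_h T \<beta> q z') v" unfolding Fh_def by blast
  show "(\<lambda>v. g v + h v) \<in> Fh"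
    unfolding Fh_def
    by (intro CollectI bexI[OF _ lin_spaceD(2)[OF broken_lin g(1) h(1)]] bexI[OF _ lin_spaceD(2)[OF Z0(1) g(2) h(2)]] ballI)
       (simp add: g(3) h(3) bl(1)[OF g(1) h(1) Zs[OF g(2)] Zs[OF h(2)]])
qed

lemma Fh_rep:
  assumes "g \<in> Fh"
  obtains w where "w \<in> Xk" "\<forall>v\<in>Y. g v = b w v"
  using assms that unfolding Fh_def by blast

lemma Xh_Fh: "w \<in> Xk \<Longrightarrow> b w \<in> Fh"
  unfolding Fh_def by force

lemma Fh_bfun: "g \<in> Fh \<Longrightarrow> bfun g"
proof -
  assume "g \<in> Fh"
  then obtain w where "w \<in> Xk" "\<forall>v\<in>Y. g v = b w v" using Fh_rep by blast
  then show "bfun g" by (intro bfun_cong[OF Xh_bfun]) auto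
qed

text \<open>
  Needed because a dual norm over a space without nonzero functions is the unspecified supremum of
  the empty set.
\<close>

lemma detecting_function:
  obtains v where "v \<in> Y" "\<not> (AE x in lebesgue_on \<Omega>. Pi_h T \<beta> k v x = 0)" "Y_norm T \<beta> q v > 0"
proof -
  obtain s where s: "s \<in> T" using Tne by blast
  let ?c = "beta_elem \<beta> s"
  \<comment> \<open>The derivative of this linear function along beta is the constant
    \<bar>beta\<bar>^2. Hence the trial function (1, 0) takes a nonzero value on its restriction to
    one element, and also on the projection of that restriction, so neither vanishes almost
    everywhere.\<close>
  define l where "l = (\<lambda>x :: real ^ 'n. ?c \<bullet> x)"
  have lC: "C1_fun l" unfolding l_def by (rule C1_fun_bounded_linear) (rule bounded_linear_inner_right)
  have dl: "dd e l x = ?c \<bullet> e" for e x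
    unfolding l_def by (rule dd_eq) (rule bounded_linear_imp_has_derivative[OF bounded_linear_inner_right])
  have dlC: "C1_fun (dd ?c l)" unfolding dl by (rule C1_fun_const)
  define v where "v = (\<lambda>x. if x \<in> interior (elem s) then l x else 0)"
  have vs: "\<forall>x\<in>interior (elem s). v x = l x" by (simp add: v_def)
  have vt: "\<forall>x\<in>interior (elem t). v x = 0" if "t \<in> T" "t \<noteq> s" for t
    using that disj[OF that(1) s that(2)] by (auto simp: v_def)
  have q0: "q \<ge> 0" using q1 by simp
  note fs = piecewise_C1[OF s lC vs]
  have v: "v \<in> Y"
  proof (rule Y_intro)
    fix t assume t: "t \<in> T"
    show "\<exists>g. weak_pair (beta_elem \<beta> t) (elem t) v g \<and> v \<in> L_space q (elem t) \<and> g \<in> L_space q (elem t)"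
    proof (cases "t = s")
      case True
      show ?thesis unfolding True
        by (rule exI[of _ "dd ?c l"]) (intro conjI fs(2) fs(4)[OF q0] C1_L_space[OF s dlC q0])
    next
      case False
      note ft = piecewise_C1[OF t C1_fun_const[of 0] vt[OF t False]]
      show ?thesis
        by (rule exI[of _ "dd (beta_elem \<beta> t) (\<lambda>x. 0)"])
           (intro conjI ft(2) ft(4)[OF q0] C1_L_space[OF t _ q0], simp add: dd_const C1_fun_const)
    qed
  qed
  have one: "(\<lambda>x. 1) \<in> Wk"
    unfolding broken_def using k1 by (intro CollectI ballI bexI[of _ "\<lambda>x. 1"] Poly_const) auto
  have zero: "(\<lambda>x. 0) \<in> Zh0" by (rule lin_spaceD(1)[OF Z0(1)])
  have X: "(\<lambda>x. 1, D_h T \<beta> q (\<lambda>x. 0)) \<in> Xk" using one zero by blast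
  have tr: "AE x in lebesgue_on (elem t). u x = u x" "AE x in lebesgue_on (elem t). db t u x = db t u x" for t u by auto
  have D0: "D_elem \<beta> t (\<lambda>x. 0) v = 0" if t: "t \<in> T" for t
  proof -
    note g = piecewise_C1[OF t C1_fun_const[of 0] ballI[OF refl]]
    show ?thesis unfolding elem_cong_AE(1)[OF t g(1,3) tr] by (simp add: L2_ip_def dd_const)
  qed
  have o1: "AE x in lebesgue_on (elem t). (1::real) = 1" "AE x in lebesgue_on (elem t). db t (\<lambda>x. 1) x = db t (\<lambda>x. 1) x" for t
    by auto
  have L: "L2_ip (elem t) (\<lambda>x. 1) (db t v) = (if t = s then (?c \<bullet> ?c) * measure lebesgue (elem s) else 0)" if t: "t \<in> T" for t
  proof (cases "t = s")
    case True
    have "L2_ip (elem s) (\<lambda>x. 1) (db s v) = L2_ip (elem s) (\<lambda>x. 1) (dd ?c l)"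
      by (rule elem_cong_AE(2)[OF s o1 fs(1,3)])
    also have "\<dots> = (?c \<bullet> ?c) * measure (lebesgue_on (elem s)) (elem s)" unfolding L2_ip_def dl by simp
    also have "measure (lebesgue_on (elem s)) (elem s) = measure lebesgue (elem s)"
      by (rule measure_restrict_space) (use elem_sets[OF inv[OF s]] in auto)
    finally show ?thesis using True by simp
  next
    case False
    note ft = piecewise_C1[OF t C1_fun_const[of 0] vt[OF t False]]
    have "L2_ip (elem t) (\<lambda>x. 1) (db t v) = L2_ip (elem t) (\<lambda>x. 1) (dd (beta_elem \<beta> t) (\<lambda>x. 0))"
      by (rule elem_cong_AE(2)[OF t o1 ft(1,3)])
    then show ?thesis using False by (simp add: L2_ip_def dd_const)
  qed
  have mpos: "measure lebesgue (elem s) > 0"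
  proof -
    have "0 < (\<integral>x. (1::real) \<partial>lebesgue_on (elem s))"
    proof -
      obtain x where "x \<in> interior (elem s)" using interior_elem_ne[OF inv[OF s]] by blast
      then show ?thesis
        by (rule integral_pos_continuous[OF elem_compact[OF inv[OF s]] continuous_on_const, rotated]) auto
    qed
    moreover have "measure (lebesgue_on (elem s)) (elem s) = measure lebesgue (elem s)"
      by (rule measure_restrict_space) (use elem_sets[OF inv[OF s]] in auto)
    ultimately show ?thesis by simp
  qed
  have "b (\<lambda>x. 1, D_h T \<beta> q (\<lambda>x. 0)) v = (\<Sum>t\<in>T. if t = s then - ((?c \<bullet> ?c) * measure lebesgue (elem s)) else 0)"
    unfolding b_form_eq[OF p1 qp cond VY v] using D0 L by (intro sum.cong) auto
  also have "\<dots> = - ((?c \<bullet> ?c) * measure lebesgue (elem s))" using s finT by simp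
  finally have b0: "b (\<lambda>x. 1, D_h T \<beta> q (\<lambda>x. 0)) v \<noteq> 0" using mpos bne[OF s] by simp
  have PY: "Pi_h T \<beta> k v \<in> Y" using Pi_Yh[OF v] Yh(3) by blast
  have "\<not> (AE x in lebesgue_on \<Omega>. Pi_h T \<beta> k v x = 0)"
    using bfun_AE_zero[OF Xh_bfun[OF X] PY] Xh_Pi[OF X v] b0 by auto
  moreover have "Y_norm T \<beta> q v > 0"
    using bfun_AE_zero[OF Xh_bfun[OF X] v] b0 by (intro Y_norm_pos[OF v]) auto
  ultimately show ?thesis using that v by blast
qed

lemma nontrivial_Yh: "nontrivial Yh"
  using detecting_function Pi_Yh unfolding nontrivial_def by metis

lemma nontrivial_Y: "nontrivial Y"
  using nontrivial_Yh Yh(3) unfolding nontrivial_def by blast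

lemma C_nonneg: "0 \<le> C"
proof -
  obtain v where v: "v \<in> Y" "Y_norm T \<beta> q v > 0" using detecting_function by blast
  have "0 \<le> C * Y_norm T \<beta> q v" using C[OF v(1)] Y_norm_nonneg[of "Pi_h T \<beta> k v"] by linarith
  then show ?thesis using v(2) by (simp add: zero_le_mult_iff)
qed

lemma residual_norm_eq: "residual_norm \<Omega> T \<beta> q Yh f w = dn Yh (\<lambda>v. L2_ip \<Omega> f v - b w v)"
  by (simp add: residual_norm_def)

text \<open>Moves the minimization from pairs to the linear space \<open>Fh\<close> of functionals,
  the setting of the abstract existence and uniqueness results.\<close>

lemma minimizer_iff:
  "is_arg_min (residual_norm \<Omega> T \<beta> q Yh f) (\<lambda>w. w \<in> Xk) w \<longleftrightarrow>
    w \<in> Xk \<and> (\<forall>g\<in>Fh. dn Yh (\<lambda>v. L2_ip \<Omega> f v - b w v) \<le> dn Yh (\<lambda>v. L2_ip \<Omega> f v - g v))"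
proof
  assume a: "is_arg_min (residual_norm \<Omega> T \<beta> q Yh f) (\<lambda>w. w \<in> Xk) w"
  show "w \<in> Xk \<and> (\<forall>g\<in>Fh. dn Yh (\<lambda>v. L2_ip \<Omega> f v - b w v) \<le> dn Yh (\<lambda>v. L2_ip \<Omega> f v - g v))"
  proof (intro conjI ballI)
    show "w \<in> Xk" using a by (simp add: is_arg_min_def)
    fix g assume "g \<in> Fh"
    then obtain w' where w': "w' \<in> Xk" "\<forall>v\<in>Y. g v = b w' v" using Fh_rep by blast
    have "dn Yh (\<lambda>v. L2_ip \<Omega> f v - g v) = dn Yh (\<lambda>v. L2_ip \<Omega> f v - b w' v)"
      by (rule dual_norm_cong) (use w'(2) Yh(3) in auto)
    moreover have "\<not> residual_norm \<Omega> T \<beta> q Yh f w' < residual_norm \<Omega> T \<beta> q Yh f w"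
      using a w'(1) unfolding is_arg_min_def by blast
    ultimately show "dn Yh (\<lambda>v. L2_ip \<Omega> f v - b w v) \<le> dn Yh (\<lambda>v. L2_ip \<Omega> f v - g v)"
      by (simp add: residual_norm_eq)
  qed
next
  assume a: "w \<in> Xk \<and> (\<forall>g\<in>Fh. dn Yh (\<lambda>v. L2_ip \<Omega> f v - b w v) \<le> dn Yh (\<lambda>v. L2_ip \<Omega> f v - g v))"
  show "is_arg_min (residual_norm \<Omega> T \<beta> q Yh f) (\<lambda>w. w \<in> Xk) w"
    unfolding is_arg_min_def residual_norm_eq
  proof (intro conjI notI)
    show "w \<in> Xk" using a by blast
    assume "\<exists>w'. w' \<in> Xk \<and> dn Yh (\<lambda>v. L2_ip \<Omega> f v - b w' v) < dn Yh (\<lambda>v. L2_ip \<Omega> f v - b w v)"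
    then obtain w' where "w' \<in> Xk" "dn Yh (\<lambda>v. L2_ip \<Omega> f v - b w' v) < dn Yh (\<lambda>v. L2_ip \<Omega> f v - b w v)" by blast
    then show False using a Xh_Fh[of w'] by (meson not_le)
  qed
qed

text \<open>Equality of the two functionals on the discrete test space extends to Y through the
  projection. The kernel property then identifies the first components, and what is left of the form
  identifies the second ones.\<close>

lemma minimizer_unique:
  assumes "is_arg_min (residual_norm \<Omega> T \<beta> q Yh f) (\<lambda>w. w \<in> Xk) w"
    and "is_arg_min (residual_norm \<Omega> T \<beta> q Yh f) (\<lambda>w. w \<in> Xk) w'"
  shows "trial_eq \<Omega> w w'"
proof -
  have w: "w \<in> Xk" "w' \<in> Xk"
    and m: "\<And>g. g \<in> Fh \<Longrightarrow> dn Yh (\<lambda>v. L2_ip \<Omega> f v - b w v) \<le> dn Yh (\<lambda>v. L2_ip \<Omega> f v - g v)"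
      "\<And>g. g \<in> Fh \<Longrightarrow> dn Yh (\<lambda>v. L2_ip \<Omega> f v - b w' v) \<le> dn Yh (\<lambda>v. L2_ip \<Omega> f v - g v)"
    using assms unfolding minimizer_iff by auto
  have eqh: "b w' y = b w y" if "y \<in> Yh" for y
    \<comment> \<open>Strict convexity yields equality on \<open>Yh\<close> only; nothing is known
      at this point about other arguments in Y.\<close>
    by (rule residual_minimizer_unique[OF Yh(1,3) nontrivial_Yh Fh_lin Fh_bfun ell_bfun
          Xh_Fh[OF w(1)] m(1) Xh_Fh[OF w(2)] m(2) that])
  have eq: "b w' v = b w v" if v: "v \<in> Y" for v
    using eqh[OF Pi_Yh[OF v]] Xh_Pi[OF w(1) v] Xh_Pi[OF w(2) v] by simp
  obtain a z where a: "a \<in> Wk" "z \<in> Zh0" "w = (a, D_h T \<beta> q z)" using w(1) by blast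
  obtain a' z' where a': "a' \<in> Wk" "z' \<in> Zh0" "w' = (a', D_h T \<beta> q z')" using w(2) by blast
  have ZZ: "z \<in> broken T (\<lambda>s. Poly (int k))" "z' \<in> broken T (\<lambda>s. Poly (int k))" using a a' Z0(2) by auto
  note bl = b_form_lin[OF p1 qp cond VY]
  have na: "(\<lambda>x. (- 1) * a' x) \<in> Wk" "(\<lambda>x. (- 1) * z' x) \<in> Zh0"
    by (rule lin_spaceD(3)[OF broken_lin a'(1)], rule lin_spaceD(3)[OF Z0(1) a'(2)])
  have "AE x in lebesgue_on \<Omega>. a x + (- 1) * a' x = 0"
  proof (rule ker[OF lin_spaceD(2)[OF broken_lin a(1) na(1)] lin_spaceD(2)[OF Z0(1) a(2) na(2)]])
    fix v assume v: "v \<in> Y"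
    have nz: "(\<lambda>x. (- 1) * z' x) \<in> broken T (\<lambda>s. Poly (int k))" using na(2) Z0(2) by blast
    show "b (\<lambda>x. a x + (- 1) * a' x, D_h T \<beta> q (\<lambda>x. z x + (- 1) * z' x)) v = 0"
      unfolding bl(1)[OF a(1) na(1) ZZ(1) nz v] bl(2)[OF a'(1) a'(1) ZZ(2) ZZ(2) v]
      using eq[OF v] unfolding a(3) a'(3) by simp
  qed
  then have ae: "AE x in lebesgue_on \<Omega>. a x = a' x" by eventually_elim simp
  have "D_h T \<beta> q z v = D_h T \<beta> q z' v" for v
  proof (cases "v \<in> Y")
    case False
    then show ?thesis by (simp add: D_h_def)
  next
    case True
    have "L2_ip (elem s) a (db s v) = L2_ip (elem s) a' (db s v)" if s: "s \<in> T" for s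
      unfolding L2_ip_def
      by (rule integral_lebesgue_on_cong_AE(1)[OF elem_sets[OF inv[OF s]]])
         (use ae[unfolded AE_Omega_iff, rule_format, OF s] in eventually_elim, simp)
    then have "(\<Sum>s\<in>T. L2_ip (elem s) a (db s v)) = (\<Sum>s\<in>T. L2_ip (elem s) a' (db s v))" by (intro sum.cong refl)
    then show ?thesis using eq[OF True] unfolding a(3) a'(3) b_form_def by simp
  qed
  then show ?thesis using ae unfolding trial_eq_def a(3) a'(3) by auto
qed

text \<open>The two residuals differ by a discrete functional, which may be evaluated at the
  projection of v instead of v. There each residual is at most E times the norm of the projection,
  whence the two summands C.\<close>

lemma quasi_optimal_le:
  assumes m: "is_arg_min (residual_norm \<Omega> T \<beta> q Yh f) (\<lambda>w. w \<in> Xk) uh" and w: "w \<in> Xk"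
  shows "energy_norm \<Omega> T \<beta> q (trial_diff (u, D_h T \<beta> q u) uh)
    \<le> (1 + 2 * C) * energy_norm \<Omega> T \<beta> q (trial_diff (u, D_h T \<beta> q u) w)"
proof -
  have uh: "uh \<in> Xk" and min: "\<And>g. g \<in> Fh \<Longrightarrow> dn Yh (\<lambda>v. L2_ip \<Omega> f v - b uh v) \<le> dn Yh (\<lambda>v. L2_ip \<Omega> f v - g v)"
    using m unfolding minimizer_iff by auto
  note lin = fin_dim_lin[OF Yh(1)]
  define e where "e w v = L2_ip \<Omega> f v - b w v" for w v
  have eb: "bfun (e w)" if "w \<in> Xk" for w unfolding e_def[abs_def] by (rule bfun_diff[OF ell_bfun Xh_bfun[OF that]])
  define E where "E = dn Y (e w)"
  have sub: "dn Yh (e w) \<le> E"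
    unfolding E_def by (rule dn_least[OF Yh(3) nontrivial_Yh]) (rule dn_upper[OF eb[OF w]], use Yh(3) in auto)
  have E0: "0 \<le> dn Yh (e w)" by (rule dn_nonneg[OF eb[OF w] Yh(3) lin nontrivial_Yh])
  have mu: "dn Yh (e uh) \<le> dn Yh (e w)" unfolding e_def[abs_def] by (rule min[OF Xh_Fh[OF w]])
  have "dn Y (e uh) \<le> (1 + 2 * C) * E"
  proof (rule dn_least[OF subset_refl nontrivial_Y])
    fix v assume v: "v \<in> Y"
    let ?\<pi> = "Pi_h T \<beta> k v"
    have PY: "?\<pi> \<in> Yh" by (rule Pi_Yh[OF v])
    have "b w v - b uh v = e uh ?\<pi> - e w ?\<pi>"
      unfolding e_def Xh_Pi[OF w v] Xh_Pi[OF uh v] by simp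
    also have "\<dots> \<le> \<bar>e uh ?\<pi>\<bar> + \<bar>e w ?\<pi>\<bar>" by linarith
    also have "\<dots> \<le> dn Yh (e uh) * Y_norm T \<beta> q ?\<pi> + dn Yh (e w) * Y_norm T \<beta> q ?\<pi>"
      by (intro add_mono dn_abs[OF eb Yh(3) lin PY] uh w)
    also have "\<dots> \<le> E * Y_norm T \<beta> q ?\<pi> + E * Y_norm T \<beta> q ?\<pi>"
      using mu sub by (intro add_mono mult_right_mono Y_norm_nonneg) auto
    also have "\<dots> \<le> E * (C * Y_norm T \<beta> q v) + E * (C * Y_norm T \<beta> q v)"
      using E0 sub by (intro add_mono mult_left_mono C v) auto
    finally have 1: "b w v - b uh v \<le> 2 * C * E * Y_norm T \<beta> q v" by (simp add: mult_ac)
    have 2: "e w v \<le> E * Y_norm T \<beta> q v" unfolding E_def by (rule dn_upper[OF eb[OF w] subset_refl v])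
    have "e uh v = e w v + (b w v - b uh v)" by (simp add: e_def)
    also have "\<dots> \<le> E * Y_norm T \<beta> q v + 2 * C * E * Y_norm T \<beta> q v" by (rule add_mono[OF 2 1])
    also have "\<dots> = (1 + 2 * C) * E * Y_norm T \<beta> q v" by (simp add: algebra_simps)
    finally show "e uh v \<le> (1 + 2 * C) * E * Y_norm T \<beta> q v" .
  qed
  then show ?thesis unfolding energy_eq[OF uh] energy_eq[OF w] E_def e_def[abs_def] .
qed

lemma residual_minimization:
  "\<exists>uh. is_arg_min (residual_norm \<Omega> T \<beta> q Yh f) (\<lambda>w. w \<in> Xk) uh \<and>
     (\<forall>wh. is_arg_min (residual_norm \<Omega> T \<beta> q Yh f) (\<lambda>w. w \<in> Xk) wh \<longrightarrow> trial_eq \<Omega> wh uh) \<and>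
     energy_norm \<Omega> T \<beta> q (trial_diff (u, D_h T \<beta> q u) uh)
       \<le> (1 + 2 * C) * (INF wh \<in> Xk. energy_norm \<Omega> T \<beta> q (trial_diff (u, D_h T \<beta> q u) wh))"
proof -
  obtain g where g: "g \<in> Fh" "\<forall>h\<in>Fh. dn Yh (\<lambda>v. L2_ip \<Omega> f v - g v) \<le> dn Yh (\<lambda>v. L2_ip \<Omega> f v - h v)"
    using residual_minimizer_exists[OF Yh(1,3) nontrivial_Yh Fh_lin Fh_bfun ell_bfun] by blast
  obtain uh where uh: "uh \<in> Xk" "\<forall>v\<in>Y. g v = b uh v" using Fh_rep[OF g(1)] by blast
  have "dn Yh (\<lambda>v. L2_ip \<Omega> f v - b uh v) = dn Yh (\<lambda>v. L2_ip \<Omega> f v - g v)"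
    by (rule dual_norm_cong) (use uh(2) Yh(3) in auto)
  then have m: "is_arg_min (residual_norm \<Omega> T \<beta> q Yh f) (\<lambda>w. w \<in> Xk) uh"
    unfolding minimizer_iff using uh(1) g(2) by auto
  have Cp: "1 + 2 * C > 0" using C_nonneg by simp
  have "energy_norm \<Omega> T \<beta> q (trial_diff (u, D_h T \<beta> q u) uh) / (1 + 2 * C)
    \<le> (INF wh \<in> Xk. energy_norm \<Omega> T \<beta> q (trial_diff (u, D_h T \<beta> q u) wh))"
  proof (rule cINF_greatest)
    show "Xk \<noteq> {}" using uh(1) by blast
    fix w assume w: "w \<in> Xk"
    show "energy_norm \<Omega> T \<beta> q (trial_diff (u, D_h T \<beta> q u) uh) / (1 + 2 * C)
      \<le> energy_norm \<Omega> T \<beta> q (trial_diff (u, D_h T \<beta> q u) w)"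
      using quasi_optimal_le[OF m w] Cp by (simp add: divide_le_eq mult.commute)
  qed
  then have "energy_norm \<Omega> T \<beta> q (trial_diff (u, D_h T \<beta> q u) uh)
    \<le> (1 + 2 * C) * (INF wh \<in> Xk. energy_norm \<Omega> T \<beta> q (trial_diff (u, D_h T \<beta> q u) wh))"
    using Cp by (simp add: divide_le_eq mult.commute)
  then show ?thesis using m minimizer_unique[OF _ m] by blast
qed

end

end

section \<open>Geometry of the mesh\<close>

text \<open>Excludes slits, so that interiors of elements lie in the domain and not merely in its
  closure. At a boundary point the region below the Lipschitz graph contains balls that miss the
  domain.\<close>

lemma lipschitz_domain_interior_closure:
  assumes "lipschitz_domain \<Omega>"
  shows "interior (closure \<Omega>) \<subseteq> \<Omega>"
proof
  fix x0 assume x0: "x0 \<in> interior (closure \<Omega>)"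
  have op: "open \<Omega>" using assms by (simp add: lipschitz_domain_def)
  show "x0 \<in> \<Omega>"
  proof (rule ccontr)
    assume n: "x0 \<notin> \<Omega>"
    then have "x0 \<in> frontier \<Omega>" using x0 interior_subset[of "closure \<Omega>"] op
      by (auto simp: frontier_def interior_open)
    then obtain e r L g where e: "norm e = 1" "r > 0" and g: "L-lipschitz_on {y. y \<bullet> e = 0} g"
      and eq: "\<Omega> \<inter> ball x0 r = {x \<in> ball x0 r. g (x - (x \<bullet> e) *\<^sub>R e) < x \<bullet> e}"
      using assms unfolding lipschitz_domain_def by blast
    have ee: "e \<bullet> e = 1" using e(1) by (simp add: norm_eq_1)
    have L: "0 \<le> L" by (rule lipschitz_on_nonneg[OF g])
    define pr where "pr x = x - (x \<bullet> e) *\<^sub>R e" for x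
    have prH: "pr x \<in> {y. y \<bullet> e = 0}" for x by (simp add: pr_def inner_diff_left ee)
    have prd: "norm (pr x - pr y) \<le> 2 * norm (x - y)" for x y
    proof -
      have "pr x - pr y = (x - y) - ((x - y) \<bullet> e) *\<^sub>R e" by (simp add: pr_def algebra_simps inner_diff_left)
      then have "norm (pr x - pr y) \<le> norm (x - y) + \<bar>(x - y) \<bullet> e\<bar> * norm e"
        by (metis norm_scaleR norm_triangle_ineq4)
      also have "\<bar>(x - y) \<bullet> e\<bar> \<le> norm (x - y) * norm e" by (rule Cauchy_Schwarz_ineq2)
      finally show ?thesis using e(1) by simp
    qed
    have gx: "x0 \<bullet> e \<le> g (pr x0)"
    proof (rule ccontr)
      assume "\<not> x0 \<bullet> e \<le> g (pr x0)"
      then have "x0 \<in> {x \<in> ball x0 r. g (x - (x \<bullet> e) *\<^sub>R e) < x \<bullet> e}" using e(2) by (simp add: pr_def)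
      then show False using n unfolding eq[symmetric] by blast
    qed
    obtain d where d: "d > 0" "ball x0 d \<subseteq> closure \<Omega>" using x0 unfolding mem_interior by blast
    define t where "t = min d r / 2"
    have t: "t > 0" "t < d" "t < r" using d(1) e(2) by (auto simp: t_def)
    \<comment> \<open>A point at depth at least t below the graph and still close enough to x0 to
      belong to the closure by assumption.\<close>
    define y where "y = x0 - t *\<^sub>R e"
    have yd: "dist x0 y = t" using e(1) t(1) by (simp add: y_def dist_norm)
    have py: "pr y = pr x0" by (simp add: pr_def y_def inner_diff_left ee algebra_simps)
    have ye: "y \<bullet> e = x0 \<bullet> e - t" by (simp add: y_def inner_diff_left ee)
    \<comment> \<open>A move by norm (z - y) changes the height by at most that amount and the graph
      by at most 2L times it, since \<open>pr\<close> has Lipschitz constant at most 2. So t/(1 +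
      2L) is not enough to climb the depth t, while r - t keeps z in the ball.\<close>
    define \<eta> where "\<eta> = min (t / (1 + 2 * L)) (r - t)"
    have \<eta>: "\<eta> > 0" "\<eta> \<le> t / (1 + 2 * L)" "\<eta> \<le> r - t" using t L by (auto simp: \<eta>_def)
    have "y \<in> closure \<Omega>" using d(2) yd t(2) by auto
    then obtain z where z: "z \<in> \<Omega>" "dist z y < \<eta>" using \<eta>(1) closure_approachable by blast
    have "dist x0 z < r" using dist_triangle[of x0 z y] yd z(2) \<eta>(3) by (simp add: dist_commute)
    then have "z \<in> \<Omega> \<inter> ball x0 r" using z(1) by simp
    then have gz: "g (pr z) < z \<bullet> e" unfolding eq pr_def by simp
    have "dist (g (pr z)) (g (pr y)) \<le> L * dist (pr z) (pr y)" by (rule lipschitz_onD[OF g prH prH])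
    also have "\<dots> \<le> L * (2 * norm (z - y))" unfolding dist_norm by (rule mult_left_mono[OF prd L])
    finally have "g (pr y) - 2 * L * norm (z - y) \<le> g (pr z)" by (simp add: dist_real_def abs_le_iff)
    moreover have "z \<bullet> e \<le> y \<bullet> e + norm (z - y)"
    proof -
      have "(z - y) \<bullet> e \<le> norm (z - y) * norm e" by (rule norm_cauchy_schwarz)
      then show ?thesis using e(1) by (simp add: inner_diff_left)
    qed
    ultimately have "t < (1 + 2 * L) * norm (z - y)" using gz gx py ye by (simp add: algebra_simps)
    also have "\<dots> < (1 + 2 * L) * (t / (1 + 2 * L))"
      using z(2) \<eta>(2) L by (intro mult_strict_left_mono) (auto simp: dist_norm)
    also have "\<dots> = t" using L by simp
    finally show False by simp
  qed
qed

lemma advection_field_const: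
  assumes "advection_field T \<beta>" "s \<in> T" "invertible (aff_matrix s)"
  shows "\<forall>x\<in>interior (elem s). \<beta> x = beta_elem \<beta> s" "beta_elem \<beta> s \<noteq> 0"
proof -
  have "\<forall>s\<in>T. \<exists>c. c \<noteq> 0 \<and> (\<forall>x\<in>interior (elem s). \<beta> x = c)"
    using assms(1) unfolding advection_field_def by (rule conjunct1)
  from bspec[OF this assms(2)] obtain c where c: "c \<noteq> 0" "\<forall>x\<in>interior (elem s). \<beta> x = c" by blast
  have "beta_elem \<beta> s = c" by (rule beta_elem_eq[OF assms(3) c(2)])
  then show "\<forall>x\<in>interior (elem s). \<beta> x = beta_elem \<beta> s" "beta_elem \<beta> s \<noteq> 0" using c by auto
qed

lemma conforming_mesh_imp_advection_mesh:
  fixes \<Omega> :: "(real ^ 'n::finite) set"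
  assumes lip: "lipschitz_domain \<Omega>" and mesh: "conforming_mesh \<Omega> T" and adv: "advection_field T \<beta>" and q: "q > 1"
  shows "advection_mesh \<Omega> T \<beta> q"
proof
  have fin: "finite T" and inv: "\<And>s. s \<in> T \<Longrightarrow> invertible (aff_matrix s)" and inj: "inj_on elem T"
    and tri: "triangulation (elem ` T)" and cov: "\<Union>(elem ` T) = closure \<Omega>"
    using mesh unfolding conforming_mesh_def by auto
  have op: "open \<Omega>" and bd: "bounded \<Omega>" using lip by (auto simp: lipschitz_domain_def)
  show "finite T" by fact
  show "invertible (aff_matrix s)" if "s \<in> T" for s by (rule inv[OF that])
  show "\<forall>x\<in>interior (elem s). \<beta> x = beta_elem \<beta> s" "beta_elem \<beta> s \<noteq> 0" if "s \<in> T" for s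
    using advection_field_const[OF adv that inv[OF that]] by auto
  show "\<Omega> \<in> lmeasurable" by (rule lmeasurable_open[OF bd op])
  show "interior (elem s) \<subseteq> \<Omega>" if "s \<in> T" for s
  proof -
    have "elem s \<subseteq> closure \<Omega>" using cov that by blast
    then show ?thesis using interior_mono lipschitz_domain_interior_closure[OF lip] by blast
  qed
  \<comment> \<open>A face that meets the interior of a convex set is the whole set. Two elements
    with a common interior point therefore coincide.\<close>
  have face: "(elem s \<inter> elem t) face_of elem s" if "s \<in> T" "t \<in> T" for s t
    using tri that unfolding triangulation_def by blast
  show "interior (elem s) \<inter> interior (elem t) = {}" if st: "s \<in> T" "t \<in> T" "s \<noteq> t" for s t
  proof (rule ccontr)
    assume "interior (elem s) \<inter> interior (elem t) \<noteq> {}"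
    then obtain x where x: "x \<in> interior (elem s)" "x \<in> interior (elem t)" by blast
    then have xe: "x \<in> elem s" "x \<in> elem t" using interior_subset by blast+
    have "elem s \<inter> elem t = elem s" using face_of_disjoint_interior[OF face[OF st(1,2)]] x xe by blast
    moreover have "elem t \<inter> elem s = elem t" using face_of_disjoint_interior[OF face[OF st(2,1)]] x xe by blast
    ultimately have "elem s = elem t" by blast
    then show False using inj st by (auto dest: inj_onD)
  qed
  have "AE x in lebesgue. \<forall>s\<in>T. x \<in> elem s \<longrightarrow> x \<in> interior (elem s)"
  proof (intro AE_finite_allI fin)
    fix s assume s: "s \<in> T"
    show "AE x in lebesgue. x \<in> elem s \<longrightarrow> x \<in> interior (elem s)"
      using AE_interior[OF inv[OF s]] by (subst (asm) AE_restrict_space_iff) (use elem_sets[OF inv[OF s]] in auto)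
  qed
  then show "AE x in lebesgue. x \<in> \<Omega> \<longrightarrow> (\<exists>s\<in>T. x \<in> interior (elem s))"
  proof eventually_elim
    case (elim x)
    then show ?case using cov closure_subset[of \<Omega>] by blast
  qed
qed (rule q)

section \<open>Facets and their surface measure\<close>

context
  fixes s :: "'n::finite vertices"
  assumes inv: "invertible (aff_matrix s)"
begin

lemma affine_hull_facet: "affine hull (facet s i) = {x. bary s i x = 0}"
proof
  have "affine {x. bary s i x = 0}"
    unfolding affine_def by (auto simp: bary_convex[OF inv])
  then show "affine hull (facet s i) \<subseteq> {x. bary s i x = 0}"
    by (intro hull_minimal) (auto simp: facet_eq[OF inv])
  show "{x. bary s i x = 0} \<subseteq> affine hull (facet s i)"
  proof
    fix x assume "x \<in> {x. bary s i x = 0}"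
    then have x: "bary s i x = 0" by simp
    obtain g where g: "\<And>h. bgrad s i h = g \<bullet> h" using normal_eq[OF inv, of i] by blast
    have v: "s j \<in> facet s i" if "j \<noteq> i" for j
      using that by (simp add: facet_eq[OF inv] vertex_in_elem[OF inv] bary_vertex[OF inv])
    have inj: "inj s"
    proof (rule injI)
      fix j l assume "s j = s l"
      then have "bary s j (s l) = 1" using bary_vertex[OF inv, of j j] by simp
      then show "j = l" by (simp add: bary_vertex[OF inv] split: if_splits)
    qed
    then have ij: "inj_on s (UNIV - {i})" by (rule inj_on_subset) simp
    \<comment> \<open>The library description of affine sets sums over points, so the coefficients
      are carried over from indices to vertices by injectivity of s.\<close>
    define u where "u y = bary s (Hilbert_Choice.inv s y) x" for y
    have us: "u (s j) = bary s j x" for j by (simp add: u_def inj)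
    have r: "(\<Sum>y\<in>s ` (UNIV - {i}). h y) = (\<Sum>j\<in>UNIV - {i}. h (s j))" for h :: "real ^ 'n \<Rightarrow> 'z :: comm_monoid_add"
      by (simp add: sum.reindex[OF ij])
    have "(\<Sum>y\<in>s ` (UNIV - {i}). u y *\<^sub>R y) \<in> affine hull (facet s i)"
    proof (rule affine[THEN iffD1, OF affine_affine_hull, rule_format], intro conjI)
      show "sum u (s ` (UNIV - {i})) = 1"
        unfolding r us using bary_sum[OF inv, of x] x by (simp add: sum.remove[of UNIV i])
      show "s ` (UNIV - {i}) \<noteq> {}" using exists_other[OF inv, of i] by blast
      show "s ` (UNIV - {i}) \<subseteq> affine hull (facet s i)" using v by (auto intro: hull_inc)
    qed simp
    then have "(\<Sum>j\<in>UNIV - {i}. bary s j x *\<^sub>R s j) \<in> affine hull (facet s i)"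
      unfolding r us .
    also have "(\<Sum>j\<in>UNIV - {i}. bary s j x *\<^sub>R s j) = x"
      using bary_point[OF inv, of x] x by (simp add: sum.remove[of UNIV i])
    finally show "x \<in> affine hull (facet s i)" .
  qed
qed

lemma facet_rel_interior:
  assumes "x \<in> facet s i" "\<And>j. j \<noteq> i \<Longrightarrow> bary s j x \<noteq> 0"
  shows "x \<in> rel_interior (facet s i)"
  unfolding mem_rel_interior
proof (intro exI conjI)
  let ?U = "{y. \<forall>j\<in>UNIV - {i}. 0 < bary s j y}"
  have eq: "?U = (\<Inter>j\<in>UNIV - {i}. {y. 0 < bary s j y})" by auto
  show "open ?U" unfolding eq
    by (intro open_INT ballI open_Collect_less continuous_on_const bary_cont[OF inv]) simp
  have "0 \<le> bary s j x" for j using assms(1) by (simp add: facet_eq[OF inv] mem_elem[OF inv])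
  then show "x \<in> ?U \<inter> facet s i" using assms by (auto simp: order_less_le)
  show "?U \<inter> affine hull (facet s i) \<subseteq> facet s i"
  proof
    fix y assume y: "y \<in> ?U \<inter> affine hull (facet s i)"
    then have z: "bary s i y = 0" by (simp add: affine_hull_facet)
    have "0 \<le> bary s j y" for j using y z by (cases "j = i") (auto intro: less_imp_le)
    then show "y \<in> facet s i" using z by (simp add: facet_eq[OF inv] mem_elem[OF inv])
  qed
qed

lemma facet_compact: "compact (facet s i)"
  unfolding facet_def by (intro finite_imp_compact_convex_hull finite_imageI) simp

lemma facet_ne: "facet s i \<noteq> {}"
proof -
  obtain l where "l \<noteq> i" using exists_other[OF inv, of i] by blast
  then have "s l \<in> facet s i" by (simp add: facet_eq[OF inv] vertex_in_elem[OF inv] bary_vertex[OF inv])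
  then show ?thesis by blast
qed

text \<open>\<open>Gamma_in\<close> and \<open>Gamma_out\<close> consist of relative interiors,
  while traces live on whole facets. The rest of a facet is null because its preimage under the
  projection lies in finitely many hyperplanes.\<close>

lemma AE_facet_measure: "AE x in facet_measure (facet s i). x \<in> rel_interior (facet s i)"
proof -
  let ?F = "facet s i"
  define A where "A = affine hull ?F"
  define \<pi> where "\<pi> = closest_point A"
  define S where "S = {x. \<pi> x \<in> ?F \<and> dist x (\<pi> x) \<le> 1 / 2}"
  have fm: "facet_measure ?F = distr (restrict_space lborel S) borel \<pi>"
    by (simp add: facet_measure_def Let_def S_def \<pi>_def A_def)
  have Aeq: "A = {x. bary s i x = 0}" unfolding A_def by (rule affine_hull_facet)
  have Acl: "closed A" "convex A" "A \<noteq> {}"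
    using facet_ne hull_subset[of ?F affine] by (auto simp: A_def affine_imp_convex)
  have \<pi>c: "continuous_on UNIV \<pi>" unfolding \<pi>_def by (rule continuous_on_closest_point[OF Acl(2,1,3)])
  have [measurable]: "\<pi> \<in> borel_measurable borel" by (rule borel_measurable_continuous_onI[OF \<pi>c])
  have "S = \<pi> -` ?F \<inter> {x. dist x (\<pi> x) \<le> 1 / 2}" by (auto simp: S_def)
  moreover have "closed (\<pi> -` ?F)"
    using continuous_closed_vimage[OF compact_imp_closed[OF facet_compact], of \<pi>] \<pi>c
    by (simp add: continuous_on_eq_continuous_at)
  moreover have "closed {x. dist x (\<pi> x) \<le> 1 / 2}" by (intro closed_Collect_le continuous_intros \<pi>c)
  ultimately have Sb: "S \<in> sets borel" by (simp add: closed_Int borel_closed)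
  obtain g where g: "\<And>h. bgrad s i h = g \<bullet> h" "g \<noteq> 0" using normal_eq[OF inv, of i] by blast
  \<comment> \<open>The closest point on the hyperplane lambda_i = 0 is reached along the gradient g
    of lambda_i, so the projection is an explicit affine map.\<close>
  have \<pi>eq: "\<pi> x = x - (bary s i x / (g \<bullet> g)) *\<^sub>R g" for x
  proof -
    define a where "a = bary s i x / (g \<bullet> g)"
    define y where "y = x - a *\<^sub>R g"
    have "bary s i y = bary s i x + bgrad s i (- (a *\<^sub>R g))"
      unfolding y_def using bary_add[OF inv, of i x "- (a *\<^sub>R g)"] by simp
    also have "\<dots> = 0" using g(2) by (simp add: g(1) a_def)
    finally have y: "y \<in> A" by (simp add: Aeq)
    have "dist x y \<le> dist x z" if z: "z \<in> A" for z
    proof -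
      have "g \<bullet> (y - z) = 0" using y z by (simp add: g(1)[symmetric] bgrad_diff[OF inv] Aeq)
      then have "orthogonal (x - y) (y - z)" by (simp add: orthogonal_def y_def)
      then have "(norm ((x - y) + (y - z)))\<^sup>2 = (norm (x - y))\<^sup>2 + (norm (y - z))\<^sup>2" by (rule norm_add_Pythagorean)
      then have "(norm (x - y))\<^sup>2 \<le> (norm (x - z))\<^sup>2" by simp
      then show ?thesis unfolding dist_norm by (rule power2_le_imp_le) simp
    qed
    then have "y = \<pi> x" unfolding \<pi>_def by (intro closest_point_unique[OF Acl(2,1) y]) blast
    then show ?thesis by (simp add: y_def a_def)
  qed
  have null: "AE x in lborel. bary s j (\<pi> x) \<noteq> 0" if j: "j \<noteq> i" for j
  proof -
    obtain gj where gj: "\<And>h. bgrad s j h = gj \<bullet> h" using normal_eq[OF inv, of j] by blast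
    define H where "H = gj - ((gj \<bullet> g) / (g \<bullet> g)) *\<^sub>R g"
    define d where "d = bary s j 0 - bary s i 0 * ((gj \<bullet> g) / (g \<bullet> g))"
    have h: "bary s j (\<pi> x) = H \<bullet> x + d" for x
    proof -
      have bx: "bary s k x = bary s k 0 + bgrad s k x" for k using bary_add[OF inv, of k 0 x] by simp
      have "bary s j (\<pi> x) = bary s j x + bgrad s j (- ((bary s i x / (g \<bullet> g)) *\<^sub>R g))"
        unfolding \<pi>eq using bary_add[OF inv, of j x "- ((bary s i x / (g \<bullet> g)) *\<^sub>R g)"] by simp
      also have "\<dots> = bary s j 0 + gj \<bullet> x - (bary s i 0 + g \<bullet> x) * ((gj \<bullet> g) / (g \<bullet> g))"
        by (simp add: bx gj g(1))
      finally show ?thesis by (simp add: H_def d_def inner_diff_left algebra_simps)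
    qed
    \<comment> \<open>The projection fixes the vertex s j, where lambda_j is 1. Hence the affine
      function H x + d is not identically zero, and its zero set is a hyperplane or, if H = 0,
      empty.\<close>
    have "\<pi> (s j) = s j" using j by (simp add: \<pi>eq bary_vertex[OF inv])
    then have "H \<bullet> s j + d = 1" using h[of "s j"] by (simp add: bary_vertex[OF inv])
    then have "H \<noteq> 0 \<or> - d \<noteq> 0" by auto
    then have "negligible {x. H \<bullet> x = - d}" by (rule negligible_hyperplane)
    then have "AE x in lebesgue. x \<notin> {x. H \<bullet> x = - d}"
      by (intro AE_not_in) (simp only: negligible_iff_null_sets)
    then have "AE x in lborel. x \<notin> {x. H \<bullet> x = - d}" by (simp only: AE_completion_iff)
    then show ?thesis by eventually_elim (auto simp: h)
  qed
  have "AE x in facet_measure ?F. x \<in> ?F \<and> (\<forall>j\<in>UNIV - {i}. bary s j x \<noteq> 0)"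
  proof -
    have bm: "{x \<in> space borel. x \<in> ?F \<and> (\<forall>j\<in>UNIV - {i}. bary s j x \<noteq> 0)} \<in> sets borel"
    proof -
      have o: "open {x. bary s j x \<noteq> 0}" for j by (intro open_Collect_neq bary_cont[OF inv] continuous_on_const)
      have "open (\<Inter>j\<in>UNIV - {i}. {x. bary s j x \<noteq> 0})" by (intro open_INT ballI o) simp
      then have "?F \<inter> (\<Inter>j\<in>UNIV - {i}. {x. bary s j x \<noteq> 0}) \<in> sets borel"
        by (intro sets.Int borel_open borel_closed compact_imp_closed facet_compact)
      moreover have "{x \<in> space borel. x \<in> ?F \<and> (\<forall>j\<in>UNIV - {i}. bary s j x \<noteq> 0)}
        = ?F \<inter> (\<Inter>j\<in>UNIV - {i}. {x. bary s j x \<noteq> 0})" by auto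
      ultimately show ?thesis by simp
    qed
    have "AE x in lborel. \<forall>j\<in>UNIV - {i}. bary s j (\<pi> x) \<noteq> 0"
      by (intro AE_finite_allI null) auto
    then have "AE x in restrict_space lborel S. \<pi> x \<in> ?F \<and> (\<forall>j\<in>UNIV - {i}. bary s j (\<pi> x) \<noteq> 0)"
      by (subst AE_restrict_space_iff) (use Sb in \<open>auto simp: S_def elim: eventually_mono\<close>)
    then show ?thesis
      unfolding fm by (subst AE_distr_iff[OF _ bm]) (auto intro!: measurable_restrict_space1)
  qed
  then show ?thesis by eventually_elim (auto intro: facet_rel_interior)
qed

end

section \<open>The boundary term\<close>

context advection_mesh
begin

context
  fixes \<zeta> g :: "real ^ 'n \<Rightarrow> real" and c0 M :: real
  assumes \<zeta>: "\<And>s. s \<in> T \<Longrightarrow> weak_pair (beta_elem \<beta> s) (elem s) \<zeta> (\<lambda>x. - c0)"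
      "\<And>s. s \<in> T \<Longrightarrow> AE x in lebesgue_on (elem s). \<bar>\<zeta> x\<bar> \<le> M"
    and c0: "AE x in lebesgue_on \<Omega>. - d_beta \<beta> \<Omega> \<zeta> x = c0"
    and tr: "has_trace \<Omega> T \<beta> 1 \<zeta> g"
    and out: "\<forall>(s, i) \<in> boundary_facets \<Omega> T. AE x in facet_measure (facet s i). x \<in> Gamma_out \<Omega> T \<beta> \<longrightarrow> g x = 0"
    and cl: "\<Union>(elem ` T) = closure \<Omega>"
begin

text \<open>Apart from a null set beta has its element value, so the volume integrals in the
  definition of the trace split over the elements.\<close>

lemma trace_formula:
  assumes \<phi>: "C1_fun \<phi>"
  shows "(\<Sum>s\<in>T. \<integral>x. \<zeta> x * dd (beta_elem \<beta> s) \<phi> x + (- c0) * \<phi> x \<partial>lebesgue_on (elem s))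
    = (\<Sum>(s, i) \<in> boundary_facets \<Omega> T. \<integral>x. beta_normal \<beta> s i * g x * \<phi> x \<partial>facet_measure (facet s i))"
proof -
  have i1: "integrable (lebesgue_on (elem s)) (\<lambda>x. \<zeta> x * dd (beta_elem \<beta> s) \<phi> x)"
    "integrable (lebesgue_on (elem s)) (\<lambda>x. (- c0) * \<phi> x)" if s: "s \<in> T" for s
    using \<zeta>(1)[OF s] unfolding weak_pair_def
    by (intro integrable_mult_cont elem_compact[OF inv[OF s]] C1_fun_cont C1_fun_dd_cont \<phi>; simp)+
  have ae: "AE x in lebesgue_on (elem s). \<zeta> x * dd (\<beta> x) \<phi> x = \<zeta> x * dd (beta_elem \<beta> s) \<phi> x" if s: "s \<in> T" for s
    using AE_interior[OF inv[OF s]] by eventually_elim (use bc[OF s] in simp)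
  have i2: "integrable (lebesgue_on (elem s)) (\<lambda>x. \<zeta> x * dd (\<beta> x) \<phi> x)" if s: "s \<in> T" for s
    by (rule integral_lebesgue_on_cong_AE(2)[OF elem_sets[OF inv[OF s]] ae[OF s], THEN iffD2, OF i1(1)[OF s]])
  have "(\<integral>x. \<zeta> x * dd (\<beta> x) \<phi> x \<partial>lebesgue_on \<Omega>) = (\<Sum>s\<in>T. \<integral>x. \<zeta> x * dd (\<beta> x) \<phi> x \<partial>lebesgue_on (elem s))"
    by (rule integral_Omega(2)[OF i2])
  also have "\<dots> = (\<Sum>s\<in>T. \<integral>x. \<zeta> x * dd (beta_elem \<beta> s) \<phi> x \<partial>lebesgue_on (elem s))"
    by (intro sum.cong refl integral_lebesgue_on_cong_AE(1) elem_sets inv ae)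
  finally have 1: "(\<integral>x. \<zeta> x * dd (\<beta> x) \<phi> x \<partial>lebesgue_on \<Omega>) = (\<Sum>s\<in>T. \<integral>x. \<zeta> x * dd (beta_elem \<beta> s) \<phi> x \<partial>lebesgue_on (elem s))" .
  have "(\<integral>x. d_beta \<beta> \<Omega> \<zeta> x * \<phi> x \<partial>lebesgue_on \<Omega>) = (\<integral>x. (- c0) * \<phi> x \<partial>lebesgue_on \<Omega>)"
    by (rule integral_lebesgue_on_cong_AE(1)[OF Om_sets]) (use c0 in eventually_elim, auto)
  also have "\<dots> = (\<Sum>s\<in>T. \<integral>x. (- c0) * \<phi> x \<partial>lebesgue_on (elem s))"
    by (rule integral_Omega(2)[OF i1(2)])
  finally have 2: "(\<integral>x. d_beta \<beta> \<Omega> \<zeta> x * \<phi> x \<partial>lebesgue_on \<Omega>) = (\<Sum>s\<in>T. \<integral>x. (- c0) * \<phi> x \<partial>lebesgue_on (elem s))" .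
  have "(\<Sum>s\<in>T. \<integral>x. \<zeta> x * dd (beta_elem \<beta> s) \<phi> x + (- c0) * \<phi> x \<partial>lebesgue_on (elem s))
    = (\<Sum>s\<in>T. (\<integral>x. \<zeta> x * dd (beta_elem \<beta> s) \<phi> x \<partial>lebesgue_on (elem s)) + (\<integral>x. (- c0) * \<phi> x \<partial>lebesgue_on (elem s)))"
    by (intro sum.cong refl Bochner_Integration.integral_add i1)
  also have "\<dots> = (\<integral>x. d_beta \<beta> \<Omega> \<zeta> x * \<phi> x \<partial>lebesgue_on \<Omega>) + (\<integral>x. \<zeta> x * dd (\<beta> x) \<phi> x \<partial>lebesgue_on \<Omega>)"
    unfolding 1 2 by (simp only: sum.distrib add.commute)
  also have "\<dots> = (\<Sum>(s, i) \<in> boundary_facets \<Omega> T. \<integral>x. beta_normal \<beta> s i * g x * \<phi> x \<partial>facet_measure (facet s i))"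
    using tr \<phi> unfolding has_trace_def by blast
  finally show ?thesis .
qed

text \<open>
  The trace \<open>g\<close> of \<open>\<zeta>\<close> may be tested with globally \<open>C\<^sup>1\<close> functions only, whereas \<open>z\<^sup>2\<close> is merely continuous
  and piecewise polynomial. Hence \<open>z\<^sup>2\<close> is replaced by a uniformly close polynomial \<open>\<phi>\<close>.
\<close>

lemma inflow_outflow_term:
  assumes z: "continuous_on (closure \<Omega>) z" "\<forall>x\<in>Gamma_in \<Omega> T \<beta>. z x = 0"
    and b: "(s, i) \<in> boundary_facets \<Omega> T"
    and \<phi>: "\<And>x. x \<in> closure \<Omega> \<Longrightarrow> \<bar>z x * z x - \<phi> x\<bar> \<le> e" and e: "e > 0"
  shows "\<bar>\<integral>x. beta_normal \<beta> s i * g x * \<phi> x \<partial>facet_measure (facet s i)\<bar>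
    \<le> e * (\<integral>x. \<bar>beta_normal \<beta> s i\<bar> * \<bar>g x\<bar> powr 1 \<partial>facet_measure (facet s i))"
proof -
  let ?\<mu> = "facet_measure (facet s i)" and ?b = "beta_normal \<beta> s i"
  have s: "s \<in> T" and Ff: "facet s i \<subseteq> frontier \<Omega>" using b by (auto simp: boundary_facets_def)
  have Fc: "facet s i \<subseteq> closure \<Omega>" using Ff by (auto simp: frontier_def)
  have gi: "integrable ?\<mu> (\<lambda>x. \<bar>?b\<bar> * \<bar>g x\<bar> powr 1)" using tr b unfolding has_trace_def by blast
  have riF: "rel_interior (facet s i) \<subseteq> facet s i" by (rule rel_interior_subset)
  \<comment> \<open>On inflow facets z is zero, on outflow facets the trace g, and on characteristic
    facets the weight.\<close>
  have z0: "AE x in ?\<mu>. ?b * g x * (z x * z x) = 0"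
  proof -
    consider "?b = 0" | "?b < 0" | "?b > 0" by linarith
    then show ?thesis
    proof cases
      case 1
      then show ?thesis by simp
    next
      case 2
      have "rel_interior (facet s i) \<subseteq> Gamma_in \<Omega> T \<beta>" using b 2 unfolding Gamma_in_def by blast
      then have zz: "z x = 0" if "x \<in> rel_interior (facet s i)" for x using z(2) that by blast
      show ?thesis using AE_facet_measure[OF inv[OF s], of i] by eventually_elim (simp add: zz)
    next
      case 3
      have sub: "rel_interior (facet s i) \<subseteq> Gamma_out \<Omega> T \<beta>" using b 3 unfolding Gamma_out_def by blast
      have "AE x in ?\<mu>. x \<in> Gamma_out \<Omega> T \<beta> \<longrightarrow> g x = 0" using out b by blast
      with AE_facet_measure[OF inv[OF s], of i] show ?thesis
        by eventually_elim (use sub in auto)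
    qed
  qed
  show ?thesis
  proof (cases "integrable ?\<mu> (\<lambda>x. ?b * g x * \<phi> x)")
    \<comment> \<open>An integral of a non-integrable function is 0 by default, and the bound is
      nonnegative.\<close>
    case False
    have "0 \<le> (\<integral>x. \<bar>?b\<bar> * \<bar>g x\<bar> powr 1 \<partial>?\<mu>)" by (rule integral_nonneg_AE) simp
    then show ?thesis using e False by (simp add: not_integrable_integral_eq)
  next
    case True
    have "\<bar>\<integral>x. ?b * g x * \<phi> x \<partial>?\<mu>\<bar> \<le> (\<integral>x. \<bar>?b * g x * \<phi> x\<bar> \<partial>?\<mu>)"
      using integral_norm_bound[of ?\<mu> "\<lambda>x. ?b * g x * \<phi> x"] by simp
    also have "\<dots> \<le> (\<integral>x. e * (\<bar>?b\<bar> * \<bar>g x\<bar> powr 1) \<partial>?\<mu>)"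
    proof (rule integral_mono_AE)
      show "AE x in ?\<mu>. \<bar>?b * g x * \<phi> x\<bar> \<le> e * (\<bar>?b\<bar> * \<bar>g x\<bar> powr 1)"
        using z0 AE_facet_measure[OF inv[OF s], of i]
      proof eventually_elim
        case (elim x)
        have "x \<in> closure \<Omega>" using elim(2) riF Fc by blast
        then have "\<bar>z x * z x - \<phi> x\<bar> \<le> e" by (rule \<phi>)
        then have "\<bar>?b * g x\<bar> * \<bar>z x * z x - \<phi> x\<bar> \<le> \<bar>?b * g x\<bar> * e" by (rule mult_left_mono) simp
        moreover have "\<bar>?b * g x\<bar> * \<bar>z x * z x - \<phi> x\<bar> = \<bar>?b * g x * \<phi> x\<bar>"
          unfolding abs_mult[symmetric] right_diff_distrib elim(1) by simp
        ultimately have "\<bar>?b * g x * \<phi> x\<bar> \<le> \<bar>?b * g x\<bar> * e" by (simp only:)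
        also have "\<bar>?b * g x\<bar> * e = e * (\<bar>?b\<bar> * \<bar>g x\<bar> powr 1)" by (simp add: abs_mult)
        finally show ?case .
      qed
    qed (use True gi in auto)
    also have "\<dots> = e * (\<integral>x. \<bar>?b\<bar> * \<bar>g x\<bar> powr 1 \<partial>?\<mu>)" by simp
    finally show ?thesis .
  qed
qed

text \<open>Replacing z^2 by a polynomial within e changes each element integral by a multiple of e
  through \<open>green_bound\<close>, and the facet integrals of the polynomial are themselves a
  multiple of e. Since e is arbitrary, the sum is zero.\<close>

lemma boundary_term_zero:
  assumes M: "M \<ge> 0" and bdd: "bounded \<Omega>" and zc: "continuous_on (closure \<Omega>) z" "\<forall>x\<in>Gamma_in \<Omega> T \<beta>. z x = 0"
    and P: "\<And>s. s \<in> T \<Longrightarrow> P s \<in> Poly j" "\<And>s. s \<in> T \<Longrightarrow> \<forall>x\<in>interior (elem s). z x = P s x"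
  shows "(\<Sum>s\<in>T. \<integral>x. \<zeta> x * dd (beta_elem \<beta> s) (\<lambda>x. P s x * P s x) x + (- c0) * (P s x * P s x) \<partial>lebesgue_on (elem s)) = 0"
proof -
  \<comment> \<open>The constant of \<open>green_bound\<close> on the element s.\<close>
  define B where "B s = M * (\<Sum>j\<in>UNIV. \<bar>bgrad s j (beta_elem \<beta> s)\<bar> * (4 * real CARD('n) * measure lebesgue (elem s)))" for s
  define D where "D = (\<lambda>(s, i). \<integral>x. \<bar>beta_normal \<beta> s i\<bar> * \<bar>g x\<bar> powr 1 \<partial>facet_measure (facet s i))"
  define A where "A = (\<Sum>s\<in>T. B s) + (\<Sum>si\<in>boundary_facets \<Omega> T. D si)"
  define I where "I s f = (\<integral>x. \<zeta> x * dd (beta_elem \<beta> s) f x + (- c0) * f x \<partial>lebesgue_on (elem s))" for s f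
  \<comment> \<open>The broken polynomial describes z only in interiors; by continuity of z on the
    closed domain it does so up to the facets, where the uniform approximation is needed.\<close>
  have zP: "z x = P s x" if s: "s \<in> T" and x: "x \<in> elem s" for s x
  proof -
    have cK: "closure (interior (elem s)) = elem s"
      using convex_closure_interior[OF elem_convex[OF inv[OF s]] interior_elem_ne[OF inv[OF s]]]
        elem_compact[OF inv[OF s]] by (simp add: compact_imp_closed closure_closed)
    have sub: "elem s \<subseteq> closure \<Omega>" using cl s by blast
    have "continuous_on (closure (interior (elem s))) (\<lambda>x. z x - P s x)"
      unfolding cK by (intro continuous_on_diff continuous_on_subset[OF zc(1) sub] C1_fun_cont Poly_C1[OF P(1)[OF s]])
    then have "z x - P s x = 0"
      by (rule continuous_constant_on_closure) (use P(2)[OF s] x cK in auto)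
    then show ?thesis by simp
  qed
  have PC: "C1_fun (\<lambda>x. P s x * P s x)" if "s \<in> T" for s by (intro C1_fun_mult Poly_C1[OF P(1)[OF that]])
  have "\<bar>\<Sum>s\<in>T. I s (\<lambda>x. P s x * P s x)\<bar> \<le> 0 + e * A" if e: "e > 0" for e
  proof -
    have "compact (closure \<Omega>)" using bdd by simp
    moreover have "continuous_on (closure \<Omega>) (\<lambda>x. z x * z x)" by (intro continuous_on_mult zc(1))
    ultimately obtain \<phi> where \<phi>: "real_polynomial_function \<phi>" "\<And>x. x \<in> closure \<Omega> \<Longrightarrow> \<bar>z x * z x - \<phi> x\<bar> < e"
      using Stone_Weierstrass_real_polynomial_function[of "closure \<Omega>" "\<lambda>x. z x * z x" e] e by blast
    have \<phi>C: "C1_fun \<phi>" by (rule C1_fun_polynomial[OF \<phi>(1)])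
    have dif: "\<bar>I s (\<lambda>x. P s x * P s x) - I s \<phi>\<bar> \<le> B s * e" if s: "s \<in> T" for s
    proof -
      let ?c = "beta_elem \<beta> s" and ?K = "lebesgue_on (elem s)"
      have C: "C1_fun (\<lambda>x. P s x * P s x - \<phi> x)" by (rule C1_fun_diff[OF PC[OF s] \<phi>C])
      have Ig: "integrable ?K (\<lambda>x. \<zeta> x * dd ?c f x + (- c0) * f x)" if "C1_fun f" for f
        using \<zeta>(1)[OF s] unfolding weak_pair_def
        by (intro Bochner_Integration.integrable_add integrable_mult_cont elem_compact[OF inv[OF s]] C1_fun_cont C1_fun_dd_cont that) auto
      have "I s (\<lambda>x. P s x * P s x) - I s \<phi> = (\<integral>x. (\<zeta> x * dd ?c (\<lambda>x. P s x * P s x) x + (- c0) * (P s x * P s x))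
          - (\<zeta> x * dd ?c \<phi> x + (- c0) * \<phi> x) \<partial>?K)"
        unfolding I_def by (rule Bochner_Integration.integral_diff[symmetric, OF Ig[OF PC[OF s]] Ig[OF \<phi>C]])
      also have "\<dots> = (\<integral>x. \<zeta> x * dd ?c (\<lambda>x. P s x * P s x - \<phi> x) x + (- c0) * (P s x * P s x - \<phi> x) \<partial>?K)"
        by (rule Bochner_Integration.integral_cong) (auto simp: dd_diff[OF PC[OF s] \<phi>C] algebra_simps)
      finally have eq: "I s (\<lambda>x. P s x * P s x) - I s \<phi> = (\<integral>x. \<zeta> x * dd ?c (\<lambda>x. P s x * P s x - \<phi> x) x + (- c0) * (P s x * P s x - \<phi> x) \<partial>?K)" .
      show ?thesis unfolding eq B_def
      proof (rule green_bound[OF inv[OF s] \<zeta>(1)[OF s] M \<zeta>(2)[OF s] C])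
        fix x assume x: "x \<in> elem s"
        then have "x \<in> closure \<Omega>" using cl s by blast
        then show "\<bar>P s x * P s x - \<phi> x\<bar> \<le> e" using \<phi>(2)[of x] zP[OF s x] by simp
      qed
    qed
    have "(\<Sum>s\<in>T. I s (\<lambda>x. P s x * P s x)) = (\<Sum>s\<in>T. I s (\<lambda>x. P s x * P s x) - I s \<phi>) + (\<Sum>s\<in>T. I s \<phi>)"
      by (simp add: sum_subtractf)
    moreover have "\<bar>\<Sum>s\<in>T. I s (\<lambda>x. P s x * P s x) - I s \<phi>\<bar> \<le> (\<Sum>s\<in>T. B s * e)"
      by (rule order_trans[OF sum_abs sum_mono[OF dif]])
    moreover have "\<bar>\<Sum>s\<in>T. I s \<phi>\<bar> \<le> (\<Sum>si\<in>boundary_facets \<Omega> T. e * D si)"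
      unfolding I_def trace_formula[OF \<phi>C]
    proof (rule order_trans[OF sum_abs sum_mono])
      fix si assume si: "si \<in> boundary_facets \<Omega> T"
      obtain s i where p: "si = (s, i)" by (cases si)
      show "\<bar>case si of (s, i) \<Rightarrow> \<integral>x. beta_normal \<beta> s i * g x * \<phi> x \<partial>facet_measure (facet s i)\<bar> \<le> e * D si"
        unfolding p D_def prod.case
        by (rule inflow_outflow_term[OF zc _ _ e]) (use si p \<phi>(2) in \<open>auto intro: less_imp_le\<close>)
    qed
    ultimately have "\<bar>\<Sum>s\<in>T. I s (\<lambda>x. P s x * P s x)\<bar> \<le> (\<Sum>s\<in>T. B s * e) + (\<Sum>si\<in>boundary_facets \<Omega> T. e * D si)"
      by linarith
    also have "\<dots> = e * A" by (simp add: A_def distrib_left sum_distrib_left mult.commute)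
    finally show ?thesis by simp
  qed
  note key = this
  have D0: "0 \<le> D si" for si unfolding D_def by (cases si) (auto intro!: integral_nonneg_AE)
  have B0: "0 \<le> B s" for s unfolding B_def by (intro mult_nonneg_nonneg sum_nonneg M) auto
  have A0: "0 \<le> A" unfolding A_def by (intro add_nonneg_nonneg sum_nonneg D0 B0)
  have "\<bar>\<Sum>s\<in>T. I s (\<lambda>x. P s x * P s x)\<bar> \<le> 0"
  proof (rule field_le_epsilon)
    fix e :: real assume e: "e > 0"
    have "\<bar>\<Sum>s\<in>T. I s (\<lambda>x. P s x * P s x)\<bar> \<le> e / (A + 1) * A" using key[of "e / (A + 1)"] e A0 by simp
    also have "\<dots> \<le> e" using e A0 by (simp add: field_simps)
    finally show "\<bar>\<Sum>s\<in>T. I s (\<lambda>x. P s x * P s x)\<bar> \<le> 0 + e" by simp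
  qed
  then show ?thesis by (simp add: I_def)
qed

end

end

theorem theorem7p5:
  fixes \<Omega> :: "(real ^ 'n) set" and T :: "'n::finite vertices set"
    and \<beta> :: "real ^ 'n \<Rightarrow> real ^ 'n" and k :: nat and p q \<kappa>\<^sub>0 \<theta>\<^sub>0 C\<^sub>\<Pi> :: real
    and Y\<^sub>h :: "(real ^ 'n \<Rightarrow> real) set" and f u :: "real ^ 'n \<Rightarrow> real"
  assumes "k \<ge> 1" and "1 < p" and "q = p / (p - 1)"
    and "\<kappa>\<^sub>0 > 0" and "0 < \<theta>\<^sub>0" and "\<theta>\<^sub>0 \<le> 1"
    and "lipschitz_domain \<Omega>" and "polyhedral \<Omega>" and "conforming_mesh \<Omega> T"
    and "\<forall>s\<in>T. onorm ((*v) (aff_matrix s)) * onorm ((*v) (matrix_inv (aff_matrix s))) \<le> \<kappa>\<^sub>0"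
    and "advection_field T \<beta>" and "flow_conditions \<Omega> T \<beta>"
    and "k = 1 \<or> (\<forall>s\<in>T. \<forall>i. \<bar>beta_elem \<beta> s \<bullet> normal s i\<bar> \<ge> \<theta>\<^sub>0 * norm (beta_elem \<beta> s))"
    and "fin_dim_space \<Omega> Y\<^sub>h" and "broken T (V_elem \<beta> k) \<subseteq> Y\<^sub>h" and "Y\<^sub>h \<subseteq> Y_space T \<beta> q"
    and "f \<in> L_space p \<Omega>"
    and "u \<in> W_space0 \<Omega> T \<beta> p" and "AE x in lebesgue_on \<Omega>. d_beta \<beta> \<Omega> u x = f x"
    and "\<forall>v\<in>Y_space T \<beta> q. Y_norm T \<beta> q (Pi_h T \<beta> k v) \<le> C\<^sub>\<Pi> * Y_norm T \<beta> q v"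
  shows "\<exists>u\<^sub>h. is_arg_min (residual_norm \<Omega> T \<beta> q Y\<^sub>h f) (\<lambda>w. w \<in> X_h \<Omega> T \<beta> q k) u\<^sub>h \<and>
              (\<forall>w\<^sub>h. is_arg_min (residual_norm \<Omega> T \<beta> q Y\<^sub>h f) (\<lambda>w. w \<in> X_h \<Omega> T \<beta> q k) w\<^sub>h \<longrightarrow> trial_eq \<Omega> w\<^sub>h u\<^sub>h) \<and>
              energy_norm \<Omega> T \<beta> q (trial_diff (u, D_h T \<beta> q u) u\<^sub>h)
                \<le> (1 + 2 * C\<^sub>\<Pi>) *
                  (INF w\<^sub>h \<in> X_h \<Omega> T \<beta> q k. energy_norm \<Omega> T \<beta> q (trial_diff (u, D_h T \<beta> q u) w\<^sub>h))"
proof -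
  note k1 = assms(1) and p1 = assms(2) and qp = assms(3) and \<theta> = assms(5) and lip = assms(7)
    and mesh = assms(9) and adv = assms(11) and flow = assms(12) and nrm = assms(13)
  have q1: "q > 1" by (rule conjugate_exponent(1)[OF p1 qp])
  interpret advection_mesh \<Omega> T \<beta> q
    by (rule conforming_mesh_imp_advection_mesh[OF lip mesh adv q1])
  have cl: "\<Union>(elem ` T) = closure \<Omega>" using mesh by (simp add: conforming_mesh_def)
  have bdd: "bounded \<Omega>" and ne: "\<Omega> \<noteq> {}" using lip by (auto simp: lipschitz_domain_def)
  have Tne: "T \<noteq> {}"
  proof
    assume "T = {}"
    then have "closure \<Omega> = {}" using cl by simp
    then show False using ne by simp
  qed
  have cond: "\<forall>s\<in>T. k = 1 \<or> (\<forall>i. bgrad s i (beta_elem \<beta> s) \<noteq> 0)"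
  proof (intro ballI disjCI allI)
    fix s i assume s: "s \<in> T" and "\<not> (\<forall>i. bgrad s i (beta_elem \<beta> s) \<noteq> 0)"
    then obtain i where "bgrad s i (beta_elem \<beta> s) = 0" by blast
    then have "sgn (beta_elem \<beta> s \<bullet> normal s i) = 0" by (simp add: sgn_inner_normal[OF inv[OF s]])
    then have "beta_elem \<beta> s \<bullet> normal s i = 0" by (simp add: sgn_zero_iff)
    then have "\<not> \<theta>\<^sub>0 * norm (beta_elem \<beta> s) \<le> \<bar>beta_elem \<beta> s \<bullet> normal s i\<bar>"
      using \<theta> bne[OF s] by (simp add: not_le)
    then show "k = 1" using nrm s by blast
  qed
  \<comment> \<open>The weight is the solution with zero trace on the outflow part: paired with a z
    that vanishes on the inflow part it makes the boundary term zero.\<close>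
  obtain zp c0 g where c0: "c0 > 0" and zp: "zp \<in> W_inf \<beta> \<Omega>" and dzp: "AE x in lebesgue_on \<Omega>. - d_beta \<beta> \<Omega> zp x = c0"
    and tr: "has_trace \<Omega> T \<beta> 1 zp g"
    and out: "\<forall>(s, i) \<in> boundary_facets \<Omega> T. AE x in facet_measure (facet s i). x \<in> Gamma_out \<Omega> T \<beta> \<longrightarrow> g x = 0"
    using flow unfolding flow_conditions_def trace_vanishes_def by blast
  obtain M0 where M0: "zp \<in> borel_measurable (lebesgue_on \<Omega>)" "AE x in lebesgue_on \<Omega>. \<bar>zp x\<bar> \<le> M0"
    using zp unfolding W_inf_def L_inf_def by blast
  define M where "M = max M0 0"
  have zM: "AE x in lebesgue_on \<Omega>. \<bar>zp x\<bar> \<le> M" using M0(2) by eventually_elim (simp add: M_def)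
  have zMs: "AE x in lebesgue_on (elem s). \<bar>zp x\<bar> \<le> M" if "s \<in> T" for s
    using zM that unfolding AE_Omega_iff by blast
  have zL: "zp \<in> L_space 1 \<Omega>" by (rule L_space_bounded[OF Om _ M0(1) zM]) simp
  \<comment> \<open>The existence of some weak derivative is what makes the chosen
    \<open>d_beta\<close> a weak derivative.\<close>
  obtain g0 where "weak_deriv \<beta> \<Omega> zp g0" using zp unfolding W_inf_def by blast
  then have wz: "weak_deriv \<beta> \<Omega> zp (d_beta \<beta> \<Omega> zp)"
    unfolding d_beta_def by (rule someI[of "weak_deriv \<beta> \<Omega> zp"])
  have zpair: "weak_pair (beta_elem \<beta> s) (elem s) zp (\<lambda>x. - c0)" if s: "s \<in> T" for s
  proof (rule weak_deriv_restrict[OF s wz])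
    show "AE x in lebesgue_on \<Omega>. d_beta \<beta> \<Omega> zp x = - c0" using dzp by eventually_elim linarith
    show "integrable (lebesgue_on (elem s)) zp"
      by (rule L_space_integrable[OF elem_lmeasurable[OF inv[OF s]] order_refl L_space_restrict[OF s zL]])
    show "integrable (lebesgue_on (elem s)) (\<lambda>x. - c0)"
      by (rule integrable_const_on_compact[OF elem_compact[OF inv[OF s]]])
  qed
  have uW: "u \<in> W_space \<beta> p \<Omega>" using assms(18) by (simp add: W_space0_def)
  then have uL: "u \<in> L_space p \<Omega>" by (simp add: W_space_def)
  obtain gu where "weak_deriv \<beta> \<Omega> u gu" using uW unfolding W_space_def by blast
  then have wu: "weak_deriv \<beta> \<Omega> u (d_beta \<beta> \<Omega> u)"
    unfolding d_beta_def by (rule someI[of "weak_deriv \<beta> \<Omega> u"])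
  have u: "weak_pair (beta_elem \<beta> s) (elem s) u f" "u \<in> L_space p (elem s)" "f \<in> L_space p (elem s)" if s: "s \<in> T" for s
  proof -
    show L: "u \<in> L_space p (elem s)" "f \<in> L_space p (elem s)"
      by (rule L_space_restrict[OF s uL], rule L_space_restrict[OF s assms(17)])
    show "weak_pair (beta_elem \<beta> s) (elem s) u f"
      using p1 by (intro weak_deriv_restrict[OF s wu assms(19)] L_space_integrable[OF elem_lmeasurable[OF inv[OF s]] _ L(1)]
          L_space_integrable[OF elem_lmeasurable[OF inv[OF s]] _ L(2)]) auto
  qed
  have Z0: "lin_space (S_h0 \<Omega> T \<beta> k)"
    unfolding lin_space_def S_h0_def using lin_spaceD[OF broken_lin]
    by (auto intro!: continuous_on_add continuous_on_mult continuous_on_const)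
  have Z1: "S_h0 \<Omega> T \<beta> k \<subseteq> broken T (\<lambda>s. Poly (int k))" by (auto simp: S_h0_def)
  have VY: "broken T (V_elem \<beta> k) \<subseteq> Y" using assms(15,16) by blast
  have ker: "AE x in lebesgue_on \<Omega>. w x = 0"
    if w: "w \<in> broken T (\<lambda>s. Poly (int k - 1))" and z: "z \<in> S_h0 \<Omega> T \<beta> k"
      and b: "\<And>v. v \<in> Y \<Longrightarrow> b_form T \<beta> (w, D_h T \<beta> q z) v = 0" for w z
  proof -
    have zb: "z \<in> broken T (\<lambda>s. Poly (int k))" and zc: "continuous_on (closure \<Omega>) z" "\<forall>x\<in>Gamma_in \<Omega> T \<beta>. z x = 0"
      using z by (auto simp: S_h0_def)
    obtain P where P: "\<And>s. s \<in> T \<Longrightarrow> P s \<in> Poly (int k)" "\<And>s. s \<in> T \<Longrightarrow> \<forall>x\<in>interior (elem s). z x = P s x"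
      using poly_rep[OF zb] by blast
    have M: "0 \<le> M" by (simp add: M_def)
    show ?thesis
      by (rule kernel_trivial[OF p1 qp cond VY w zb b c0 zpair zMs P
            boundary_term_zero[OF zpair zMs dzp tr out cl M bdd zc P]])
  qed
  show ?thesis
    unfolding X_h_def
  proof (rule residual_minimization[OF p1 qp k1 Tne cond assms(14,15,16) Z0 Z1])
    show "AE x in lebesgue_on \<Omega>. w x = 0"
      if "w \<in> broken T (\<lambda>s. Poly (int k - 1))" "z \<in> S_h0 \<Omega> T \<beta> k"
        "\<And>v. v \<in> Y \<Longrightarrow> b_form T \<beta> (w, D_h T \<beta> q z) v = 0" for w z
      by (rule ker[OF that])
    show "Y_norm T \<beta> q (Pi_h T \<beta> k v) \<le> C\<^sub>\<Pi> * Y_norm T \<beta> q v" if "v \<in> Y" for v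
      by (rule bspec[OF assms(20) that])
  qed (fact u)+
qed

end
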